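(* Let $0<H<\tfrac12$ and let $\psi(s;T)$ and $\psi(s;T,t)$ be the infinite- and finite-past predictor coefficients of the process $(X(t))$ described in the context. Let $g$ be locally bounded in $[0,\infty)$ and regularly varying with index $\rho$ (i.e. $g\in R_\rho$), where $\rho\in(-\tfrac12+H,\tfrac12+H)$. Fix $T>0$. (a) As $t\to\infty$, $$\int_0^t\{\psi(s;T,t)-\psi(s;T)\}g(s)\,ds\sim C(H,\rho)\int_t^\infty\psi(s;T)g(s)\,ds .$$ (b) There exists a positive constant $M$ such that $$\int_0^t\{\psi(s;T,t)-\psi(s;T)\}g(s)\,ds\le M\int_t^\infty\psi(s;T)g(s)\,ds\qquad (t>1).$$
   Context: Notation. $f(t)\sim g(t)$ as $t\to\infty$ means $\lim_{t\to\infty}f(t)/g(t)=1$. A positive measurable function $f$, defined on some neighbourhood $[M_0,\infty)$ of $\infty$, is regularly varying with index $\rho\in\mathbf{R}$, written $f\in R_\rho$, if $\lim_{t\to\infty}f(t\lambda)/f(t)=\lambda^\rho$ for all $\lambda\in(0,\infty)$; it is slowly varying if $\rho=0$. $B(p,q):=\int_0^1u^{p-1}(1-u)^{q-1}du$ is the beta function. For $0<H<\frac12$ and $\rho>-\frac12+H$, $$C(H,\rho):=1-\rho\,B(\tfrac12-H+\rho,\tfrac12-H)\,\frac{1-2H}{1+2H}.$$ The process $(X(t))$. Fix $H\in(0,\frac12)$. Let $\nu$ be a Borel measure on $(0,\infty)$ with $\int_0^\infty(1+s)^{-1}\nu(ds)<\infty$, and put $c(t)=\int_0^\infty e^{-ts}\nu(ds)$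 for $t>0$ and $c(t)=0$ for $t\le0$. Assume: $\lim_{t\to0+}c(t)=\infty$; $c(t)=O(t^q)$ as $t\to0+$ for some $q>-\frac12$; and $c(t)\sim\frac{1}{\Gamma(\frac12+H)}t^{-(\frac12-H)}\ell(t)$ as $t\to\infty$, where $\ell$ is a slowly varying function. The process is the stationary-increment Gaussian process $X(t)=\int_{-\infty}^\infty\{c(t-s)-c(-s)\}\,dW(s)$, $t\in\mathbf{R}$, with $(W(t):t\in\mathbf{R})$ the ordinary Brownian motion. Autoregressive coefficient. Let $\alpha$ be the unique function on $(0,\infty)$ satisfying $-iz\left(\int_0^\infty e^{izt}c(t)dt\right)\left(\int_0^\infty e^{izt}\alpha(t)dt\right)=1$ for all $z$ with $\operatorname{Im}z>0$, and let $a(t):=-\frac{d\alpha}{dt}(t)$ for $t>0$. (It is known that $a(t)=\int_0^\infty e^{-ts}s\,\mu(ds)$ for some Borel measure $\mu$ on $(0,\infty)$; $a$ is positive and decreasing.) Predictor coefficients. For $s,u>0$ put $b(s,u):=\int_0^uc(u-v)a(s+v)\,dv$. For $s,t,T>0$ put $b_1(s;T,t):=b(s,T)$ and $b_k(s;T,t):=\int_0^\infty b(s,u)\,b_{k-1}(t+u;T,t)\,du$ for $k=2,3,\dots$. Then $$\psi(s;T):=b(s,T)\quad(s>0),\qquad \psi(s;T,t):=\sum_{k=1}^\infty\{b_{2k-1}(s;T,t)+b_{2k}(t-s;T,t)\}\quad(0<s<t).$$ These are the coefficients in the linear least-squares prediction formulas: for $-\infty<t_0\le0\le t_1<t_2<\infty$,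 $t_0<t_1$, $T=t_2-t_1$, $t=t_1-t_0$, the predictor of $X(t_2)$ based on $\{X(s):-\infty<s\le t_1\}$ is $\int_0^\infty\psi(s;T)X(t_1-s)ds$ and that based on $\{X(s):t_0\le s\le t_1\}$ is $\int_0^t\psi(s;T,t)X(t_1-s)ds$. *)

theory Defs
  imports "HOL-Analysis.Analysis" "HOL-Library.Landau_Symbols"
begin

definition regularly_varying :: "real \<Rightarrow> (real \<Rightarrow> real) \<Rightarrow> bool" where
  "regularly_varying \<rho> f \<longleftrightarrow>
     (\<exists>M\<^sub>0. f \<in> borel_measurable (restrict_space borel {M\<^sub>0..}) \<and> (\<forall>t\<ge>M\<^sub>0. 0 < f t)) \<and>
     (\<forall>x>0. ((\<lambda>t. f (t * x) / f t) \<longlongrightarrow> x powr \<rho>) at_top)"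

abbreviation slowly_varying :: "(real \<Rightarrow> real) \<Rightarrow> bool" where
  "slowly_varying \<equiv> regularly_varying 0"

definition C_const :: "real \<Rightarrow> real \<Rightarrow> real" where
  "C_const H \<rho> = 1 - \<rho> * Beta (1/2 - H + \<rho>) (1/2 - H) * ((1 - 2 * H) / (1 + 2 * H))"

(* A Borel measure on (0,\<infinity>) is a measure whose measurable sets are those of
   restrict_space borel {0<..}; in particular its space is {0<..}, so that the
   integral below ranges over (0,\<infinity>). *)
definition ma_coeff :: "real measure \<Rightarrow> real \<Rightarrow> real" where
  "ma_coeff \<nu> t = (if 0 < t then (\<integral>s. exp (- t * s) \<partial>\<nu>) else 0)"

(* Differentiability is what makes a = - d\<alpha>/dt meaningful, and it singles out one function
   among those agreeing with it almost everywhere: by uniqueness of Laplace transforms, \<alpha> is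
   determined on (0,\<infinity>). Only the values of \<alpha> on (0,\<infinity>) are constrained or used. *)
definition is_ar_alpha :: "(real \<Rightarrow> real) \<Rightarrow> (real \<Rightarrow> real) \<Rightarrow> bool" where
  "is_ar_alpha c \<alpha> \<longleftrightarrow>
     (\<forall>t>0. \<alpha> differentiable (at t)) \<and>
     (\<forall>z::complex. 0 < Im z \<longrightarrow>
        set_integrable lborel {0<..} (\<lambda>t. exp (\<i> * z * of_real t) * of_real (c t)) \<and>
        set_integrable lborel {0<..} (\<lambda>t. exp (\<i> * z * of_real t) * of_real (\<alpha> t)) \<and>
        - \<i> * z * (LINT t:{0<..}|lborel. exp (\<i> * z * of_real t) * of_real (c t))
                * (LINT t:{0<..}|lborel. exp (\<i> * z * of_real t) * of_real (\<alpha> t)) = 1)"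

definition ar_coeff :: "(real \<Rightarrow> real) \<Rightarrow> real \<Rightarrow> real" where
  "ar_coeff \<alpha> t = - deriv \<alpha> t"

definition b_coeff :: "(real \<Rightarrow> real) \<Rightarrow> (real \<Rightarrow> real) \<Rightarrow> real \<Rightarrow> real \<Rightarrow> real" where
  "b_coeff c a s u = (LINT v:{0<..<u}|lborel. c (u - v) * a (s + v))"

(* b_iter c a k s T t is b_k(s;T,t), for k = 1, 2, ...; the value at k = 0 is a dummy. *)
fun b_iter :: "(real \<Rightarrow> real) \<Rightarrow> (real \<Rightarrow> real) \<Rightarrow> nat \<Rightarrow> real \<Rightarrow> real \<Rightarrow> real \<Rightarrow> real" where
  "b_iter c a 0 s T t = 0"
| "b_iter c a (Suc 0) s T t = b_coeff c a s T"
| "b_iter c a (Suc (Suc k)) s T t =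
     (LINT u:{0<..}|lborel. b_coeff c a s u * b_iter c a (Suc k) (t + u) T t)"

definition psi_inf :: "(real \<Rightarrow> real) \<Rightarrow> (real \<Rightarrow> real) \<Rightarrow> real \<Rightarrow> real \<Rightarrow> real" where
  "psi_inf c a s T = b_coeff c a s T"

(* The sum over k = 1, 2, ... of b_{2k-1}(s;T,t) + b_{2k}(t-s;T,t), with k shifted by one. *)
definition psi_fin :: "(real \<Rightarrow> real) \<Rightarrow> (real \<Rightarrow> real) \<Rightarrow> real \<Rightarrow> real \<Rightarrow> real \<Rightarrow> real" where
  "psi_fin c a s T t = (\<Sum>k. b_iter c a (2 * k + 1) s T t + b_iter c a (2 * k + 2) (t - s) T t)"

end

theory Submission imports Defs begin

text \<open>
  Put \<open>\<gamma> = 1/2 + H\<close>. By the Laplace transform of the defining relation, \<open>\<alpha>\<close> is a nonnegative decreasing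
  convex function with \<open>\<integral>\<^sub>0\<^sup>u c (u - v) \<alpha> v dv \<le> 1\<close>, and \<open>t c(t) \<alpha>(t) \<longlongrightarrow> sin (\<pi>\<gamma>) / \<pi>\<close>,
  \<open>t a(t) / \<alpha>(t) \<longlongrightarrow> \<gamma>\<close>: \<open>\<alpha>\<close> is approximated by the renewal inverses of sampled values of \<open>c\<close>, which are
  moment sequences, and its asymptotics follow from the continuity theorem for
  Laplace transforms and monotonicity. Therefore
  \<open>t b(t x, t u)\<close> converges to the overshoot kernel
  \<open>\<beta> x u = sin (\<pi>\<gamma>) / \<pi> (u / x)\<^sup>\<gamma> / (x + u)\<close>. It has the eigenfunction \<open>x\<^bsup>-\<gamma>-1/2\<^esup>\<close> with eigenvalue
  \<open>sin (\<pi>\<gamma>) < 1\<close>, and this survives for \<open>b\<close> at finite times as a Lyapunov inequality, so that the rescaled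
  iterates \<open>b\<^sub>k(t x) / (a(t) \<integral>\<^sub>0\<^sup>T c)\<close> are geometrically dominated and converge to the iterates of \<open>\<beta>\<close>.
  These are summed in closed form by pairing them with a bounded function that \<open>\<beta>\<close> reproduces up to
  the density of landing in the unit interval; integrating the sum against \<open>x\<^sup>\<rho>\<close> gives \<open>C(H, \<rho>) / (\<gamma> - \<rho>)\<close>, while the tail integral
  contributes \<open>1 / (\<gamma> - \<rho>)\<close>.
  For bounded \<open>t\<close> the finite-past coefficients have mass at most one.
\<close>

subsection \<open>Regularly varying functions\<close>

text \<open>The signs of \<alpha> and of its increments cannot be read off a transform; on a mesh
  they become signs of the coefficients of a discrete inverse, where they are a matter of algebra.
  As \<open>c\<close> is unbounded at 0, the samples start at the mesh width. The iterates read
  their predecessor only beyond the interval and from its opposite end, so powers, which diagonalise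
  the limit kernel, are not preserved. The sum is therefore found from the dual side: for a fixed
  landing place one solves a linear equation for a function of the excess over the interval. Its
  solutions can be changed by multiples of a function that the kernel reproduces; boundedness
  selects the one for which the remainder of the telescoping sum vanishes. The selected multiple
  \<open>2 * \<gamma> - 1\<close> is the origin of the factor
  \<open>(1 - \<gamma>) / \<gamma> = (1 - 2 * H) / (1 + 2 * H)\<close> in the constant. Since
  \<open>\<gamma> > 1/2\<close>, the exponent \<open>\<gamma> + 1/2\<close> exceeds 1: the weight is
  integrable at infinity and may be paired with a bounded function.\<close>

lemma regularly_varyingD:
  assumes "regularly_varying \<rho> f"
  shows "\<And>x. x > 0 \<Longrightarrow> ((\<lambda>t. f (t * x) / f t) \<longlongrightarrow> x powr \<rho>) at_top"
    and "eventually (\<lambda>t. f t > 0) at_top"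
  using assms unfolding regularly_varying_def eventually_at_top_linorder by blast+

text \<open>The uniform convergence theorem of Karamata theory in additive form, for
  \<open>ln f\<close> after an exponential change of variable. The proof is of Steinhaus type: a bad
  increment from \<open>x\<close> to \<open>x + u\<close> is refuted by a third point whose
  increments from both ends are accurate; measurability guarantees that such a point exists.\<close>

lemma regularly_varying_log_uniform:
  assumes rv: "regularly_varying \<rho> f" and e: "e > 0"
  shows "\<exists>X. \<forall>x\<ge>X. \<forall>u\<in>{0..1}. f (exp x) > 0 \<and> \<bar>ln (f (exp (x + u))) - ln (f (exp x)) - \<rho> * u\<bar> \<le> e"
proof -
  from rv obtain M where M: "f \<in> borel_measurable (restrict_space borel {M..})" "\<And>t. t \<ge> M \<Longrightarrow> 0 < f t"
    unfolding regularly_varying_def by blast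
  \<comment> \<open>The value 1 outside \<open>{M..}\<close> makes \<open>F\<close> Borel on the
    whole line and keeps its logarithm meaningful.\<close>
  define F where "F = (\<lambda>t. if t \<in> {M..} then f t else 1)"
  define h where "h x = ln (F (exp x))" for x
  have Fm: "F \<in> borel_measurable borel"
    unfolding F_def using M(1) by (subst (asm) measurable_restrict_space_iff[where c=1]) auto
  have hm [measurable]: "h \<in> borel_measurable borel"
    unfolding h_def using Fm by measurable
  have Fpos: "F t > 0" for t using M(2) by (auto simp: F_def)
  have hf: "h x = ln (f (exp x))" "f (exp x) > 0" if "x \<ge> ln (max M 1)" for x
  proof -
    have "exp x \<ge> max M 1"
      using that by (metis exp_ge_zero exp_le_cancel_iff exp_ln less_max_iff_disj zero_less_one)
    then show "h x = ln (f (exp x))" "f (exp x) > 0" using M(2) by (auto simp: h_def F_def)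
  qed
  have lim: "((\<lambda>x. h (x + u) - h x - \<rho> * u) \<longlongrightarrow> 0) at_top" for u
  proof -
    have "((\<lambda>t. f (t * exp u) / f t) \<longlongrightarrow> exp u powr \<rho>) at_top"
      by (rule regularly_varyingD(1)[OF rv]) simp
    then have "((\<lambda>x. f (exp x * exp u) / f (exp x)) \<longlongrightarrow> exp u powr \<rho>) at_top"
      by (rule filterlim_compose) (rule exp_at_top)
    then have "((\<lambda>x. ln (f (exp x * exp u) / f (exp x))) \<longlongrightarrow> ln (exp u powr \<rho>)) at_top"
      by (rule tendsto_ln) simp
    then have "((\<lambda>x. ln (f (exp (x + u)) / f (exp x)) - \<rho> * u) \<longlongrightarrow> \<rho> * u - \<rho> * u) at_top"
      by (intro tendsto_diff tendsto_const) (simp add: exp_add ln_powr)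
    then have "((\<lambda>x. ln (f (exp (x + u)) / f (exp x)) - \<rho> * u) \<longlongrightarrow> 0) at_top" by simp
    then show ?thesis
    proof (rule Lim_transform_eventually)
      show "\<forall>\<^sub>F x in at_top. ln (f (exp (x + u)) / f (exp x)) - \<rho> * u = h (x + u) - h x - \<rho> * u"
        using eventually_ge_at_top[of "ln (max M 1) + \<bar>u\<bar>"]
      proof eventually_elim
        case (elim x)
        then have "x \<ge> ln (max M 1)" "x + u \<ge> ln (max M 1)" by linarith+
        then show ?case using hf(1)[of x] hf(1)[of "x + u"] hf(2)[of x] hf(2)[of "x + u"] by (simp add: ln_div)
      qed
    qed
  qed
  have "\<exists>X. \<forall>x\<ge>X. \<forall>u\<in>{0..1}. \<bar>h (x + u) - h x - \<rho> * u\<bar> \<le> e"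
  proof (rule ccontr)
    assume "\<not> ?thesis"
    then have "\<forall>n::nat. \<exists>x u. x \<ge> real n \<and> u \<in> {0..1} \<and> \<bar>h (x + u) - h x - \<rho> * u\<bar> > e"
      by (meson not_le)
    then obtain x u where xu: "\<And>n. x n \<ge> real n" "\<And>n. u n \<in> {0..1}"
      "\<And>n. \<bar>h (x n + u n) - h (x n) - \<rho> * u n\<bar> > e" by metis
    \<comment> \<open>\<open>U y n\<close> collects the increments \<open>v\<close> that are
      accurate along \<open>y\<close> from index \<open>n\<close> on. By pointwise convergence these
      sets exhaust \<open>{0..2}\<close>, so their measures tend to 2.\<close>
    define U where "U y n = {v\<in>{0..2}. \<forall>m\<ge>n. \<bar>h (y m + v) - h (y m) - \<rho> * v\<bar> < e / 2}"
      for y :: "nat \<Rightarrow> real" and n :: nat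
    have Um: "U y n \<in> sets lborel" for y n unfolding U_def by measurable
    have Ulim: "(\<lambda>n. measure lborel (U y n)) \<longlonglongrightarrow> 2" if y: "filterlim y at_top sequentially" for y
    proof -
      have "(\<lambda>n. measure lborel (U y n)) \<longlonglongrightarrow> measure lborel (\<Union>n. U y n)"
      proof (rule Lim_measure_incseq)
        show "range (U y) \<subseteq> sets lborel" using Um by auto
        show "incseq (U y)" unfolding U_def incseq_def by auto
        have "emeasure lborel (\<Union>n. U y n) \<le> emeasure lborel {0..2::real}"
          by (rule emeasure_mono) (auto simp: U_def)
        then show "emeasure lborel (\<Union>n. U y n) \<noteq> \<infinity>" by (auto simp: top_unique)
      qed
      also have "(\<Union>n. U y n) = {0..2}"
      proof -
        have "\<exists>n. v \<in> U y n" if v: "v \<in> {0..2}" for v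
        proof -
          have "(\<lambda>n. h (y n + v) - h (y n) - \<rho> * v) \<longlonglongrightarrow> 0"
            by (rule filterlim_compose[OF lim y])
          then have "eventually (\<lambda>n. \<bar>h (y n + v) - h (y n) - \<rho> * v\<bar> < e / 2) sequentially"
            using e by (auto dest!: tendstoD[where e="e/2"] simp: dist_real_def)
          then show ?thesis using v by (auto simp: U_def eventually_sequentially)
        qed
        then show ?thesis by (auto simp: U_def)
      qed
      finally show ?thesis by simp
    qed
    have y1: "filterlim x at_top sequentially"
      using xu(1) by (intro filterlim_at_top_mono[OF filterlim_real_sequentially]) auto
    have y2: "filterlim (\<lambda>n. x n + u n) at_top sequentially"
      using xu(1,2) by (intro filterlim_at_top_mono[OF y1]) auto
    have "eventually (\<lambda>n. measure lborel (U x n) > 3/2 \<and> measure lborel (U (\<lambda>n. x n + u n) n) > 3/2) sequentially"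
      by (intro eventually_conj order_tendstoD[OF Ulim] y1 y2) auto
    then obtain n where n: "measure lborel (U x n) > 3/2" "measure lborel (U (\<lambda>n. x n + u n) n) > 3/2"
      by (auto simp: eventually_sequentially)
    let ?A = "U x n" and ?B = "(+) (u n) ` U (\<lambda>n. x n + u n) n"
    have Bm: "?B \<in> sets lborel"
    proof -
      have "?B = {w. w - u n \<in> U (\<lambda>n. x n + u n) n}"
        by (auto simp: image_iff) (metis add.commute diff_add_cancel)
      also have "\<dots> = (\<lambda>w. w - u n) -` U (\<lambda>n. x n + u n) n \<inter> space lborel" by auto
      also have "\<dots> \<in> sets lborel" by (rule measurable_sets[OF _ Um]) simp
      finally show ?thesis .
    qed
    have sub: "?A \<subseteq> {0..3}" "?B \<subseteq> {0..3}" using xu(2)[of n] by (auto simp: U_def)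
    have f3: "{0..3::real} \<in> fmeasurable lborel" by (rule fmeasurableI) auto
    have fin: "?A \<in> fmeasurable lborel" "?B \<in> fmeasurable lborel"
      by (rule fmeasurableI2[OF f3 sub(1) Um], rule fmeasurableI2[OF f3 sub(2) Bm])
    have "measure lborel ?B = measure lebesgue ?B"
      using Bm by (simp add: measure_completion)
    also have "\<dots> = measure lborel (U (\<lambda>n. x n + u n) n)"
      using Um by (simp add: measure_translation measure_completion)
    finally have mB: "measure lborel ?B > 3/2" using n by simp
    \<comment> \<open>Both sets lie in \<open>{0..3}\<close> and have measure above 3/2, so they
      meet. A common point is accurate seen from \<open>x n\<close> and seen from
      \<open>x n + u n\<close>; subtracting the two estimates contradicts the choice of
      \<open>u n\<close>.\<close>
    have "?A \<inter> ?B \<noteq> {}"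
    proof
      assume "?A \<inter> ?B = {}"
      then have "measure lborel (?A \<union> ?B) = measure lborel ?A + measure lborel ?B"
        using fin by (intro measure_Union) (auto simp: fmeasurable_def)
      moreover have "measure lborel (?A \<union> ?B) \<le> measure lborel {0..3::real}"
        using sub Um Bm f3 by (intro measure_mono_fmeasurable) (auto intro!: sets.Un)
      ultimately show False using n(1) mB by simp
    qed
    then obtain v where v: "u n + v \<in> U x n" "v \<in> U (\<lambda>n. x n + u n) n" by auto
    have "\<bar>h (x n + (u n + v)) - h (x n) - \<rho> * (u n + v)\<bar> < e / 2"
      using v(1) unfolding U_def by auto
    moreover have "\<bar>h (x n + u n + v) - h (x n + u n) - \<rho> * v\<bar> < e / 2"
      using v(2) unfolding U_def by auto
    ultimately show False using xu(3)[of n] by (auto simp: algebra_simps abs_if split: if_splits)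
  qed
  then obtain X where X: "\<forall>x\<ge>X. \<forall>u\<in>{0..1}. \<bar>h (x + u) - h x - \<rho> * u\<bar> \<le> e" by blast
  show ?thesis
  proof (intro exI[of _ "max X (ln (max M 1))"] allI impI ballI)
    fix x u assume x: "max X (ln (max M 1)) \<le> x" and u: "u \<in> {0..1::real}"
    then have "x + u \<ge> ln (max M 1)" by auto
    then have "h (x + u) = ln (f (exp (x + u)))" using hf(1) by blast
    then show "0 < f (exp x) \<and> \<bar>ln (f (exp (x + u))) - ln (f (exp x)) - \<rho> * u\<bar> \<le> e"
      using X[rule_format, of x u] x u hf(1,2)[of x] by simp
  qed
qed

text \<open>Potter's bounds. The uniform estimate on unit steps of the logarithmic scale is chained
  over the length \<open>v = ln y - ln x\<close>. Every started step costs at most \<open>d\<close>,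
  so the total error \<open>d * (v + 1)\<close> splits into the change \<open>d\<close> of the
  exponent and the constant \<open>exp d\<close>.\<close>

lemma regularly_varying_potter:
  assumes rv: "regularly_varying \<rho> f" and d: "d > 0"
  shows "\<exists>X K. X > 0 \<and> K \<ge> 1 \<and> (\<forall>x\<ge>X. f x > 0) \<and>
    (\<forall>x\<ge>X. \<forall>y\<ge>x. f y / f x \<le> K * (y / x) powr (\<rho> + d) \<and> f x / f y \<le> K * (x / y) powr (\<rho> - d))"
proof -
  obtain X where X0: "\<forall>x\<ge>X. \<forall>u\<in>{0..1}. f (exp x) > 0 \<and> \<bar>ln (f (exp (x + u))) - ln (f (exp x)) - \<rho> * u\<bar> \<le> d"
    using regularly_varying_log_uniform[OF rv d] by blast
  have X: "f (exp x) > 0" "\<bar>ln (f (exp (x + u))) - ln (f (exp x)) - \<rho> * u\<bar> \<le> d"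
    if "x \<ge> X" "u \<in> {0..1}" for x u
    using X0 that by blast+
  have iter: "\<bar>ln (f (exp (x + v))) - ln (f (exp x)) - \<rho> * v\<bar> \<le> d * (v + 1)"
    if "x \<ge> X" "0 \<le> v" "v \<le> real n" for x v n
    using that
  proof (induction n arbitrary: x v)
    case 0
    then show ?case using d by simp
  next
    case (Suc n)
    show ?case
    proof (cases "v \<le> 1")
      case True
      then show ?thesis using X(2)[of x v] Suc.prems d
        by (smt (verit) atLeastAtMost_iff mult_left_mono mult_cancel_left2)
    next
      case False
      have a: "\<bar>ln (f (exp (x + 1 + (v - 1)))) - ln (f (exp (x + 1))) - \<rho> * (v - 1)\<bar> \<le> d * (v - 1 + 1)"
        using Suc False by (intro Suc.IH) auto
      have b: "\<bar>ln (f (exp (x + 1))) - ln (f (exp x)) - \<rho> * 1\<bar> \<le> d"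
        using Suc by (intro X(2)) auto
      show ?thesis using a b by (auto simp: algebra_simps abs_if split: if_splits)
    qed
  qed
  have pos: "f x > 0" if "x \<ge> exp X" for x
  proof -
    have "x > 0" using that exp_gt_zero[of X] by linarith
    then have "ln x \<ge> X" using that by (simp add: ln_ge_iff)
    then have "f (exp (ln x)) > 0" using X(1)[of "ln x" 0] by auto
    then show ?thesis using \<open>x > 0\<close> by simp
  qed
  show ?thesis
  proof (rule exI[of _ "exp X"], rule exI[of _ "exp d"], intro conjI allI impI)
    show "1 \<le> exp d" using d by simp
    show "f x > 0" if "x \<ge> exp X" for x using that by (rule pos)
  next
    fix x y assume x: "x \<ge> exp X" and y: "x \<le> y"
    have xy: "x > 0" "y > 0" using x y exp_gt_zero[of X] by linarith+
    define v where "v = ln y - ln x"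
    have v: "v \<ge> 0" using y xy by (simp add: v_def)
    have "\<bar>ln (f (exp (ln x + v))) - ln (f (exp (ln x))) - \<rho> * v\<bar> \<le> d * (v + 1)"
      using x xy v by (intro iter[where n="nat \<lceil>v\<rceil>"]) (auto simp: ln_ge_iff)
    then have *: "\<bar>ln (f y) - ln (f x) - \<rho> * v\<bar> \<le> d * (v + 1)"
      using xy by (simp add: v_def)
    have fp: "f x > 0" "f y > 0" using x y by (auto intro!: pos)
    have "ln (f y / f x) \<le> d + (\<rho> + d) * v" using * fp by (simp add: ln_div algebra_simps abs_le_iff)
    then have "f y / f x \<le> exp (d + (\<rho> + d) * v)" using fp by (metis divide_pos_pos exp_ln exp_le_cancel_iff)
    also have "\<dots> = exp d * (y / x) powr (\<rho> + d)"
      using xy by (simp add: exp_add powr_def v_def ln_div)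
    finally show "f y / f x \<le> exp d * (y / x) powr (\<rho> + d)" .
    have "ln (f x / f y) \<le> d - (\<rho> - d) * v" using * fp by (simp add: ln_div algebra_simps abs_le_iff)
    then have "f x / f y \<le> exp (d - (\<rho> - d) * v)" using fp by (metis divide_pos_pos exp_ln exp_le_cancel_iff)
    also have "\<dots> = exp d * (x / y) powr (\<rho> - d)"
      using xy by (simp add: exp_diff exp_add[symmetric] powr_def v_def ln_div algebra_simps)
    finally show "f x / f y \<le> exp d * (x / y) powr (\<rho> - d)" .
  qed simp
qed

text \<open>The factor \<open>l i\<close> moves with \<open>i\<close>, so pointwise convergence does
  not suffice; the logarithmic estimate is used for its uniformity.\<close>

lemma regularly_varying_tendsto_compose:
  assumes rv: "regularly_varying \<rho> f" and l: "(l \<longlongrightarrow> x) F" and t: "filterlim t at_top F" and x: "x > 0"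
  shows "((\<lambda>i. f (t i * l i) / f (t i)) \<longlongrightarrow> x powr \<rho>) F"
proof -
  \<comment> \<open>With this base point \<open>ln (l i) - ln z\<close> tends to 1/2, the middle of
    the interval on which the estimate is uniform.\<close>
  define z where "z = x / exp (1/2)"
  have z: "z > 0" using x by (simp add: z_def)
  have tz: "filterlim (\<lambda>i. t i * z) at_top F"
    using filterlim_tendsto_pos_mult_at_top[OF tendsto_const z t] by (simp add: mult.commute)
  define u where "u i = ln (l i) - ln z" for i
  have ulim: "(u \<longlongrightarrow> 1/2) F"
  proof -
    have "((\<lambda>i. ln (l i) - ln z) \<longlongrightarrow> ln x - ln z) F" using x by (intro tendsto_intros l) auto
    then show ?thesis using x by (simp add: u_def[abs_def] z_def ln_div)
  qed
  have ev_u: "eventually (\<lambda>i. u i \<in> {0..1}) F"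
    using order_tendstoD(1)[OF ulim, of 0, simplified] order_tendstoD(2)[OF ulim, of 1, simplified]
    by eventually_elim simp
  have ev_l: "eventually (\<lambda>i. l i > 0) F" using order_tendstoD(1)[OF l x] .
  have lim0: "((\<lambda>i. ln (f (t i * l i)) - ln (f (t i * z)) - \<rho> * u i) \<longlongrightarrow> 0) F"
  proof (rule tendstoI)
    fix e :: real assume "e > 0"
    then have "e / 2 > 0" by simp
    then obtain X where X0: "\<forall>x\<ge>X. \<forall>u\<in>{0..1}. f (exp x) > 0 \<and> \<bar>ln (f (exp (x + u))) - ln (f (exp x)) - \<rho> * u\<bar> \<le> e/2"
      using regularly_varying_log_uniform[OF rv] by blast
    have X: "f (exp x) > 0" "\<bar>ln (f (exp (x + u))) - ln (f (exp x)) - \<rho> * u\<bar> \<le> e/2"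
      if "x \<ge> X" "u \<in> {0..1}" for x u
      using X0 that by blast+
    have "eventually (\<lambda>i. t i * z \<ge> exp X) F" using tz by (auto simp: filterlim_at_top)
    then show "eventually (\<lambda>i. dist (ln (f (t i * l i)) - ln (f (t i * z)) - \<rho> * u i) 0 < e) F"
      using ev_u ev_l
    proof eventually_elim
      case (elim i)
      have "t i * z > 0" using elim(1) exp_gt_zero[of X] by linarith
      then have tp: "t i > 0" using z by (simp add: zero_less_mult_iff)
      have 1: "exp (ln (t i * z)) = t i * z" using \<open>t i * z > 0\<close> by simp
      have 2: "exp (ln (t i * z) + u i) = t i * l i"
        using tp z elim(3) by (simp add: u_def ln_mult exp_add exp_diff)
      have "\<bar>ln (f (exp (ln (t i * z) + u i))) - ln (f (exp (ln (t i * z)))) - \<rho> * u i\<bar> \<le> e/2"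
        using elim \<open>t i * z > 0\<close> by (intro X(2)) (auto simp: ln_ge_iff)
      then show ?case using \<open>e > 0\<close> unfolding 1 2 by (simp add: dist_real_def)
    qed
  qed
  have fz: "((\<lambda>i. f (t i * z) / f (t i)) \<longlongrightarrow> z powr \<rho>) F"
    by (rule filterlim_compose[OF regularly_varyingD(1)[OF rv z] t])
  have pos: "eventually (\<lambda>i. f (t i * z) > 0 \<and> f (t i * l i) > 0) F"
  proof -
    obtain X where X: "\<And>t. t \<ge> X \<Longrightarrow> f t > 0" using regularly_varyingD(2)[OF rv] by (auto simp: eventually_at_top_linorder)
    have "eventually (\<lambda>i. t i * z \<ge> max X 0) F" using tz unfolding filterlim_at_top by blast
    then show ?thesis using ev_u ev_l
    proof eventually_elim
      case (elim i)
      then have "t i \<ge> 0" using z by (simp add: zero_le_mult_iff)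
      have "z \<le> l i" using elim z by (simp add: u_def)
      then have "t i * z \<le> t i * l i" using \<open>t i \<ge> 0\<close> by (intro mult_left_mono)
      then show ?case using X elim by auto
    qed
  qed
  have "((\<lambda>i. exp ((ln (f (t i * l i)) - ln (f (t i * z)) - \<rho> * u i) + \<rho> * u i) * (f (t i * z) / f (t i)))
     \<longlongrightarrow> exp (0 + \<rho> * (1/2)) * z powr \<rho>) F"
    by (intro tendsto_intros lim0 ulim fz)
  moreover have "exp (0 + \<rho> * (1/2)) * z powr \<rho> = x powr \<rho>"
    using x z by (simp add: powr_def exp_add[symmetric]) (simp add: z_def ln_div algebra_simps)
  ultimately show ?thesis
  proof (subst tendsto_cong)
    show "\<forall>\<^sub>F i in F. f (t i * l i) / f (t i) =
      exp ((ln (f (t i * l i)) - ln (f (t i * z)) - \<rho> * u i) + \<rho> * u i) * (f (t i * z) / f (t i))"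
      using pos by eventually_elim (simp add: exp_diff)
  qed simp
qed

lemma regularly_varying_at_top:
  assumes rv: "regularly_varying \<rho> f" and r: "\<rho> > 0"
  shows "filterlim f at_top at_top"
proof -
  obtain X K where X: "X > 0" "K \<ge> 1" "\<And>x. x \<ge> X \<Longrightarrow> f x > 0"
    "\<And>x y. x \<ge> X \<Longrightarrow> y \<ge> x \<Longrightarrow> f x / f y \<le> K * (x / y) powr (\<rho> - \<rho>/2)"
    using regularly_varying_potter[OF rv, of "\<rho>/2"] r by (metis half_gt_zero)
  have "filterlim (\<lambda>y. f X / K / X powr (\<rho>/2) * y powr (\<rho>/2)) at_top at_top"
    using X r by (intro filterlim_tendsto_pos_mult_at_top[OF tendsto_const]) (auto intro: real_powr_at_top)
  then show ?thesis
  proof (rule filterlim_at_top_mono)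
    show "\<forall>\<^sub>F y in at_top. f X / K / X powr (\<rho>/2) * y powr (\<rho>/2) \<le> f y"
      using eventually_ge_at_top[of X]
    proof eventually_elim
      case (elim y)
      have "f X / f y \<le> K * (X powr (\<rho>/2) / y powr (\<rho>/2))"
        using X(4)[of X y] X(1) elim by (simp add: powr_divide)
      then show ?case using X(1,2) X(3)[of X] X(3)[of y] elim by (simp add: field_simps)
    qed
  qed
qed

lemma regularly_varying_inverse:
  assumes rv: "regularly_varying \<rho> f"
  shows "regularly_varying (-\<rho>) (\<lambda>t. 1 / f t)"
  unfolding regularly_varying_def
proof (intro conjI allI impI)
  from rv obtain M where M: "f \<in> borel_measurable (restrict_space borel {M..})" "\<And>t. t \<ge> M \<Longrightarrow> 0 < f t"
    unfolding regularly_varying_def by blast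
  show "\<exists>M. (\<lambda>t. 1 / f t) \<in> borel_measurable (restrict_space borel {M..}) \<and> (\<forall>t\<ge>M. 0 < 1 / f t)"
    using M by (intro exI[of _ M]) auto
  fix x :: real assume x: "x > 0"
  have "((\<lambda>t. inverse (f (t * x) / f t)) \<longlongrightarrow> inverse (x powr \<rho>)) at_top"
    using x by (intro tendsto_inverse regularly_varyingD[OF rv]) auto
  then show "((\<lambda>t. 1 / f (t * x) / (1 / f t)) \<longlongrightarrow> x powr - \<rho>) at_top"
    using x by (simp add: powr_minus)
qed

lemma regularly_varying_tendsto_0:
  assumes rv: "regularly_varying \<rho> f" and r: "\<rho> < 0"
  shows "(f \<longlongrightarrow> 0) at_top"
proof -
  have "filterlim (\<lambda>t. 1 / f t) at_top at_top"
    using regularly_varying_at_top[OF regularly_varying_inverse[OF rv]] r by simp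
  then have "((\<lambda>t. inverse (1 / f t)) \<longlongrightarrow> 0) at_top"
    by (rule tendsto_inverse_0_at_top)
  then show ?thesis by simp
qed

lemma regularly_varying_mult:
  assumes f: "regularly_varying \<rho> f" and g: "regularly_varying \<sigma> g"
  shows "regularly_varying (\<rho> + \<sigma>) (\<lambda>t. f t * g t)"
  unfolding regularly_varying_def
proof (intro conjI allI impI)
  from f obtain M where M: "f \<in> borel_measurable (restrict_space borel {M..})" "\<And>t. t \<ge> M \<Longrightarrow> 0 < f t"
    unfolding regularly_varying_def by blast
  from g obtain N where N: "g \<in> borel_measurable (restrict_space borel {N..})" "\<And>t. t \<ge> N \<Longrightarrow> 0 < g t"
    unfolding regularly_varying_def by blast
  have "f \<in> borel_measurable (restrict_space borel {max M N..})"
    by (rule measurable_restrict_mono[OF M(1)]) auto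
  moreover have "g \<in> borel_measurable (restrict_space borel {max M N..})"
    by (rule measurable_restrict_mono[OF N(1)]) auto
  ultimately have "(\<lambda>t. f t * g t) \<in> borel_measurable (restrict_space borel {max M N..})"
    by (rule borel_measurable_times)
  then show "\<exists>M. (\<lambda>t. f t * g t) \<in> borel_measurable (restrict_space borel {M..}) \<and> (\<forall>t\<ge>M. 0 < f t * g t)"
    using M(2) N(2) by (intro exI[of _ "max M N"]) auto
  fix x :: real assume x: "x > 0"
  have "((\<lambda>t. (f (t * x) / f t) * (g (t * x) / g t)) \<longlongrightarrow> x powr \<rho> * x powr \<sigma>) at_top"
    using x by (intro tendsto_mult regularly_varyingD[OF f] regularly_varyingD[OF g])
  then show "((\<lambda>t. f (t * x) * g (t * x) / (f t * g t)) \<longlongrightarrow> x powr (\<rho> + \<sigma>)) at_top"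
    using x by (simp add: powr_add times_divide_times_eq)
qed

lemma regularly_varying_powr: "regularly_varying \<rho> (\<lambda>t. t powr \<rho>)"
  unfolding regularly_varying_def
proof (intro conjI allI impI)
  show "\<exists>M. (\<lambda>t::real. t powr \<rho>) \<in> borel_measurable (restrict_space borel {M..}) \<and> (\<forall>t\<ge>M. 0 < t powr \<rho>)"
    by (intro exI[of _ 1]) (auto intro: measurable_restrict_space1)
  fix x :: real assume x: "x > 0"
  have "eventually (\<lambda>t. x powr \<rho> = (t * x) powr \<rho> / t powr \<rho>) at_top"
    using eventually_gt_at_top[of 0] by eventually_elim (use x in \<open>simp add: powr_mult\<close>)
  then show "((\<lambda>t. (t * x) powr \<rho> / t powr \<rho>) \<longlongrightarrow> x powr \<rho>) at_top"
    by (rule tendsto_eventually[OF eventually_mono]) simp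
qed

lemma regularly_varying_ident: "regularly_varying 1 (\<lambda>t. t)"
  unfolding regularly_varying_def
proof (intro conjI allI impI)
  show "\<exists>M. (\<lambda>t::real. t) \<in> borel_measurable (restrict_space borel {M..}) \<and> (\<forall>t\<ge>M. 0 < t)"
    by (intro exI[of _ 1]) (auto intro: measurable_restrict_space1)
  fix x :: real assume x: "x > 0"
  have "eventually (\<lambda>t. (t * x) / t = x powr 1) at_top"
    using eventually_gt_at_top[of 0] by eventually_elim (use x in simp)
  then show "((\<lambda>t. (t * x) / t) \<longlongrightarrow> x powr 1) at_top"
    by (rule tendsto_eventually)
qed

text \<open>Transfers regular variation from products of known functions to functions such as
  \<open>c\<close>, \<open>a0\<close> and \<open>Cc\<close>, which are only asymptotically
  proportional to such products.\<close>

lemma regularly_varying_asymp: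
  assumes g: "regularly_varying \<rho> g" and fm: "f \<in> borel_measurable borel"
    and lim: "((\<lambda>t. f t / g t) \<longlongrightarrow> L) at_top" and L: "L > 0"
  shows "regularly_varying \<rho> f"
  unfolding regularly_varying_def
proof (intro conjI allI impI)
  have gp: "eventually (\<lambda>t. g t > 0) at_top" by (rule regularly_varyingD[OF g])
  have rp: "eventually (\<lambda>t. f t / g t > 0) at_top" using order_tendstoD(1)[OF lim L] .
  have fp: "eventually (\<lambda>t. f t > 0) at_top"
    using gp rp by eventually_elim (auto simp: zero_less_divide_iff)
  then obtain M where M: "\<And>t. t \<ge> M \<Longrightarrow> f t > 0" by (auto simp: eventually_at_top_linorder)
  then show "\<exists>M. f \<in> borel_measurable (restrict_space borel {M..}) \<and> (\<forall>t\<ge>M. 0 < f t)"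
    using fm by (intro exI[of _ M]) (auto intro: measurable_restrict_space1)
  fix x :: real assume x: "x > 0"
  have tx: "filterlim (\<lambda>t. t * x) at_top at_top"
    using filterlim_tendsto_pos_mult_at_top[OF tendsto_const x filterlim_ident] by (simp add: mult.commute)
  have "((\<lambda>t. (f (t * x) / g (t * x)) / (f t / g t) * (g (t * x) / g t)) \<longlongrightarrow> L / L * x powr \<rho>) at_top"
    using L x by (intro tendsto_intros filterlim_compose[OF lim tx] lim regularly_varyingD[OF g]) auto
  moreover have "eventually (\<lambda>t. g (t * x) > 0) at_top"
    using filterlim_iff[THEN iffD1, OF tx, rule_format, OF gp] .
  then have "\<forall>\<^sub>F t in at_top. (f (t * x) / g (t * x)) / (f t / g t) * (g (t * x) / g t) = f (t * x) / f t"
    using gp by eventually_elim simp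
  ultimately show "((\<lambda>t. f (t * x) / f t) \<longlongrightarrow> x powr \<rho>) at_top"
    using L by (simp add: tendsto_cong)
qed

subsection \<open>Integrals on the half line\<close>

text \<open>The explicit integrals below are evaluated for nonnegative functions, where integrals
  may be exchanged freely; this turns such a value into integrability together with the real
  value.\<close>

lemma set_integral_eq_nn_integralI:
  fixes f :: "'a \<Rightarrow> real"
  assumes m: "set_borel_measurable M A f" and nn: "\<And>x. x \<in> A \<Longrightarrow> 0 \<le> f x"
    and i: "(\<integral>\<^sup>+x\<in>A. ennreal (f x) \<partial>M) = ennreal v" and v: "0 \<le> v"
  shows "set_integrable M A f" "(LINT x:A|M. f x) = v"
proof -
  have e: "(\<integral>\<^sup>+x. ennreal (indicator A x *\<^sub>R f x) \<partial>M) = ennreal v"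
    unfolding i[symmetric] by (intro nn_integral_cong) (auto split: split_indicator)
  have "has_bochner_integral M (\<lambda>x. indicator A x *\<^sub>R f x) v"
    using m v nn e unfolding set_borel_measurable_def
    by (intro has_bochner_integral_nn_integral) (auto split: split_indicator)
  then show "set_integrable M A f" "(LINT x:A|M. f x) = v"
    unfolding set_integrable_def set_lebesgue_integral_def by (auto simp: has_bochner_integral_iff)
qed

lemma nn_set_integral_eq_set_integral:
  fixes f :: "'a \<Rightarrow> real"
  assumes i: "set_integrable M A f" and nn: "\<And>x. x \<in> A \<Longrightarrow> 0 \<le> f x"
  shows "(\<integral>\<^sup>+x\<in>A. ennreal (f x) \<partial>M) = ennreal (LINT x:A|M. f x)"
proof -
  have "(\<integral>\<^sup>+x\<in>A. ennreal (f x) \<partial>M) = (\<integral>\<^sup>+x. ennreal (indicator A x *\<^sub>R f x) \<partial>M)"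
    by (intro nn_integral_cong) (auto split: split_indicator)
  also have "\<dots> = ennreal (LINT x:A|M. f x)"
    unfolding set_lebesgue_integral_def using i nn unfolding set_integrable_def
    by (intro nn_integral_eq_integral) (auto split: split_indicator)
  finally show ?thesis .
qed

lemma set_integrable_nonneg_bound:
  fixes f :: "'a \<Rightarrow> real"
  assumes "set_borel_measurable M A f" and nn: "\<And>x. x \<in> A \<Longrightarrow> 0 \<le> f x"
    and i: "(\<integral>\<^sup>+x\<in>A. ennreal (f x) \<partial>M) < \<infinity>"
  shows "set_integrable M A f"
  unfolding set_integrable_def
proof (rule integrableI_nonneg)
  have "(\<integral>\<^sup>+x. ennreal (indicator A x *\<^sub>R f x) \<partial>M) = (\<integral>\<^sup>+x\<in>A. ennreal (f x) \<partial>M)"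
    by (intro nn_integral_cong) (auto split: split_indicator)
  then show "(\<integral>\<^sup>+x. ennreal (indicator A x *\<^sub>R f x) \<partial>M) < \<infinity>" using i by simp
qed (use assms in \<open>auto simp: set_borel_measurable_def split: split_indicator\<close>)

lemma set_integrable_measurable:
  "set_integrable M A f \<Longrightarrow> (\<lambda>x. indicator A x *\<^sub>R f x) \<in> borel_measurable M"
  unfolding set_integrable_def by (rule borel_measurable_integrable)

lemma Gamma_nn_integral_scaled:
  assumes q: "q > 0" and r: "r > 0"
  shows "(\<integral>\<^sup>+u\<in>{0<..}. ennreal (u powr (q - 1) * exp (- (r * u))) \<partial>lborel) = ennreal (Gamma q * r powr (- q))"
proof -
  have "ennreal (Gamma q) = (\<integral>\<^sup>+t. ennreal (indicator {0..} t * t powr (q - 1) / exp t) \<partial>lborel)"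
    by (rule Gamma_conv_nn_integral_real[OF q])
  also have "\<dots> = (\<integral>\<^sup>+t. ennreal (indicator {0<..} t * t powr (q - 1) / exp t) \<partial>lborel)"
    using AE_lborel_singleton[of 0] by (intro nn_integral_cong_AE) (auto elim!: eventually_mono split: split_indicator)
  also have "\<dots> = r * (\<integral>\<^sup>+u. ennreal (indicator {0<..} (0 + r * u) * (0 + r * u) powr (q - 1) / exp (0 + r * u)) \<partial>lborel)"
    using r by (subst nn_integral_real_affine[where c=r and t=0]) auto
  also have "\<dots> = r * (\<integral>\<^sup>+u. ennreal (r powr (q - 1)) * (ennreal (u powr (q - 1) * exp (- (r * u))) * indicator {0<..} u) \<partial>lborel)"
  proof (intro arg_cong[where f="(*) (ennreal r)"] nn_integral_cong)
    fix u :: real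
    show "ennreal (indicator {0<..} (0 + r * u) * (0 + r * u) powr (q - 1) / exp (0 + r * u))
      = ennreal (r powr (q - 1)) * (ennreal (u powr (q - 1) * exp (- (r * u))) * indicator {0<..} u)"
    proof (cases "u > 0")
      case True
      then have *: "(r * u) powr (q - 1) / exp (r * u) = r powr (q - 1) * (u powr (q - 1) * exp (- (r * u)))"
        using r by (simp add: powr_mult exp_minus divide_inverse)
      have "ennreal (indicator {0<..} (0 + r * u) * (0 + r * u) powr (q - 1) / exp (0 + r * u))
        = ennreal ((r * u) powr (q - 1) / exp (r * u))" using True r by simp
      also have "\<dots> = ennreal (r powr (q - 1)) * ennreal (u powr (q - 1) * exp (- (r * u)))"
        unfolding * by (rule ennreal_mult) simp_all
      finally show ?thesis using True by simp
    next
      case False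
      then have "\<not> r * u > 0" using r by (simp add: zero_less_mult_iff)
      then show ?thesis using False by simp
    qed
  qed
  also have "\<dots> = r * (ennreal (r powr (q - 1)) * (\<integral>\<^sup>+u\<in>{0<..}. ennreal (u powr (q - 1) * exp (- (r * u))) \<partial>lborel))"
    by (subst nn_integral_cmult) auto
  also have "\<dots> = ennreal (r powr q) * (\<integral>\<^sup>+u\<in>{0<..}. ennreal (u powr (q - 1) * exp (- (r * u))) \<partial>lborel)"
    using r by (simp only: mult.assoc[symmetric] ennreal_mult[symmetric] powr_ge_zero less_imp_le powr_mult_base) (simp add: powr_mult_base)
  finally have e: "ennreal (Gamma q) = ennreal (r powr q) * (\<integral>\<^sup>+u\<in>{0<..}. ennreal (u powr (q - 1) * exp (- (r * u))) \<partial>lborel)" .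
  have "ennreal (Gamma q * r powr (- q)) = ennreal (r powr (- q)) * ennreal (Gamma q)"
    using r q by (simp add: ennreal_mult[symmetric] mult.commute Gamma_real_nonneg)
  also have "\<dots> = ennreal (r powr (- q) * r powr q) * (\<integral>\<^sup>+u\<in>{0<..}. ennreal (u powr (q - 1) * exp (- (r * u))) \<partial>lborel)"
    unfolding e by (simp only: mult.assoc[symmetric] ennreal_mult[symmetric] powr_ge_zero)
  also have "r powr (- q) * r powr q = 1" using r by (simp add: powr_add[symmetric])
  finally show ?thesis by simp
qed

lemma Gamma_reflection_real:
  fixes q :: real
  shows "Gamma q * Gamma (1 - q) = pi / sin (pi * q)"
proof -
  have "complex_of_real (Gamma q * Gamma (1 - q)) = Gamma (of_real q) * Gamma (of_real (1 - q))"
    by (simp only: of_real_mult Gamma_complex_of_real)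
  also have "\<dots> = Gamma (of_real q) * Gamma (1 - of_real q)" by (simp only: of_real_diff of_real_1)
  also have "\<dots> = of_real pi / sin (of_real pi * of_real q)" by (rule Gamma_reflection_complex)
  also have "\<dots> = complex_of_real (pi / sin (pi * q))" by (simp only: of_real_mult[symmetric] sin_of_real of_real_divide)
  finally show ?thesis by (simp only: of_real_eq_iff)
qed

lemma sin_pi_mult_pos:
  assumes "0 < q" "q < 1" shows "sin (pi * q) > 0"
  using assms by (intro sin_gt_zero) auto

text \<open>Writing \<open>1 / (s + u)\<close> as a Laplace integral in \<open>r\<close> and
  exchanging the integrals leaves two Gamma integrals, and the product
  \<open>Gamma q * Gamma (1 - q)\<close> is evaluated by the reflection formula.\<close>

lemma stieltjes_powr_nn_integral:
  assumes q: "0 < q" "q < 1" and s: "s > 0"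
  shows "(\<integral>\<^sup>+u\<in>{0<..}. ennreal (u powr (q - 1) / (s + u)) \<partial>lborel) = ennreal (s powr (q - 1) * (pi / sin (pi * q)))"
proof -
  have inv: "ennreal (1 / z) = (\<integral>\<^sup>+r\<in>{0<..}. ennreal (exp (- (r * z))) \<partial>lborel)" if "z > 0" for z
  proof -
    have "(\<integral>\<^sup>+r\<in>{0<..}. ennreal (exp (- (r * z))) \<partial>lborel) = (\<integral>\<^sup>+r\<in>{0<..}. ennreal (r powr (1 - 1) * exp (- (z * r))) \<partial>lborel)"
      by (intro nn_integral_cong) (auto split: split_indicator simp: mult.commute)
    also have "\<dots> = ennreal (1 / z)"
      using that by (subst Gamma_nn_integral_scaled) (auto simp: powr_minus field_simps)
    finally show ?thesis ..
  qed
  have "(\<integral>\<^sup>+u\<in>{0<..}. ennreal (u powr (q - 1) / (s + u)) \<partial>lborel)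
      = (\<integral>\<^sup>+u. (\<integral>\<^sup>+r. ennreal (u powr (q - 1) * exp (- (r * (s + u)))) * indicator {0<..} r * indicator {0<..} u \<partial>lborel) \<partial>lborel)"
  proof (intro nn_integral_cong)
    fix u :: real
    show "ennreal (u powr (q - 1) / (s + u)) * indicator {0<..} u
      = (\<integral>\<^sup>+r. ennreal (u powr (q - 1) * exp (- (r * (s + u)))) * indicator {0<..} r * indicator {0<..} u \<partial>lborel)"
    proof (cases "u > 0")
      case True
      have "ennreal (u powr (q - 1) / (s + u)) = ennreal (u powr (q - 1)) * ennreal (1 / (s + u))"
        using True s by (simp add: ennreal_mult[symmetric])
      also have "\<dots> = (\<integral>\<^sup>+r. ennreal (u powr (q - 1)) * (ennreal (exp (- (r * (s + u)))) * indicator {0<..} r) \<partial>lborel)"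
        using True s by (subst inv) (auto simp: nn_integral_cmult)
      finally show ?thesis using True by (simp add: ennreal_mult mult.assoc)
    qed simp
  qed
  also have "\<dots> = (\<integral>\<^sup>+r. (\<integral>\<^sup>+u. ennreal (u powr (q - 1) * exp (- (r * (s + u)))) * indicator {0<..} r * indicator {0<..} u \<partial>lborel) \<partial>lborel)"
    by (rule lborel_pair.Fubini') measurable
  also have "\<dots> = (\<integral>\<^sup>+r. ennreal (Gamma q) * (ennreal (r powr ((1 - q) - 1) * exp (- (s * r))) * indicator {0<..} r) \<partial>lborel)"
  proof (intro nn_integral_cong)
    fix r :: real
    show "(\<integral>\<^sup>+u. ennreal (u powr (q - 1) * exp (- (r * (s + u)))) * indicator {0<..} r * indicator {0<..} u \<partial>lborel)
      = ennreal (Gamma q) * (ennreal (r powr ((1 - q) - 1) * exp (- (s * r))) * indicator {0<..} r)"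
    proof (cases "r > 0")
      case True
      have ex: "exp (- (r * (s + u))) = exp (- (r * s)) * exp (- (r * u))" for u
        by (simp add: mult_exp_exp algebra_simps)
      have "(\<integral>\<^sup>+u. ennreal (u powr (q - 1) * exp (- (r * (s + u)))) * indicator {0<..} r * indicator {0<..} u \<partial>lborel)
        = (\<integral>\<^sup>+u. ennreal (exp (- (r * s))) * (ennreal (u powr (q - 1) * exp (- (r * u))) * indicator {0<..} u) \<partial>lborel)"
        using True unfolding ex by (intro nn_integral_cong) (simp add: ennreal_mult[symmetric] mult_ac split: split_indicator)
      also have "\<dots> = ennreal (exp (- (r * s))) * ennreal (Gamma q * r powr (- q))"
        using True q by (simp add: nn_integral_cmult Gamma_nn_integral_scaled)
      finally show ?thesis using True q by (simp add: ennreal_mult[symmetric] Gamma_real_nonneg mult_ac)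
    qed simp
  qed
  also have "\<dots> = ennreal (Gamma q) * ennreal (Gamma (1 - q) * s powr (- (1 - q)))"
    using q s by (subst nn_integral_cmult) (simp_all only: Gamma_nn_integral_scaled diff_gt_0_iff_gt, measurable)
  also have "\<dots> = ennreal (s powr (q - 1) * (pi / sin (pi * q)))"
    using q by (simp add: ennreal_mult[symmetric] Gamma_real_nonneg Gamma_reflection_real[symmetric] mult_ac)
  finally show ?thesis .
qed

lemma stieltjes_powr_integral:
  assumes q: "0 < q" "q < 1" and s: "s > 0"
  shows "set_integrable lborel {0<..} (\<lambda>u. u powr (q - 1) / (s + u))"
    and "(LINT u:{0<..}|lborel. u powr (q - 1) / (s + u)) = s powr (q - 1) * (pi / sin (pi * q))"
  using set_integral_eq_nn_integralI[OF _ _ stieltjes_powr_nn_integral[OF q s]] sin_pi_mult_pos[OF q] s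
  by (auto simp: set_borel_measurable_def)

text \<open>Partial fractions: the numerator \<open>w powr q\<close> is
  \<open>w * w powr (q - 1)\<close>, and \<open>w / ((w + A) * (w + B))\<close> is a combination of
  simple poles. This leaves two Stieltjes integrals with exponent \<open>q - 1\<close>.\<close>

lemma stieltjes_two_poles_integral:
  assumes q: "0 < q" "q < 1" and A: "A > 0" and B: "B > 0" and AB: "A \<noteq> B"
  shows "set_integrable lborel {0<..} (\<lambda>w. w powr q / ((w + A) * (w + B)))"
    and "(LINT w:{0<..}|lborel. w powr q / ((w + A) * (w + B))) = (pi / sin (pi * q)) * (A powr q - B powr q) / (A - B)"
proof -
  let ?f = "\<lambda>w. (A / (A - B)) * (w powr (q - 1) / (A + w)) - (B / (A - B)) * (w powr (q - 1) / (B + w))"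
  have e: "w powr q / ((w + A) * (w + B)) = ?f w" if "w \<in> {0<..}" for w
  proof -
    have w: "w > 0" using that by simp
    have "w powr q = w * w powr (q - 1)" using w by (simp add: powr_mult_base)
    moreover have "A / (A + w) - B / (B + w) = (A - B) * (w / ((w + A) * (w + B)))"
    proof -
      have nz: "A + w \<noteq> 0" "B + w \<noteq> 0" using w A B by auto
      have "A / (A + w) - B / (B + w) = (A * (B + w) - B * (A + w)) / ((A + w) * (B + w))"
        using nz by (simp add: diff_frac_eq)
      also have "A * (B + w) - B * (A + w) = (A - B) * w" by (simp add: algebra_simps)
      finally show ?thesis by (simp add: add.commute)
    qed
    moreover have "?f w = w powr (q - 1) / (A - B) * (A / (A + w) - B / (B + w))"
      by (simp add: right_diff_distrib mult.commute)
    ultimately show ?thesis using AB by simp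
  qed
  have i: "set_integrable lborel {0<..} ?f"
    by (intro set_integral_diff set_integrable_mult_right stieltjes_powr_integral q A B)
  show "set_integrable lborel {0<..} (\<lambda>w. w powr q / ((w + A) * (w + B)))"
    using i by (rule set_integrable_cong[THEN iffD1, rotated -1]) (use e in auto)
  have "(LINT w:{0<..}|lborel. w powr q / ((w + A) * (w + B))) = (LINT w:{0<..}|lborel. ?f w)"
    by (intro set_lebesgue_integral_cong) (use e in auto)
  also have "\<dots> = (LINT w:{0<..}|lborel. (A / (A - B)) * (w powr (q - 1) / (A + w)))
      - (LINT w:{0<..}|lborel. (B / (A - B)) * (w powr (q - 1) / (B + w)))"
    by (intro set_integral_diff(2) set_integrable_mult_right stieltjes_powr_integral q A B)
  also have "\<dots> = (A / (A - B)) * (A powr (q - 1) * (pi / sin (pi * q))) - (B / (A - B)) * (B powr (q - 1) * (pi / sin (pi * q)))"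
    by (simp only: set_integral_mult_right stieltjes_powr_integral(2)[OF q A] stieltjes_powr_integral(2)[OF q B])
  also have "\<dots> = (pi / sin (pi * q)) * (A * A powr (q - 1) - B * B powr (q - 1)) / (A - B)"
    by (simp add: diff_divide_distrib right_diff_distrib mult_ac)
  also have "\<dots> = (pi / sin (pi * q)) * (A powr q - B powr q) / (A - B)"
    using A B by (simp add: powr_mult_base)
  finally show "(LINT w:{0<..}|lborel. w powr q / ((w + A) * (w + B))) = (pi / sin (pi * q)) * (A powr q - B powr q) / (A - B)" .
qed

text \<open>\<open>f\<close> may be unbounded at 0, so the fundamental theorem is applied on
  \<open>{x/2..y}\<close> only; the part of the integral below \<open>x/2\<close> is a
  constant.\<close>

lemma DERIV_set_integral_Ioo:
  fixes f :: "real \<Rightarrow> real"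
  assumes cont: "continuous_on {0<..} f" and int: "\<And>x. x > 0 \<Longrightarrow> set_integrable lborel {0<..<x} f"
    and x: "x > 0"
  shows "((\<lambda>x. LINT v:{0<..<x}|lborel. f v) has_real_derivative f x) (at x)"
proof -
  have split: "(LINT v:{0<..<y}|lborel. f v) = (LINT v:{0<..<x/2}|lborel. f v) + integral {x/2..y} f"
    if y: "y > x/2" for y
  proof -
    have c: "set_integrable lborel {x/2..y} f"
      using x by (intro borel_integrable_compact[unfolded real_scaleR_def[symmetric], folded set_integrable_def] continuous_on_subset[OF cont]) auto
    have "(LINT v:{0<..<y}|lborel. f v) = (LINT v:{0<..<x/2} \<union> {x/2..<y}|lborel. f v)"
      using x y by (intro arg_cong[where f="\<lambda>A. set_lebesgue_integral lborel A f"]) auto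
    also have "\<dots> = (LINT v:{0<..<x/2}|lborel. f v) + (LINT v:{x/2..<y}|lborel. f v)"
      using x by (intro set_integral_Un int set_integrable_subset[OF c]) auto
    also have "(LINT v:{x/2..<y}|lborel. f v) = (LINT v:{x/2..y}|lborel. f v)"
      unfolding set_lebesgue_integral_def
    proof (rule integral_cong_AE)
      show "(\<lambda>v. indicat_real {x/2..<y} v *\<^sub>R f v) \<in> borel_measurable lborel"
        by (rule set_integrable_measurable[OF set_integrable_subset[OF c]]) auto
      show "(\<lambda>v. indicat_real {x/2..y} v *\<^sub>R f v) \<in> borel_measurable lborel"
        using c unfolding set_integrable_def by (rule borel_measurable_integrable)
      show "AE v in lborel. indicat_real {x/2..<y} v *\<^sub>R f v = indicat_real {x/2..y} v *\<^sub>R f v"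
        using AE_lborel_singleton[of y] by eventually_elim (auto split: split_indicator)
    qed
    also have "\<dots> = integral {x/2..y} f" by (rule set_borel_integral_eq_integral(2)[OF c])
    finally show ?thesis .
  qed
  have "((\<lambda>y. integral {x/2..y} f) has_real_derivative f x) (at x within {x/2..2*x})"
    using x by (intro integral_has_real_derivative continuous_on_subset[OF cont]) auto
  then have "((\<lambda>y. integral {x/2..y} f) has_real_derivative f x) (at x)"
    using x by (subst (asm) at_within_interior) auto
  then have "((\<lambda>y. (LINT v:{0<..<x/2}|lborel. f v) + integral {x/2..y} f) has_real_derivative f x) (at x)"
    by (auto intro!: derivative_eq_intros)
  then show ?thesis
  proof (rule DERIV_cong_ev[THEN iffD1, rotated -1])
    have "eventually (\<lambda>y. y \<in> {x/2<..}) (nhds x)" using x by (intro eventually_nhds_in_open) auto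
    then show "\<forall>\<^sub>F y in nhds x. (LINT v:{0<..<x/2}|lborel. f v) + integral {x/2..y} f = (LINT v:{0<..<y}|lborel. f v)"
      by eventually_elim (simp add: split)
  qed simp_all
qed

text \<open>Absolute continuity of the integral, obtained by dominated convergence after
  \<open>t = inverse x\<close> has turned the limit at 0 into one at infinity.\<close>

lemma set_integral_Ioo_tendsto_0:
  fixes f :: "real \<Rightarrow> real"
  assumes int: "set_integrable lborel {0<..<1} f"
  shows "((\<lambda>x. LINT v:{0<..<x}|lborel. f v) \<longlongrightarrow> 0) (at_right 0)"
proof -
  have "((\<lambda>t. LINT v|lborel. indicator {0<..<inverse t} v *\<^sub>R f v) \<longlongrightarrow> (LINT v|(lborel::real measure). 0)) at_top"
  proof -
    have "((\<lambda>t. LINT v|lborel. indicator {0<..<min 1 (inverse t)} v *\<^sub>R f v) \<longlongrightarrow> (LINT v|(lborel::real measure). 0)) at_top"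
    proof (rule integral_dominated_convergence_at_top[where w="\<lambda>v. norm (indicator {0<..<1} v *\<^sub>R f v)"])
      show "integrable lborel (\<lambda>v. norm (indicator {0<..<1} v *\<^sub>R f v))"
        using int unfolding set_integrable_def by (rule integrable_norm)
      show "(\<lambda>v. indicator {0<..<min 1 (inverse t)} v *\<^sub>R f v) \<in> borel_measurable lborel" for t
        by (rule set_integrable_measurable[OF set_integrable_subset[OF int]]) auto
      show "AE v in lborel. ((\<lambda>t. indicator {0<..<min 1 (inverse t)} v *\<^sub>R f v) \<longlongrightarrow> 0) at_top"
      proof (rule AE_I2)
        fix v :: real
        show "((\<lambda>t. indicator {0<..<min 1 (inverse t)} v *\<^sub>R f v) \<longlongrightarrow> 0) at_top"
        proof (cases "v > 0")
          case True
          have "eventually (\<lambda>t. indicator {0<..<min 1 (inverse t)} v *\<^sub>R f v = 0) at_top"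
            using eventually_gt_at_top[of "inverse v"] eventually_gt_at_top[of 0]
          proof eventually_elim
            case (elim t)
            then have "inverse t < v" using True by (simp add: field_simps)
            then show ?case by simp
          qed
          then show ?thesis by (rule tendsto_eventually)
        qed simp
      qed
    qed (auto split: split_indicator)
    then show ?thesis
    proof (rule Lim_transform_eventually)
      show "\<forall>\<^sub>F t in at_top. (LINT v|lborel. indicator {0<..<min 1 (inverse t)} v *\<^sub>R f v) = (LINT v|lborel. indicator {0<..<inverse t} v *\<^sub>R f v)"
        using eventually_ge_at_top[of 1] by eventually_elim (simp add: min_absorb2 inverse_le_1_iff)
    qed
  qed
  then have "((\<lambda>t. LINT v:{0<..<inverse t}|lborel. f v) \<longlongrightarrow> 0) at_top"
    by (simp add: set_lebesgue_integral_def)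
  then have "((\<lambda>x. LINT v:{0<..<inverse (inverse x)}|lborel. f v) \<longlongrightarrow> 0) (at_right 0)"
    by (rule filterlim_compose) (rule filterlim_inverse_at_top_right)
  then show ?thesis by simp
qed

subsection \<open>The stable overshoot chain\<close>

text \<open>The Dynkin-Lamperti law: as a function of \<open>s\<close>, the density of the distance
  by which a stable subordinator of index \<gamma> jumps beyond the level \<open>u\<close>.\<close>

definition stable_overshoot :: "real \<Rightarrow> real \<Rightarrow> real \<Rightarrow> real" where
  "stable_overshoot \<gamma> s u = sin (pi * \<gamma>) / pi * (u powr \<gamma> * s powr (- \<gamma>) / (s + u))"

text \<open>The iterates in the scaling limit, with the interval normalised to length 1. The start
  is the limit of \<open>a (t * s) / a t\<close>. In the recursion \<open>1 + u\<close> is a point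
  beyond the unit interval, and its excess \<open>u\<close> is the level that is jumped over
  next.\<close>

fun stable_iter :: "real \<Rightarrow> nat \<Rightarrow> real \<Rightarrow> real" where
  "stable_iter \<gamma> 0 s = s powr (- \<gamma> - 1)"
| "stable_iter \<gamma> (Suc k) s = (LINT u:{0<..}|lborel. stable_overshoot \<gamma> s u * stable_iter \<gamma> k (1 + u))"

lemma stable_overshoot_measurable [measurable]:
  "case_prod (stable_overshoot \<gamma>) \<in> borel_measurable (borel \<Otimes>\<^sub>M borel)"
  unfolding stable_overshoot_def by measurable

lemma stable_overshoot_measurable' [measurable (raw)]:
  assumes "f \<in> borel_measurable M" "g \<in> borel_measurable M"
  shows "(\<lambda>x. stable_overshoot \<gamma> (f x) (g x)) \<in> borel_measurable M"
  using measurable_compose[OF measurable_Pair[OF assms] stable_overshoot_measurable] by simp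

lemma stable_iter_measurable [measurable]: "stable_iter \<gamma> k \<in> borel_measurable borel"
proof (induction k)
  case 0
  show ?case by simp
next
  case (Suc k)
  note [measurable] = Suc
  show ?case unfolding stable_iter.simps(2)[abs_def] set_lebesgue_integral_def by measurable
qed

locale stable_index =
  fixes \<gamma> :: real
  assumes gamma_gt: "1/2 < \<gamma>" and gamma_lt: "\<gamma> < 1"
begin

abbreviation "\<kappa> \<equiv> sin (pi * \<gamma>) / pi"
abbreviation "\<beta> \<equiv> stable_overshoot \<gamma>"
abbreviation "\<phi> \<equiv> stable_iter \<gamma>"
abbreviation "\<theta> \<equiv> sin (pi * \<gamma>)"

lemma kappa_pos: "\<kappa> > 0"
  using sin_pi_mult_pos[of \<gamma>] gamma_gt gamma_lt by simp

lemma theta: "0 < \<theta>" "\<theta> < 1"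
proof -
  show "0 < \<theta>" using sin_pi_mult_pos[of \<gamma>] gamma_gt gamma_lt by simp
  have "sin (pi * \<gamma>) = sin (pi - pi * \<gamma>)" by simp
  also have "\<dots> < sin (pi / 2)"
  proof (rule sin_monotone_2pi)
    show "- (pi / 2) \<le> pi - pi * \<gamma>"
      using gamma_lt pi_gt_zero mult_left_mono[of \<gamma> 1 pi] by linarith
    have "pi * (1/2) < pi * \<gamma>" using gamma_gt pi_gt_zero by (intro mult_strict_left_mono) auto
    then show "pi - pi * \<gamma> < pi / 2" by simp
  qed simp
  finally show "\<theta> < 1" by simp
qed

lemma beta_nonneg: "s > 0 \<Longrightarrow> u > 0 \<Longrightarrow> 0 \<le> \<beta> s u"
  using kappa_pos by (auto simp: stable_overshoot_def intro!: mult_nonneg_nonneg divide_nonneg_nonneg less_imp_le[OF theta(1)])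

text \<open>The exponent \<open>\<gamma> + 1/2\<close> turns the Stieltjes integral into one at \<open>1/2\<close>, where \<open>pi / sin\<close> is
  smallest; this gives the contraction factor \<open>sin (pi \<gamma>)\<close>.\<close>
lemma beta_powr_eigen:
  assumes s: "s > 0"
  shows "set_integrable lborel {0<..} (\<lambda>u. \<beta> s u * u powr (- \<gamma> - 1/2))"
    and "(LINT u:{0<..}|lborel. \<beta> s u * u powr (- \<gamma> - 1/2)) = \<theta> * s powr (- \<gamma> - 1/2)"
proof -
  have e: "\<beta> s u * u powr (- \<gamma> - 1/2) = (\<kappa> * s powr (- \<gamma>)) * (u powr (1/2 - 1) / (s + u))"
    if "u \<in> {0<..}" for u
  proof -
    have "u powr (1/2 - 1) = u powr \<gamma> * u powr (- \<gamma> - 1/2)"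
      unfolding powr_add[symmetric] by (rule arg_cong[where f="\<lambda>z. u powr z"]) simp
    then show ?thesis unfolding stable_overshoot_def by (simp add: mult_ac)
  qed
  have i: "set_integrable lborel {0<..} (\<lambda>u. (\<kappa> * s powr (- \<gamma>)) * (u powr (1/2 - 1) / (s + u)))"
    by (intro set_integrable_mult_right stieltjes_powr_integral s) auto
  then show "set_integrable lborel {0<..} (\<lambda>u. \<beta> s u * u powr (- \<gamma> - 1/2))"
    by (rule set_integrable_cong[THEN iffD1, rotated -1]) (simp_all only: e)
  have "(LINT u:{0<..}|lborel. \<beta> s u * u powr (- \<gamma> - 1/2))
     = (LINT u:{0<..}|lborel. (\<kappa> * s powr (- \<gamma>)) * (u powr (1/2 - 1) / (s + u)))"
    by (intro set_lebesgue_integral_cong) (auto simp: e)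
  also have "\<dots> = (\<kappa> * s powr (- \<gamma>)) * (s powr (1/2 - 1) * (pi / sin (pi * (1/2))))"
    by (subst set_integral_mult_right, subst stieltjes_powr_integral(2)[OF _ _ s]) simp_all
  also have "\<dots> = \<theta> * (s powr (- \<gamma>) * s powr (1/2 - 1))"
    by (simp add: mult_ac)
  also have "s powr (- \<gamma>) * s powr (1/2 - 1) = s powr (- \<gamma> - 1/2)"
    unfolding powr_add[symmetric] by (rule arg_cong[where f="\<lambda>z. s powr z"]) simp
  finally show "(LINT u:{0<..}|lborel. \<beta> s u * u powr (- \<gamma> - 1/2)) = \<theta> * s powr (- \<gamma> - 1/2)" .
qed

text \<open>Nonnegativity, decay and integrability feed each other, hence one induction for all
  three. The start \<open>s powr (- \<gamma> - 1)\<close> lies below the eigenfunction only from 1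
  on, while one application of the kernel weakens the singularity at 0; therefore the case
  \<open>k = 0\<close> of the bound is restricted to \<open>s \<ge> 1\<close>.\<close>

lemma phi_bounds:
  shows "s > 0 \<Longrightarrow> 0 \<le> \<phi> k s"
    and "s \<ge> 1 \<or> (k > 0 \<and> s > 0) \<Longrightarrow> \<phi> k s \<le> \<theta> ^ k * s powr (- \<gamma> - 1/2)"
    and "s > 0 \<Longrightarrow> set_integrable lborel {0<..} (\<lambda>u. \<beta> s u * \<phi> k (1 + u))"
proof (induction k arbitrary: s)
  case 0
  {
    case 1 then show ?case by simp
  next
    case 2
    then have "s powr (- \<gamma> - 1) \<le> s powr (- \<gamma> - 1/2)" by (intro powr_mono) auto
    then show ?case by simp
  next
    case 3
    show ?case
    proof (rule set_integrable_bound[OF beta_powr_eigen(1)[OF 3]])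
      show "set_borel_measurable lborel {0<..} (\<lambda>u. \<beta> s u * \<phi> 0 (1 + u))"
        unfolding set_borel_measurable_def by measurable
      show "AE u in lborel. u \<in> {0<..} \<longrightarrow> norm (\<beta> s u * \<phi> 0 (1 + u)) \<le> norm (\<beta> s u * u powr (- \<gamma> - 1/2))"
      proof (intro AE_I2 impI)
        fix u :: real assume "u \<in> {0<..}"
        then have u: "u > 0" by simp
        have "(1 + u) powr (- \<gamma> - 1) \<le> (1 + u) powr (- \<gamma> - 1/2)" using u by (intro powr_mono) auto
        also have "\<dots> \<le> u powr (- \<gamma> - 1/2)" using u gamma_gt by (intro powr_mono2') auto
        finally show "norm (\<beta> s u * \<phi> 0 (1 + u)) \<le> norm (\<beta> s u * u powr (- \<gamma> - 1/2))"
          by (simp add: abs_mult mult_left_mono)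
      qed
    qed
  }
next
  case (Suc k)
  have bd: "\<phi> k (1 + u) \<le> \<theta> ^ k * u powr (- \<gamma> - 1/2)" "0 \<le> \<phi> k (1 + u)" if "u > 0" for u
  proof -
    have "\<phi> k (1 + u) \<le> \<theta> ^ k * (1 + u) powr (- \<gamma> - 1/2)" using that by (intro Suc.IH(2)) auto
    \<comment> \<open>Dropping the shift by 1 costs nothing for a decreasing power and makes the
      eigenfunction identity applicable.\<close>
    also have "\<dots> \<le> \<theta> ^ k * u powr (- \<gamma> - 1/2)"
      using that theta gamma_gt by (intro mult_left_mono powr_mono2') auto
    finally show "\<phi> k (1 + u) \<le> \<theta> ^ k * u powr (- \<gamma> - 1/2)" .
    show "0 \<le> \<phi> k (1 + u)" using that by (intro Suc.IH(1)) auto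
  qed
  have nn: "0 \<le> \<phi> (Suc k) s" if "s > 0" for s
    unfolding stable_iter.simps set_lebesgue_integral_def
    using that bd(2) beta_nonneg[OF that] by (intro integral_nonneg_AE AE_I2) (auto split: split_indicator)
  have le: "\<phi> (Suc k) s \<le> \<theta> ^ Suc k * s powr (- \<gamma> - 1/2)" if s: "s > 0" for s
  proof -
    have "\<phi> (Suc k) s \<le> (LINT u:{0<..}|lborel. \<theta> ^ k * (\<beta> s u * u powr (- \<gamma> - 1/2)))"
      unfolding stable_iter.simps
    proof (rule set_integral_mono)
      show "set_integrable lborel {0<..} (\<lambda>u. \<beta> s u * \<phi> k (1 + u))" using s by (rule Suc.IH(3))
      show "set_integrable lborel {0<..} (\<lambda>u. \<theta> ^ k * (\<beta> s u * u powr (- \<gamma> - 1/2)))"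
        by (intro set_integrable_mult_right beta_powr_eigen s)
      fix u :: real assume "u \<in> {0<..}"
      then have u: "u > 0" by simp
      have "\<beta> s u * \<phi> k (1 + u) \<le> \<beta> s u * (\<theta> ^ k * u powr (- \<gamma> - 1/2))"
        using bd[OF u] beta_nonneg[OF s u] by (intro mult_left_mono) auto
      then show "\<beta> s u * \<phi> k (1 + u) \<le> \<theta> ^ k * (\<beta> s u * u powr (- \<gamma> - 1/2))" by (simp only: mult_ac)
    qed
    also have "\<dots> = \<theta> ^ Suc k * s powr (- \<gamma> - 1/2)"
      by (simp only: set_integral_mult_right beta_powr_eigen(2)[OF s]) simp
    finally show ?thesis .
  qed
  {
    case 1 then show ?case by (rule nn)
  next
    case 2 then show ?case using le[of s] by auto
  next
    case 3
    show ?case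
    proof (rule set_integrable_bound[OF beta_powr_eigen(1)[OF 3]])
      show "set_borel_measurable lborel {0<..} (\<lambda>u. \<beta> s u * \<phi> (Suc k) (1 + u))"
        unfolding set_borel_measurable_def by measurable
      show "AE u in lborel. u \<in> {0<..} \<longrightarrow> norm (\<beta> s u * \<phi> (Suc k) (1 + u)) \<le> norm (\<beta> s u * u powr (- \<gamma> - 1/2))"
      proof (intro AE_I2 impI)
        fix u :: real assume "u \<in> {0<..}"
        then have u: "u > 0" by simp
        have "\<phi> (Suc k) (1 + u) \<le> \<theta> ^ Suc k * (1 + u) powr (- \<gamma> - 1/2)" using u by (intro le) auto
        also have "\<dots> \<le> 1 * u powr (- \<gamma> - 1/2)"
          using u gamma_gt theta by (intro mult_mono powr_mono2' power_le_one) auto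
        finally have "\<phi> (Suc k) (1 + u) \<le> u powr (- \<gamma> - 1/2)" by simp
        moreover have "0 \<le> \<phi> (Suc k) (1 + u)" using u by (intro nn) auto
        ultimately show "norm (\<beta> s u * \<phi> (Suc k) (1 + u)) \<le> norm (\<beta> s u * u powr (- \<gamma> - 1/2))"
          by (simp only: norm_mult) (intro mult_left_mono, auto)
      qed
    qed
  }
qed

subsection \<open>The balayage kernel of the unit interval\<close>

text \<open>A function of the excess \<open>u\<close> that the kernel
  \<open>\<beta> (1 + w) u\<close> reproduces exactly; it grows like
  \<open>u powr (2 * \<gamma> - 1)\<close>.\<close>

definition J_fun :: "real \<Rightarrow> real" where
  "J_fun u = (LINT v:{0<..<u}|lborel. (v * (1 + v)) powr (\<gamma> - 1))"

text \<open>The numerator is chosen to cancel the factor \<open>(1 + w) powr (- \<gamma>)\<close> of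
  the kernel: the product with the kernel is then \<open>w powr \<gamma>\<close> over two linear
  factors in \<open>w\<close>.\<close>

definition A_fun :: "real \<Rightarrow> real \<Rightarrow> real" where
  "A_fun y u = (u * (1 + u)) powr \<gamma> / (1 + u - y)"

lemma J_integrand_integrable: "x > 0 \<Longrightarrow> set_integrable lborel {0<..<x} (\<lambda>v. (v * (1 + v)) powr (\<gamma> - 1))"
proof -
  assume x: "x > 0"
  have "set_integrable lborel {0<..<x} (\<lambda>v. (1 + x) * (v powr (\<gamma> - 1) / (1 + v)))"
    using gamma_gt gamma_lt by (intro set_integrable_mult_right set_integrable_subset[OF stieltjes_powr_integral(1)]) auto
  then show ?thesis
  proof (rule set_integrable_bound)
    show "set_borel_measurable lborel {0<..<x} (\<lambda>v. (v * (1 + v)) powr (\<gamma> - 1))"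
      unfolding set_borel_measurable_def by measurable
    show "AE v in lborel. v \<in> {0<..<x} \<longrightarrow>
      norm ((v * (1 + v)) powr (\<gamma> - 1)) \<le> norm ((1 + x) * (v powr (\<gamma> - 1) / (1 + v)))"
    proof (intro AE_I2 impI)
      fix v assume "v \<in> {0<..<x}"
      then have v: "0 < v" "v < x" by auto
      have "(v * (1 + v)) powr (\<gamma> - 1) = v powr (\<gamma> - 1) * (1 + v) powr (\<gamma> - 1)"
        using v by (simp add: powr_mult)
      also have "\<dots> \<le> v powr (\<gamma> - 1) * 1"
        using v gamma_lt powr_mono[of "\<gamma> - 1" 0 "1 + v"] by (intro mult_left_mono) auto
      also have "\<dots> \<le> v powr (\<gamma> - 1) * ((1 + x) / (1 + v))"
        using v by (intro mult_left_mono) auto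
      finally show "norm ((v * (1 + v)) powr (\<gamma> - 1)) \<le> norm ((1 + x) * (v powr (\<gamma> - 1) / (1 + v)))"
        using v by (simp add: mult_ac abs_mult)
    qed
  qed
qed

lemma J_nonneg: "0 \<le> J_fun u"
  unfolding J_fun_def set_lebesgue_integral_def by (intro integral_nonneg_AE AE_I2) (auto split: split_indicator)

lemma J_measurable [measurable]: "J_fun \<in> borel_measurable borel"
proof -
  have "J_fun = (\<lambda>u. LINT v|lborel. (if 0 < v \<and> v < u then (v * (1 + v)) powr (\<gamma> - 1) else 0))"
    unfolding J_fun_def set_lebesgue_integral_def by (intro ext Bochner_Integration.integral_cong) (auto split: split_indicator)
  also have "\<dots> \<in> borel_measurable borel" by measurable
  finally show ?thesis .
qed

lemma A_measurable [measurable]: "A_fun y \<in> borel_measurable borel"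
  unfolding A_fun_def by measurable

lemma nn_J: "u > 0 \<Longrightarrow> ennreal (J_fun u) = (\<integral>\<^sup>+v\<in>{0<..<u}. ennreal ((v * (1 + v)) powr (\<gamma> - 1)) \<partial>lborel)"
  unfolding J_fun_def by (intro nn_set_integral_eq_set_integral[symmetric] J_integrand_integrable) auto

text \<open>The incomplete Stieltjes integral; multiplied by \<kappa> it is the distribution
  function, in the variable \<open>u / s\<close>, of the overshoot law.\<close>

definition G_fun :: "real \<Rightarrow> real" where
  "G_fun x = (LINT r:{0<..<x}|lborel. r powr (\<gamma> - 1) / (1 + r))"

lemma G_integrable: "set_integrable lborel {0<..<x} (\<lambda>r. r powr (\<gamma> - 1) / (1 + r))"
  using gamma_gt gamma_lt by (intro set_integrable_subset[OF stieltjes_powr_integral(1)]) auto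

lemma G_nonneg: "0 \<le> G_fun x"
  unfolding G_fun_def set_lebesgue_integral_def by (intro integral_nonneg_AE AE_I2) (auto split: split_indicator)

lemma DERIV_G: "x > 0 \<Longrightarrow> (G_fun has_real_derivative x powr (\<gamma> - 1) / (1 + x)) (at x)"
  unfolding G_fun_def[abs_def]
  by (rule DERIV_set_integral_Ioo[OF _ G_integrable]) (auto intro!: continuous_intros)

text \<open>The substitution \<open>r = u / s\<close> turns the tail into \<open>G_fun\<close>. It
  is carried out through the antiderivative \<open>- \<kappa> * G_fun (u / s)\<close>, which
  vanishes as \<open>s\<close> tends to infinity.\<close>

lemma beta_tail:
  assumes z: "z > 0" and u: "u > 0"
  shows "(\<integral>\<^sup>+s\<in>{z..}. ennreal (\<beta> s u) \<partial>lborel) = ennreal (\<kappa> * G_fun (u / z))"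
proof -
  define f where "f s = (if s \<ge> z then \<beta> s u else 0)" for s
  have "(\<integral>\<^sup>+s\<in>{z..}. ennreal (\<beta> s u) \<partial>lborel) = (\<integral>\<^sup>+s. ennreal (f s) * indicator {z..} s \<partial>lborel)"
    by (intro nn_integral_cong) (auto simp: f_def split: split_indicator)
  also have "\<dots> = ennreal (0 - (- \<kappa> * G_fun (u / z)))"
  proof (rule nn_integral_FTC_atLeast)
    show "f \<in> borel_measurable borel" unfolding f_def by measurable
    show "0 \<le> f s" if "z \<le> s" for s using that z u beta_nonneg by (auto simp: f_def)
    show "((\<lambda>s. - \<kappa> * G_fun (u / s)) has_real_derivative f s) (at s)" if s: "z \<le> s" for s
    proof -
      have sp: "s > 0" using s z by simp
      have "((\<lambda>s. G_fun (u / s)) has_real_derivative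
          ((u / s) powr (\<gamma> - 1) / (1 + u / s)) * (- u / s\<^sup>2)) (at s)"
      proof (rule DERIV_chain2[OF DERIV_G])
        show "0 < u / s" using u sp by simp
        show "((\<lambda>s. u / s) has_real_derivative - u / s\<^sup>2) (at s)"
          using sp by (auto intro!: derivative_eq_intros simp: power2_eq_square)
      qed
      then have "((\<lambda>s. - \<kappa> * G_fun (u / s)) has_real_derivative
          - \<kappa> * (((u / s) powr (\<gamma> - 1) / (1 + u / s)) * (- u / s\<^sup>2))) (at s)"
        by (rule DERIV_cmult)
      moreover have "- \<kappa> * (((u / s) powr (\<gamma> - 1) / (1 + u / s)) * (- u / s\<^sup>2)) = f s"
      proof -
        have p: "(u / s) * (u / s) powr (\<gamma> - 1) = u powr \<gamma> * s powr (- \<gamma>)"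
          using u sp by (simp add: powr_mult_base powr_divide powr_minus_divide)
        have "- \<kappa> * (((u / s) powr (\<gamma> - 1) / (1 + u / s)) * (- u / s\<^sup>2))
          = \<kappa> * (((u / s) * (u / s) powr (\<gamma> - 1)) * (1 / (s * (1 + u / s))))"
          by (simp add: power2_eq_square mult_ac)
        also have "s * (1 + u / s) = s + u" using sp by (simp add: field_simps)
        finally show ?thesis using s unfolding p f_def stable_overshoot_def by simp
      qed
      ultimately show ?thesis by simp
    qed
    have "((\<lambda>s. - \<kappa> * G_fun (u / s)) \<longlongrightarrow> - \<kappa> * 0) at_top"
    proof (intro tendsto_intros)
      have 0: "(G_fun \<longlongrightarrow> 0) (at_right 0)"
        unfolding G_fun_def[abs_def] by (rule set_integral_Ioo_tendsto_0[OF G_integrable])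
      have "filterlim (\<lambda>s. u / s) (at_right 0) at_top"
        unfolding filterlim_at
      proof
        show "\<forall>\<^sub>F s in at_top. u / s \<in> {0<..} \<and> u / s \<noteq> 0"
          using eventually_gt_at_top[of 0] by eventually_elim (use u in auto)
        show "((\<lambda>s. u / s) \<longlongrightarrow> 0) at_top" by (intro tendsto_divide_0[OF tendsto_const] filterlim_at_top_imp_at_infinity filterlim_ident)
      qed
      then show "((\<lambda>s. G_fun (u / s)) \<longlongrightarrow> 0) at_top" by (rule filterlim_compose[OF 0])
    qed
    then show "((\<lambda>s. - \<kappa> * G_fun (u / s)) \<longlongrightarrow> 0) at_top" by simp
  qed
  finally show ?thesis by simp
qed

text \<open>The substitution \<open>r = t / z\<close> puts \<open>z\<close> next to \<open>t\<close>
  in the denominator; this is the form in which the integrals for \<open>J_fun\<close> can be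
  exchanged.\<close>

lemma G_scaled:
  assumes z: "z > 0" and u: "u > 0"
  shows "ennreal (G_fun (u / z)) = (\<integral>\<^sup>+t\<in>{0<..<u}. ennreal (z powr (1 - \<gamma>) * (t powr (\<gamma> - 1) / (z + t))) \<partial>lborel)"
proof -
  have "ennreal (G_fun (u / z)) = (\<integral>\<^sup>+r\<in>{0<..<u/z}. ennreal (r powr (\<gamma> - 1) / (1 + r)) \<partial>lborel)"
    unfolding G_fun_def by (intro nn_set_integral_eq_set_integral[symmetric] G_integrable) auto
  also have "\<dots> = ennreal (1 / z) * (\<integral>\<^sup>+t. ennreal ((0 + (1 / z) * t) powr (\<gamma> - 1) / (1 + (0 + (1 / z) * t))) * indicator {0<..<u/z} (0 + (1 / z) * t) \<partial>lborel)"
    using z by (subst nn_integral_real_affine[where c="1/z" and t=0]) auto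
  also have "\<dots> = (\<integral>\<^sup>+t. ennreal (1 / z) * (ennreal ((0 + (1 / z) * t) powr (\<gamma> - 1) / (1 + (0 + (1 / z) * t))) * indicator {0<..<u/z} (0 + (1 / z) * t)) \<partial>lborel)"
    by (rule nn_integral_cmult[symmetric]) measurable
  also have "\<dots> = (\<integral>\<^sup>+t\<in>{0<..<u}. ennreal (z powr (1 - \<gamma>) * (t powr (\<gamma> - 1) / (z + t))) \<partial>lborel)"
  proof (intro nn_integral_cong)
    fix t :: real
    show "ennreal (1 / z) * (ennreal ((0 + (1 / z) * t) powr (\<gamma> - 1) / (1 + (0 + (1 / z) * t))) * indicator {0<..<u/z} (0 + (1 / z) * t))
      = ennreal (z powr (1 - \<gamma>) * (t powr (\<gamma> - 1) / (z + t))) * indicator {0<..<u} t"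
    proof (cases "0 < t \<and> t < u")
      case True
      have "(1 / z) * ((t / z) powr (\<gamma> - 1) / (1 + t / z)) = z powr (1 - \<gamma>) * (t powr (\<gamma> - 1) / (z + t))"
      proof -
        have "(t / z) powr (\<gamma> - 1) = t powr (\<gamma> - 1) * z powr (1 - \<gamma>)"
          using True z by (simp add: powr_divide powr_diff)
        moreover have "z * (1 + t / z) = z + t" using z by (simp add: field_simps)
        ultimately show ?thesis by (simp add: mult_ac)
      qed
      moreover have "ennreal (1 / z) * ennreal ((t / z) powr (\<gamma> - 1) / (1 + t / z)) = ennreal ((1 / z) * ((t / z) powr (\<gamma> - 1) / (1 + t / z)))"
        using True z by (intro ennreal_mult[symmetric]) auto
      ultimately show ?thesis using True z by (simp add: divide_strict_right_mono)
    next
      case False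
      then have "\<not> (0 < t / z \<and> t / z < u / z)" using z by (auto simp: zero_less_divide_iff divide_less_cancel)
      then show ?thesis using False by (auto split: split_indicator)
    qed
  qed
  finally show ?thesis .
qed

text \<open>Two exchanges of integrals. Writing \<open>J_fun w\<close> as an integral over
  \<open>v < w\<close> produces the tail of the kernel beyond \<open>1 + v\<close>. This tail is an
  integral over \<open>t < u\<close> whose denominator \<open>1 + t + v\<close> is symmetric in
  \<open>t\<close> and \<open>v\<close>, and the power \<open>(1 + v) powr (1 - \<gamma>)\<close> in
  front of it cancels. After the second exchange the \<open>v\<close>-integral is a complete
  Stieltjes integral and returns the integrand of \<open>J_fun\<close> at \<open>t\<close>.\<close>

lemma J_harmonic_nn:
  assumes u: "u > 0"
  shows "(\<integral>\<^sup>+w\<in>{0<..}. ennreal (\<beta> (1 + w) u * J_fun w) \<partial>lborel) = ennreal (J_fun u)"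
proof -
  let ?f = "\<lambda>v. (v * (1 + v)) powr (\<gamma> - 1)"
  have "(\<integral>\<^sup>+w\<in>{0<..}. ennreal (\<beta> (1 + w) u * J_fun w) \<partial>lborel)
    = (\<integral>\<^sup>+w. (\<integral>\<^sup>+v. ennreal (\<beta> (1 + w) u) * ennreal (?f v) * (if 0 < v \<and> v < w then 1 else 0) \<partial>lborel) \<partial>lborel)"
  proof (intro nn_integral_cong)
    fix w :: real
    show "ennreal (\<beta> (1 + w) u * J_fun w) * indicator {0<..} w
      = (\<integral>\<^sup>+v. ennreal (\<beta> (1 + w) u) * ennreal (?f v) * (if 0 < v \<and> v < w then 1 else 0) \<partial>lborel)"
    proof (cases "w > 0")
      case True
      have "ennreal (\<beta> (1 + w) u * J_fun w) = ennreal (\<beta> (1 + w) u) * (\<integral>\<^sup>+v\<in>{0<..<w}. ennreal (?f v) \<partial>lborel)"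
        using True u J_nonneg beta_nonneg[of "1 + w" u] by (simp add: ennreal_mult nn_J)
      also have "\<dots> = (\<integral>\<^sup>+v. ennreal (\<beta> (1 + w) u) * (ennreal (?f v) * indicator {0<..<w} v) \<partial>lborel)"
        by (rule nn_integral_cmult[symmetric]) measurable
      also have "\<dots> = (\<integral>\<^sup>+v. ennreal (\<beta> (1 + w) u) * ennreal (?f v) * (if 0 < v \<and> v < w then 1 else 0) \<partial>lborel)"
        by (intro nn_integral_cong) (auto split: split_indicator)
      finally show ?thesis using True by simp
    next
      case False
      have "(\<integral>\<^sup>+v. ennreal (\<beta> (1 + w) u) * ennreal (?f v) * (if 0 < v \<and> v < w then 1 else 0) \<partial>lborel) = (\<integral>\<^sup>+v. 0 \<partial>(lborel::real measure))"
        using False by (intro nn_integral_cong) auto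
      then show ?thesis using False by simp
    qed
  qed
  also have "\<dots> = (\<integral>\<^sup>+v. (\<integral>\<^sup>+w. ennreal (\<beta> (1 + w) u) * ennreal (?f v) * (if 0 < v \<and> v < w then 1 else 0) \<partial>lborel) \<partial>lborel)"
    by (rule lborel_pair.Fubini') measurable
  also have "\<dots> = (\<integral>\<^sup>+v. (\<integral>\<^sup>+t. ennreal (\<kappa> * t powr (\<gamma> - 1)) * ennreal (v powr (\<gamma> - 1) / ((1 + t) + v)) * (if 0 < v \<and> 0 < t \<and> t < u then 1 else 0) \<partial>lborel) \<partial>lborel)"
  proof (rule nn_integral_cong)
    fix v :: real
    show "(\<integral>\<^sup>+w. ennreal (\<beta> (1 + w) u) * ennreal (?f v) * (if 0 < v \<and> v < w then 1 else 0) \<partial>lborel)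
      = (\<integral>\<^sup>+t. ennreal (\<kappa> * t powr (\<gamma> - 1)) * ennreal (v powr (\<gamma> - 1) / ((1 + t) + v)) * (if 0 < v \<and> 0 < t \<and> t < u then 1 else 0) \<partial>lborel)"
    proof (cases "v > 0")
      case True
      have m: "(\<lambda>s. ennreal (\<beta> s u) * indicator {1 + v..} s) \<in> borel_measurable borel" by measurable
      have "(\<integral>\<^sup>+w. ennreal (\<beta> (1 + w) u) * ennreal (?f v) * (if 0 < v \<and> v < w then 1 else 0) \<partial>lborel)
        = (\<integral>\<^sup>+w. ennreal (?f v) * (ennreal (\<beta> (1 + w) u) * indicator {1 + v..} (1 + w)) \<partial>lborel)"
        using True AE_lborel_singleton[of v]
        by (intro nn_integral_cong_AE) (auto elim!: eventually_mono split: split_indicator simp: mult_ac)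
      also have "\<dots> = ennreal (?f v) * (\<integral>\<^sup>+w. ennreal (\<beta> (1 + 1 * w) u) * indicator {1 + v..} (1 + 1 * w) \<partial>lborel)"
        using measurable_compose[OF _ m, of "\<lambda>w. 1 + w" lborel] by (subst nn_integral_cmult) auto
      also have "(\<integral>\<^sup>+w. ennreal (\<beta> (1 + 1 * w) u) * indicator {1 + v..} (1 + 1 * w) \<partial>lborel) = (\<integral>\<^sup>+s\<in>{1 + v..}. ennreal (\<beta> s u) \<partial>lborel)"
        using nn_integral_real_affine[OF m, of 1 1] by simp
      also have "\<dots> = ennreal \<kappa> * ennreal (G_fun (u / (1 + v)))"
        using True u kappa_pos G_nonneg by (subst beta_tail) (auto simp only: ennreal_mult less_imp_le add_pos_pos zero_less_one)
      also have "ennreal (?f v) * (ennreal \<kappa> * ennreal (G_fun (u / (1 + v))))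
        = (ennreal (?f v) * ennreal \<kappa>) * (\<integral>\<^sup>+t\<in>{0<..<u}. ennreal ((1 + v) powr (1 - \<gamma>) * (t powr (\<gamma> - 1) / ((1 + v) + t))) \<partial>lborel)"
        using True u by (subst G_scaled) (auto simp: mult_ac)
      also have "\<dots> = (\<integral>\<^sup>+t. (ennreal (?f v) * ennreal \<kappa>) * (ennreal ((1 + v) powr (1 - \<gamma>) * (t powr (\<gamma> - 1) / ((1 + v) + t))) * indicator {0<..<u} t) \<partial>lborel)"
        by (rule nn_integral_cmult[symmetric]) measurable
      also have "\<dots> = (\<integral>\<^sup>+t. ennreal (\<kappa> * t powr (\<gamma> - 1)) * ennreal (v powr (\<gamma> - 1) / ((1 + t) + v)) * (if 0 < v \<and> 0 < t \<and> t < u then 1 else 0) \<partial>lborel)"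
      proof (intro nn_integral_cong)
        fix t :: real
        show "(ennreal (?f v) * ennreal \<kappa>) * (ennreal ((1 + v) powr (1 - \<gamma>) * (t powr (\<gamma> - 1) / ((1 + v) + t))) * indicator {0<..<u} t)
          = ennreal (\<kappa> * t powr (\<gamma> - 1)) * ennreal (v powr (\<gamma> - 1) / ((1 + t) + v)) * (if 0 < v \<and> 0 < t \<and> t < u then 1 else 0)"
        proof (cases "0 < t \<and> t < u")
          case t: True
          have "(1 + v) powr (\<gamma> - 1) * (1 + v) powr (1 - \<gamma>) = 1"
            using True by (simp add: powr_add[symmetric])
          then have e: "?f v * \<kappa> * ((1 + v) powr (1 - \<gamma>) * (t powr (\<gamma> - 1) / ((1 + v) + t)))
            = \<kappa> * t powr (\<gamma> - 1) * (v powr (\<gamma> - 1) / ((1 + t) + v))"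
          proof -
            have "?f v * \<kappa> * ((1 + v) powr (1 - \<gamma>) * (t powr (\<gamma> - 1) / ((1 + v) + t)))
              = ((1 + v) powr (\<gamma> - 1) * (1 + v) powr (1 - \<gamma>)) * (\<kappa> * t powr (\<gamma> - 1) * (v powr (\<gamma> - 1) / ((1 + v) + t)))"
              using True by (simp add: powr_mult mult_ac)
            also have "\<dots> = \<kappa> * t powr (\<gamma> - 1) * (v powr (\<gamma> - 1) / ((1 + t) + v))"
              unfolding \<open>(1 + v) powr (\<gamma> - 1) * (1 + v) powr (1 - \<gamma>) = 1\<close> mult_1_left by (simp only: add_ac)
            finally show ?thesis .
          qed
          have "(ennreal (?f v) * ennreal \<kappa>) * ennreal ((1 + v) powr (1 - \<gamma>) * (t powr (\<gamma> - 1) / ((1 + v) + t)))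
            = ennreal (?f v * \<kappa> * ((1 + v) powr (1 - \<gamma>) * (t powr (\<gamma> - 1) / ((1 + v) + t))))"
          proof -
            have nn: "0 \<le> ?f v" "0 \<le> \<kappa>" "0 \<le> (1 + v) powr (1 - \<gamma>) * (t powr (\<gamma> - 1) / ((1 + v) + t))"
              using True t kappa_pos by auto
            show ?thesis by (simp only: ennreal_mult[symmetric] nn mult_nonneg_nonneg)
          qed
          also have "\<dots> = ennreal (\<kappa> * t powr (\<gamma> - 1)) * ennreal (v powr (\<gamma> - 1) / ((1 + t) + v))"
            unfolding e using True t kappa_pos less_imp_le[OF theta(1)] by (intro ennreal_mult mult_nonneg_nonneg divide_nonneg_nonneg) auto
          finally show ?thesis using True t by simp
        next
          case False
          then show ?thesis by (auto split: split_indicator)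
        qed
      qed
      finally show ?thesis .
    next
      case False
      then show ?thesis by simp
    qed
  qed
  also have "\<dots> = (\<integral>\<^sup>+t. (\<integral>\<^sup>+v. ennreal (\<kappa> * t powr (\<gamma> - 1)) * ennreal (v powr (\<gamma> - 1) / ((1 + t) + v)) * (if 0 < v \<and> 0 < t \<and> t < u then 1 else 0) \<partial>lborel) \<partial>lborel)"
    by (rule lborel_pair.Fubini') measurable
  also have "\<dots> = (\<integral>\<^sup>+t\<in>{0<..<u}. ennreal (?f t) \<partial>lborel)"
  proof (intro nn_integral_cong)
    fix t :: real
    show "(\<integral>\<^sup>+v. ennreal (\<kappa> * t powr (\<gamma> - 1)) * ennreal (v powr (\<gamma> - 1) / ((1 + t) + v)) * (if 0 < v \<and> 0 < t \<and> t < u then 1 else 0) \<partial>lborel)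
      = ennreal (?f t) * indicator {0<..<u} t"
    proof (cases "0 < t \<and> t < u")
      case True
      have "(\<integral>\<^sup>+v. ennreal (\<kappa> * t powr (\<gamma> - 1)) * ennreal (v powr (\<gamma> - 1) / ((1 + t) + v)) * (if 0 < v \<and> 0 < t \<and> t < u then 1 else 0) \<partial>lborel)
        = (\<integral>\<^sup>+v. ennreal (\<kappa> * t powr (\<gamma> - 1)) * (ennreal (v powr (\<gamma> - 1) / ((1 + t) + v)) * indicator {0<..} v) \<partial>lborel)"
        using True by (intro nn_integral_cong) (auto split: split_indicator)
      also have "\<dots> = ennreal (\<kappa> * t powr (\<gamma> - 1)) * (\<integral>\<^sup>+v\<in>{0<..}. ennreal (v powr (\<gamma> - 1) / ((1 + t) + v)) \<partial>lborel)"
        by (rule nn_integral_cmult) measurable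
      also have "\<dots> = ennreal (\<kappa> * t powr (\<gamma> - 1)) * ennreal ((1 + t) powr (\<gamma> - 1) * (pi / sin (pi * \<gamma>)))"
        using True gamma_gt gamma_lt by (subst stieltjes_powr_nn_integral) auto
      also have "\<dots> = ennreal (\<kappa> * t powr (\<gamma> - 1) * ((1 + t) powr (\<gamma> - 1) * (pi / sin (pi * \<gamma>))))"
        using kappa_pos theta by (intro ennreal_mult[symmetric]) (auto intro!: mult_nonneg_nonneg)
      also have "\<kappa> * t powr (\<gamma> - 1) * ((1 + t) powr (\<gamma> - 1) * (pi / sin (pi * \<gamma>))) = ?f t"
        using True theta by (simp add: powr_mult)
      finally show ?thesis using True by simp
    next
      case False
      then have "(\<integral>\<^sup>+v. ennreal (\<kappa> * t powr (\<gamma> - 1)) * ennreal (v powr (\<gamma> - 1) / ((1 + t) + v)) * (if 0 < v \<and> 0 < t \<and> t < u then 1 else 0) \<partial>lborel) = (\<integral>\<^sup>+v. 0 \<partial>(lborel::real measure))"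
        by (intro nn_integral_cong) auto
      then show ?thesis using False by (auto split: split_indicator)
    qed
  qed
  also have "\<dots> = ennreal (J_fun u)" by (rule nn_J[OF u, symmetric])
  finally show ?thesis .
qed

lemma J_harmonic:
  assumes u: "u > 0"
  shows "set_integrable lborel {0<..} (\<lambda>w. \<beta> (1 + w) u * J_fun w)"
    and "(LINT w:{0<..}|lborel. \<beta> (1 + w) u * J_fun w) = J_fun u"
  using set_integral_eq_nn_integralI[OF _ _ J_harmonic_nn[OF u] J_nonneg] u J_nonneg beta_nonneg
  by (auto simp: set_borel_measurable_def)

end

section \<open>Tails of powers\<close>

lemma powr_tail_nn_integral:
  assumes p: "p > 1" and a: "a > 0"
  shows "(\<integral>\<^sup>+u\<in>{a..}. ennreal (u powr (- p)) \<partial>lborel) = ennreal (a powr (1 - p) / (p - 1))"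
proof -
  define f where "f u = (if u \<ge> a then u powr (- p) else 0)" for u
  have "(\<integral>\<^sup>+u\<in>{a..}. ennreal (u powr (- p)) \<partial>lborel) = (\<integral>\<^sup>+u. ennreal (f u) * indicator {a..} u \<partial>lborel)"
    by (intro nn_integral_cong) (auto simp: f_def split: split_indicator)
  also have "\<dots> = ennreal (0 - (a powr (1 - p) / (1 - p)))"
  proof (rule nn_integral_FTC_atLeast)
    show "f \<in> borel_measurable borel" unfolding f_def by measurable
    show "((\<lambda>u. u powr (1 - p) / (1 - p)) has_real_derivative f u) (at u)" if "a \<le> u" for u
      using that a p by (auto intro!: derivative_eq_intros simp: f_def)
    have "((\<lambda>u. u powr (1 - p) / (1 - p)) \<longlongrightarrow> 0 / (1 - p)) at_top"
      using p by (intro tendsto_divide tendsto_const tendsto_neg_powr filterlim_ident) auto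
    then show "((\<lambda>u. u powr (1 - p) / (1 - p)) \<longlongrightarrow> 0) at_top" by simp
  qed (auto simp: f_def)
  also have "0 - (a powr (1 - p) / (1 - p)) = a powr (1 - p) / (p - 1)"
    using p by (simp add: field_simps)
  finally show ?thesis .
qed

lemma powr_shift_integrable:
  assumes p: "p > 1"
  shows "set_integrable lborel {0<..} (\<lambda>u::real. (1 + u) powr (- p))"
proof (rule set_integrable_nonneg_bound)
  have "(\<integral>\<^sup>+u\<in>{0<..}. ennreal ((1 + u) powr (- p)) \<partial>lborel)
     \<le> (\<integral>\<^sup>+w. ennreal ((1 + 1 * w) powr (- p)) * indicator {1..} (1 + 1 * w) \<partial>lborel)"
    by (intro nn_integral_mono) (auto split: split_indicator)
  also have "\<dots> = (\<integral>\<^sup>+u\<in>{1..}. ennreal (u powr (- p)) \<partial>lborel)"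
    using nn_integral_real_affine[of "\<lambda>u. ennreal (u powr (- p)) * indicator {1..} u" 1 1] by simp
  also have "\<dots> < \<infinity>" using p by (subst powr_tail_nn_integral) auto
  finally show "(\<integral>\<^sup>+u\<in>{0<..}. ennreal ((1 + u) powr (- p)) \<partial>lborel) < \<infinity>" .
qed (auto simp: set_borel_measurable_def)

section \<open>A bounded solution of the landing equation\<close>

context stable_index
begin

text \<open>The poles of the integrand lie at \<open>- (1 + u)\<close> and \<open>- y\<close>. The
  value is \<open>A_fun y u\<close> minus the term with \<open>y powr \<gamma>\<close>: integration
  against the kernel exchanges \<open>y\<close> and \<open>1 - y\<close> up to this defect.\<close>

lemma A_harmonic:
  assumes u: "u > 0" and y: "0 < y" "y < 1"
  shows "set_integrable lborel {0<..} (\<lambda>w. \<beta> (1 + w) u * A_fun (1 - y) w)"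
    and "(LINT w:{0<..}|lborel. \<beta> (1 + w) u * A_fun (1 - y) w) = u powr \<gamma> * ((1 + u) powr \<gamma> - y powr \<gamma>) / (1 + u - y)"
proof -
  have e: "\<beta> (1 + w) u * A_fun (1 - y) w = (\<kappa> * u powr \<gamma>) * (w powr \<gamma> / ((w + (1 + u)) * (w + y)))"
    if "w \<in> {0<..}" for w
  proof -
    have "(1 + w) powr (- \<gamma>) * (w * (1 + w)) powr \<gamma> = w powr \<gamma> * ((1 + w) powr (- \<gamma>) * (1 + w) powr \<gamma>)"
      using that by (simp add: powr_mult)
    also have "(1 + w) powr (- \<gamma>) * (1 + w) powr \<gamma> = 1" using that by (simp add: powr_add[symmetric])
    finally have 1: "(1 + w) powr (- \<gamma>) * (w * (1 + w)) powr \<gamma> = w powr \<gamma>" by simp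
    have "\<beta> (1 + w) u * A_fun (1 - y) w = (\<kappa> * u powr \<gamma>) * (((1 + w) powr (- \<gamma>) * (w * (1 + w)) powr \<gamma>) / ((w + (1 + u)) * (w + y)))"
      unfolding stable_overshoot_def A_fun_def by (simp add: algebra_simps)
    then show ?thesis unfolding 1 .
  qed
  have i: "set_integrable lborel {0<..} (\<lambda>w. (\<kappa> * u powr \<gamma>) * (w powr \<gamma> / ((w + (1 + u)) * (w + y))))"
    using u y gamma_gt gamma_lt by (intro set_integrable_mult_right stieltjes_two_poles_integral) auto
  then show "set_integrable lborel {0<..} (\<lambda>w. \<beta> (1 + w) u * A_fun (1 - y) w)"
    by (rule set_integrable_cong[THEN iffD1, rotated -1]) (simp_all only: e)
  have "(LINT w:{0<..}|lborel. \<beta> (1 + w) u * A_fun (1 - y) w)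
     = (LINT w:{0<..}|lborel. (\<kappa> * u powr \<gamma>) * (w powr \<gamma> / ((w + (1 + u)) * (w + y))))"
    by (intro set_lebesgue_integral_cong) (auto simp: e)
  also have "\<dots> = (\<kappa> * u powr \<gamma>) * ((pi / sin (pi * \<gamma>)) * ((1 + u) powr \<gamma> - y powr \<gamma>) / ((1 + u) - y))"
    using u y gamma_gt gamma_lt by (subst set_integral_mult_right, subst stieltjes_two_poles_integral(2)) auto
  also have "\<dots> = u powr \<gamma> * ((1 + u) powr \<gamma> - y powr \<gamma>) / (1 + u - y)"
    using theta by simp
  finally show "(LINT w:{0<..}|lborel. \<beta> (1 + w) u * A_fun (1 - y) w) = u powr \<gamma> * ((1 + u) powr \<gamma> - y powr \<gamma>) / (1 + u - y)" .
qed

text \<open>The normalisation for which the defect of \<open>A_fun\<close> is exactly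
  \<open>\<beta> (1 - y) u\<close>. Being symmetric in \<open>y\<close> and \<open>1 - y\<close>, it
  passes unchanged through the equation.\<close>

definition P_fun :: "real \<Rightarrow> real" where
  "P_fun y = \<kappa> * (y * (1 - y)) powr (- \<gamma>)"

text \<open>As \<open>J_fun\<close> is reproduced by the kernel, its coefficient does not affect the
  equation that \<open>h_fun\<close> satisfies and remains free for achieving boundedness.\<close>

definition h_fun :: "real \<Rightarrow> real \<Rightarrow> real" where
  "h_fun y u = P_fun y * (A_fun y u - (2 * \<gamma> - 1) * J_fun u)"

lemma h_measurable [measurable]: "h_fun y \<in> borel_measurable borel"
  unfolding h_fun_def by measurable

lemma P_sym: "P_fun (1 - y) = P_fun y" by (simp add: P_fun_def mult.commute)

text \<open>From the excess \<open>u\<close> the next jump either lands at \<open>1 - y\<close>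
  inside the unit interval or leaves a new excess \<open>w\<close>; in the second case the process
  continues with \<open>y\<close> and \<open>1 - y\<close> exchanged, because consecutive iterates
  are read from opposite ends of the interval. The defect of \<open>A_fun\<close> supplies the first
  alternative, and \<open>J_fun\<close> contributes the same to both sides.\<close>

lemma h_equation:
  assumes u: "u > 0" and y: "0 < y" "y < 1"
  shows "set_integrable lborel {0<..} (\<lambda>w. \<beta> (1 + w) u * h_fun (1 - y) w)"
    and "h_fun y u = \<beta> (1 - y) u + (LINT w:{0<..}|lborel. \<beta> (1 + w) u * h_fun (1 - y) w)"
proof -
  have e: "\<beta> (1 + w) u * h_fun (1 - y) w
    = P_fun y * (\<beta> (1 + w) u * A_fun (1 - y) w) - (P_fun y * (2 * \<gamma> - 1)) * (\<beta> (1 + w) u * J_fun w)" for w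
    unfolding h_fun_def P_sym by (simp add: algebra_simps)
  have i: "set_integrable lborel {0<..} (\<lambda>w. P_fun y * (\<beta> (1 + w) u * A_fun (1 - y) w))"
    "set_integrable lborel {0<..} (\<lambda>w. (P_fun y * (2 * \<gamma> - 1)) * (\<beta> (1 + w) u * J_fun w))"
    by (intro set_integrable_mult_right A_harmonic J_harmonic u y)+
  show "set_integrable lborel {0<..} (\<lambda>w. \<beta> (1 + w) u * h_fun (1 - y) w)"
    unfolding e using i by (rule set_integral_diff)
  have "(LINT w:{0<..}|lborel. \<beta> (1 + w) u * h_fun (1 - y) w)
    = P_fun y * (u powr \<gamma> * ((1 + u) powr \<gamma> - y powr \<gamma>) / (1 + u - y)) - (P_fun y * (2 * \<gamma> - 1)) * J_fun u"
    unfolding e set_integral_diff(2)[OF i] set_integral_mult_right A_harmonic(2)[OF u y] J_harmonic(2)[OF u] by simp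
  moreover have "P_fun y * A_fun y u = \<beta> (1 - y) u + P_fun y * (u powr \<gamma> * ((1 + u) powr \<gamma> - y powr \<gamma>) / (1 + u - y))"
  proof -
    have "P_fun y * (u powr \<gamma> * y powr \<gamma> / (1 + u - y)) = \<beta> (1 - y) u"
    proof -
      have "(y * (1 - y)) powr (- \<gamma>) * y powr \<gamma> = (1 - y) powr (- \<gamma>) * (y powr (- \<gamma>) * y powr \<gamma>)"
        using y by (simp add: powr_mult mult_ac)
      also have "y powr (- \<gamma>) * y powr \<gamma> = 1" using y by (simp add: powr_add[symmetric])
      finally have 1: "(y * (1 - y)) powr (- \<gamma>) * y powr \<gamma> = (1 - y) powr (- \<gamma>)" by simp
      have "P_fun y * (u powr \<gamma> * y powr \<gamma> / (1 + u - y))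
        = \<kappa> * (u powr \<gamma> * ((y * (1 - y)) powr (- \<gamma>) * y powr \<gamma>) / (1 + u - y))"
        unfolding P_fun_def by (simp add: mult_ac)
      also have "\<dots> = \<beta> (1 - y) u" unfolding 1 stable_overshoot_def by (simp add: add.commute diff_add_eq)
      finally show ?thesis .
    qed
    moreover have "A_fun y u = u powr \<gamma> * y powr \<gamma> / (1 + u - y) + u powr \<gamma> * ((1 + u) powr \<gamma> - y powr \<gamma>) / (1 + u - y)"
    proof -
      have pm: "(u * (1 + u)) powr \<gamma> = u powr \<gamma> * y powr \<gamma> + u powr \<gamma> * ((1 + u) powr \<gamma> - y powr \<gamma>)"
        using u by (simp add: powr_mult right_diff_distrib)
      show ?thesis unfolding A_fun_def pm add_divide_distrib ..
    qed
    ultimately show ?thesis by (simp add: distrib_left)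
  qed
  ultimately show "h_fun y u = \<beta> (1 - y) u + (LINT w:{0<..}|lborel. \<beta> (1 + w) u * h_fun (1 - y) w)"
    unfolding h_fun_def[of y u] by (simp add: right_diff_distrib)
qed

lemma DERIV_J: "u > 0 \<Longrightarrow> (J_fun has_real_derivative (u * (1 + u)) powr (\<gamma> - 1)) (at u)"
  unfolding J_fun_def[abs_def]
  by (rule DERIV_set_integral_Ioo[OF _ J_integrand_integrable]) (auto intro!: continuous_intros)

lemma J_mono: "0 < u \<Longrightarrow> u \<le> v \<Longrightarrow> J_fun u \<le> J_fun v"
proof (rule DERIV_nonneg_imp_nondecreasing[where f=J_fun])
  fix x :: real assume "0 < u" "u \<le> x"
  then show "\<exists>d. (J_fun has_real_derivative d) (at x) \<and> 0 \<le> d"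
    using DERIV_J[of x] by (intro exI[of _ "(x * (1 + x)) powr (\<gamma> - 1)"]) auto
qed

text \<open>Both terms of \<open>h\<close> grow like \<open>u powr (2 \<gamma> - 1)\<close>; the factor \<open>2 \<gamma> - 1\<close> makes the growth cancel.\<close>
lemma h_bounded:
  assumes y: "0 < y" "y < 1"
  shows "\<exists>C. \<forall>u>0. \<bar>h_fun y u\<bar> \<le> C"
proof -
  define h where "h u = A_fun y u - (2 * \<gamma> - 1) * J_fun u" for u
  \<comment> \<open>The derivative of \<open>h\<close>. The terms of order
    \<open>u powr (2 * \<gamma> - 2)\<close> have cancelled, and what is left is of order
    \<open>u powr (2 * \<gamma> - 3)\<close>, which is integrable at infinity because
    \<open>\<gamma> < 1\<close>.\<close>
  define D where "D u = (u * (1 + u)) powr (\<gamma> - 1) * ((\<gamma> - 1) * (2 * y - 1) / (1 + u - y) + y * (1 - y) / (1 + u - y)\<^sup>2)" for u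
  have deriv: "(h has_real_derivative D u) (at u)" if u: "u > 0" for u
  proof -
    have n: "1 + u - y > 0" using u y by simp
    have "((\<lambda>u. (u * (1 + u)) powr \<gamma>) has_real_derivative \<gamma> * (u * (1 + u)) powr (\<gamma> - 1) * (1 + 2 * u)) (at u)"
      using u add_pos_pos[OF u mult_pos_pos[OF u u]] by (auto intro!: derivative_eq_intros simp: algebra_simps)
    then have "((\<lambda>u. (u * (1 + u)) powr \<gamma> / (1 + u - y)) has_real_derivative
       (\<gamma> * (u * (1 + u)) powr (\<gamma> - 1) * (1 + 2 * u) * (1 + u - y) - (u * (1 + u)) powr \<gamma> * 1) / ((1 + u - y) * (1 + u - y))) (at u)"
      using n by (intro DERIV_divide) (auto intro!: derivative_eq_intros)
    then have "(h has_real_derivative (\<gamma> * (u * (1 + u)) powr (\<gamma> - 1) * (1 + 2 * u) * (1 + u - y) - (u * (1 + u)) powr \<gamma> * 1) / ((1 + u - y) * (1 + u - y))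
        - (2 * \<gamma> - 1) * (u * (1 + u)) powr (\<gamma> - 1)) (at u)"
      unfolding h_def[abs_def] A_fun_def[abs_def] by (intro DERIV_diff DERIV_cmult DERIV_J u)
    moreover have "(\<gamma> * (u * (1 + u)) powr (\<gamma> - 1) * (1 + 2 * u) * (1 + u - y) - (u * (1 + u)) powr \<gamma> * 1) / ((1 + u - y) * (1 + u - y))
        - (2 * \<gamma> - 1) * (u * (1 + u)) powr (\<gamma> - 1) = D u"
    proof -
      define q where "q = (u * (1 + u)) powr (\<gamma> - 1)"
      define n where "n = 1 + u - y"
      have n0: "n \<noteq> 0" using u y by (simp add: n_def)
      have un: "u = n + y - 1" by (simp add: n_def)
      have p: "(u * (1 + u)) powr \<gamma> = q * (u * (1 + u))"
        using u by (simp add: q_def powr_diff)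
      have "(\<gamma> * q * (1 + 2 * u) * n - q * (u * (1 + u))) / (n * n) - (2 * \<gamma> - 1) * q
        = q * ((\<gamma> - 1) * (2 * y - 1) / n + y * (1 - y) / n\<^sup>2)"
        using n0 unfolding un by (simp add: divide_simps power2_eq_square) algebra
      then show ?thesis unfolding p D_def q_def[symmetric] n_def[symmetric] by simp
    qed
    ultimately show ?thesis by simp
  qed
  have Dbound: "\<bar>D u\<bar> \<le> 8 * (1 + u) powr (2 * \<gamma> - 3)" if u: "u \<ge> 1" for u
  proof -
    have n: "1 + u - y \<ge> u" using y by simp
    have "\<bar>(\<gamma> - 1) * (2 * y - 1) / (1 + u - y)\<bar> \<le> 1 / u"
    proof -
      have "\<bar>(\<gamma> - 1) * (2 * y - 1)\<bar> \<le> 1 * 1"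
        unfolding abs_mult using gamma_gt gamma_lt y by (intro mult_mono) auto
      then have "\<bar>(\<gamma> - 1) * (2 * y - 1)\<bar> / (1 + u - y) \<le> 1 / u"
        using n u by (intro frac_le) auto
      then show ?thesis using n u by simp
    qed
    moreover have "\<bar>y * (1 - y) / (1 + u - y)\<^sup>2\<bar> \<le> 1 / u"
    proof -
      have "y * (1 - y) \<le> 1 * 1" using y by (intro mult_mono) auto
      moreover have "u \<le> (1 + u - y)\<^sup>2"
        using n u mult_mono[of 1 "1 + u - y" u "1 + u - y"] by (simp add: power2_eq_square)
      ultimately have "y * (1 - y) / (1 + u - y)\<^sup>2 \<le> 1 / u"
        using u y by (intro frac_le) auto
      then show ?thesis using y by simp
    qed
    ultimately have b1: "\<bar>(\<gamma> - 1) * (2 * y - 1) / (1 + u - y) + y * (1 - y) / (1 + u - y)\<^sup>2\<bar> \<le> 4 / (1 + u)"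
    proof -
      have "1 / u + 1 / u \<le> 4 / (1 + u)" using u by (simp add: field_simps)
      then show ?thesis
        using \<open>\<bar>(\<gamma> - 1) * (2 * y - 1) / (1 + u - y)\<bar> \<le> 1 / u\<close> \<open>\<bar>y * (1 - y) / (1 + u - y)\<^sup>2\<bar> \<le> 1 / u\<close>
        by (meson abs_triangle_ineq add_mono order_trans)
    qed
    have b2: "(u * (1 + u)) powr (\<gamma> - 1) \<le> 2 * (1 + u) powr (2 * \<gamma> - 2)"
    proof -
      have "(u * (1 + u)) powr (\<gamma> - 1) \<le> ((1 + u) / 2 * (1 + u)) powr (\<gamma> - 1)"
        using u gamma_lt by (intro powr_mono2' mult_right_mono) auto
      also have "\<dots> = (1 + u) powr (\<gamma> - 1) * (1 + u) powr (\<gamma> - 1) / 2 powr (\<gamma> - 1)"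
        using u by (simp add: powr_mult powr_divide)
      also have "(1 + u) powr (\<gamma> - 1) * (1 + u) powr (\<gamma> - 1) = (1 + u) powr (2 * \<gamma> - 2)"
        by (simp add: powr_add[symmetric])
      also have "\<dots> / 2 powr (\<gamma> - 1) = 2 powr (1 - \<gamma>) * (1 + u) powr (2 * \<gamma> - 2)"
        by (simp add: powr_diff mult_ac)
      also have "\<dots> \<le> 2 powr 1 * (1 + u) powr (2 * \<gamma> - 2)"
        using gamma_gt by (intro mult_right_mono powr_mono) auto
      finally show ?thesis by simp
    qed
    have "\<bar>D u\<bar> \<le> (2 * (1 + u) powr (2 * \<gamma> - 2)) * (4 / (1 + u))"
      unfolding D_def abs_mult using b1 b2 by (intro mult_mono) auto
    also have "\<dots> = 8 * ((1 + u) powr (2 * \<gamma> - 2) / (1 + u) powr 1)"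
      using u by simp
    also have "\<dots> = 8 * (1 + u) powr (2 * \<gamma> - 3)"
      by (simp only: powr_diff[symmetric]) simp
    finally show ?thesis .
  qed
  \<comment> \<open>With this constant \<open>- c * (1 + u) powr (2 * \<gamma> - 2)\<close> is an
    antiderivative of the bound on \<open>D\<close>, so that it stays nondecreasing from 1 on when
    \<open>h\<close> is added or subtracted. As it takes values in \<open>{-c..0}\<close>,
    \<open>h\<close> varies by at most \<open>c\<close>.\<close>
  define c where "c = 8 / (2 - 2 * \<gamma>)"
  have c: "c > 0" using gamma_lt by (simp add: c_def)
  have Ederiv: "((\<lambda>u. - c * (1 + u) powr (2 * \<gamma> - 2)) has_real_derivative 8 * (1 + u) powr (2 * \<gamma> - 3)) (at u)" if "u \<ge> 1" for u
  proof -
    have "((\<lambda>u. - c * (1 + u) powr (2 * \<gamma> - 2)) has_real_derivative - c * ((2 * \<gamma> - 2) * (1 + u) powr (2 * \<gamma> - 2 - 1))) (at u)"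
      using that by (auto intro!: derivative_eq_intros)
    moreover have "- c * ((2 * \<gamma> - 2) * (1 + u) powr (2 * \<gamma> - 2 - 1)) = 8 * (1 + u) powr (2 * \<gamma> - 3)"
    proof -
      have "- c * (2 * \<gamma> - 2) = 8" using gamma_lt by (simp add: c_def field_simps)
      then show ?thesis by (simp only: mult.assoc[symmetric]) simp
    qed
    ultimately show ?thesis by simp
  qed
  have large: "\<bar>h u\<bar> \<le> \<bar>h 1\<bar> + c" if u: "u \<ge> 1" for u
  proof -
    have "- c * (1 + 1) powr (2 * \<gamma> - 2) + h 1 \<le> - c * (1 + u) powr (2 * \<gamma> - 2) + h u"
    proof (rule DERIV_nonneg_imp_nondecreasing[OF u])
      fix x :: real assume "1 \<le> x" "x \<le> u"
      then show "\<exists>d. ((\<lambda>u. - c * (1 + u) powr (2 * \<gamma> - 2) + h u) has_real_derivative d) (at x) \<and> 0 \<le> d"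
        using DERIV_add[OF Ederiv deriv, of x] Dbound[of x] by (intro exI[of _ "8 * (1 + x) powr (2 * \<gamma> - 3) + D x"]) auto
    qed
    moreover have "- c * (1 + 1) powr (2 * \<gamma> - 2) - h 1 \<le> - c * (1 + u) powr (2 * \<gamma> - 2) - h u"
    proof (rule DERIV_nonneg_imp_nondecreasing[OF u])
      fix x :: real assume "1 \<le> x" "x \<le> u"
      then show "\<exists>d. ((\<lambda>u. - c * (1 + u) powr (2 * \<gamma> - 2) - h u) has_real_derivative d) (at x) \<and> 0 \<le> d"
        using DERIV_diff[OF Ederiv deriv, of x] Dbound[of x] by (intro exI[of _ "8 * (1 + x) powr (2 * \<gamma> - 3) - D x"]) auto
    qed
    moreover have "0 \<le> c * (1 + u) powr (2 * \<gamma> - 2)" using c by simp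
    moreover have "c * (1 + 1) powr (2 * \<gamma> - 2) \<le> c * 1"
      using c gamma_lt powr_mono[of "2 * \<gamma> - 2" 0 "1 + 1 :: real"] by (intro mult_left_mono) auto
    ultimately show ?thesis by linarith
  qed
  have small: "\<bar>h u\<bar> \<le> 2 / (1 - y) + J_fun 1" if u: "u > 0" "u \<le> 1" for u
  proof -
    have "(u * (1 + u)) powr \<gamma> \<le> 2 powr 1"
    proof -
      have "u * (1 + u) \<le> 1 * 2" using u by (intro mult_mono) auto
      then have "(u * (1 + u)) powr \<gamma> \<le> 2 powr \<gamma>" using u gamma_gt by (intro powr_mono2) auto
      also have "\<dots> \<le> 2 powr 1" using gamma_lt by (intro powr_mono) auto
      finally show ?thesis .
    qed
    then have "A_fun y u \<le> 2 / (1 - y)"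
      unfolding A_fun_def using u y by (intro frac_le) auto
    moreover have "0 \<le> A_fun y u" unfolding A_fun_def using u y by simp
    moreover have "(2 * \<gamma> - 1) * J_fun u \<le> 1 * J_fun 1"
      using u gamma_gt gamma_lt J_nonneg J_mono[of u 1] by (intro mult_mono) auto
    moreover have "0 \<le> (2 * \<gamma> - 1) * J_fun u" using gamma_gt J_nonneg by simp
    ultimately show ?thesis unfolding h_def by simp
  qed
  have "\<bar>h u\<bar> \<le> max (\<bar>h 1\<bar> + c) (2 / (1 - y) + J_fun 1)" if "u > 0" for u
    using large[of u] small[of u] that by linarith
  then have "\<bar>h_fun y u\<bar> \<le> \<bar>P_fun y\<bar> * max (\<bar>h 1\<bar> + c) (2 / (1 - y) + J_fun 1)" if "u > 0" for u
    using that unfolding h_fun_def h_def[symmetric] abs_mult by (intro mult_left_mono) auto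
  then show ?thesis by blast
qed

end

section \<open>Pairing the limit chain with the bounded solution\<close>

context stable_index
begin

text \<open>The overshoot law has total mass 1, and only the overshoots beyond 1 are counted; the
  deficit is the probability of landing in the unit interval.\<close>

lemma beta_mass:
  assumes u: "u > 0"
  shows "(\<integral>\<^sup>+w\<in>{0<..}. ennreal (\<beta> (1 + w) u) \<partial>lborel) \<le> 1"
proof -
  have m: "(\<lambda>s. ennreal (\<beta> s u) * indicator {1..} s) \<in> borel_measurable borel" by measurable
  have "(\<integral>\<^sup>+w\<in>{0<..}. ennreal (\<beta> (1 + w) u) \<partial>lborel) \<le> (\<integral>\<^sup>+w. ennreal (\<beta> (1 + 1 * w) u) * indicator {1..} (1 + 1 * w) \<partial>lborel)"
    by (intro nn_integral_mono) (auto split: split_indicator)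
  also have "\<dots> = ennreal (\<kappa> * G_fun (u / 1))"
    using nn_integral_real_affine[OF m, of 1 1] beta_tail[of 1 u] u by simp
  also have "\<kappa> * G_fun (u / 1) \<le> \<kappa> * (pi / sin (pi * \<gamma>))"
  proof (intro mult_left_mono)
    have "G_fun u \<le> (LINT r:{0<..}|lborel. r powr (\<gamma> - 1) / (1 + r))"
      unfolding G_fun_def set_lebesgue_integral_def
      using gamma_gt gamma_lt stieltjes_powr_integral(1)[of \<gamma> 1] G_integrable[of u]
      by (intro integral_mono) (auto simp: set_integrable_def split: split_indicator)
    then show "G_fun (u / 1) \<le> pi / sin (pi * \<gamma>)"
      using gamma_gt gamma_lt by (simp add: stieltjes_powr_integral(2))
  qed (use kappa_pos in simp)
  also have "\<kappa> * (pi / sin (pi * \<gamma>)) = 1" using theta by simp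
  finally show ?thesis by (simp add: ennreal_leI)
qed

lemma phi_shift_integrable: "set_integrable lborel {0<..} (\<lambda>u. \<phi> k (1 + u))"
proof (rule set_integrable_bound)
  show "set_integrable lborel {0<..} (\<lambda>u::real. (1 + u) powr (- (\<gamma> + 1/2)))"
    using gamma_gt by (intro powr_shift_integrable) auto
  show "set_borel_measurable lborel {0<..} (\<lambda>u. \<phi> k (1 + u))"
    unfolding set_borel_measurable_def by measurable
  show "AE u in lborel. u \<in> {0<..} \<longrightarrow> norm (\<phi> k (1 + u)) \<le> norm ((1 + u) powr (- (\<gamma> + 1/2)))"
  proof (intro AE_I2 impI)
    fix u :: real assume "u \<in> {0<..}"
    then have u: "u > 0" by simp
    have "\<phi> k (1 + u) \<le> \<theta> ^ k * (1 + u) powr (- \<gamma> - 1/2)" using u by (intro phi_bounds(2)) auto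
    also have "\<dots> \<le> 1 * (1 + u) powr (- \<gamma> - 1/2)"
      using theta by (intro mult_right_mono power_le_one) auto
    finally show "norm (\<phi> k (1 + u)) \<le> norm ((1 + u) powr (- (\<gamma> + 1/2)))"
      using phi_bounds(1)[of "1 + u" k] u by simp
  qed
qed

definition pairing :: "nat \<Rightarrow> real \<Rightarrow> real" where
  "pairing k y = (LINT u:{0<..}|lborel. \<phi> k (1 + u) * h_fun y u)"

lemma pairing_integrable:
  assumes y: "0 < y" "y < 1"
  shows "set_integrable lborel {0<..} (\<lambda>u. \<phi> k (1 + u) * h_fun y u)"
proof -
  obtain C where C: "\<And>u. u > 0 \<Longrightarrow> \<bar>h_fun y u\<bar> \<le> C" using h_bounded[OF y] by blast
  have "set_integrable lborel {0<..} (\<lambda>u. \<phi> k (1 + u) * C)"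
    by (intro set_integrable_mult_left phi_shift_integrable)
  then show ?thesis
  proof (rule set_integrable_bound)
    show "set_borel_measurable lborel {0<..} (\<lambda>u. \<phi> k (1 + u) * h_fun y u)"
      unfolding set_borel_measurable_def by measurable
    show "AE u in lborel. u \<in> {0<..} \<longrightarrow> norm (\<phi> k (1 + u) * h_fun y u) \<le> norm (\<phi> k (1 + u) * C)"
      using C by (intro AE_I2 impI) (auto simp: abs_mult intro!: mult_left_mono order_trans[OF C abs_ge_self])
  qed
qed

text \<open>Here the boundedness of \<open>h_fun\<close> is spent: \<open>\<phi> k (1 + u)\<close>
  is at most \<open>\<theta> ^ k\<close> times a power that is integrable because
  \<open>\<gamma> + 1/2 > 1\<close>.\<close>

lemma pairing_tendsto_0:
  assumes y: "0 < y" "y < 1"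
  shows "(\<lambda>k. pairing k y) \<longlonglongrightarrow> 0"
proof -
  obtain C where C: "\<And>u. u > 0 \<Longrightarrow> \<bar>h_fun y u\<bar> \<le> C" using h_bounded[OF y] by blast
  have C0: "C \<ge> 0" using C[of 1] by simp
  let ?I = "LINT u:{0<..}|lborel. (1 + u) powr (- (\<gamma> + 1/2))"
  have i: "set_integrable lborel {0<..} (\<lambda>u::real. (1 + u) powr (- (\<gamma> + 1/2)))"
    using gamma_gt by (intro powr_shift_integrable) auto
  have "norm (pairing k y) \<le> \<theta> ^ k * (C * ?I)" for k
  proof -
    have "norm (pairing k y) \<le> (LINT u:{0<..}|lborel. norm (\<phi> k (1 + u) * h_fun y u))"
      unfolding pairing_def by (rule set_integral_norm_bound[OF pairing_integrable[OF y]])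
    also have "\<dots> \<le> (LINT u:{0<..}|lborel. (\<theta> ^ k * C) * (1 + u) powr (- (\<gamma> + 1/2)))"
    proof (rule set_integral_mono)
      show "set_integrable lborel {0<..} (\<lambda>u. norm (\<phi> k (1 + u) * h_fun y u))"
        by (rule set_integrable_norm[OF pairing_integrable[OF y]])
      show "set_integrable lborel {0<..} (\<lambda>u. (\<theta> ^ k * C) * (1 + u) powr (- (\<gamma> + 1/2)))"
        by (intro set_integrable_mult_right i)
      fix u :: real assume "u \<in> {0<..}"
      then have u: "u > 0" by simp
      have "norm (\<phi> k (1 + u) * h_fun y u) = \<phi> k (1 + u) * \<bar>h_fun y u\<bar>"
        using u phi_bounds(1)[of "1 + u" k] by (simp add: abs_mult)
      also have "\<dots> \<le> (\<theta> ^ k * (1 + u) powr (- \<gamma> - 1/2)) * C"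
        using u C phi_bounds(1)[of "1 + u" k] theta by (intro mult_mono phi_bounds(2)) auto
      finally show "norm (\<phi> k (1 + u) * h_fun y u) \<le> (\<theta> ^ k * C) * (1 + u) powr (- (\<gamma> + 1/2))"
        by (simp add: mult_ac)
    qed
    also have "\<dots> = \<theta> ^ k * (C * ?I)" by (subst set_integral_mult_right) simp
    finally show ?thesis .
  qed
  moreover have "(\<lambda>k. \<theta> ^ k * (C * ?I)) \<longlonglongrightarrow> 0"
    using theta by (intro tendsto_mult_left_zero LIMSEQ_power_zero) auto
  ultimately show ?thesis by (rule Lim_null_comparison[OF always_eventually[OF allI]])
qed

text \<open>The landing equation is inserted for \<open>h_fun y\<close> and the integrals are
  exchanged. Its first term reproduces the recursion for \<open>\<phi> (Suc k)\<close> at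
  \<open>1 - y\<close>, its second the pairing of the next iterate. The exchange is justified by the
  bound on \<open>h_fun\<close>, the mass at most 1 of the kernel and the integrability of
  \<open>\<phi> k (1 + u)\<close>.\<close>

lemma pairing_step:
  assumes y: "0 < y" "y < 1"
  shows "pairing k y = \<phi> (Suc k) (1 - y) + pairing (Suc k) (1 - y)"
proof -
  have y': "0 < 1 - y" "1 - y < 1" using y by auto
  obtain C where C: "\<And>u. u > 0 \<Longrightarrow> \<bar>h_fun (1 - y) u\<bar> \<le> C" using h_bounded[OF y'] by blast
  have C0: "C \<ge> 0" using C[of 1] by simp
  define F where "F u w = indicator {0<..} u * indicator {0<..} w * (\<phi> k (1 + u) * (\<beta> (1 + w) u * h_fun (1 - y) w))" for u w :: real
  have Fm [measurable]: "case_prod F \<in> borel_measurable (lborel \<Otimes>\<^sub>M lborel)"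
    unfolding F_def by measurable
  have inner: "(LINT w|lborel. F u w) = indicator {0<..} u * (\<phi> k (1 + u) * (LINT w:{0<..}|lborel. \<beta> (1 + w) u * h_fun (1 - y) w))" for u
    unfolding F_def set_lebesgue_integral_def
    by (subst Bochner_Integration.integral_mult_right_zero[symmetric])+ (intro Bochner_Integration.integral_cong refl, auto split: split_indicator)
  have inner': "(LINT u|lborel. F u w) = indicator {0<..} w * (\<phi> (Suc k) (1 + w) * h_fun (1 - y) w)" for w
    unfolding F_def stable_iter.simps set_lebesgue_integral_def
    by (subst Bochner_Integration.integral_mult_left_zero[symmetric], subst Bochner_Integration.integral_mult_right_zero[symmetric])
       (intro Bochner_Integration.integral_cong refl, auto split: split_indicator)
  have int: "integrable (lborel \<Otimes>\<^sub>M lborel) (case_prod F)"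
  proof (rule integrableI_bounded)
    have "(\<integral>\<^sup>+z. ennreal (norm (case_prod F z)) \<partial>(lborel \<Otimes>\<^sub>M lborel)) = (\<integral>\<^sup>+u. (\<integral>\<^sup>+w. ennreal (norm (F u w)) \<partial>lborel) \<partial>lborel)"
      by (subst lborel.nn_integral_fst[symmetric]) auto
    also have "\<dots> \<le> (\<integral>\<^sup>+u. ennreal C * (ennreal (\<phi> k (1 + u)) * indicator {0<..} u) \<partial>lborel)"
    proof (rule nn_integral_mono)
      fix u :: real
      show "(\<integral>\<^sup>+w. ennreal (norm (F u w)) \<partial>lborel) \<le> ennreal C * (ennreal (\<phi> k (1 + u)) * indicator {0<..} u)"
      proof (cases "u > 0")
        case True
        have "(\<integral>\<^sup>+w. ennreal (norm (F u w)) \<partial>lborel)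
          \<le> (\<integral>\<^sup>+w. (ennreal C * ennreal (\<phi> k (1 + u))) * (ennreal (\<beta> (1 + w) u) * indicator {0<..} w) \<partial>lborel)"
        proof (rule nn_integral_mono)
          fix w :: real
          show "ennreal (norm (F u w)) \<le> (ennreal C * ennreal (\<phi> k (1 + u))) * (ennreal (\<beta> (1 + w) u) * indicator {0<..} w)"
          proof (cases "w > 0")
            case w: True
            have b: "0 \<le> \<beta> (1 + w) u" "0 \<le> \<phi> k (1 + u)" using True w by (auto intro!: beta_nonneg phi_bounds(1))
            have "norm (F u w) = \<phi> k (1 + u) * (\<beta> (1 + w) u * \<bar>h_fun (1 - y) w\<bar>)"
              using True w b by (simp add: F_def abs_mult)
            also have "\<dots> \<le> \<phi> k (1 + u) * (\<beta> (1 + w) u * C)"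
              using b C[OF w] by (intro mult_left_mono) auto
            also have "\<dots> = (C * \<phi> k (1 + u)) * \<beta> (1 + w) u" by simp
            finally have "ennreal (norm (F u w)) \<le> ennreal ((C * \<phi> k (1 + u)) * \<beta> (1 + w) u)" by (rule ennreal_leI)
            also have "\<dots> = (ennreal C * ennreal (\<phi> k (1 + u))) * ennreal (\<beta> (1 + w) u)"
              using b C0 by (simp only: ennreal_mult mult_nonneg_nonneg)
            finally show ?thesis using w by simp
          qed (simp add: F_def)
        qed
        also have "\<dots> = (ennreal C * ennreal (\<phi> k (1 + u))) * (\<integral>\<^sup>+w\<in>{0<..}. ennreal (\<beta> (1 + w) u) \<partial>lborel)"
          by (rule nn_integral_cmult) measurable
        also have "\<dots> \<le> (ennreal C * ennreal (\<phi> k (1 + u))) * 1"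
          by (intro mult_left_mono beta_mass True) auto
        finally show ?thesis using True by simp
      qed (simp add: F_def)
    qed
    also have "\<dots> = ennreal C * (\<integral>\<^sup>+u\<in>{0<..}. ennreal (\<phi> k (1 + u)) \<partial>lborel)"
      by (rule nn_integral_cmult) measurable
    also have "\<dots> = ennreal C * ennreal (LINT u:{0<..}|lborel. \<phi> k (1 + u))"
      by (subst nn_set_integral_eq_set_integral[OF phi_shift_integrable]) (auto intro!: phi_bounds(1))
    also have "\<dots> < \<infinity>" by (simp add: ennreal_mult_less_top)
    finally show "(\<integral>\<^sup>+z. ennreal (norm (case_prod F z)) \<partial>(lborel \<Otimes>\<^sub>M lborel)) < \<infinity>" .
  qed (rule Fm)
  have swap: "(LINT u|lborel. (LINT w|lborel. F u w)) = (LINT w|lborel. (LINT u|lborel. F u w))"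
    by (rule lborel_pair.Fubini_integral[OF int, symmetric])
  have i1: "set_integrable lborel {0<..} (\<lambda>u. \<beta> (1 - y) u * \<phi> k (1 + u))"
    using y by (intro phi_bounds(3)) auto
  have i2: "set_integrable lborel {0<..} (\<lambda>u. \<phi> k (1 + u) * (LINT w:{0<..}|lborel. \<beta> (1 + w) u * h_fun (1 - y) w))"
    using lborel_pair.integrable_fst[OF int] unfolding set_integrable_def inner by simp
  have "pairing k y = (LINT u:{0<..}|lborel. \<beta> (1 - y) u * \<phi> k (1 + u) + \<phi> k (1 + u) * (LINT w:{0<..}|lborel. \<beta> (1 + w) u * h_fun (1 - y) w))"
    unfolding pairing_def
  proof (rule set_lebesgue_integral_cong)
    show "\<forall>u. u \<in> {0<..} \<longrightarrow> \<phi> k (1 + u) * h_fun y u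
      = \<beta> (1 - y) u * \<phi> k (1 + u) + \<phi> k (1 + u) * (LINT w:{0<..}|lborel. \<beta> (1 + w) u * h_fun (1 - y) w)"
      using h_equation(2)[OF _ y] by (auto simp: distrib_left mult_ac)
  qed simp
  also have "\<dots> = \<phi> (Suc k) (1 - y) + (LINT u:{0<..}|lborel. \<phi> k (1 + u) * (LINT w:{0<..}|lborel. \<beta> (1 + w) u * h_fun (1 - y) w))"
    by (subst set_integral_add(2)[OF i1 i2]) simp
  also have "(LINT u:{0<..}|lborel. \<phi> k (1 + u) * (LINT w:{0<..}|lborel. \<beta> (1 + w) u * h_fun (1 - y) w)) = pairing (Suc k) (1 - y)"
    unfolding pairing_def set_lebesgue_integral_def[of _ "{0<..}" "\<lambda>u. \<phi> (Suc k) (1 + u) * h_fun (1 - y) u"]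
      set_lebesgue_integral_def[of _ "{0<..}" "\<lambda>u. \<phi> k (1 + u) * (LINT w:{0<..}|lborel. \<beta> (1 + w) u * h_fun (1 - y) w)"]
    using swap unfolding inner inner' by simp
  finally show ?thesis .
qed

text \<open>Against \<open>(1 + u) powr (- \<gamma> - 1)\<close> the \<open>A_fun\<close> part is
  again an integral with two poles, now at \<open>- 1\<close> and \<open>y - 1\<close>. The
  \<open>J_fun\<close> part becomes a Stieltjes integral with the factor \<open>1 / \<gamma>\<close>
  after an exchange. Both carry \<open>pi / sin (pi * \<gamma>)\<close>, which cancels the \<kappa>
  in \<open>P_fun\<close>.\<close>

lemma pairing_0:
  assumes y: "0 < y" "y < 1"
  shows "pairing 0 y = (y * (1 - y)) powr (- \<gamma>) * ((1 - (1 - y) powr \<gamma>) / y - (2 * \<gamma> - 1) / \<gamma>)"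
proof -
  have eA: "(1 + u) powr (- \<gamma> - 1) * A_fun y u = u powr \<gamma> / ((u + 1) * (u + (1 - y)))" if "u \<in> {0<..}" for u
  proof -
    have "(1 + u) powr (- \<gamma> - 1) * (u * (1 + u)) powr \<gamma> = u powr \<gamma> * ((1 + u) powr (- \<gamma> - 1) * (1 + u) powr \<gamma>)"
      using that by (simp add: powr_mult)
    also have "(1 + u) powr (- \<gamma> - 1) * (1 + u) powr \<gamma> = 1 / (u + 1)"
      using that by (simp add: powr_add[symmetric] powr_minus_divide add.commute)
    finally have 1: "(1 + u) powr (- \<gamma> - 1) * (u * (1 + u)) powr \<gamma> = u powr \<gamma> * (1 / (u + 1))" .
    have "1 + u - y = u + (1 - y)" by simp
    then show ?thesis unfolding A_fun_def times_divide_eq_right 1 by simp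
  qed
  have iA: "set_integrable lborel {0<..} (\<lambda>u. (1 + u) powr (- \<gamma> - 1) * A_fun y u)"
    using y gamma_gt gamma_lt stieltjes_two_poles_integral(1)[of \<gamma> 1 "1 - y"]
    by (subst set_integrable_cong[OF refl refl eA]) auto
  have vA: "(LINT u:{0<..}|lborel. (1 + u) powr (- \<gamma> - 1) * A_fun y u) = (pi / sin (pi * \<gamma>)) * (1 - (1 - y) powr \<gamma>) / y"
  proof -
    have "(LINT u:{0<..}|lborel. (1 + u) powr (- \<gamma> - 1) * A_fun y u) = (LINT u:{0<..}|lborel. u powr \<gamma> / ((u + 1) * (u + (1 - y))))"
      by (intro set_lebesgue_integral_cong) (auto simp: eA)
    also have "\<dots> = (pi / sin (pi * \<gamma>)) * (1 powr \<gamma> - (1 - y) powr \<gamma>) / (1 - (1 - y))"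
      using y gamma_gt gamma_lt by (intro stieltjes_two_poles_integral(2)) auto
    finally show ?thesis by simp
  qed
  have nnJ: "(\<integral>\<^sup>+u\<in>{0<..}. ennreal ((1 + u) powr (- \<gamma> - 1) * J_fun u) \<partial>lborel) = ennreal (1 / \<gamma> * (pi / sin (pi * \<gamma>)))"
  proof -
    let ?f = "\<lambda>v. (v * (1 + v)) powr (\<gamma> - 1)"
    have "(\<integral>\<^sup>+u\<in>{0<..}. ennreal ((1 + u) powr (- \<gamma> - 1) * J_fun u) \<partial>lborel)
      = (\<integral>\<^sup>+u. (\<integral>\<^sup>+v. ennreal ((1 + u) powr (- \<gamma> - 1)) * ennreal (?f v) * (if 0 < v \<and> v < u then 1 else 0) \<partial>lborel) \<partial>lborel)"
    proof (rule nn_integral_cong)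
      fix u :: real
      show "ennreal ((1 + u) powr (- \<gamma> - 1) * J_fun u) * indicator {0<..} u
        = (\<integral>\<^sup>+v. ennreal ((1 + u) powr (- \<gamma> - 1)) * ennreal (?f v) * (if 0 < v \<and> v < u then 1 else 0) \<partial>lborel)"
      proof (cases "u > 0")
        case True
        have "ennreal ((1 + u) powr (- \<gamma> - 1) * J_fun u) = ennreal ((1 + u) powr (- \<gamma> - 1)) * (\<integral>\<^sup>+v\<in>{0<..<u}. ennreal (?f v) \<partial>lborel)"
          using True J_nonneg by (simp add: ennreal_mult nn_J)
        also have "\<dots> = (\<integral>\<^sup>+v. ennreal ((1 + u) powr (- \<gamma> - 1)) * (ennreal (?f v) * indicator {0<..<u} v) \<partial>lborel)"
          by (rule nn_integral_cmult[symmetric]) measurable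
        also have "\<dots> = (\<integral>\<^sup>+v. ennreal ((1 + u) powr (- \<gamma> - 1)) * ennreal (?f v) * (if 0 < v \<and> v < u then 1 else 0) \<partial>lborel)"
          by (intro nn_integral_cong) (auto split: split_indicator)
        finally show ?thesis using True by simp
      next
        case False
        have "(\<integral>\<^sup>+v. ennreal ((1 + u) powr (- \<gamma> - 1)) * ennreal (?f v) * (if 0 < v \<and> v < u then 1 else 0) \<partial>lborel) = (\<integral>\<^sup>+v. 0 \<partial>(lborel::real measure))"
          using False by (intro nn_integral_cong) auto
        then show ?thesis using False by simp
      qed
    qed
    also have "\<dots> = (\<integral>\<^sup>+v. (\<integral>\<^sup>+u. ennreal ((1 + u) powr (- \<gamma> - 1)) * ennreal (?f v) * (if 0 < v \<and> v < u then 1 else 0) \<partial>lborel) \<partial>lborel)"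
      by (rule lborel_pair.Fubini') measurable
    also have "\<dots> = (\<integral>\<^sup>+v. ennreal (1 / \<gamma>) * (ennreal (v powr (\<gamma> - 1) / (1 + v)) * indicator {0<..} v) \<partial>lborel)"
    proof (rule nn_integral_cong)
      fix v :: real
      show "(\<integral>\<^sup>+u. ennreal ((1 + u) powr (- \<gamma> - 1)) * ennreal (?f v) * (if 0 < v \<and> v < u then 1 else 0) \<partial>lborel)
        = ennreal (1 / \<gamma>) * (ennreal (v powr (\<gamma> - 1) / (1 + v)) * indicator {0<..} v)"
      proof (cases "v > 0")
        case True
        have m: "(\<lambda>s. ennreal (s powr (- (\<gamma> + 1))) * indicator {1 + v..} s) \<in> borel_measurable borel" by measurable
        have "(\<integral>\<^sup>+u. ennreal ((1 + u) powr (- \<gamma> - 1)) * ennreal (?f v) * (if 0 < v \<and> v < u then 1 else 0) \<partial>lborel)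
          = (\<integral>\<^sup>+u. ennreal (?f v) * (ennreal ((1 + 1 * u) powr (- (\<gamma> + 1))) * indicator {1 + v..} (1 + 1 * u)) \<partial>lborel)"
          using True AE_lborel_singleton[of v]
          by (intro nn_integral_cong_AE) (auto elim!: eventually_mono split: split_indicator simp: mult_ac)
        also have "\<dots> = ennreal (?f v) * (\<integral>\<^sup>+u. ennreal ((1 + 1 * u) powr (- (\<gamma> + 1))) * indicator {1 + v..} (1 + 1 * u) \<partial>lborel)"
          using measurable_compose[OF _ m, of "\<lambda>w. 1 + w" lborel] by (subst nn_integral_cmult) auto
        also have "(\<integral>\<^sup>+u. ennreal ((1 + 1 * u) powr (- (\<gamma> + 1))) * indicator {1 + v..} (1 + 1 * u) \<partial>lborel) = ennreal ((1 + v) powr (1 - (\<gamma> + 1)) / ((\<gamma> + 1) - 1))"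
          using nn_integral_real_affine[OF m, of 1 1] powr_tail_nn_integral[of "\<gamma> + 1" "1 + v"] True gamma_gt by simp
        also have "ennreal (?f v) * ennreal ((1 + v) powr (1 - (\<gamma> + 1)) / ((\<gamma> + 1) - 1)) = ennreal (?f v * ((1 + v) powr (1 - (\<gamma> + 1)) / ((\<gamma> + 1) - 1)))"
          using gamma_gt by (intro ennreal_mult[symmetric]) auto
        also have "?f v * ((1 + v) powr (1 - (\<gamma> + 1)) / ((\<gamma> + 1) - 1)) = 1 / \<gamma> * (v powr (\<gamma> - 1) / (1 + v))"
        proof -
          have "(1 + v) powr (\<gamma> - 1) * (1 + v) powr (1 - (\<gamma> + 1)) = 1 / (1 + v)"
          proof -
            have "(1 + v) powr (\<gamma> - 1) * (1 + v) powr (1 - (\<gamma> + 1)) = (1 + v) powr (- 1)"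
              unfolding powr_add[symmetric] by simp
            then show ?thesis using True by (simp add: powr_minus_divide)
          qed
          moreover have "?f v * ((1 + v) powr (1 - (\<gamma> + 1)) / ((\<gamma> + 1) - 1))
            = 1 / \<gamma> * (v powr (\<gamma> - 1) * ((1 + v) powr (\<gamma> - 1) * (1 + v) powr (1 - (\<gamma> + 1))))"
            using True by (simp add: powr_mult)
          ultimately show ?thesis by simp
        qed
        also have "ennreal (1 / \<gamma> * (v powr (\<gamma> - 1) / (1 + v))) = ennreal (1 / \<gamma>) * ennreal (v powr (\<gamma> - 1) / (1 + v))"
          using gamma_gt True by (intro ennreal_mult) auto
        finally show ?thesis using True by simp
      qed simp
    qed
    also have "\<dots> = ennreal (1 / \<gamma>) * (\<integral>\<^sup>+v\<in>{0<..}. ennreal (v powr (\<gamma> - 1) / (1 + v)) \<partial>lborel)"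
      by (rule nn_integral_cmult) measurable
    also have "\<dots> = ennreal (1 / \<gamma>) * ennreal (1 powr (\<gamma> - 1) * (pi / sin (pi * \<gamma>)))"
      using gamma_gt gamma_lt by (subst stieltjes_powr_nn_integral) auto
    also have "\<dots> = ennreal (1 / \<gamma> * (pi / sin (pi * \<gamma>)))"
      using gamma_gt less_imp_le[OF theta(1)] by (subst ennreal_mult[symmetric]) auto
    finally show ?thesis .
  qed
  have J0: "0 \<le> 1 / \<gamma> * (pi / sin (pi * \<gamma>))" using gamma_gt less_imp_le[OF theta(1)] by auto
  have iJ: "set_integrable lborel {0<..} (\<lambda>u. (1 + u) powr (- \<gamma> - 1) * J_fun u)"
    and vJ: "(LINT u:{0<..}|lborel. (1 + u) powr (- \<gamma> - 1) * J_fun u) = 1 / \<gamma> * (pi / sin (pi * \<gamma>))"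
    using set_integral_eq_nn_integralI[OF _ _ nnJ J0] J_nonneg by (auto simp: set_borel_measurable_def)
  have e: "\<phi> 0 (1 + u) * h_fun y u = P_fun y * ((1 + u) powr (- \<gamma> - 1) * A_fun y u) - (P_fun y * (2 * \<gamma> - 1)) * ((1 + u) powr (- \<gamma> - 1) * J_fun u)" for u
    unfolding h_fun_def stable_iter.simps by (simp add: algebra_simps)
  have "pairing 0 y = P_fun y * ((pi / sin (pi * \<gamma>)) * (1 - (1 - y) powr \<gamma>) / y) - (P_fun y * (2 * \<gamma> - 1)) * (1 / \<gamma> * (pi / sin (pi * \<gamma>)))"
    unfolding pairing_def e set_integral_diff(2)[OF set_integrable_mult_right[OF iA] set_integrable_mult_right[OF iJ]]
      set_integral_mult_right vA vJ ..
  also have "\<dots> = (P_fun y * (pi / sin (pi * \<gamma>))) * ((1 - (1 - y) powr \<gamma>) / y - (2 * \<gamma> - 1) / \<gamma>)"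
  proof -
    have "P * (K * X / y) - (P * Z) * (1 / g * K) = (P * K) * (X / y - Z / g)" for P K X Z g :: real
      by (simp add: right_diff_distrib mult_ac)
    then show ?thesis .
  qed
  also have "P_fun y * (pi / sin (pi * \<gamma>)) = (y * (1 - y)) powr (- \<gamma>)"
    unfolding P_fun_def using theta by simp
  finally show ?thesis .
qed

text \<open>Harmonicity of \<open>h\<close> moves the pairing one step at a time along the chain; each step sheds the density
  of landing in the unit interval.\<close>
lemma phi_sums:
  assumes y: "0 < y" "y < 1"
  shows "(\<lambda>k. \<phi> (2 * k + 1) (1 - y) + \<phi> (2 * k + 2) y) sums
    ((y * (1 - y)) powr (- \<gamma>) * ((1 - (1 - y) powr \<gamma>) / y - (2 * \<gamma> - 1) / \<gamma>))"
proof -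
  have y': "0 < 1 - y" "1 - y < 1" using y by auto
  have step: "\<phi> (2 * k + 1) (1 - y) + \<phi> (2 * k + 2) y = pairing (2 * k) y - pairing (2 * Suc k) y" for k
    using pairing_step[OF y, of "2 * k"] pairing_step[OF y', of "2 * k + 1"] by simp
  have "(\<lambda>k. pairing (2 * k) y) \<longlonglongrightarrow> 0"
    using LIMSEQ_subseq_LIMSEQ[OF pairing_tendsto_0[OF y], of "\<lambda>k. 2 * k"] by (simp add: strict_mono_def o_def)
  then have "(\<lambda>k. pairing (2 * k) y - pairing (2 * Suc k) y) sums (pairing (2 * 0) y - 0)"
    by (rule telescope_sums')
  then show ?thesis unfolding step using pairing_0[OF y] by simp
qed

end

text \<open>Expanding the density produces the power \<open>y powr (\<rho> - \<gamma> - 1)\<close>,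
  which is not integrable at 0. An integration by parts keeps the cancelling terms together: they
  form the derivative of \<open>F\<close>, and the rest is a multiple of the Beta integrand
  \<open>b\<close>. The boundary values of \<open>F\<close> are 0 at 0, because
  \<open>\<rho> > \<gamma> - 1\<close>, and -1 at 1.\<close>

lemma has_integral_landing_powr:
  fixes \<gamma> \<rho> :: real
  assumes g: "1/2 < \<gamma>" "\<gamma> < 1" and r: "\<gamma> - 1 < \<rho>" "\<rho> < \<gamma>"
  shows "((\<lambda>y. (y * (1 - y)) powr (- \<gamma>) * ((1 - (1 - y) powr \<gamma>) / y - (2 * \<gamma> - 1) / \<gamma>) * y powr \<rho>)
    has_integral (1 - \<rho> * Beta (1 - \<gamma> + \<rho>) (1 - \<gamma>) * ((1 - \<gamma>) / \<gamma>)) / (\<gamma> - \<rho>)) {0..1}"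
proof -
  define B where "B = Beta (1 - \<gamma> + \<rho>) (1 - \<gamma>)"
  define b where "b y = y powr (\<rho> - \<gamma>) * (1 - y) powr (- \<gamma>)" for y :: real
  define F where "F y = y powr (\<rho> - \<gamma>) * ((1 - y) powr (1 - \<gamma>) - 1)" for y :: real
  define F' where "F' y = (\<rho> - \<gamma>) * (y powr (\<rho> - \<gamma> - 1) * ((1 - y) powr (1 - \<gamma>) - 1)) - (1 - \<gamma>) * b y" for y :: real
  have Bi: "(b has_integral B) {0..1}"
    using has_integral_Beta_real[of "1 - \<gamma> + \<rho>" "1 - \<gamma>"] r g unfolding B_def b_def[abs_def] by simp
  have "(F' has_integral F 1 - F 0) {0..1}"
  proof (rule fundamental_theorem_of_calculus_interior)
    show "continuous_on {0..1} F"
      unfolding continuous_on_eq_continuous_within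
    proof
      fix x :: real assume x: "x \<in> {0..1}"
      show "continuous (at x within {0..1}) F"
      proof (cases "x = 0")
        case True
        \<comment> \<open>The factor \<open>(1 - y) powr (1 - \<gamma>) - 1\<close> is at most
          \<open>y\<close> in absolute value, which raises the exponent
          \<open>\<rho> - \<gamma>\<close> by one and makes it positive.\<close>
        have "((\<lambda>y. F y) \<longlongrightarrow> 0) (at 0 within {0..1})"
        proof (rule Lim_null_comparison)
          have "((\<lambda>y::real. y powr (\<rho> - \<gamma> + 1)) \<longlongrightarrow> 0 powr (\<rho> - \<gamma> + 1)) (at 0 within {0..1})"
            using r by (intro tendsto_powr' tendsto_ident_at tendsto_const) (auto simp: eventually_at_filter)
          then show "((\<lambda>y::real. y powr (\<rho> - \<gamma> + 1)) \<longlongrightarrow> 0) (at 0 within {0..1})" by simp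
          show "\<forall>\<^sub>F y in at 0 within {0..1}. norm (F y) \<le> y powr (\<rho> - \<gamma> + 1)"
            unfolding eventually_at_filter
          proof (intro always_eventually allI impI)
            fix y :: real assume "y \<noteq> 0" "y \<in> {0..1}"
            then have y: "0 < y" "y \<le> 1" by auto
            have "(1 - y) powr (1 - \<gamma>) \<le> 1" using y g by (intro powr_le1) auto
            moreover have "1 - y \<le> (1 - y) powr (1 - \<gamma>)"
            proof (cases "y = 1")
              case False
              then have "(1 - y) powr 1 \<le> (1 - y) powr (1 - \<gamma>)" using y g by (intro powr_mono') auto
              then show ?thesis using y by simp
            qed simp
            ultimately have "\<bar>(1 - y) powr (1 - \<gamma>) - 1\<bar> \<le> y" by simp
            then have "norm (F y) \<le> y powr (\<rho> - \<gamma>) * y" unfolding F_def by (simp add: abs_mult mult_left_mono)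
            also have "\<dots> = y powr (\<rho> - \<gamma> + 1)" using y by (simp add: powr_add)
            finally show "norm (F y) \<le> y powr (\<rho> - \<gamma> + 1)" .
          qed
        qed
        moreover have "F 0 = 0" by (simp add: F_def)
        ultimately show ?thesis unfolding continuous_within True by simp
      next
        case False
        then show ?thesis using x g unfolding F_def continuous_within
          by (intro tendsto_mult tendsto_diff tendsto_const tendsto_powr' tendsto_ident_at) (auto simp: eventually_at_filter)
      qed
    qed
    fix x :: real assume x: "x \<in> {0<..<1}"
    have "(F has_real_derivative F' x) (at x)"
      unfolding F_def[abs_def] F'_def b_def using x
      by (auto intro!: derivative_eq_intros simp: algebra_simps)
    then show "(F has_vector_derivative F' x) (at x)"
      by (simp add: has_real_derivative_iff_has_vector_derivative)
  qed simp
  then have Fi: "(F' has_integral - 1) {0..1}" using g by (simp add: F_def)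
  have "((\<lambda>y. (1 / (\<rho> - \<gamma>)) * F' y + ((1 - \<gamma>) / (\<rho> - \<gamma>) + (1 - \<gamma>) / \<gamma>) * b y)
     has_integral (1 / (\<rho> - \<gamma>)) * (- 1) + ((1 - \<gamma>) / (\<rho> - \<gamma>) + (1 - \<gamma>) / \<gamma>) * B) {0..1}"
    by (intro has_integral_add has_integral_mult_right Fi Bi)
  moreover have "(1 / (\<rho> - \<gamma>)) * (- 1) + ((1 - \<gamma>) / (\<rho> - \<gamma>) + (1 - \<gamma>) / \<gamma>) * B = (1 - \<rho> * B * ((1 - \<gamma>) / \<gamma>)) / (\<gamma> - \<rho>)"
  proof -
    have "(1 / (\<rho> - \<gamma>)) * (- 1) = 1 / (\<gamma> - \<rho>)" using r by (simp add: field_simps)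
    moreover have "(1 - \<gamma>) / (\<rho> - \<gamma>) + (1 - \<gamma>) / \<gamma> = - (\<rho> * ((1 - \<gamma>) / \<gamma>)) / (\<gamma> - \<rho>)"
    proof -
      have "\<rho> - \<gamma> \<noteq> 0" "\<gamma> \<noteq> 0" "\<gamma> - \<rho> \<noteq> 0" using r g by auto
      then show ?thesis by (simp add: divide_simps) algebra
    qed
    ultimately show ?thesis by (simp add: diff_divide_distrib mult_ac)
  qed
  ultimately have "((\<lambda>y. (1 / (\<rho> - \<gamma>)) * F' y + ((1 - \<gamma>) / (\<rho> - \<gamma>) + (1 - \<gamma>) / \<gamma>) * b y)
     has_integral (1 - \<rho> * B * ((1 - \<gamma>) / \<gamma>)) / (\<gamma> - \<rho>)) {0..1}" by simp
  then have "((\<lambda>y. (1 / (\<rho> - \<gamma>)) * F' y + ((1 - \<gamma>) / (\<rho> - \<gamma>) + (1 - \<gamma>) / \<gamma>) * b y)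
     has_integral (1 - \<rho> * B * ((1 - \<gamma>) / \<gamma>)) / (\<gamma> - \<rho>)) {0<..<1}"
    by (simp add: has_integral_Icc_iff_Ioo)
  then have "((\<lambda>y. (y * (1 - y)) powr (- \<gamma>) * ((1 - (1 - y) powr \<gamma>) / y - (2 * \<gamma> - 1) / \<gamma>) * y powr \<rho>)
    has_integral (1 - \<rho> * B * ((1 - \<gamma>) / \<gamma>)) / (\<gamma> - \<rho>)) {0<..<1}"
  proof (rule has_integral_eq[rotated])
    fix y :: real assume "y \<in> {0<..<1}"
    then have y: "0 < y" "y < 1" by auto
    define p where "p = y powr (\<rho> - \<gamma> - 1)"
    define q where "q = (1 - y) powr (- \<gamma>)"
    have q1: "(1 - y) powr (1 - \<gamma>) = (1 - y) * q" using y by (simp add: q_def powr_diff powr_minus_divide)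
    have p1: "y powr (\<rho> - \<gamma>) = y * p" using y by (simp add: p_def powr_diff)
    have F'e: "F' y = (\<rho> - \<gamma>) * (p * ((1 - y) * q - 1)) - (1 - \<gamma>) * (y * p * q)"
      unfolding F'_def b_def q1 p1 p_def[symmetric] q_def[symmetric] ..
    have ce: "c0 * (c1 * (p * Z) - c2 * Y) = p * Z - (c0 * c2) * Y" if "c0 * c1 = 1" for c0 c1 c2 Z Y :: real
      using that by (simp add: algebra_simps)
    have "(1 / (\<rho> - \<gamma>)) * F' y = p * ((1 - y) * q - 1) - ((1 / (\<rho> - \<gamma>)) * (1 - \<gamma>)) * (y * p * q)"
      unfolding F'e using r by (intro ce) auto
    then have "(1 / (\<rho> - \<gamma>)) * F' y + ((1 - \<gamma>) / (\<rho> - \<gamma>) + (1 - \<gamma>) / \<gamma>) * b y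
      = p * ((1 - y) * q - 1) + ((1 - \<gamma>) / \<gamma>) * (y * p * q)"
      unfolding b_def p1 q_def[symmetric] by (simp add: algebra_simps)
    moreover have "(y * (1 - y)) powr (- \<gamma>) * ((1 - (1 - y) powr \<gamma>) / y - (2 * \<gamma> - 1) / \<gamma>) * y powr \<rho>
      = p * (q - 1) - (2 * \<gamma> - 1) / \<gamma> * (y * p * q)"
    proof -
      have a: "(y * (1 - y)) powr (- \<gamma>) * y powr \<rho> = y * p * q"
        using y by (simp add: powr_mult p1[symmetric] q_def powr_diff powr_minus_divide)
      have bq: "q * (1 - y) powr \<gamma> = 1" using y by (simp add: q_def powr_add[symmetric])
      have "(y * (1 - y)) powr (- \<gamma>) * ((1 - (1 - y) powr \<gamma>) / y - (2 * \<gamma> - 1) / \<gamma>) * y powr \<rho>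
        = ((y * (1 - y)) powr (- \<gamma>) * y powr \<rho>) * ((1 - (1 - y) powr \<gamma>) / y - (2 * \<gamma> - 1) / \<gamma>)"
        by (simp only: mult_ac)
      also have "\<dots> = p * (q - q * (1 - y) powr \<gamma>) - (2 * \<gamma> - 1) / \<gamma> * (y * p * q)"
      proof -
        have c: "(y * p * q) * ((1 - X) / y) = p * (q - q * X)" for X
        proof -
          have "(y * p * q) * ((1 - X) / y) = p * q * (1 - X)" using y by (simp add: mult.assoc)
          then show ?thesis by (simp add: algebra_simps)
        qed
        show ?thesis unfolding a right_diff_distrib[of "y * p * q"] c by (simp only: mult.commute)
      qed
      finally show ?thesis unfolding bq .
    qed
    moreover have "(1 - \<gamma>) / \<gamma> = 1 - (2 * \<gamma> - 1) / \<gamma>" using g by (simp add: field_simps)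
    moreover have "p * ((1 - y) * q - 1) + (1 - z) * (y * p * q) = p * (q - 1) - z * (y * p * q)" for z
      by (simp add: algebra_simps)
    ultimately show "(1 / (\<rho> - \<gamma>)) * F' y + ((1 - \<gamma>) / (\<rho> - \<gamma>) + (1 - \<gamma>) / \<gamma>) * b y
      = (y * (1 - y)) powr (- \<gamma>) * ((1 - (1 - y) powr \<gamma>) / y - (2 * \<gamma> - 1) / \<gamma>) * y powr \<rho>"
      by (simp only:)
  qed
  then show ?thesis unfolding B_def by (simp add: has_integral_Icc_iff_Ioo)
qed

subsection \<open>Discrete moment sequences\<close>

text \<open>Not an orthogonalisation: after each multiplication by \<open>X\<close> only the
  component along the constants is removed. The removed means are the coefficients of the renewal
  equation.\<close>

primrec centred_powers :: "'a measure \<Rightarrow> ('a \<Rightarrow> real) \<Rightarrow> nat \<Rightarrow> 'a \<Rightarrow> real" where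
  "centred_powers M X 0 = (\<lambda>_. 1)"
| "centred_powers M X (Suc n) =
     (\<lambda>w. X w * centred_powers M X n w - (\<integral>z. X z * centred_powers M X n z \<partial>M) / measure M (space M))"

text \<open>In the renewal equation of a Hausdorff moment sequence the coefficients \<open>f\<close> are
  \<open>\<parallel>v\<^sub>i\<parallel>\<^sup>2\<close> and \<open>\<langle>v\<^sub>i, X v\<^sub>i\<rangle>\<close> alternately, where \<open>v\<^sub>i\<close> are the centred powers;
  so they decrease because \<open>0 \<le> X \<le> 1\<close>.\<close>
lemma moment_sequence_renewal:
  fixes X :: "'a \<Rightarrow> real"
  assumes "finite_measure M" and [measurable]: "X \<in> borel_measurable M"
    and X01: "\<And>w. w \<in> space M \<Longrightarrow> 0 \<le> X w \<and> X w \<le> 1" and pos: "measure M (space M) > 0"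
  shows "\<exists>f. (\<forall>n. 0 \<le> f n) \<and> (\<forall>n. f (Suc n) \<le> f n) \<and>
    (\<forall>n. (\<integral>w. X w ^ Suc n \<partial>M) = (\<Sum>k\<le>n. f k * (\<integral>w. X w ^ (n - k) \<partial>M)))"
proof -
  interpret finite_measure M by fact
  define v where "v = centred_powers M X"
  define s where "s = measure M (space M)"
  define f where "f n = (\<integral>z. X z * v n z \<partial>M) / s" for n
  have s: "s > 0" using pos by (simp add: s_def)
  have v0: "v 0 w = 1" for w by (simp add: v_def)
  have vS: "v (Suc n) w = X w * v n w - f n" for n w by (simp add: v_def f_def s_def)
  have vm [measurable]: "v n \<in> borel_measurable M" for n
  proof (induction n)
    case 0 then show ?case by (simp add: v_def)
  next
    case (Suc n)
    have "v (Suc n) = (\<lambda>w. X w * v n w - f n)" using vS by auto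
    then show ?case using Suc by simp
  qed
  have vb: "\<exists>B. \<forall>w\<in>space M. \<bar>v n w\<bar> \<le> B" for n
  proof (induction n)
    case 0 then show ?case by (auto simp: v0)
  next
    case (Suc n)
    then obtain B where B: "\<And>w. w \<in> space M \<Longrightarrow> \<bar>v n w\<bar> \<le> B" by blast
    have "\<bar>v (Suc n) w\<bar> \<le> B + \<bar>f n\<bar>" if w: "w \<in> space M" for w
    proof -
      have "\<bar>X w * v n w\<bar> \<le> 1 * B" unfolding abs_mult using X01[OF w] B[OF w] by (intro mult_mono) auto
      then show ?thesis unfolding vS by linarith
    qed
    then show ?case by blast
  qed
  have int: "integrable M (\<lambda>w. X w ^ k * (v i w * v j w))" for i j k
  proof -
    obtain B where B: "\<And>w. w \<in> space M \<Longrightarrow> \<bar>v i w\<bar> \<le> B" using vb by blast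
    obtain B' where B': "\<And>w. w \<in> space M \<Longrightarrow> \<bar>v j w\<bar> \<le> B'" using vb by blast
    show ?thesis
    proof (rule integrable_const_bound[where B="1 * (B * B')"])
      show "AE w in M. norm (X w ^ k * (v i w * v j w)) \<le> 1 * (B * B')"
      proof (rule AE_I2)
        fix w assume w: "w \<in> space M"
        have p1: "\<bar>v i w\<bar> * \<bar>v j w\<bar> \<le> B * B'"
          using B[OF w] B'[OF w] order_trans[OF abs_ge_zero B[OF w]] by (intro mult_mono) auto
        have p2: "\<bar>X w ^ k\<bar> \<le> 1" using X01[OF w] by (simp add: power_le_one power_abs)
        show "norm (X w ^ k * (v i w * v j w)) \<le> 1 * (B * B')"
          using mult_mono[OF p2 p1] by (simp add: abs_mult)
      qed
    qed measurable
  qed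
  have i0: "integrable M (\<lambda>w. v i w * v j w)" for i j using int[of 0 i j] by simp
  have i1: "integrable M (\<lambda>w. X w * (v i w * v j w))" for i j using int[of 1 i j] by simp
  have iv: "integrable M (\<lambda>w. v i w)" for i using i0[of i 0] by (simp add: v0)
  have iXv: "integrable M (\<lambda>w. X w * v i w)" for i using i1[of i 0] by (simp add: v0)
  have iX: "integrable M (\<lambda>w. X w ^ k)" for k using int[of k 0 0] by (simp add: v0)
  have sf: "(\<integral>w. X w * v n w \<partial>M) = s * f n" for n using s by (simp add: f_def)
  have mean0: "(\<integral>w. v (Suc n) w \<partial>M) = 0" for n
    unfolding vS by (subst Bochner_Integration.integral_diff) (auto simp: iXv sf s_def)
  \<comment> \<open>The constant subtracted in \<open>v (Suc i)\<close> is invisible against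
    \<open>v (Suc j)\<close>, which has mean 0.\<close>
  have shift: "(\<integral>w. v (Suc i) w * v (Suc j) w \<partial>M) = (\<integral>w. X w * (v i w * v (Suc j) w) \<partial>M)" for i j
  proof -
    have "(\<integral>w. v (Suc i) w * v (Suc j) w \<partial>M) = (\<integral>w. X w * (v i w * v (Suc j) w) - f i * v (Suc j) w \<partial>M)"
      by (intro Bochner_Integration.integral_cong refl) (simp add: vS[of i] algebra_simps)
    also have "\<dots> = (\<integral>w. X w * (v i w * v (Suc j) w) \<partial>M) - f i * (\<integral>w. v (Suc j) w \<partial>M)"
      by (subst Bochner_Integration.integral_diff) (auto simp: i1 iv)
    finally show ?thesis by (simp add: mean0)
  qed
  \<comment> \<open>Multiplication by \<open>X\<close> is symmetric, so factors can be moved from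
    one side to the other: the inner products form a Hankel matrix, which depends on
    \<open>i + j\<close> only.\<close>
  have cross: "(\<integral>w. v (Suc i) w * v (Suc j) w \<partial>M) = s * f (Suc (i + j))" for i j
  proof (induction i arbitrary: j)
    case 0
    show ?case using shift[of 0 j] by (simp add: v0 sf)
  next
    case (Suc i)
    have "(\<integral>w. v (Suc (Suc i)) w * v (Suc j) w \<partial>M) = (\<integral>w. X w * (v (Suc i) w * v (Suc j) w) \<partial>M)"
      by (rule shift)
    also have "\<dots> = (\<integral>w. X w * (v (Suc j) w * v (Suc i) w) \<partial>M)"
      by (intro Bochner_Integration.integral_cong refl) (simp add: mult_ac)
    also have "\<dots> = (\<integral>w. v (Suc (Suc j)) w * v (Suc i) w \<partial>M)" by (rule shift[symmetric])
    also have "\<dots> = (\<integral>w. v (Suc i) w * v (Suc (Suc j)) w \<partial>M)"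
      by (intro Bochner_Integration.integral_cong refl) (simp add: mult_ac)
    also have "\<dots> = s * f (Suc (i + Suc j))" by (rule Suc.IH)
    finally show ?case by simp
  qed
  have odd: "s * f (Suc (2 * i)) = (\<integral>w. v (Suc i) w * v (Suc i) w \<partial>M)" for i
    using cross[of i i] by (simp add: mult_2)
  have even: "s * f (2 * i) = (\<integral>w. X w * (v i w * v i w) \<partial>M)" for i
  proof (cases i)
    case 0
    then show ?thesis using sf[of 0] by (simp add: v0)
  next
    case (Suc j)
    have "(\<integral>w. X w * (v (Suc j) w * v (Suc j) w) \<partial>M) = (\<integral>w. v (Suc (Suc j)) w * v (Suc j) w \<partial>M)"
      by (rule shift[symmetric])
    also have "\<dots> = s * f (Suc (Suc j + j))" by (rule cross)
    finally show ?thesis using Suc by (simp add: mult_2)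
  qed
  have odd_le_even: "s * f (Suc (2 * i)) \<le> s * f (2 * i)" for i
  proof -
    \<comment> \<open>Centring \<open>X * v i\<close> lowers its squared norm by
      \<open>s * (f i)\<^sup>2\<close>; after dropping this, \<open>X ^ 2 \<le> X\<close> compares
      with the even coefficient.\<close>
    have "s * f (Suc (2 * i)) = (\<integral>w. X w ^ 2 * (v i w * v i w) - 2 * f i * (X w * v i w) + (f i)\<^sup>2 \<partial>M)"
      unfolding odd by (intro Bochner_Integration.integral_cong refl) (simp add: vS power2_eq_square algebra_simps)
    also have "\<dots> = (\<integral>w. X w ^ 2 * (v i w * v i w) \<partial>M) - 2 * f i * (s * f i) + (f i)\<^sup>2 * s"
      by (simp add: int iXv sf flip: s_def)
    also have "\<dots> = (\<integral>w. X w ^ 2 * (v i w * v i w) \<partial>M) - s * (f i)\<^sup>2" by (simp add: power2_eq_square)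
    also have "\<dots> \<le> (\<integral>w. X w ^ 2 * (v i w * v i w) \<partial>M)" using s by simp
    also have "\<dots> \<le> (\<integral>w. X w * (v i w * v i w) \<partial>M)"
    proof (rule integral_mono[OF int i1])
      fix w assume w: "w \<in> space M"
      have "X w ^ 2 \<le> X w" using X01[OF w] by (simp add: power2_eq_square mult_left_le)
      then show "X w ^ 2 * (v i w * v i w) \<le> X w * (v i w * v i w)" by (intro mult_right_mono) auto
    qed
    finally show ?thesis unfolding even .
  qed
  have even_le_odd: "s * f (2 * Suc i) \<le> s * f (Suc (2 * i))" for i
    unfolding even odd
  proof (rule integral_mono[OF i1 i0])
    fix w assume w: "w \<in> space M"
    have "X w * (v (Suc i) w * v (Suc i) w) \<le> 1 * (v (Suc i) w * v (Suc i) w)"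
      using X01[OF w] by (intro mult_right_mono) auto
    then show "X w * (v (Suc i) w * v (Suc i) w) \<le> v (Suc i) w * v (Suc i) w" by simp
  qed
  have nonneg: "0 \<le> f n" for n
  proof -
    have "0 \<le> s * f n"
    proof (cases "even n")
      case True
      then obtain i where "n = 2 * i" by (elim evenE)
      then show ?thesis using even[of i] X01 by (auto intro!: integral_nonneg_AE AE_I2)
    next
      case False
      then obtain i where "n = Suc (2 * i)" by (elim oddE) auto
      then show ?thesis using odd[of i] by (auto intro!: integral_nonneg_AE AE_I2)
    qed
    then show ?thesis using s by (simp add: zero_le_mult_iff)
  qed
  have decr: "f (Suc n) \<le> f n" for n
  proof -
    have "s * f (Suc n) \<le> s * f n"
    proof (cases "even n")
      case True
      then obtain i where "n = 2 * i" by (elim evenE)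
      then show ?thesis using odd_le_even[of i] by simp
    next
      case False
      then obtain i where "n = Suc (2 * i)" by (elim oddE) auto
      then show ?thesis using even_le_odd[of i] by simp
    qed
    then show ?thesis using s by simp
  qed
  \<comment> \<open>The recursion of \<open>v\<close> unfolded; integrating removes
    \<open>v (Suc n)\<close>, which has mean 0, and leaves the renewal equation.\<close>
  have expand: "X w ^ Suc n = v (Suc n) w + (\<Sum>k\<le>n. f k * X w ^ (n - k))" for n w
  proof (induction n)
    case 0
    show ?case using vS[of 0 w] by (simp add: v0)
  next
    case (Suc n)
    have "X w ^ Suc (Suc n) = X w * (v (Suc n) w + (\<Sum>k\<le>n. f k * X w ^ (n - k)))"
      using Suc by simp
    also have "\<dots> = v (Suc (Suc n)) w + f (Suc n) + (\<Sum>k\<le>n. f k * X w ^ (Suc n - k))"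
      unfolding vS[of "Suc n"] by (simp add: distrib_left sum_distrib_left Suc_diff_le mult_ac)
    finally show ?case by simp
  qed
  have "(\<integral>w. X w ^ Suc n \<partial>M) = (\<Sum>k\<le>n. f k * (\<integral>w. X w ^ (n - k) \<partial>M))" for n
  proof -
    have "(\<integral>w. X w ^ Suc n \<partial>M) = (\<integral>w. v (Suc n) w \<partial>M) + (\<integral>w. (\<Sum>k\<le>n. f k * X w ^ (n - k)) \<partial>M)"
      unfolding expand by (rule Bochner_Integration.integral_add) (auto intro!: iv integrable_sum iX)
    then show ?thesis unfolding mean0 by (subst (asm) Bochner_Integration.integral_sum) (auto intro!: iX)
  qed
  with nonneg decr show ?thesis by blast
qed

text \<open>The inverse is the renewal tail \<open>q n\<close>, the mass 1 minus the first
  \<open>n\<close> coefficients. Its decrements are the \<open>f n\<close>, so the sign and the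
  monotonicity of \<open>f\<close> are the monotonicity and the convexity of \<open>q\<close>;
  summation by parts turns the renewal equation into a convolution with constant value
  \<open>s\<close>. Nonnegativity of \<open>q\<close> is where the decay of the moments
  enters.\<close>

lemma moment_sequence_inverse:
  fixes X :: "'a \<Rightarrow> real"
  assumes fin: "finite_measure M" and X: "X \<in> borel_measurable M"
    and X01: "\<And>w. w \<in> space M \<Longrightarrow> 0 \<le> X w \<and> X w \<le> 1" and pos: "measure M (space M) > 0"
    and lim: "(\<lambda>n. \<integral>w. X w ^ n \<partial>M) \<longlonglongrightarrow> 0"
  shows "\<exists>r. (\<forall>n. 0 \<le> r n) \<and> (\<forall>n. r (Suc n) \<le> r n) \<and> (\<forall>n. r (Suc n) - r (Suc (Suc n)) \<le> r n - r (Suc n)) \<and>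
    (\<forall>n. (\<Sum>j\<le>n. r j * (\<integral>w. X w ^ (n - j) \<partial>M)) = 1)"
proof -
  interpret finite_measure M by fact
  define s where "s = measure M (space M)"
  define u where "u n = (\<integral>w. X w ^ n \<partial>M)" for n
  have u0: "u 0 = s" by (simp add: u_def s_def)
  have s: "s > 0" using pos by (simp add: s_def)
  have unn: "0 \<le> u n" for n unfolding u_def using X01 by (auto intro!: integral_nonneg_AE AE_I2)
  obtain f where f: "\<And>n. 0 \<le> f n" "\<And>n. f (Suc n) \<le> f n" "\<And>n. u (Suc n) = (\<Sum>k\<le>n. f k * u (n - k))"
    using moment_sequence_renewal[OF fin X X01 pos] unfolding u_def by blast
  define q where "q n = 1 - (\<Sum>k<n. f k)" for n
  have qS: "q (Suc n) = q n - f n" for n by (simp add: q_def)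
  have conv: "(\<Sum>j\<le>n. q j * u (n - j)) = s" for n
  proof (induction n)
    case 0 then show ?case by (simp add: q_def u0)
  next
    case (Suc n)
    have "(\<Sum>j\<le>Suc n. q j * u (Suc n - j)) = q 0 * u (Suc n) + (\<Sum>j\<le>n. q (Suc j) * u (n - j))"
      by (subst sum.atMost_Suc_shift) simp
    also have "\<dots> = u (Suc n) + ((\<Sum>j\<le>n. q j * u (n - j)) - (\<Sum>j\<le>n. f j * u (n - j)))"
      unfolding qS by (simp add: left_diff_distrib sum_subtractf q_def[of 0])
    finally show ?case using Suc f(3)[of n] by simp
  qed
  have qdec: "q n \<le> q m" if "m \<le> n" for m n
    using that by (rule lift_Suc_antimono_le[rotated]) (simp add: qS f)
  have qnn: "0 \<le> q k" for k
  proof (rule ccontr)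
    assume "\<not> 0 \<le> q k"
    \<comment> \<open>A negative \<open>q k\<close> would stay negative. The constant convolution
      would then be carried by the finitely many terms \<open>j < k\<close>, whose moments tend to 0
      as \<open>n\<close> grows.\<close>
    then have neg: "q n < 0" if "k \<le> n" for n using qdec[OF that] by simp
    have le: "s \<le> (\<Sum>j<k. q j * u (n - j))" if n: "n \<ge> k" for n
    proof -
      have "s = (\<Sum>j\<in>{..<k} \<union> {k..n}. q j * u (n - j))"
        using n by (subst conv[of n, symmetric], intro sum.cong) auto
      also have "\<dots> = (\<Sum>j<k. q j * u (n - j)) + (\<Sum>j\<in>{k..n}. q j * u (n - j))"
        by (intro sum.union_disjoint) auto
      also have "(\<Sum>j\<in>{k..n}. q j * u (n - j)) \<le> 0"
        using neg unn by (intro sum_nonpos mult_nonpos_nonneg) (auto intro: less_imp_le)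
      finally show ?thesis by simp
    qed
    have "(\<lambda>n. \<Sum>j<k. q j * u (n - j)) \<longlonglongrightarrow> (\<Sum>j<k. q j * 0)"
    proof (intro tendsto_sum tendsto_mult tendsto_const)
      fix j
      have "(\<lambda>n. u ((n + j) - j)) \<longlonglongrightarrow> 0" using lim by (simp add: u_def)
      then show "(\<lambda>n. u (n - j)) \<longlonglongrightarrow> 0" by (rule LIMSEQ_offset)
    qed
    then have "s \<le> (\<Sum>j<k. q j * 0)"
      by (rule tendsto_lowerbound) (auto intro!: eventually_sequentiallyI[of k] le)
    then show False using s by simp
  qed
  show ?thesis
  proof (intro exI[of _ "\<lambda>n. q n / s"] conjI allI)
    fix n
    show "0 \<le> q n / s" using qnn s by simp
    show "q (Suc n) / s \<le> q n / s" using s f by (simp add: qS divide_right_mono)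
    show "q (Suc n) / s - q (Suc (Suc n)) / s \<le> q n / s - q (Suc n) / s"
      unfolding diff_divide_distrib[symmetric] using s f by (intro divide_right_mono) (auto simp: qS)
    have "(\<Sum>j\<le>n. q j / s * u (n - j)) = (\<Sum>j\<le>n. q j * u (n - j)) / s"
      by (simp add: sum_divide_distrib)
    then show "(\<Sum>j\<le>n. q j / s * (\<integral>w. X w ^ (n - j) \<partial>M)) = 1" using conv[of n] s by (simp add: u_def)
  qed
qed

subsection \<open>Convergence of Laplace transforms\<close>

text \<open>The hypothesis is convergence of all moments in the variable \<open>exp (- t)\<close>,
  which lives in the unit interval. Weierstrass approximation extends it from polynomials to
  continuous test functions, the total masses being bounded by the case
  \<open>k = 0\<close>.\<close>

lemma laplace_test_convergence:
  fixes f :: "nat \<Rightarrow> real \<Rightarrow> real" and g \<phi> :: "real \<Rightarrow> real"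
  assumes fi: "\<And>n. set_integrable lborel {0<..} (\<lambda>t. exp (- t) * f n t)"
    and nn: "\<And>n t. t > 0 \<Longrightarrow> 0 \<le> f n t"
    and gi: "set_integrable lborel {0<..} (\<lambda>t. exp (- t) * g t)"
    and lim: "\<And>k::nat. (\<lambda>n. LINT t:{0<..}|lborel. exp (- t) ^ k * (exp (- t) * f n t))
      \<longlonglongrightarrow> (LINT t:{0<..}|lborel. exp (- t) ^ k * (exp (- t) * g t))"
    and cont: "continuous_on {0..1} \<phi>"
  shows "(\<lambda>n. LINT t:{0<..}|lborel. \<phi> (exp (- t)) * (exp (- t) * f n t))
      \<longlonglongrightarrow> (LINT t:{0<..}|lborel. \<phi> (exp (- t)) * (exp (- t) * g t))"
proof -
  define I where "I F n = (LINT t:{0<..}|lborel. F (exp (- t)) * (exp (- t) * f n t))" for F :: "real \<Rightarrow> real" and n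
  define J where "J F = (LINT t:{0<..}|lborel. F (exp (- t)) * (exp (- t) * g t))" for F :: "real \<Rightarrow> real"
  have mult_int: "set_integrable lborel {0<..} (\<lambda>t. F (exp (- t)) * (exp (- t) * h t))"
    if hi: "set_integrable lborel {0<..} (\<lambda>t. exp (- t) * h t)" and F: "continuous_on {0..1} F" for h F :: "real \<Rightarrow> real"
  proof -
    have "bounded (F ` {0..1})" using F by (intro compact_imp_bounded compact_continuous_image) auto
    then obtain B where B0: "\<forall>x\<in>{0..1}. \<bar>F x\<bar> \<le> B" by (auto simp: bounded_iff)
    have B: "\<bar>F x\<bar> \<le> B" if "x \<in> {0..1}" for x using B0 that by blast
    have Fm: "(\<lambda>t. indicator {0<..} t *\<^sub>R F (exp (- t))) \<in> borel_measurable lborel"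
    proof -
      have "continuous_on {0<..} (\<lambda>t. F (exp (- t)))"
        by (rule continuous_on_compose2[OF F]) (auto intro!: continuous_intros)
      from borel_measurable_continuous_on_indicator[OF _ this] show ?thesis by simp
    qed
    show ?thesis
    proof (rule set_integrable_bound[OF set_integrable_mult_right[OF hi, of B]])
      have "(\<lambda>t. (indicator {0<..} t *\<^sub>R F (exp (- t))) * (indicator {0<..} t *\<^sub>R (exp (- t) * h t))) \<in> borel_measurable lborel"
        by (intro borel_measurable_times Fm set_integrable_measurable[OF hi])
      moreover have "(\<lambda>t. (indicator {0<..} t *\<^sub>R F (exp (- t))) * (indicator {0<..} t *\<^sub>R (exp (- t) * h t)))
         = (\<lambda>t. indicator {0<..} t *\<^sub>R (F (exp (- t)) * (exp (- t) * h t)))"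
        by (auto split: split_indicator)
      ultimately show "set_borel_measurable lborel {0<..} (\<lambda>t. F (exp (- t)) * (exp (- t) * h t))"
        unfolding set_borel_measurable_def by simp
      show "AE t in lborel. t \<in> {0<..} \<longrightarrow> norm (F (exp (- t)) * (exp (- t) * h t)) \<le> norm (B * (exp (- t) * h t))"
        by (intro AE_I2 impI) (auto simp: abs_mult intro!: mult_right_mono order_trans[OF B abs_ge_self])
    qed
  qed
  have bound: "\<bar>(LINT t:{0<..}|lborel. F (exp (- t)) * (exp (- t) * h t)) - (LINT t:{0<..}|lborel. G (exp (- t)) * (exp (- t) * h t))\<bar>
      \<le> e * (LINT t:{0<..}|lborel. \<bar>exp (- t) * h t\<bar>)"
    if hi: "set_integrable lborel {0<..} (\<lambda>t. exp (- t) * h t)" and F: "continuous_on {0..1} F" and G: "continuous_on {0..1} G"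
      and d: "\<And>x. x \<in> {0..1} \<Longrightarrow> \<bar>F x - G x\<bar> \<le> e" for h F G :: "real \<Rightarrow> real" and e
  proof -
    have d1: "set_integrable lborel {0<..} (\<lambda>t. F (exp (- t)) * (exp (- t) * h t))"
      and d2: "set_integrable lborel {0<..} (\<lambda>t. G (exp (- t)) * (exp (- t) * h t))"
      by (rule mult_int[OF hi F], rule mult_int[OF hi G])
    have eq: "(LINT t:{0<..}|lborel. F (exp (- t)) * (exp (- t) * h t)) - (LINT t:{0<..}|lborel. G (exp (- t)) * (exp (- t) * h t))
      = (LINT t:{0<..}|lborel. F (exp (- t)) * (exp (- t) * h t) - G (exp (- t)) * (exp (- t) * h t))"
      by (rule set_integral_diff(2)[symmetric]) (rule d1, rule d2)
    have "\<bar>(LINT t:{0<..}|lborel. F (exp (- t)) * (exp (- t) * h t)) - (LINT t:{0<..}|lborel. G (exp (- t)) * (exp (- t) * h t))\<bar> \<le> (LINT t:{0<..}|lborel. norm (F (exp (- t)) * (exp (- t) * h t) - G (exp (- t)) * (exp (- t) * h t)))"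
      unfolding eq using set_integral_norm_bound[OF set_integral_diff(1)[OF d1 d2]] by simp
    also have "\<dots> \<le> (LINT t:{0<..}|lborel. e * \<bar>exp (- t) * h t\<bar>)"
    proof (rule set_integral_mono)
      show "set_integrable lborel {0<..} (\<lambda>t. norm (F (exp (- t)) * (exp (- t) * h t) - G (exp (- t)) * (exp (- t) * h t)))"
        by (rule set_integrable_norm, rule set_integral_diff(1), rule d1, rule d2)
      show "set_integrable lborel {0<..} (\<lambda>t. e * \<bar>exp (- t) * h t\<bar>)"
        using set_integrable_mult_right[OF set_integrable_norm[OF hi], of e] unfolding real_norm_def .
      fix t :: real assume "t \<in> {0<..}"
      then have "\<bar>F (exp (- t)) - G (exp (- t))\<bar> \<le> e" by (intro d) auto
      then show "norm (F (exp (- t)) * (exp (- t) * h t) - G (exp (- t)) * (exp (- t) * h t)) \<le> e * \<bar>exp (- t) * h t\<bar>"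
        unfolding left_diff_distrib[symmetric] real_norm_def abs_mult[of "F (exp (- t)) - G (exp (- t))"] by (intro mult_right_mono) auto
    qed
    finally show ?thesis by simp
  qed
  have poly: "I p \<longlonglongrightarrow> J p" if p: "real_polynomial_function p" for p
  proof -
    obtain a N where p: "p = (\<lambda>x. \<Sum>i\<le>N. a i * x ^ i)" using p by (auto simp: real_polynomial_function_iff_sum)
    have e: "(LINT t:{0<..}|lborel. p (exp (- t)) * (exp (- t) * h t)) = (\<Sum>i\<le>N. a i * (LINT t:{0<..}|lborel. exp (- t) ^ i * (exp (- t) * h t)))"
      if hi: "set_integrable lborel {0<..} (\<lambda>t. exp (- t) * h t)" for h :: "real \<Rightarrow> real"
    proof -
      have ii: "integrable lborel (\<lambda>t. indicator {0<..} t *\<^sub>R (exp (- t) ^ i * (exp (- t) * h t)))" for i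
        by (rule mult_int[OF hi, of "\<lambda>x. x ^ i", unfolded set_integrable_def]) (intro continuous_intros)
      have "(LINT t:{0<..}|lborel. p (exp (- t)) * (exp (- t) * h t))
        = (LINT t|lborel. (\<Sum>i\<le>N. a i * (indicator {0<..} t *\<^sub>R (exp (- t) ^ i * (exp (- t) * h t)))))"
        unfolding set_lebesgue_integral_def p
        by (intro Bochner_Integration.integral_cong refl) (simp add: sum_distrib_left sum_distrib_right mult_ac)
      also have "\<dots> = (\<Sum>i\<le>N. a i * (LINT t:{0<..}|lborel. exp (- t) ^ i * (exp (- t) * h t)))"
        using ii by (subst Bochner_Integration.integral_sum) (auto simp: set_lebesgue_integral_def)
      finally show ?thesis .
    qed
    have Ip: "I p n = (\<Sum>i\<le>N. a i * (LINT t:{0<..}|lborel. exp (- t) ^ i * (exp (- t) * f n t)))" for n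
      unfolding I_def by (rule e[OF fi])
    have Jp: "J p = (\<Sum>i\<le>N. a i * (LINT t:{0<..}|lborel. exp (- t) ^ i * (exp (- t) * g t)))"
      unfolding J_def by (rule e[OF gi])
    show ?thesis unfolding Ip[abs_def] Jp by (intro tendsto_intros lim)
  qed
  have one: "(\<lambda>n. LINT t:{0<..}|lborel. exp (- t) * f n t) \<longlonglongrightarrow> (LINT t:{0<..}|lborel. exp (- t) * g t)"
    using lim[of 0] by simp
  then have "Bseq (\<lambda>n. LINT t:{0<..}|lborel. exp (- t) * f n t)" by (intro convergent_imp_Bseq) (auto simp: convergent_def)
  then obtain K where K: "K > 0" "\<And>n. \<bar>LINT t:{0<..}|lborel. exp (- t) * f n t\<bar> \<le> K" by (auto simp: Bseq_def)
  have Kf: "(LINT t:{0<..}|lborel. \<bar>exp (- t) * f n t\<bar>) \<le> K" for n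
  proof -
    have "(LINT t:{0<..}|lborel. \<bar>exp (- t) * f n t\<bar>) = (LINT t:{0<..}|lborel. exp (- t) * f n t)"
      using nn by (intro set_lebesgue_integral_cong) auto
    then show ?thesis using K(2)[of n] by simp
  qed
  define L where "L = K + (LINT t:{0<..}|lborel. \<bar>exp (- t) * g t\<bar>)"
  have Lg: "0 \<le> (LINT t:{0<..}|lborel. \<bar>exp (- t) * g t\<bar>)"
    unfolding set_lebesgue_integral_def by (intro integral_nonneg_AE AE_I2) auto
  have L: "L > 0" using K Lg by (simp add: L_def)
  have "I \<phi> \<longlonglongrightarrow> J \<phi>"
  proof (rule LIMSEQ_I)
    fix e :: real assume e: "e > 0"
    \<comment> \<open>\<open>L\<close> adds a common bound for the masses of the \<open>f n\<close>
      to the mass of \<open>g\<close>, so an approximation within \<open>d\<close> costs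
      \<open>e / 2\<close> altogether.\<close>
    define d where "d = e / (2 * L)"
    have d: "d > 0" using e L by (simp add: d_def)
    obtain p where p: "real_polynomial_function p" "\<And>x. x \<in> {0..1} \<Longrightarrow> \<bar>\<phi> x - p x\<bar> < d"
      using Stone_Weierstrass_real_polynomial_function[OF compact_Icc cont d] by blast
    have pc: "continuous_on {0..1} p"
      using p(1) continuous_on_polymonial_function[of p] by (simp add: real_polynomial_function_eq)
    obtain N where N: "\<And>n. n \<ge> N \<Longrightarrow> norm (I p n - J p) < e / 2"
      using LIMSEQ_D[OF poly[OF p(1)], of "e/2"] e by auto
    show "\<exists>N. \<forall>n\<ge>N. norm (I \<phi> n - J \<phi>) < e"
    proof (intro exI allI impI)
      fix n assume n: "N \<le> n"
      have "\<bar>I \<phi> n - I p n\<bar> \<le> d * (LINT t:{0<..}|lborel. \<bar>exp (- t) * f n t\<bar>)"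
        unfolding I_def using p(2) by (intro bound fi cont pc) (auto intro: less_imp_le)
      also have "\<dots> \<le> d * K" using d Kf by (intro mult_left_mono) auto
      finally have 1: "\<bar>I \<phi> n - I p n\<bar> \<le> d * K" .
      have 2: "\<bar>J \<phi> - J p\<bar> \<le> d * (LINT t:{0<..}|lborel. \<bar>exp (- t) * g t\<bar>)"
        unfolding J_def using p(2) by (intro bound gi cont pc) (auto intro: less_imp_le)
      have "d * K + d * (LINT t:{0<..}|lborel. \<bar>exp (- t) * g t\<bar>) = e / 2"
        using L unfolding d_def distrib_left[symmetric] L_def[symmetric] by simp
      then show "norm (I \<phi> n - J \<phi>) < e" using 1 2 N[OF n] unfolding real_norm_def by linarith
    qed
  qed
  then show ?thesis unfolding I_def J_def .
qed

text \<open>Monotonicity upgrades the weak convergence to pointwise convergence.\<close>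
lemma laplace_pointwise_convergence:
  fixes f :: "nat \<Rightarrow> real \<Rightarrow> real" and g :: "real \<Rightarrow> real"
  assumes fi: "\<And>n. set_integrable lborel {0<..} (\<lambda>t. exp (- t) * f n t)"
    and nn: "\<And>n t. t > 0 \<Longrightarrow> 0 \<le> f n t"
    and mono: "\<And>n s t. 0 < s \<Longrightarrow> s \<le> t \<Longrightarrow> f n t \<le> f n s"
    and gi: "set_integrable lborel {0<..} (\<lambda>t. exp (- t) * g t)"
    and lim: "\<And>k::nat. (\<lambda>n. LINT t:{0<..}|lborel. exp (- t) ^ k * (exp (- t) * f n t))
      \<longlonglongrightarrow> (LINT t:{0<..}|lborel. exp (- t) ^ k * (exp (- t) * g t))"
    and x: "x > 0" and gc: "isCont g x"
  shows "(\<lambda>n. f n x) \<longlonglongrightarrow> g x"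
proof -
  have key: "\<exists>\<eta>. \<eta> \<in> borel_measurable borel \<and> (\<forall>t. 0 \<le> \<eta> t) \<and> (\<forall>t. t \<notin> {y - d<..<y + d} \<longrightarrow> \<eta> t = 0) \<and>
      set_integrable lborel {0<..} \<eta> \<and> (LINT t:{0<..}|lborel. \<eta> t) > 0 \<and>
      (\<forall>h. set_integrable lborel {0<..} (\<lambda>t. exp (- t) * h t) \<longrightarrow> set_integrable lborel {0<..} (\<lambda>t. \<eta> t * h t)) \<and>
      (\<lambda>n. LINT t:{0<..}|lborel. \<eta> t * f n t) \<longlonglongrightarrow> (LINT t:{0<..}|lborel. \<eta> t * g t)"
    if y: "0 < d" "d < y" for y d :: real
  proof -
    define \<eta> where "\<eta> t = max 0 (1 - \<bar>t - y\<bar> / d)" for t :: real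
    define m where "m = exp (- (y + d))"
    \<comment> \<open>Chosen so that \<open>\<phi> (exp (- t)) * exp (- t)\<close> is the tent
      \<open>\<eta> t\<close>. The cut at \<open>m\<close>, the image of the right end of the tent,
      keeps the logarithm continuous at 0 and changes nothing, since the tent vanishes from there
      on.\<close>
    define \<phi> where "\<phi> w = \<eta> (- ln (max m w)) / max m w" for w
    have m: "m > 0" by (simp add: m_def)
    have supp: "\<eta> t = 0" if "t \<notin> {y - d<..<y + d}" for t
      using that y by (auto simp: \<eta>_def max_def field_simps abs_if)
    have \<eta>c: "continuous_on UNIV \<eta>" unfolding \<eta>_def using y by (intro continuous_intros) auto
    have \<phi>c: "continuous_on {0..1} \<phi>"
      unfolding \<phi>_def using m by (intro continuous_intros continuous_on_compose2[OF \<eta>c]) (auto simp: max_def)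
    have \<phi>\<eta>: "\<phi> (exp (- t)) * exp (- t) = \<eta> t" for t
    proof (cases "t \<le> y + d")
      case True
      then have "max m (exp (- t)) = exp (- t)" by (simp add: m_def max_def)
      then show ?thesis by (simp add: \<phi>_def)
    next
      case False
      then have "max m (exp (- t)) = m" by (simp add: m_def max_def)
      moreover have "- ln m = y + d" by (simp add: m_def)
      ultimately show ?thesis using supp[of "y + d"] supp[of t] False by (simp add: \<phi>_def del: minus_add_distrib)
    qed
    have e: "\<phi> (exp (- t)) * (exp (- t) * h t) = \<eta> t * h t" for h t
      by (simp add: \<phi>\<eta>[symmetric])
    have L: "(\<lambda>n. LINT t:{0<..}|lborel. \<eta> t * f n t) \<longlonglongrightarrow> (LINT t:{0<..}|lborel. \<eta> t * g t)"
      using laplace_test_convergence[OF fi nn gi lim \<phi>c] unfolding e .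
    have \<eta>m [measurable]: "\<eta> \<in> borel_measurable borel" using \<eta>c by (rule borel_measurable_continuous_onI)
    have \<eta>1: "0 \<le> \<eta> t" "\<eta> t \<le> 1" for t using y by (auto simp: \<eta>_def)
    have \<eta>i: "set_integrable lborel {0<..} \<eta>"
    proof (rule set_integrable_bound)
      show "set_integrable lborel {0<..} (indicator {y - d..y + d} :: real \<Rightarrow> real)"
        unfolding set_integrable_def by (rule integrable_mult_indicator) (auto simp: integrable_indicator_iff emeasure_lborel_Icc_eq)
      show "AE t in lborel. t \<in> {0<..} \<longrightarrow> norm (\<eta> t) \<le> norm (indicator {y - d..y + d} t :: real)"
        using \<eta>1 supp by (intro AE_I2 impI) (auto split: split_indicator)
    qed (auto simp: set_borel_measurable_def)
    have pos: "(LINT t:{0<..}|lborel. \<eta> t) > 0"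
    proof -
      have "0 < d / 2" using y by simp
      also have "d / 2 = (LINT t|lborel. 1/2 * indicator {y - d/2..y + d/2} t)" using y by simp
      also have "\<dots> \<le> (LINT t:{0<..}|lborel. \<eta> t)"
        unfolding set_lebesgue_integral_def
      proof (rule integral_mono)
        show "integrable lborel (\<lambda>t. indicator {0<..} t *\<^sub>R \<eta> t)" using \<eta>i by (simp add: set_integrable_def)
        fix t :: real
        have "1/2 \<le> \<eta> t" if "t \<in> {y - d/2..y + d/2}"
        proof -
          have "\<bar>t - y\<bar> \<le> d / 2" using that by (auto simp: abs_if)
          then have "1 / 2 \<le> 1 - \<bar>t - y\<bar> / d" using y by (simp add: field_simps)
          then show ?thesis unfolding \<eta>_def le_max_iff_disj by blast
        qed
        then show "1/2 * indicator {y - d/2..y + d/2} t \<le> indicator {0<..} t *\<^sub>R \<eta> t"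
          using y \<eta>1 by (auto split: split_indicator)
      qed (auto simp: integrable_indicator_iff emeasure_lborel_Icc_eq)
      finally show ?thesis .
    qed
    have hi: "set_integrable lborel {0<..} (\<lambda>t. \<eta> t * h t)" if h: "set_integrable lborel {0<..} (\<lambda>t. exp (- t) * h t)" for h
    proof (rule set_integrable_bound[OF set_integrable_mult_right[OF h, of "exp (y + d)"]])
      have "(\<lambda>t. (\<eta> t * exp t) * (indicator {0<..} t *\<^sub>R (exp (- t) * h t))) \<in> borel_measurable lborel"
        by (intro borel_measurable_times set_integrable_measurable[OF h]) auto
      moreover have "(\<lambda>t. (\<eta> t * exp t) * (indicator {0<..} t *\<^sub>R (exp (- t) * h t))) = (\<lambda>t. indicator {0<..} t *\<^sub>R (\<eta> t * h t))"
        by (auto split: split_indicator simp: exp_minus)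
      ultimately show "set_borel_measurable lborel {0<..} (\<lambda>t. \<eta> t * h t)" unfolding set_borel_measurable_def by simp
      show "AE t in lborel. t \<in> {0<..} \<longrightarrow> norm (\<eta> t * h t) \<le> norm (exp (y + d) * (exp (- t) * h t))"
      proof (intro AE_I2 impI)
        fix t :: real
        have "\<eta> t \<le> exp (y + d) * exp (- t)"
        proof (cases "t \<le> y + d")
          case True
          then have "1 \<le> exp (y + d) * exp (- t)" by (simp add: exp_add[symmetric])
          then show ?thesis using \<eta>1[of t] by linarith
        next
          case False
          then show ?thesis using supp[of t] by simp
        qed
        then have "\<eta> t * \<bar>h t\<bar> \<le> exp (y + d) * exp (- t) * \<bar>h t\<bar>" by (intro mult_right_mono) auto
        then show "norm (\<eta> t * h t) \<le> norm (exp (y + d) * (exp (- t) * h t))" using \<eta>1[of t] by (simp add: abs_mult)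
      qed
    qed
    show ?thesis
      by (rule exI[of _ \<eta>]) (use \<eta>m \<eta>1 supp \<eta>i pos hi L in blast)
  qed
  show ?thesis
  proof (rule LIMSEQ_I)
    fix e :: real assume e: "e > 0"
    obtain r where r: "r > 0" "\<And>z. \<bar>z - x\<bar> < r \<Longrightarrow> \<bar>g z - g x\<bar> < e / 2"
      using gc e unfolding continuous_at_eps_delta dist_real_def by (metis half_gt_zero)
    \<comment> \<open>Both tents reach at most \<open>2 * d\<close> from \<open>x\<close>, which is
      inside the continuity radius \<open>r\<close> and keeps their supports positive.\<close>
    define d where "d = min r x / 4"
    have d: "d > 0" "2 * d < r" "2 * d < x" using r x by (auto simp: d_def)
    text \<open>Tents just to the right and just to the left of \<open>x\<close>.\<close>
    have upper: "eventually (\<lambda>n. g x - e < f n x) sequentially"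
    proof -
      obtain \<eta> where \<eta>: "\<And>t. 0 \<le> \<eta> t" "\<And>t. t \<notin> {x + d - d<..<x + d + d} \<Longrightarrow> \<eta> t = 0" "set_integrable lborel {0<..} \<eta>"
        "(LINT t:{0<..}|lborel. \<eta> t) > 0"
        "\<And>h. set_integrable lborel {0<..} (\<lambda>t. exp (- t) * h t) \<Longrightarrow> set_integrable lborel {0<..} (\<lambda>t. \<eta> t * h t)"
        "(\<lambda>n. LINT t:{0<..}|lborel. \<eta> t * f n t) \<longlonglongrightarrow> (LINT t:{0<..}|lborel. \<eta> t * g t)"
        using key[of d "x + d"] d x by auto
      let ?A = "LINT t:{0<..}|lborel. \<eta> t"
      have "(g x - e) * ?A < (g x - e/2) * ?A" using \<eta>(4) e by simp
      also have "\<dots> = (LINT t:{0<..}|lborel. \<eta> t * (g x - e/2))" by simp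
      also have "\<dots> \<le> (LINT t:{0<..}|lborel. \<eta> t * g t)"
      proof (rule set_integral_mono)
        fix t
        show "\<eta> t * (g x - e/2) \<le> \<eta> t * g t"
        proof (cases "t \<in> {x + d - d<..<x + d + d}")
          case True
          then have "\<bar>g t - g x\<bar> < e/2" using d by (intro r) auto
          then have "g x - e/2 \<le> g t" "g t \<le> g x + e/2" by linarith+
          then show ?thesis using \<eta>(1) by (intro mult_left_mono) auto
        next
          case False
          then show ?thesis using \<eta>(2) by simp
        qed
      qed (auto intro!: \<eta>(3,5) gi set_integrable_mult_left)
      finally have "eventually (\<lambda>n. (g x - e) * ?A < (LINT t:{0<..}|lborel. \<eta> t * f n t)) sequentially"
        by (rule order_tendstoD(1)[OF \<eta>(6)])
      then show ?thesis
      proof eventually_elim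
        case (elim n)
        also have "(LINT t:{0<..}|lborel. \<eta> t * f n t) \<le> (LINT t:{0<..}|lborel. \<eta> t * f n x)"
        proof (rule set_integral_mono)
          fix t
          show "\<eta> t * f n t \<le> \<eta> t * f n x"
          proof (cases "t \<in> {x + d - d<..<x + d + d}")
            case True
            then show ?thesis using \<eta>(1) x by (intro mult_left_mono mono) auto
          next
            case False
            then show ?thesis using \<eta>(2) by simp
          qed
        qed (auto intro!: \<eta>(3,5) fi set_integrable_mult_left)
        also have "\<dots> = f n x * ?A" by simp
        finally show ?case using \<eta>(4) by simp
      qed
    qed
    have lower: "eventually (\<lambda>n. f n x < g x + e) sequentially"
    proof -
      obtain \<eta> where \<eta>: "\<And>t. 0 \<le> \<eta> t" "\<And>t. t \<notin> {x - d - d<..<x - d + d} \<Longrightarrow> \<eta> t = 0" "set_integrable lborel {0<..} \<eta>"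
        "(LINT t:{0<..}|lborel. \<eta> t) > 0"
        "\<And>h. set_integrable lborel {0<..} (\<lambda>t. exp (- t) * h t) \<Longrightarrow> set_integrable lborel {0<..} (\<lambda>t. \<eta> t * h t)"
        "(\<lambda>n. LINT t:{0<..}|lborel. \<eta> t * f n t) \<longlonglongrightarrow> (LINT t:{0<..}|lborel. \<eta> t * g t)"
        using key[of d "x - d"] d x by auto
      let ?A = "LINT t:{0<..}|lborel. \<eta> t"
      have "(LINT t:{0<..}|lborel. \<eta> t * g t) \<le> (LINT t:{0<..}|lborel. \<eta> t * (g x + e/2))"
      proof (rule set_integral_mono)
        fix t
        show "\<eta> t * g t \<le> \<eta> t * (g x + e/2)"
        proof (cases "t \<in> {x - d - d<..<x - d + d}")
          case True
          then have "\<bar>g t - g x\<bar> < e/2" using d by (intro r) auto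
          then have "g x - e/2 \<le> g t" "g t \<le> g x + e/2" by linarith+
          then show ?thesis using \<eta>(1) by (intro mult_left_mono) auto
        next
          case False
          then show ?thesis using \<eta>(2) by simp
        qed
      qed (auto intro!: \<eta>(3,5) gi set_integrable_mult_left)
      also have "\<dots> = (g x + e/2) * ?A" by simp
      also have "\<dots> < (g x + e) * ?A" using \<eta>(4) e by simp
      finally have "eventually (\<lambda>n. (LINT t:{0<..}|lborel. \<eta> t * f n t) < (g x + e) * ?A) sequentially"
        by (rule order_tendstoD(2)[OF \<eta>(6)])
      then show ?thesis
      proof eventually_elim
        case (elim n)
        have "f n x * ?A = (LINT t:{0<..}|lborel. \<eta> t * f n x)" by simp
        also have "\<dots> \<le> (LINT t:{0<..}|lborel. \<eta> t * f n t)"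
        proof (rule set_integral_mono)
          fix t
          show "\<eta> t * f n x \<le> \<eta> t * f n t"
          proof (cases "t \<in> {x - d - d<..<x - d + d}")
            case True
            then show ?thesis using \<eta>(1) d by (intro mult_left_mono mono) auto
          next
            case False
            then show ?thesis using \<eta>(2) by simp
          qed
        qed (auto intro!: \<eta>(3,5) fi set_integrable_mult_left)
        also note elim
        finally show ?case using \<eta>(4) by simp
      qed
    qed
    from upper lower have "eventually (\<lambda>n. norm (f n x - g x) < e) sequentially"
      by eventually_elim auto
    then show "\<exists>N. \<forall>n\<ge>N. norm (f n x - g x) < e" by (simp add: eventually_sequentially)
  qed
qed

text \<open>On a mesh of width \<open>h\<close> the transform is a power series in
  \<open>exp (- (y * h))\<close> times the transform \<open>(1 - exp (- (y * h))) / y\<close> of one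
  cell. Thus a Cauchy product of sequences becomes a product of transforms.\<close>

lemma step_function_laplace:
  fixes g :: "nat \<Rightarrow> real"
  assumes h: "h > 0" and y: "y > 0" and g: "\<And>n. 0 \<le> g n" "\<And>n. g n \<le> B"
  shows "set_integrable lborel {0<..} (\<lambda>t. exp (- (y * t)) * g (nat \<lfloor>t / h\<rfloor>))"
    and "(LINT t:{0<..}|lborel. exp (- (y * t)) * g (nat \<lfloor>t / h\<rfloor>)) = (\<Sum>j. g j * exp (- (y * h)) ^ j) * ((1 - exp (- (y * h))) / y)"
    and "summable (\<lambda>j. g j * exp (- (y * h)) ^ j)"
proof -
  let ?z = "exp (- (y * h))"
  have z: "0 < ?z" "?z < 1" using h y by auto
  show sm: "summable (\<lambda>j. g j * ?z ^ j)"
  proof (rule summable_comparison_test')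
    show "summable (\<lambda>j. B * ?z ^ j)" using z by (intro summable_mult summable_geometric) auto
    show "norm (g j * ?z ^ j) \<le> B * ?z ^ j" if "j \<ge> 0" for j using g[of j] by (simp add: abs_mult mult_right_mono)
  qed
  have fl: "(j * h \<le> t \<and> t < (j + 1) * h) \<longleftrightarrow> nat \<lfloor>t / h\<rfloor> = j" if "t > 0" for t and j :: nat
  proof -
    have "(j * h \<le> t \<and> t < (j + 1) * h) \<longleftrightarrow> (of_int (int j) \<le> t / h \<and> t / h < of_int (int j) + 1)"
      using h by (simp add: field_simps)
    also have "\<dots> \<longleftrightarrow> \<lfloor>t / h\<rfloor> = int j" by (simp add: floor_eq_iff)
    also have "\<dots> \<longleftrightarrow> nat \<lfloor>t / h\<rfloor> = j" using that h by (auto simp: nat_eq_iff)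
    finally show ?thesis .
  qed
  have piece: "(\<integral>\<^sup>+t. ennreal (exp (- (y * t)) * indicator {j * h..(j + 1) * h} t) \<partial>lborel) = ennreal (?z ^ j * ((1 - ?z) / y))" for j :: nat
  proof -
    have "has_bochner_integral lborel (\<lambda>t. exp (- (y * t)) * indicator {j * h..(j + 1) * h} t)
      (- exp (- (y * ((j + 1) * h))) / y - (- exp (- (y * (j * h))) / y))"
    proof (rule has_bochner_integral_FTC_Icc_real)
      show "j * h \<le> (j + 1) * h" using h by simp
      show "((\<lambda>t. - exp (- (y * t)) / y) has_real_derivative exp (- (y * x))) (at x)" for x
        using y by (auto intro!: derivative_eq_intros)
      show "isCont (\<lambda>t. exp (- (y * t))) x" for x by (intro continuous_intros)
    qed
    then have "(\<integral>\<^sup>+t. ennreal (exp (- (y * t)) * indicator {j * h..(j + 1) * h} t) \<partial>lborel)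
      = ennreal (- exp (- (y * ((j + 1) * h))) / y - (- exp (- (y * (j * h))) / y))"
      by (subst nn_integral_eq_integral) (auto simp: has_bochner_integral_iff)
    also have "- exp (- (y * ((j + 1) * h))) / y - (- exp (- (y * (j * h))) / y) = ?z ^ j * ((1 - ?z) / y)"
    proof -
      have a: "exp (- (y * (j * h))) = ?z ^ j" by (simp add: exp_of_nat_mult[symmetric] mult_ac)
      have "exp (- (y * ((j + 1) * h))) = exp (- (y * (j * h))) * ?z" by (simp add: mult_exp_exp algebra_simps)
      then show ?thesis unfolding a by (simp add: algebra_simps diff_divide_distrib)
    qed
    finally show ?thesis .
  qed
  have nn: "(\<integral>\<^sup>+t\<in>{0<..}. ennreal (exp (- (y * t)) * g (nat \<lfloor>t / h\<rfloor>)) \<partial>lborel) = ennreal ((\<Sum>j. g j * ?z ^ j) * ((1 - ?z) / y))"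
  proof -
    have "(\<integral>\<^sup>+t\<in>{0<..}. ennreal (exp (- (y * t)) * g (nat \<lfloor>t / h\<rfloor>)) \<partial>lborel)
      = (\<integral>\<^sup>+t. (\<Sum>j. ennreal (g j) * (ennreal (exp (- (y * t)) * indicator {j * h..<(j + 1) * h} t) * indicator {0<..} t)) \<partial>lborel)"
    proof (rule nn_integral_cong)
      fix t :: real
      show "ennreal (exp (- (y * t)) * g (nat \<lfloor>t / h\<rfloor>)) * indicator {0<..} t
        = (\<Sum>j. ennreal (g j) * (ennreal (exp (- (y * t)) * indicator {j * h..<(j + 1) * h} t) * indicator {0<..} t))"
      proof (cases "t > 0")
        case True
        have "(\<Sum>j. ennreal (g j) * (ennreal (exp (- (y * t)) * indicator {j * h..<(j + 1) * h} t) * indicator {0<..} t))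
          = (\<Sum>j\<in>{nat \<lfloor>t / h\<rfloor>}. ennreal (g j) * (ennreal (exp (- (y * t)) * indicator {j * h..<(j + 1) * h} t) * indicator {0<..} t))"
          by (rule suminf_finite) (use fl[OF True] in \<open>auto simp: indicator_def\<close>)
        also have "\<dots> = ennreal (g (nat \<lfloor>t / h\<rfloor>)) * ennreal (exp (- (y * t)))"
          using True fl[OF True, of "nat \<lfloor>t / h\<rfloor>"] by (simp add: indicator_def)
        finally show ?thesis using True g by (simp add: ennreal_mult[symmetric] mult.commute)
      qed simp
    qed
    also have "\<dots> = (\<Sum>j. (\<integral>\<^sup>+t. ennreal (g j) * (ennreal (exp (- (y * t)) * indicator {j * h..<(j + 1) * h} t) * indicator {0<..} t) \<partial>lborel))"
      by (rule nn_integral_suminf) measurable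
    also have "\<dots> = (\<Sum>j. ennreal (g j) * ennreal (?z ^ j * ((1 - ?z) / y)))"
    proof (rule suminf_cong)
      fix j :: nat
      have "(\<integral>\<^sup>+t. ennreal (g j) * (ennreal (exp (- (y * t)) * indicator {j * h..<(j + 1) * h} t) * indicator {0<..} t) \<partial>lborel)
        = ennreal (g j) * (\<integral>\<^sup>+t. ennreal (exp (- (y * t)) * indicator {j * h..<(j + 1) * h} t) * indicator {0<..} t \<partial>lborel)"
        by (rule nn_integral_cmult) measurable
      also have "(\<integral>\<^sup>+t. ennreal (exp (- (y * t)) * indicator {j * h..<(j + 1) * h} t) * indicator {0<..} t \<partial>lborel)
        = (\<integral>\<^sup>+t. ennreal (exp (- (y * t)) * indicator {j * h..(j + 1) * h} t) \<partial>lborel)"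
      proof (rule nn_integral_cong_AE)
        show "AE t in lborel. ennreal (exp (- (y * t)) * indicator {j * h..<(j + 1) * h} t) * indicator {0<..} t
          = ennreal (exp (- (y * t)) * indicator {j * h..(j + 1) * h} t)"
          using AE_lborel_singleton[of 0] AE_lborel_singleton[of "(j + 1) * h"]
        proof eventually_elim
          case (elim t)
          have "0 \<le> j * h" using h by simp
          then show ?case using elim by (auto simp: indicator_def)
        qed
      qed
      finally show "(\<integral>\<^sup>+t. ennreal (g j) * (ennreal (exp (- (y * t)) * indicator {j * h..<(j + 1) * h} t) * indicator {0<..} t) \<partial>lborel)
        = ennreal (g j) * ennreal (?z ^ j * ((1 - ?z) / y))" unfolding piece .
    qed
    also have "\<dots> = (\<Sum>j. ennreal (g j * ?z ^ j * ((1 - ?z) / y)))"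
      using g z y by (intro suminf_cong) (simp add: ennreal_mult[symmetric] mult.assoc)
    also have "\<dots> = ennreal (\<Sum>j. g j * ?z ^ j * ((1 - ?z) / y))"
      using g z y by (intro suminf_ennreal2 summable_mult2 sm) auto
    also have "(\<Sum>j. g j * ?z ^ j * ((1 - ?z) / y)) = (\<Sum>j. g j * ?z ^ j) * ((1 - ?z) / y)"
      by (rule suminf_mult2[symmetric, OF sm])
    finally show ?thesis .
  qed
  have v0: "0 \<le> (\<Sum>j. g j * ?z ^ j) * ((1 - ?z) / y)"
    using z y g by (intro mult_nonneg_nonneg suminf_nonneg sm) auto
  show "set_integrable lborel {0<..} (\<lambda>t. exp (- (y * t)) * g (nat \<lfloor>t / h\<rfloor>))"
    "(LINT t:{0<..}|lborel. exp (- (y * t)) * g (nat \<lfloor>t / h\<rfloor>)) = (\<Sum>j. g j * ?z ^ j) * ((1 - ?z) / y)"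
    using set_integral_eq_nn_integralI[OF _ _ nn v0] g by (auto simp: set_borel_measurable_def)
qed

lemma step_function_nn_integral:
  fixes G :: "nat \<Rightarrow> ennreal"
  assumes h: "h > 0"
  shows "(\<integral>\<^sup>+v\<in>{0..<real N * h}. G (nat \<lfloor>v / h\<rfloor>) \<partial>lborel) = (\<Sum>j<N. G j * ennreal h)"
proof (induction N)
  case 0
  then show ?case by simp
next
  case (Suc N)
  have m: "(\<lambda>v. G (nat \<lfloor>v / h\<rfloor>)) \<in> borel_measurable lborel" by measurable
  have "(\<integral>\<^sup>+v\<in>{0..<real (Suc N) * h}. G (nat \<lfloor>v / h\<rfloor>) \<partial>lborel)
    = (\<integral>\<^sup>+v\<in>{0..<real N * h} \<union> {real N * h..<real (Suc N) * h}. G (nat \<lfloor>v / h\<rfloor>) \<partial>lborel)"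
  proof -
    have "0 \<le> real N * h" using h by simp
    then have "{0..<real (Suc N) * h} = {0..<real N * h} \<union> {real N * h..<real (Suc N) * h}"
      using h by (intro ivl_disj_un_two(3)[symmetric]) (auto simp: algebra_simps)
    then show ?thesis by simp
  qed
  also have "\<dots> = (\<integral>\<^sup>+v\<in>{0..<real N * h}. G (nat \<lfloor>v / h\<rfloor>) \<partial>lborel) + (\<integral>\<^sup>+v\<in>{real N * h..<real (Suc N) * h}. G (nat \<lfloor>v / h\<rfloor>) \<partial>lborel)"
    using m by (intro nn_integral_disjoint_pair) auto
  also have "(\<integral>\<^sup>+v\<in>{real N * h..<real (Suc N) * h}. G (nat \<lfloor>v / h\<rfloor>) \<partial>lborel) = (\<integral>\<^sup>+v. G N * indicator {real N * h..<real (Suc N) * h} v \<partial>lborel)"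
  proof (rule nn_integral_cong)
    fix v :: real
    show "G (nat \<lfloor>v / h\<rfloor>) * indicator {real N * h..<real (Suc N) * h} v = G N * indicator {real N * h..<real (Suc N) * h} v"
    proof (cases "v \<in> {real N * h..<real (Suc N) * h}")
      case True
      then have "of_int (int N) \<le> v / h \<and> v / h < of_int (int N) + 1" using h by (simp add: field_simps)
      then have "\<lfloor>v / h\<rfloor> = int N" by (simp add: floor_eq_iff)
      then show ?thesis by simp
    qed simp
  qed
  also have "\<dots> = G N * ennreal h"
    using h by (subst nn_integral_cmult_indicator) (auto simp: algebra_simps)
  finally show ?case using Suc by simp
qed

subsection \<open>The moving average and autoregressive coefficients\<close>

locale ma_measure =
  fixes \<nu> :: "real measure" and c :: "real \<Rightarrow> real"
  assumes sets_nu: "sets \<nu> = sets (restrict_space borel {0<..})"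
    and int_nu: "integrable \<nu> (\<lambda>s. 1 / (1 + s))"
    and c_eq: "c = ma_coeff \<nu>"
begin

lemma space_nu: "space \<nu> = {0<..}"
  using sets_eq_imp_space_eq[OF sets_nu] by (simp add: space_restrict_space)

lemma measurable_nu: "f \<in> borel_measurable borel \<Longrightarrow> f \<in> borel_measurable \<nu>"
  unfolding measurable_cong_sets[OF sets_nu refl] by (rule measurable_restrict_space1)

text \<open>From \<open>t * s \<le> exp (t * s)\<close> the exponential is at most
  \<open>(1 + 1 / t) / (1 + s)\<close>, so the growth condition on \<nu> dominates it.\<close>

lemma exp_integrable:
  assumes t: "t > 0"
  shows "integrable \<nu> (\<lambda>s. exp (- t * s))"
proof (rule Bochner_Integration.integrable_bound)
  show "integrable \<nu> (\<lambda>s. (1 + 1 / t) * (1 / (1 + s)))" by (intro integrable_mult_right int_nu)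
  show "(\<lambda>s. exp (- t * s)) \<in> borel_measurable \<nu>" by (rule measurable_nu) measurable
  show "AE s in \<nu>. norm (exp (- t * s)) \<le> norm ((1 + 1 / t) * (1 / (1 + s)))"
  proof (rule AE_I2)
    fix s assume "s \<in> space \<nu>"
    then have s: "s > 0" by (simp add: space_nu)
    have "t * s \<le> exp (t * s)" using exp_ge_add_one_self[of "t * s"] by linarith
    then have "s * exp (- t * s) \<le> 1 / t" using t by (simp add: exp_minus field_simps)
    moreover have "exp (- t * s) \<le> 1" using s t by simp
    moreover have "exp (- t * s) * (1 + s) = exp (- t * s) + s * exp (- t * s)" by (simp add: algebra_simps)
    ultimately have "exp (- t * s) * (1 + s) \<le> 1 + 1 / t" by linarith
    then have "exp (- t * s) \<le> (1 + 1 / t) / (1 + s)" using s by (subst pos_le_divide_eq) auto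
    moreover have "0 \<le> (1 + 1 / t) / (1 + s)" using s t by auto
    ultimately show "norm (exp (- t * s)) \<le> norm ((1 + 1 / t) * (1 / (1 + s)))"
      by (simp only: real_norm_def abs_of_nonneg exp_ge_zero times_divide_eq_right mult_1_right)
  qed
qed

lemma c_pos_eq: "t > 0 \<Longrightarrow> c t = (\<integral>s. exp (- t * s) \<partial>\<nu>)"
  by (simp add: c_eq ma_coeff_def)

lemma c_nonpos: "t \<le> 0 \<Longrightarrow> c t = 0"
  by (simp add: c_eq ma_coeff_def)

lemma c_nonneg: "0 \<le> c t"
  by (simp add: c_eq ma_coeff_def)

lemma c_antimono: "0 < s \<Longrightarrow> s \<le> t \<Longrightarrow> c t \<le> c s"
proof -
  assume st: "0 < s" "s \<le> t"
  have "(\<integral>x. exp (- t * x) \<partial>\<nu>) \<le> (\<integral>x. exp (- s * x) \<partial>\<nu>)"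
    using st by (intro integral_mono exp_integrable) (auto simp: space_nu mult_right_mono)
  then show ?thesis using st by (simp add: c_pos_eq)
qed

lemma c_cont: assumes t: "t > 0" shows "isCont c t"
  unfolding continuous_at_sequentially
proof (intro allI impI)
  fix x :: "nat \<Rightarrow> real" assume x: "x \<longlonglongrightarrow> t"
  \<comment> \<open>Raising the sequence to at least \<open>t/2\<close> changes only finitely many
    terms and yields one dominating function for all of them.\<close>
  define y where "y n = max (t/2) (x n)" for n
  have y: "y \<longlonglongrightarrow> t" using tendsto_max[OF tendsto_const x, of "t/2"] t by (simp add: y_def[abs_def])
  have yp: "y n > 0" "t/2 \<le> y n" for n using t by (auto simp: y_def)
  have "(\<lambda>n. \<integral>s. exp (- y n * s) \<partial>\<nu>) \<longlonglongrightarrow> (\<integral>s. exp (- t * s) \<partial>\<nu>)"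
  proof (rule integral_dominated_convergence[where w="\<lambda>s. exp (- (t/2) * s)"])
    show "integrable \<nu> (\<lambda>s. exp (- (t/2) * s))" using t by (intro exp_integrable) auto
    show "(\<lambda>s. exp (- t * s)) \<in> borel_measurable \<nu>" by (rule measurable_nu) measurable
    show "(\<lambda>s. exp (- y n * s)) \<in> borel_measurable \<nu>" for n by (rule measurable_nu) measurable
    show "AE s in \<nu>. (\<lambda>n. exp (- y n * s)) \<longlonglongrightarrow> exp (- t * s)"
      by (intro AE_I2 tendsto_intros y)
    show "AE s in \<nu>. norm (exp (- y n * s)) \<le> exp (- (t/2) * s)" for n
      using yp(2)[of n] by (intro AE_I2) (auto simp: space_nu mult_right_mono)
  qed
  then have "(\<lambda>n. c (y n)) \<longlonglongrightarrow> c t" using t yp by (simp add: c_pos_eq)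
  moreover have "eventually (\<lambda>n. c (y n) = c (x n)) sequentially"
    using order_tendstoD(1)[OF x, of "t/2"] t by (auto elim!: eventually_mono simp: y_def)
  ultimately show "(c \<circ> x) \<longlonglongrightarrow> c t" unfolding o_def by (rule Lim_transform_eventually)
qed

lemma c_measurable [measurable]: "c \<in> borel_measurable borel"
proof -
  have "(\<lambda>t. indicator {0<..} t *\<^sub>R c t) \<in> borel_measurable borel"
    using c_cont by (intro borel_measurable_continuous_on_indicator continuous_at_imp_continuous_on) auto
  moreover have "(\<lambda>t. indicator {0<..} t *\<^sub>R c t) = c" by (auto split: split_indicator simp: c_nonpos not_less)
  ultimately show ?thesis by simp
qed

text \<open>The samples of \<open>c\<close> at \<open>h, 2 * h, ...\<close> are the moments of
  \<open>exp (- h * s)\<close> under \<nu> weighted by the same exponential. The weight makes the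
  total mass \<open>c h\<close> finite; it is also the reason for the index
  \<open>n - j + 1\<close>, since sampling starts at \<open>h\<close> instead of 0.\<close>

lemma discrete_inverse:
  assumes h: "h > 0" and cpos: "c h > 0" and c0: "(c \<longlongrightarrow> 0) at_top"
  shows "\<exists>r. (\<forall>n. 0 \<le> r n) \<and> (\<forall>n. r (Suc n) \<le> r n) \<and> (\<forall>n. r (Suc n) - r (Suc (Suc n)) \<le> r n - r (Suc n)) \<and>
    (\<forall>n. (\<Sum>j\<le>n. r j * c (real (n - j + 1) * h)) = 1)"
proof -
  define M where "M = density \<nu> (\<lambda>s. ennreal (exp (- h * s)))"
  define X where "X s = exp (- h * s)" for s :: real
  have em: "(\<lambda>s. exp (- h * s)) \<in> borel_measurable \<nu>" by (rule measurable_nu) measurable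
  have Xm: "X \<in> borel_measurable M" using em unfolding M_def X_def by simp
  have mom: "(\<integral>w. X w ^ n \<partial>M) = c (real (n + 1) * h)" for n
  proof -
    have "(\<integral>w. X w ^ n \<partial>M) = (\<integral>s. exp (- h * s) *\<^sub>R X s ^ n \<partial>\<nu>)"
      unfolding M_def X_def using em by (subst integral_density) auto
    also have "\<dots> = (\<integral>s. exp (- (real (n + 1) * h) * s) \<partial>\<nu>)"
      unfolding X_def by (intro Bochner_Integration.integral_cong refl)
        (simp add: exp_of_nat_mult[symmetric] exp_add[symmetric] algebra_simps)
    also have "\<dots> = c (real (n + 1) * h)" using h by (subst c_pos_eq) auto
    finally show ?thesis .
  qed
  have "emeasure M (space M) = (\<integral>\<^sup>+s. ennreal (exp (- h * s)) \<partial>\<nu>)"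
    unfolding M_def using em by (subst emeasure_density) (auto intro!: nn_integral_cong)
  also have "\<dots> = ennreal (\<integral>s. exp (- h * s) \<partial>\<nu>)"
    by (rule nn_integral_eq_integral[OF exp_integrable[OF h]]) simp
  finally have em: "emeasure M (space M) = ennreal (c h)" using h by (simp add: c_pos_eq)
  have fin: "finite_measure M" by (rule finite_measureI) (simp add: em)
  have ms: "measure M (space M) > 0" using cpos by (simp add: measure_def em)
  have lim: "(\<lambda>n. \<integral>w. X w ^ n \<partial>M) \<longlonglongrightarrow> 0"
    unfolding mom
  proof (rule filterlim_compose[OF c0])
    have "filterlim (\<lambda>n. h * real (n + 1)) at_top sequentially"
      using h by (intro filterlim_tendsto_pos_mult_at_top[OF tendsto_const]
          filterlim_compose[OF filterlim_real_sequentially filterlim_add_const_nat_at_top]) auto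
    then show "filterlim (\<lambda>n. real (n + 1) * h) at_top sequentially" by (simp add: mult.commute)
  qed
  have X01: "0 \<le> X w \<and> X w \<le> 1" if "w \<in> space M" for w
    using that h by (auto simp: M_def X_def space_nu)
  obtain r where "\<forall>n. 0 \<le> r n" "\<forall>n. r (Suc n) \<le> r n" "\<forall>n. r (Suc n) - r (Suc (Suc n)) \<le> r n - r (Suc n)"
    "\<forall>n. (\<Sum>j\<le>n. r j * (\<integral>w. X w ^ (n - j) \<partial>M)) = 1"
    using moment_sequence_inverse[OF fin Xm X01 ms lim] by blast
  then show ?thesis unfolding mom by blast
qed

end

locale ar_coefficients = ma_measure +
  fixes \<alpha> :: "real \<Rightarrow> real"
  assumes alpha: "is_ar_alpha c \<alpha>"
    and c_pos: "\<And>t. t > 0 \<Longrightarrow> c t > 0"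
    and c_lim: "(c \<longlongrightarrow> 0) at_top"
begin

lemma alpha_differentiable: "t > 0 \<Longrightarrow> \<alpha> differentiable (at t)"
  using alpha unfolding is_ar_alpha_def by blast

lemma alpha_cont: "t > 0 \<Longrightarrow> isCont \<alpha> t"
  by (rule differentiable_imp_continuous_within[OF alpha_differentiable])

text \<open>On the positive imaginary axis \<open>z = \<i> * y\<close> the defining relation becomes
  a relation between real Laplace transforms, and the factor in front becomes
  \<open>y\<close>.\<close>

lemma laplace:
  assumes y: "y > 0"
  shows "set_integrable lborel {0<..} (\<lambda>t. exp (- (y * t)) * c t)"
    and "set_integrable lborel {0<..} (\<lambda>t. exp (- (y * t)) * \<alpha> t)"
    and "y * (LINT t:{0<..}|lborel. exp (- (y * t)) * c t) * (LINT t:{0<..}|lborel. exp (- (y * t)) * \<alpha> t) = 1"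
proof -
  define z where "z = \<i> * complex_of_real y"
  have Im: "0 < Im z" using y by (simp add: z_def)
  have e: "exp (\<i> * z * of_real t) * of_real (f t) = complex_of_real (exp (- (y * t)) * f t)" for f :: "real \<Rightarrow> real" and t
  proof -
    have "\<i> * z * of_real t = complex_of_real (- (y * t))" by (simp add: z_def mult.assoc[symmetric])
    then show ?thesis by (simp only: exp_of_real of_real_mult)
  qed
  have si: "set_integrable lborel {0<..} f" if "set_integrable lborel {0<..} (\<lambda>t. complex_of_real (f t))" for f :: "real \<Rightarrow> real"
  proof -
    have "(\<lambda>t. indicator {0<..} t *\<^sub>R complex_of_real (f t)) = (\<lambda>t. complex_of_real (indicator {0<..} t *\<^sub>R f t))"
      by (auto split: split_indicator)
    then show ?thesis using that unfolding set_integrable_def by (simp only: complex_of_real_integrable_eq)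
  qed
  note all = alpha[unfolded is_ar_alpha_def, THEN conjunct2, rule_format, OF Im, unfolded e]
  have A: "set_integrable lborel {0<..} (\<lambda>t. complex_of_real (exp (- (y * t)) * c t))"
    "set_integrable lborel {0<..} (\<lambda>t. complex_of_real (exp (- (y * t)) * \<alpha> t))"
    "- \<i> * z * (LINT t:{0<..}|lborel. complex_of_real (exp (- (y * t)) * c t))
      * (LINT t:{0<..}|lborel. complex_of_real (exp (- (y * t)) * \<alpha> t)) = 1"
    by (rule all[THEN conjunct1], rule all[THEN conjunct2, THEN conjunct1], rule all[THEN conjunct2, THEN conjunct2])
  show "set_integrable lborel {0<..} (\<lambda>t. exp (- (y * t)) * c t)"
    "set_integrable lborel {0<..} (\<lambda>t. exp (- (y * t)) * \<alpha> t)"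
    using A by (auto intro: si simp del: of_real_mult)
  have zz: "- \<i> * z = complex_of_real y" by (simp add: z_def)
  have "complex_of_real (y * (LINT t:{0<..}|lborel. exp (- (y * t)) * c t) * (LINT t:{0<..}|lborel. exp (- (y * t)) * \<alpha> t)) = of_real 1"
    using A(3) unfolding zz set_integral_complex_of_real by simp
  then show "y * (LINT t:{0<..}|lborel. exp (- (y * t)) * c t) * (LINT t:{0<..}|lborel. exp (- (y * t)) * \<alpha> t) = 1"
    by (simp only: of_real_eq_iff)
qed

text \<open>The sampled \<open>c\<close> has a discrete inverse with every sign property wanted of
  \<alpha>. The product of the two step-function transforms is explicit and that of the sampled
  \<open>c\<close> converges, so the transform of the inverse converges to that of \<alpha>;
  monotonicity of the step functions and continuity of \<alpha> then give pointwise
  convergence.\<close>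

lemma approximation:
  assumes h: "\<And>n. h n > 0" and h0: "h \<longlonglongrightarrow> 0"
  obtains r where "\<And>n j. 0 \<le> r n j" "\<And>n j. r n (Suc j) \<le> r n j"
    "\<And>n j. r n (Suc j) - r n (Suc (Suc j)) \<le> r n j - r n (Suc j)"
    "\<And>n m. (\<Sum>j\<le>m. r n j * c (real (m - j + 1) * h n)) = 1"
    "\<And>x. x > 0 \<Longrightarrow> (\<lambda>n. r n (nat \<lfloor>x / h n\<rfloor>) / h n) \<longlonglongrightarrow> \<alpha> x"
proof -
  define P where "P n r \<longleftrightarrow> (\<forall>j. 0 \<le> r j) \<and> (\<forall>j. r (Suc j) \<le> r j) \<and>
    (\<forall>j. r (Suc j) - r (Suc (Suc j)) \<le> r j - r (Suc j)) \<and>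
    (\<forall>m. (\<Sum>j\<le>m. r j * c (real (m - j + 1) * h n)) = 1)" for n and r :: "nat \<Rightarrow> real"
  have "\<exists>r. P n r" for n
    unfolding P_def by (rule discrete_inverse[OF h c_pos[OF h] c_lim])
  then obtain r where P: "\<And>n. P n (r n)" by metis
  have r: "\<And>n j. 0 \<le> r n j" "\<And>n j. r n (Suc j) \<le> r n j"
    "\<And>n j. r n (Suc j) - r n (Suc (Suc j)) \<le> r n j - r n (Suc j)"
    "\<And>n m. (\<Sum>j\<le>m. r n j * c (real (m - j + 1) * h n)) = 1"
    using P unfolding P_def by blast+
  have rdec: "r n j \<le> r n i" if "i \<le> j" for n i j
    using that by (rule lift_Suc_antimono_le[rotated]) (rule r)
  define g where "g n j = r n j / h n" for n j
  have g: "0 \<le> g n j" "g n j \<le> g n 0" for n j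
    using r(1)[of n j] rdec[of 0 j n] h[of n] by (auto simp: g_def divide_right_mono)
  \<comment> \<open>Sampling at the right end of each cell keeps \<open>D n\<close> below the
    decreasing \<open>c\<close>, so that \<open>c\<close> itself dominates although it is unbounded
    at 0.\<close>
  define d where "d n j = c (real (j + 1) * h n)" for n j
  have d: "0 \<le> d n j" "d n j \<le> c (h n)" for n j
    using h[of n] by (auto simp: d_def c_nonneg intro!: c_antimono)
  define F where "F n t = g n (nat \<lfloor>t / h n\<rfloor>)" for n t
  define D where "D n t = d n (nat \<lfloor>t / h n\<rfloor>)" for n t
  have Dlim: "(\<lambda>n. LINT t:{0<..}|lborel. exp (- (y * t)) * D n t) \<longlonglongrightarrow> (LINT t:{0<..}|lborel. exp (- (y * t)) * c t)" if y: "y > 0" for y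
    unfolding set_lebesgue_integral_def
  proof (rule integral_dominated_convergence[where w="\<lambda>t. indicator {0<..} t *\<^sub>R (exp (- (y * t)) * c t)"])
    show "integrable lborel (\<lambda>t. indicator {0<..} t *\<^sub>R (exp (- (y * t)) * c t))"
      using laplace(1)[OF y] by (simp add: set_integrable_def)
    have near: "real (nat \<lfloor>t / h n\<rfloor> + 1) * h n \<in> {t<..t + h n}" if t: "t > 0" for t n
    proof -
      have "real (nat \<lfloor>t / h n\<rfloor>) = of_int \<lfloor>t / h n\<rfloor>" using t h[of n] by simp
      moreover have "of_int \<lfloor>t / h n\<rfloor> * h n \<le> t"
        unfolding pos_le_divide_eq[OF h, symmetric] by linarith
      moreover have "t < (of_int \<lfloor>t / h n\<rfloor> + 1) * h n"
        unfolding pos_divide_less_eq[OF h, symmetric] by linarith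
      ultimately show ?thesis by (simp add: algebra_simps)
    qed
    show "AE t in lborel. (\<lambda>n. indicator {0<..} t *\<^sub>R (exp (- (y * t)) * D n t)) \<longlonglongrightarrow> indicator {0<..} t *\<^sub>R (exp (- (y * t)) * c t)"
    proof (rule AE_I2)
      fix t :: real
      show "(\<lambda>n. indicator {0<..} t *\<^sub>R (exp (- (y * t)) * D n t)) \<longlonglongrightarrow> indicator {0<..} t *\<^sub>R (exp (- (y * t)) * c t)"
      proof (cases "t > 0")
        case True
        have "(\<lambda>n. real (nat \<lfloor>t / h n\<rfloor> + 1) * h n) \<longlonglongrightarrow> t"
        proof (rule tendsto_sandwich[where f="\<lambda>_. t" and h="\<lambda>n. t + h n"])
          show "(\<lambda>n. t + h n) \<longlonglongrightarrow> t" using tendsto_add[OF tendsto_const h0, of t] by simp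
          have nb: "t \<le> real (nat \<lfloor>t / h n\<rfloor> + 1) * h n" "real (nat \<lfloor>t / h n\<rfloor> + 1) * h n \<le> t + h n" for n
            using near[OF True, of n] unfolding greaterThanAtMost_iff by linarith+
          show "\<forall>\<^sub>F n in sequentially. t \<le> real (nat \<lfloor>t / h n\<rfloor> + 1) * h n"
            by (intro always_eventually allI nb)
          show "\<forall>\<^sub>F n in sequentially. real (nat \<lfloor>t / h n\<rfloor> + 1) * h n \<le> t + h n"
            by (intro always_eventually allI nb)
        qed simp
        then have "(\<lambda>n. D n t) \<longlonglongrightarrow> c t"
          unfolding D_def d_def by (rule isCont_tendsto_compose[OF c_cont[OF True]])
        then show ?thesis by (intro tendsto_intros)
      qed simp
    qed
    show "AE t in lborel. norm (indicator {0<..} t *\<^sub>R (exp (- (y * t)) * D n t)) \<le> indicator {0<..} t *\<^sub>R (exp (- (y * t)) * c t)" for n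
    proof (rule AE_I2)
      fix t :: real
      show "norm (indicator {0<..} t *\<^sub>R (exp (- (y * t)) * D n t)) \<le> indicator {0<..} t *\<^sub>R (exp (- (y * t)) * c t)"
      proof (cases "t > 0")
        case True
        have "t \<le> real (nat \<lfloor>t / h n\<rfloor> + 1) * h n"
          using near[OF True, of n] unfolding greaterThanAtMost_iff by linarith
        then have "D n t \<le> c t" unfolding D_def d_def by (rule c_antimono[OF True])
        moreover have "0 \<le> D n t" by (simp add: D_def d_def c_nonneg)
        ultimately show ?thesis using True by (simp add: abs_mult)
      qed simp
    qed
    show "(\<lambda>t. indicator {0<..} t *\<^sub>R (exp (- (y * t)) * c t)) \<in> borel_measurable lborel" by measurable
    show "(\<lambda>t. indicator {0<..} t *\<^sub>R (exp (- (y * t)) * D n t)) \<in> borel_measurable lborel" for n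
      unfolding D_def by measurable
  qed
  \<comment> \<open>The discrete convolution is 1 at every index, so the Cauchy product is a
    geometric series divided by \<open>h n\<close>. As \<open>h n\<close> tends to 0 the right-hand
    side tends to \<open>1 / y\<close>.\<close>
  have prod: "(LINT t:{0<..}|lborel. exp (- (y * t)) * F n t) * (LINT t:{0<..}|lborel. exp (- (y * t)) * D n t)
      = (1 - exp (- (y * h n))) / h n / y\<^sup>2" if y: "y > 0" for y n
  proof -
    let ?z = "exp (- (y * h n))"
    have z: "0 < ?z" "?z < 1" using h[of n] y by auto
    note sg = step_function_laplace[where g="g n" and B="g n 0", OF h[of n] y g[of n]]
      and sd = step_function_laplace[where g="d n" and B="c (h n)", OF h[of n] y d[of n]]
    have "(\<Sum>j. g n j * ?z ^ j) * (\<Sum>j. d n j * ?z ^ j) = (\<Sum>k. \<Sum>i\<le>k. (g n i * ?z ^ i) * (d n (k - i) * ?z ^ (k - i)))"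
      using sg(3) sd(3) g d z by (intro Cauchy_product) (auto simp: abs_mult)
    also have "\<dots> = (\<Sum>k. (1 / h n) * ?z ^ k)"
    proof (rule suminf_cong)
      fix k
      have "(\<Sum>i\<le>k. (g n i * ?z ^ i) * (d n (k - i) * ?z ^ (k - i))) = (\<Sum>i\<le>k. (r n i * c (real (k - i + 1) * h n)) * (?z ^ k / h n))"
        by (intro sum.cong refl) (auto simp: g_def d_def power_add[symmetric])
      also have "\<dots> = (\<Sum>i\<le>k. r n i * c (real (k - i + 1) * h n)) * (?z ^ k / h n)" by (simp only: sum_distrib_right)
      finally show "(\<Sum>i\<le>k. (g n i * ?z ^ i) * (d n (k - i) * ?z ^ (k - i))) = (1 / h n) * ?z ^ k" unfolding r(4) by simp
    qed
    also have "\<dots> = (1 / h n) * (1 / (1 - ?z))"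
      using z by (subst suminf_mult) (auto simp: suminf_geometric)
    finally have S: "(\<Sum>j. g n j * ?z ^ j) * (\<Sum>j. d n j * ?z ^ j) = (1 / h n) * (1 / (1 - ?z))" .
    have "(LINT t:{0<..}|lborel. exp (- (y * t)) * F n t) * (LINT t:{0<..}|lborel. exp (- (y * t)) * D n t)
      = ((\<Sum>j. g n j * ?z ^ j) * (\<Sum>j. d n j * ?z ^ j)) * (((1 - ?z) / y) * ((1 - ?z) / y))"
      unfolding F_def D_def sg(2) sd(2) by (simp only: mult.assoc mult.left_commute)
    also have "\<dots> = (1 - ?z) / h n / y\<^sup>2"
    proof -
      have id: "((1 / a) * (1 / w)) * ((w / b) * (w / b)) = w / a / b\<^sup>2" if "w \<noteq> 0" for a b w :: real
        using that by (simp add: power2_eq_square)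
      show ?thesis unfolding S by (rule id) (use z in auto)
    qed
    finally show ?thesis .
  qed
  have Flim: "(\<lambda>n. LINT t:{0<..}|lborel. exp (- (y * t)) * F n t) \<longlonglongrightarrow> (LINT t:{0<..}|lborel. exp (- (y * t)) * \<alpha> t)" if y: "y > 0" for y
  proof -
    let ?C = "LINT t:{0<..}|lborel. exp (- (y * t)) * c t"
    have C0: "?C \<noteq> 0" using laplace(3)[OF y] by auto
    have hat: "filterlim h (at 0) sequentially"
      by (intro filterlim_atI[OF h0] always_eventually allI) (metis h less_irrefl)
    have "((\<lambda>x. exp (- (y * x))) has_real_derivative - y) (at 0)"
      by (auto intro!: derivative_eq_intros)
    then have "((\<lambda>x. (exp (- (y * x)) - 1) / x) \<longlongrightarrow> - y) (at 0)"
      by (simp add: has_field_derivative_iff)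
    then have "(\<lambda>n. (exp (- (y * h n)) - 1) / h n) \<longlonglongrightarrow> - y"
      by (rule filterlim_compose[OF _ hat])
    then have "(\<lambda>n. - ((exp (- (y * h n)) - 1) / h n)) \<longlonglongrightarrow> - (- y)" by (rule tendsto_minus)
    then have e: "(\<lambda>n. (1 - exp (- (y * h n))) / h n) \<longlonglongrightarrow> y" by (simp add: minus_divide_left)
    have lim1: "(\<lambda>n. ((1 - exp (- (y * h n))) / h n / y\<^sup>2) / (LINT t:{0<..}|lborel. exp (- (y * t)) * D n t)) \<longlonglongrightarrow> (y / y\<^sup>2) / ?C"
      using y C0 by (intro tendsto_intros e Dlim) auto
    have eq1: "(y / y\<^sup>2) / ?C = (LINT t:{0<..}|lborel. exp (- (y * t)) * \<alpha> t)"
      using laplace(3)[OF y] y C0 by (simp add: power2_eq_square field_simps)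
    have ev1: "eventually (\<lambda>n. ((1 - exp (- (y * h n))) / h n / y\<^sup>2) / (LINT t:{0<..}|lborel. exp (- (y * t)) * D n t)
      = (LINT t:{0<..}|lborel. exp (- (y * t)) * F n t)) sequentially"
      using tendsto_imp_eventually_ne[OF Dlim[OF y] C0] unfolding prod[OF y, symmetric] by eventually_elim simp
    show ?thesis using Lim_transform_eventually[OF lim1 ev1] unfolding eq1 .
  qed
  have ex: "exp (- t) ^ k * (exp (- t) * X) = exp (- (real (Suc k) * t)) * X" for k :: nat and t X :: real
    by (simp add: exp_of_nat_mult[symmetric] mult_exp_exp algebra_simps)
  have "(\<lambda>n. F n x) \<longlonglongrightarrow> \<alpha> x" if x: "x > 0" for x
  proof (rule laplace_pointwise_convergence[where f=F and g=\<alpha> and x=x])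
    show "set_integrable lborel {0<..} (\<lambda>t. exp (- t) * F n t)" for n
      using step_function_laplace(1)[where g="g n" and B="g n 0", OF h[of n] zero_less_one g[of n]] by (simp add: F_def)
    show "0 \<le> F n t" for n t using g by (simp add: F_def)
    show "F n t \<le> F n s" if "0 < s" "s \<le> t" for n s t
      unfolding F_def g_def using that h[of n]
      by (intro divide_right_mono rdec nat_mono floor_mono) (auto simp: divide_right_mono)
    show "set_integrable lborel {0<..} (\<lambda>t. exp (- t) * \<alpha> t)" using laplace(2)[of 1] by simp
    show "(\<lambda>n. LINT t:{0<..}|lborel. exp (- t) ^ k * (exp (- t) * F n t)) \<longlonglongrightarrow> (LINT t:{0<..}|lborel. exp (- t) ^ k * (exp (- t) * \<alpha> t))" for k
      unfolding ex by (rule Flim) simp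
  qed (use x alpha_cont in auto)
  then show ?thesis using r by (intro that[of r]) (auto simp: F_def g_def)
qed

lemma alpha_nonneg: assumes x: "x > 0" shows "0 \<le> \<alpha> x"
  and alpha_antimono: "\<And>y. x \<le> y \<Longrightarrow> \<alpha> y \<le> \<alpha> x"
proof -
  define h where "h n = inverse (real (Suc n))" for n
  have h: "\<And>n. h n > 0" "h \<longlonglongrightarrow> 0" unfolding h_def using LIMSEQ_inverse_real_of_nat by auto
  obtain r where r: "\<And>n j. 0 \<le> r n j" "\<And>n j. r n (Suc j) \<le> r n j"
    "\<And>x. x > 0 \<Longrightarrow> (\<lambda>n. r n (nat \<lfloor>x / h n\<rfloor>) / h n) \<longlonglongrightarrow> \<alpha> x"
    by (rule approximation[OF h]) blast
  show "0 \<le> \<alpha> x" by (rule tendsto_lowerbound[OF r(3)[OF x]]) (auto intro!: always_eventually divide_nonneg_pos r h)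
  fix y assume y: "x \<le> y"
  have rdec: "r n j \<le> r n i" if "i \<le> j" for n i j
    using that by (rule lift_Suc_antimono_le[rotated]) (rule r)
  show "\<alpha> y \<le> \<alpha> x"
  proof (rule LIMSEQ_le[OF r(3) r(3)])
    show "\<exists>N. \<forall>n\<ge>N. r n (nat \<lfloor>y / h n\<rfloor>) / h n \<le> r n (nat \<lfloor>x / h n\<rfloor>) / h n"
      using less_imp_le[OF h(1)] y by (intro exI[of _ 0] allI impI divide_right_mono rdec nat_mono floor_mono) auto
  qed (use x y in auto)
qed

text \<open>Convexity, expressed by increments. The mesh width is \<open>d\<close> divided by
  \<open>Suc n\<close>, so that a shift by \<open>d\<close> is exactly \<open>Suc n\<close> cells
  and discrete convexity applies without rounding.\<close>

lemma alpha_increments: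
  assumes x: "x > 0" "x \<le> y" and d: "d > 0"
  shows "\<alpha> y - \<alpha> (y + d) \<le> \<alpha> x - \<alpha> (x + d)"
proof -
  define h where "h n = d * inverse (real (Suc n))" for n
  have h: "\<And>n. h n > 0" "h \<longlonglongrightarrow> 0" unfolding h_def using d tendsto_mult_right_zero[OF LIMSEQ_inverse_real_of_nat] by auto
  obtain r where r: "\<And>n j. r n (Suc j) - r n (Suc (Suc j)) \<le> r n j - r n (Suc j)"
    "\<And>x. x > 0 \<Longrightarrow> (\<lambda>n. r n (nat \<lfloor>x / h n\<rfloor>) / h n) \<longlonglongrightarrow> \<alpha> x"
    by (rule approximation[OF h]) blast
  have one: "r n j - r n (Suc j) \<le> r n i - r n (Suc i)" if "i \<le> j" for n i j
    using that by (rule lift_Suc_antimono_le[where f="\<lambda>i. r n i - r n (Suc i)", rotated]) (rule r)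
  have inc: "r n j - r n (j + m) \<le> r n i - r n (i + m)" if "i \<le> j" for n m i j
  proof (induction m)
    case (Suc m)
    show ?case using Suc one[of "i + m" "j + m" n] that by simp
  qed simp
  have fl: "nat \<lfloor>(x + d) / h n\<rfloor> = nat \<lfloor>x / h n\<rfloor> + Suc n" if "x > 0" for x n
  proof -
    have "(x + d) / h n = x / h n + of_int (int (Suc n))" using d by (simp add: h_def field_simps)
    then have "\<lfloor>(x + d) / h n\<rfloor> = \<lfloor>x / h n\<rfloor> + int (Suc n)" by (simp only: floor_add_int)
    moreover have "0 \<le> \<lfloor>x / h n\<rfloor>" using that h(1)[of n] by simp
    ultimately show ?thesis by linarith
  qed
  have lim: "(\<lambda>n. r n (nat \<lfloor>x / h n\<rfloor>) / h n - r n (nat \<lfloor>(x + d) / h n\<rfloor>) / h n) \<longlonglongrightarrow> \<alpha> x - \<alpha> (x + d)" if "x > 0" for x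
    using that d by (intro tendsto_diff r(2)) auto
  show ?thesis
  proof (rule LIMSEQ_le[OF lim lim])
    show "\<exists>N. \<forall>n\<ge>N. r n (nat \<lfloor>y / h n\<rfloor>) / h n - r n (nat \<lfloor>(y + d) / h n\<rfloor>) / h n
      \<le> r n (nat \<lfloor>x / h n\<rfloor>) / h n - r n (nat \<lfloor>(x + d) / h n\<rfloor>) / h n"
    proof (intro exI allI impI)
      fix n
      have le: "nat \<lfloor>x / h n\<rfloor> \<le> nat \<lfloor>y / h n\<rfloor>" using x h(1)[of n] by (intro nat_mono floor_mono divide_right_mono) auto
      then show "r n (nat \<lfloor>y / h n\<rfloor>) / h n - r n (nat \<lfloor>(y + d) / h n\<rfloor>) / h n
        \<le> r n (nat \<lfloor>x / h n\<rfloor>) / h n - r n (nat \<lfloor>(x + d) / h n\<rfloor>) / h n"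
        using x h(1)[of n] fl[of x n] fl[of y n] inc[OF le, of n "Suc n"]
        unfolding diff_divide_distrib[symmetric] by (intro divide_right_mono) auto
    qed
  qed (use x in auto)
qed

text \<open>With mesh width \<open>u / Suc n\<close> the discrete convolution at index
  \<open>n\<close>, which is 1, is the integral of a step function over \<open>{0..<u}\<close>.
  Fatou's lemma passes to the limit without a dominating function at the ends, where the integrand
  may be unbounded, and yields the inequality.\<close>

lemma convolution_le_1:
  assumes u: "u > 0"
  shows "(\<integral>\<^sup>+v\<in>{0<..<u}. ennreal (c (u - v) * \<alpha> v) \<partial>lborel) \<le> 1"
proof -
  define h where "h n = u * inverse (real (Suc n))" for n
  have h: "\<And>n. h n > 0" "h \<longlonglongrightarrow> 0" unfolding h_def using u tendsto_mult_right_zero[OF LIMSEQ_inverse_real_of_nat] by auto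
  have hu: "real (Suc n) * h n = u" for n by (simp add: h_def)
  obtain r where r: "\<And>n j. 0 \<le> r n j" "\<And>n m. (\<Sum>j\<le>m. r n j * c (real (m - j + 1) * h n)) = 1"
    "\<And>x. x > 0 \<Longrightarrow> (\<lambda>n. r n (nat \<lfloor>x / h n\<rfloor>) / h n) \<longlonglongrightarrow> \<alpha> x"
    by (rule approximation[OF h]) blast
  define G where "G n j = ennreal (c (real (n - j + 1) * h n) * (r n j / h n))" for n j
  have int: "(\<integral>\<^sup>+v\<in>{0..<u}. G n (nat \<lfloor>v / h n\<rfloor>) \<partial>lborel) = 1" for n
  proof -
    have "(\<integral>\<^sup>+v\<in>{0..<u}. G n (nat \<lfloor>v / h n\<rfloor>) \<partial>lborel) = (\<Sum>j<Suc n. G n j * ennreal (h n))"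
      unfolding hu[of n, symmetric] by (rule step_function_nn_integral[OF h(1)])
    also have "\<dots> = (\<Sum>j<Suc n. ennreal (r n j * c (real (n - j + 1) * h n)))"
      unfolding G_def using h(1)[of n] r(1)
      by (intro sum.cong refl, subst ennreal_mult[symmetric]) (auto simp: c_nonneg mult.commute)
    also have "\<dots> = ennreal (\<Sum>j<Suc n. r n j * c (real (n - j + 1) * h n))"
      using r(1) by (intro sum_ennreal) (auto simp: c_nonneg)
    also have "\<dots> = 1" using r(2)[of n n] by (simp add: lessThan_Suc_atMost)
    finally show ?thesis .
  qed
  have "(\<integral>\<^sup>+v\<in>{0<..<u}. ennreal (c (u - v) * \<alpha> v) \<partial>lborel)
    \<le> (\<integral>\<^sup>+v. liminf (\<lambda>n. G n (nat \<lfloor>v / h n\<rfloor>) * indicator {0..<u} v) \<partial>lborel)"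
  proof (rule nn_integral_mono)
    fix v :: real
    show "ennreal (c (u - v) * \<alpha> v) * indicator {0<..<u} v \<le> liminf (\<lambda>n. G n (nat \<lfloor>v / h n\<rfloor>) * indicator {0..<u} v)"
    proof (cases "0 < v \<and> v < u")
      case True
      have "(\<lambda>n. real (n - nat \<lfloor>v / h n\<rfloor> + 1) * h n) \<longlonglongrightarrow> u - v"
      proof (rule tendsto_sandwich[where f="\<lambda>_. u - v" and h="\<lambda>n. u - v + h n"])
        have near: "u - v \<le> real (n - nat \<lfloor>v / h n\<rfloor> + 1) * h n \<and> real (n - nat \<lfloor>v / h n\<rfloor> + 1) * h n \<le> u - v + h n" for n
        proof -
          have f: "real (nat \<lfloor>v / h n\<rfloor>) = of_int \<lfloor>v / h n\<rfloor>" using True h(1)[of n] by simp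
          have fb: "of_int \<lfloor>v / h n\<rfloor> \<le> v / h n" "v / h n < of_int \<lfloor>v / h n\<rfloor> + 1" by linarith+
          have "v / h n < real (Suc n)" using True h(1)[of n] hu[of n] by (simp add: field_simps)
          then have "nat \<lfloor>v / h n\<rfloor> \<le> n" using f fb(1) by linarith
          then have "real (n - nat \<lfloor>v / h n\<rfloor> + 1) * h n = u - real (nat \<lfloor>v / h n\<rfloor>) * h n"
            using hu[of n] by (simp add: of_nat_diff algebra_simps)
          moreover have "real (nat \<lfloor>v / h n\<rfloor>) * h n \<le> v" "v \<le> real (nat \<lfloor>v / h n\<rfloor>) * h n + h n"
          proof -
            show "real (nat \<lfloor>v / h n\<rfloor>) * h n \<le> v"
              unfolding f pos_le_divide_eq[OF h(1), symmetric] by (rule fb)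
            have "v < (of_int \<lfloor>v / h n\<rfloor> + 1) * h n"
              unfolding pos_divide_less_eq[OF h(1), symmetric] by (rule fb)
            then show "v \<le> real (nat \<lfloor>v / h n\<rfloor>) * h n + h n"
              unfolding f by (simp add: algebra_simps)
          qed
          ultimately show ?thesis by simp
        qed
        show "eventually (\<lambda>n. u - v \<le> real (n - nat \<lfloor>v / h n\<rfloor> + 1) * h n) sequentially"
          "eventually (\<lambda>n. real (n - nat \<lfloor>v / h n\<rfloor> + 1) * h n \<le> u - v + h n) sequentially"
          using near by (auto intro!: always_eventually)
        show "(\<lambda>n. u - v + h n) \<longlonglongrightarrow> u - v" using tendsto_add[OF tendsto_const h(2), of "u - v"] by simp
      qed simp
      then have "(\<lambda>n. c (real (n - nat \<lfloor>v / h n\<rfloor> + 1) * h n)) \<longlonglongrightarrow> c (u - v)"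
        using True by (intro isCont_tendsto_compose[OF c_cont]) auto
      then have "(\<lambda>n. ennreal (c (real (n - nat \<lfloor>v / h n\<rfloor> + 1) * h n) * (r n (nat \<lfloor>v / h n\<rfloor>) / h n))) \<longlonglongrightarrow> ennreal (c (u - v) * \<alpha> v)"
        using True by (intro tendsto_ennrealI tendsto_mult r(3)) auto
      then have "liminf (\<lambda>n. G n (nat \<lfloor>v / h n\<rfloor>)) = ennreal (c (u - v) * \<alpha> v)"
        unfolding G_def by (rule lim_imp_Liminf[OF sequentially_bot])
      then show ?thesis using True by simp
    qed auto
  qed
  also have "\<dots> \<le> liminf (\<lambda>n. \<integral>\<^sup>+v. G n (nat \<lfloor>v / h n\<rfloor>) * indicator {0..<u} v \<partial>lborel)"
    by (rule nn_integral_liminf) measurable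
  also have "\<dots> = 1" unfolding int by (simp add: Liminf_const)
  finally show ?thesis .
qed

end

subsection \<open>A dominated convergence theorem for regularly varying functions\<close>

text \<open>Where \<open>t * x\<close> is at least \<open>X\<close>, Potter's bounds dominate the
  ratio. Below \<open>X\<close> only local integrability of \<open>f\<close> is available; after
  rescaling, that part contributes at most \<open>B * I / (t * f t)\<close>, which vanishes because
  \<open>t * f t\<close> has positive index \<open>\<rho> + 1\<close>.\<close>

lemma regularly_varying_dominated_convergence:
  fixes f w0 W :: "real \<Rightarrow> real" and w :: "real \<Rightarrow> real \<Rightarrow> real"
  assumes rv: "regularly_varying \<rho> f" and \<rho>: "\<rho> > -1"
    and fm [measurable]: "f \<in> borel_measurable borel" and fi: "\<And>r. set_integrable lborel {0<..<r} f"
    and d: "\<delta> > 0"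
    and wm [measurable]: "\<And>t. w t \<in> borel_measurable borel" "w0 \<in> borel_measurable borel"
    and wlim: "\<And>x. x > 0 \<Longrightarrow> ((\<lambda>t. w t x) \<longlongrightarrow> w0 x) at_top"
    and wb: "eventually (\<lambda>t. \<forall>x>0. \<bar>w t x\<bar> \<le> W x) at_top"
    and WB: "\<And>x. 0 < x \<Longrightarrow> x \<le> 1 \<Longrightarrow> W x \<le> B"
    and Wi: "set_integrable lborel {0<..} (\<lambda>x. W x * (x powr (\<rho> - \<delta>) + x powr (\<rho> + \<delta>)))"
  shows "((\<lambda>t. LINT x:{0<..}|lborel. w t x * (f (t * x) / f t)) \<longlongrightarrow> (LINT x:{0<..}|lborel. w0 x * x powr \<rho>)) at_top"
    and "eventually (\<lambda>t. set_integrable lborel {0<..} (\<lambda>x. w t x * (f (t * x) / f t))) at_top"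
proof -
  obtain X K where X: "X > 0" "K \<ge> 1" "\<And>x. x \<ge> X \<Longrightarrow> f x > 0"
    and pot: "\<And>x y. x \<ge> X \<Longrightarrow> y \<ge> x \<Longrightarrow> f y / f x \<le> K * (y / x) powr (\<rho> + \<delta>) \<and> f x / f y \<le> K * (x / y) powr (\<rho> - \<delta>)"
    using regularly_varying_potter[OF rv d] by blast
  define h1 where "h1 t x = indicator {0<..} x * (if X \<le> t * x then w t x * (f (t * x) / f t) else 0)" for t x
  define h2 where "h2 t x = indicator {0<..} x * (if X \<le> t * x then 0 else w t x * (f (t * x) / f t))" for t x
  have [measurable]: "h1 t \<in> borel_measurable lborel" "h2 t \<in> borel_measurable lborel" for t
    unfolding h1_def h2_def by measurable
  let ?D = "\<lambda>x. K * (indicator {0<..} x *\<^sub>R (W x * (x powr (\<rho> - \<delta>) + x powr (\<rho> + \<delta>))))"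
  have Di: "integrable lborel ?D" using Wi unfolding set_integrable_def by (rule integrable_mult_right)
  have b1: "eventually (\<lambda>t. \<forall>x. \<bar>h1 t x\<bar> \<le> ?D x) at_top"
    using wb eventually_ge_at_top[of X]
  proof eventually_elim
    case (elim t)
    have tp: "t > 0" using elim X by linarith
    show ?case
    proof
      fix x
      show "\<bar>h1 t x\<bar> \<le> ?D x"
      proof (cases "x > 0 \<and> X \<le> t * x")
        case True
        have "f (t * x) / f t \<le> K * (x powr (\<rho> - \<delta>) + x powr (\<rho> + \<delta>))"
        proof (cases "x \<le> 1")
          case x1: True
          have "f (t * x) / f t \<le> K * (t * x / t) powr (\<rho> - \<delta>)"
            using pot[of "t * x" t] True x1 tp by (simp add: mult_left_le)
          also have "\<dots> \<le> K * (x powr (\<rho> - \<delta>) + x powr (\<rho> + \<delta>))" using tp X by simp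
          finally show ?thesis .
        next
          case x1: False
          have "f (t * x) / f t \<le> K * (t * x / t) powr (\<rho> + \<delta>)"
            using pot[of t "t * x"] True x1 tp elim by simp
          also have "\<dots> \<le> K * (x powr (\<rho> - \<delta>) + x powr (\<rho> + \<delta>))" using tp X by simp
          finally show ?thesis .
        qed
        moreover have "0 \<le> f (t * x) / f t" using True X(3)[of "t * x"] X(3)[of t] elim by simp
        moreover have "\<bar>w t x\<bar> \<le> W x" using elim True by blast
        ultimately have "\<bar>w t x\<bar> * (f (t * x) / f t) \<le> W x * (K * (x powr (\<rho> - \<delta>) + x powr (\<rho> + \<delta>)))"
          by (intro mult_mono) auto
        moreover have "\<bar>h1 t x\<bar> = \<bar>w t x\<bar> * (f (t * x) / f t)"
        proof -
          have "h1 t x = w t x * (f (t * x) / f t)" using True by (simp add: h1_def)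
          then show ?thesis using \<open>0 \<le> f (t * x) / f t\<close> by (simp only: abs_mult[of "w t x"] abs_of_nonneg)
        qed
        ultimately show ?thesis using True by (simp add: mult_ac)
      next
        case False
        have "0 \<le> W x" if "x > 0" using elim(1) that by force
        then show ?thesis using False X by (auto simp: h1_def indicator_def intro!: mult_nonneg_nonneg add_nonneg_nonneg)
      qed
    qed
  qed
  have lim1: "((\<lambda>t. LINT x|lborel. h1 t x) \<longlongrightarrow> (LINT x|lborel. indicator {0<..} x * (w0 x * x powr \<rho>))) at_top"
  proof (rule integral_dominated_convergence_at_top[OF _ _ Di])
    show "\<forall>\<^sub>F t in at_top. AE x in lborel. norm (h1 t x) \<le> ?D x" using b1 by eventually_elim auto
    show "AE x in lborel. ((\<lambda>t. h1 t x) \<longlongrightarrow> indicator {0<..} x * (w0 x * x powr \<rho>)) at_top"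
    proof (rule AE_I2)
      fix x :: real
      show "((\<lambda>t. h1 t x) \<longlongrightarrow> indicator {0<..} x * (w0 x * x powr \<rho>)) at_top"
      proof (cases "x > 0")
        case True
        have "((\<lambda>t. w t x * (f (t * x) / f t)) \<longlongrightarrow> w0 x * x powr \<rho>) at_top"
          by (intro tendsto_mult wlim regularly_varyingD(1)[OF rv] True)
        moreover have "eventually (\<lambda>t. w t x * (f (t * x) / f t) = h1 t x) at_top"
          using eventually_ge_at_top[of "X / x"]
          by eventually_elim (use True in \<open>simp add: h1_def field_simps\<close>)
        ultimately have "((\<lambda>t. h1 t x) \<longlongrightarrow> w0 x * x powr \<rho>) at_top" by (rule Lim_transform_eventually)
        then show ?thesis using True by simp
      qed (simp add: h1_def)
    qed
  qed measurable
  define I where "I = (LINT s:{0<..<X}|lborel. \<bar>f s\<bar>)"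
  have Ii: "set_integrable lborel {0<..<X} (\<lambda>s. \<bar>f s\<bar>)" using set_integrable_norm[OF fi] by simp
  have sc: "integrable lborel (\<lambda>x. indicator {0<..<X} (t * x) *\<^sub>R \<bar>f (t * x)\<bar>)"
    "(LINT x|lborel. indicator {0<..<X} (t * x) *\<^sub>R \<bar>f (t * x)\<bar>) = I / t" if t: "t > 0" for t
  proof -
    show "integrable lborel (\<lambda>x. indicator {0<..<X} (t * x) *\<^sub>R \<bar>f (t * x)\<bar>)"
      using lborel_integrable_real_affine[OF Ii[unfolded set_integrable_def], of t 0] t by simp
    have "I = \<bar>t\<bar> *\<^sub>R (LINT x|lborel. indicator {0<..<X} (0 + t * x) *\<^sub>R \<bar>f (0 + t * x)\<bar>)"
      unfolding I_def set_lebesgue_integral_def using t by (intro lborel_integral_real_affine) auto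
    then show "(LINT x|lborel. indicator {0<..<X} (t * x) *\<^sub>R \<bar>f (t * x)\<bar>) = I / t" using t by simp
  qed
  have b2: "eventually (\<lambda>t. \<forall>x. \<bar>h2 t x\<bar> \<le> (B / f t) * (indicator {0<..<X} (t * x) *\<^sub>R \<bar>f (t * x)\<bar>)) at_top"
    using wb eventually_ge_at_top[of X]
  proof eventually_elim
    case (elim t)
    have tp: "t > 0" "f t > 0" using elim X by auto
    show ?case
    proof
      fix x
      show "\<bar>h2 t x\<bar> \<le> (B / f t) * (indicator {0<..<X} (t * x) *\<^sub>R \<bar>f (t * x)\<bar>)"
      proof (cases "x > 0 \<and> t * x < X")
        case True
        then have "t * x \<le> t * 1" using elim by linarith
        then have "x \<le> 1" using tp by simp
        then have "\<bar>w t x\<bar> \<le> B" using WB[of x] elim(1) True by fastforce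
        then have "\<bar>w t x\<bar> * (\<bar>f (t * x)\<bar> / f t) \<le> B * (\<bar>f (t * x)\<bar> / f t)" using tp by (intro mult_right_mono) auto
        then show ?thesis using True tp by (simp add: h2_def abs_mult)
      next
        case False
        then have 1: "h2 t x = 0" by (auto simp: h2_def)
        have 2: "indicator {0<..<X} (t * x) *\<^sub>R \<bar>f (t * x)\<bar> = 0"
          using False tp by (auto simp: indicator_def zero_less_mult_iff)
        show ?thesis unfolding 1 2 by simp
      qed
    qed
  qed
  have h2i: "eventually (\<lambda>t. integrable lborel (h2 t)) at_top"
    using b2 eventually_gt_at_top[of 0]
  proof eventually_elim
    case (elim t)
    show ?case
    proof (rule Bochner_Integration.integrable_bound)
      show "integrable lborel (\<lambda>x. (B / f t) * (indicator {0<..<X} (t * x) *\<^sub>R \<bar>f (t * x)\<bar>))"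
        by (rule integrable_mult_right[OF sc(1)[OF elim(2)]])
      show "AE x in lborel. norm (h2 t x) \<le> norm ((B / f t) * (indicator {0<..<X} (t * x) *\<^sub>R \<bar>f (t * x)\<bar>))"
        using elim(1) by (intro AE_I2) (metis abs_ge_self order_trans real_norm_def)
    qed measurable
  qed
  have lim2: "((\<lambda>t. LINT x|lborel. h2 t x) \<longlongrightarrow> 0) at_top"
  proof (rule Lim_null_comparison)
    have "filterlim (\<lambda>t. t * f t) at_top at_top"
      using regularly_varying_at_top[OF regularly_varying_mult[OF regularly_varying_ident rv]] \<rho> by simp
    then have "((\<lambda>t. inverse (t * f t)) \<longlongrightarrow> 0) at_top" by (rule tendsto_inverse_0_at_top)
    then have "((\<lambda>t. (B * I) * inverse (t * f t)) \<longlongrightarrow> (B * I) * 0) at_top" by (intro tendsto_intros)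
    then show "((\<lambda>t. (B * I) * inverse (t * f t)) \<longlongrightarrow> 0) at_top" by simp
    show "\<forall>\<^sub>F t in at_top. norm (LINT x|lborel. h2 t x) \<le> (B * I) * inverse (t * f t)"
      using b2 h2i eventually_gt_at_top[of 0]
    proof eventually_elim
      case (elim t)
      have "norm (LINT x|lborel. h2 t x) \<le> (LINT x|lborel. norm (h2 t x))" by (rule integral_norm_bound)
      also have "\<dots> \<le> (LINT x|lborel. (B / f t) * (indicator {0<..<X} (t * x) *\<^sub>R \<bar>f (t * x)\<bar>))"
        using elim by (intro integral_mono integrable_norm integrable_mult_right sc(1)) auto
      also have "\<dots> = (B / f t) * (I / t)" using sc(2)[OF elim(3)] by simp
      finally show ?case by (simp add: divide_inverse mult_ac)
    qed
  qed
  have split: "indicator {0<..} x *\<^sub>R (w t x * (f (t * x) / f t)) = h1 t x + h2 t x" for t x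
    by (simp add: h1_def h2_def)
  have h1i: "eventually (\<lambda>t. integrable lborel (h1 t)) at_top"
    using b1
  proof eventually_elim
    case (elim t)
    show ?case
    proof (rule Bochner_Integration.integrable_bound[OF Di])
      show "AE x in lborel. norm (h1 t x) \<le> norm (?D x)"
        using elim by (intro AE_I2) (metis abs_ge_self order_trans real_norm_def)
    qed measurable
  qed
  show "eventually (\<lambda>t. set_integrable lborel {0<..} (\<lambda>x. w t x * (f (t * x) / f t))) at_top"
    using h1i h2i unfolding set_integrable_def split by eventually_elim (rule Bochner_Integration.integrable_add)
  have "((\<lambda>t. (LINT x|lborel. h1 t x) + (LINT x|lborel. h2 t x)) \<longlongrightarrow> (LINT x|lborel. indicator {0<..} x * (w0 x * x powr \<rho>)) + 0) at_top"
    by (intro tendsto_add lim1 lim2)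
  moreover have "eventually (\<lambda>t. (LINT x|lborel. h1 t x) + (LINT x|lborel. h2 t x) = (LINT x:{0<..}|lborel. w t x * (f (t * x) / f t))) at_top"
    using h1i h2i unfolding set_lebesgue_integral_def split
    by eventually_elim (rule Bochner_Integration.integral_add[symmetric])
  ultimately show "((\<lambda>t. LINT x:{0<..}|lborel. w t x * (f (t * x) / f t)) \<longlongrightarrow> (LINT x:{0<..}|lborel. w0 x * x powr \<rho>)) at_top"
    unfolding set_lebesgue_integral_def[of _ _ "\<lambda>x. w0 x * x powr \<rho>"] real_scaleR_def add_0_right
    by (rule Lim_transform_eventually)
qed

subsection \<open>Asymptotics of the autoregressive coefficient\<close>

lemma exp_powr_integral:
  fixes q r :: real
  assumes "q > 0" "r > 0"
  shows "set_integrable lborel {0<..} (\<lambda>x. exp (- (r * x)) * x powr (q - 1))"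
    and "(LINT x:{0<..}|lborel. exp (- (r * x)) * x powr (q - 1)) = Gamma q * r powr (- q)"
proof -
  have nn: "(\<integral>\<^sup>+x\<in>{0<..}. ennreal (exp (- (r * x)) * x powr (q - 1)) \<partial>lborel) = ennreal (Gamma q * r powr (- q))"
    using Gamma_nn_integral_scaled[OF assms] by (simp add: mult.commute)
  have "0 \<le> Gamma q * r powr (- q)" using assms by (simp add: Gamma_real_nonneg)
  then show "set_integrable lborel {0<..} (\<lambda>x. exp (- (r * x)) * x powr (q - 1))"
    "(LINT x:{0<..}|lborel. exp (- (r * x)) * x powr (q - 1)) = Gamma q * r powr (- q)"
    using set_integral_eq_nn_integralI[OF _ _ nn] by (auto simp: set_borel_measurable_def)
qed

lemma set_integral_scale:
  fixes f :: "real \<Rightarrow> real"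
  assumes t: "t > 0"
  shows "(LINT x:{0<..}|lborel. f (t * x)) = (LINT s:{0<..}|lborel. f s) / t"
proof -
  have "(LINT s|lborel. indicator {0<..} s *\<^sub>R f s) = \<bar>t\<bar> *\<^sub>R (LINT x|lborel. indicator {0<..} (0 + t * x) *\<^sub>R f (0 + t * x))"
    using t by (intro lborel_integral_real_affine) auto
  also have "(LINT x|lborel. indicator {0<..} (0 + t * x) *\<^sub>R f (0 + t * x)) = (LINT x|lborel. indicator {0<..} x *\<^sub>R f (t * x))"
    using t by (intro Bochner_Integration.integral_cong refl) (auto simp: indicator_def zero_less_mult_iff)
  finally show ?thesis using t by (simp add: set_lebesgue_integral_def)
qed

lemma set_integrable_scale:
  fixes f :: "real \<Rightarrow> real"
  assumes t: "t > 0" and f: "set_integrable lborel {0<..} f"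
  shows "set_integrable lborel {0<..} (\<lambda>x. f (t * x))"
proof -
  have "integrable lborel (\<lambda>x. indicator {0<..} (0 + t * x) *\<^sub>R f (0 + t * x))"
    using lborel_integrable_real_affine[OF f[unfolded set_integrable_def], of t 0] t by simp
  moreover have "(\<lambda>x. indicator {0<..} (0 + t * x) *\<^sub>R f (0 + t * x)) = (\<lambda>x. indicator {0<..} x *\<^sub>R f (t * x))"
    using t by (auto simp: indicator_def zero_less_mult_iff)
  ultimately show ?thesis by (simp add: set_integrable_def)
qed

locale rv_coefficients = ar_coefficients \<nu> c \<alpha> + stable_index \<gamma> for \<nu> c \<alpha> \<gamma> +
  assumes c_rv: "regularly_varying (\<gamma> - 1) c"
begin

lemma c_int: "set_integrable lborel {0<..<r} c"
proof (cases "r > 0")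
  case True
  have "set_integrable lborel {0<..<r} (\<lambda>t. exp r * (exp (- (1 * t)) * c t))"
    by (intro set_integrable_mult_right set_integrable_subset[OF laplace(1)]) auto
  then show ?thesis
  proof (rule set_integrable_bound)
    show "AE t in lborel. t \<in> {0<..<r} \<longrightarrow> norm (c t) \<le> norm (exp r * (exp (- (1 * t)) * c t))"
    proof (intro AE_I2 impI)
      fix t assume "t \<in> {0<..<r}"
      then have "1 \<le> exp r * exp (- (1 * t))" by (simp add: mult_exp_exp)
      then have "1 * c t \<le> (exp r * exp (- (1 * t))) * c t" using c_nonneg by (intro mult_right_mono) auto
      then show "norm (c t) \<le> norm (exp r * (exp (- (1 * t)) * c t))" using c_nonneg[of t] by (simp add: abs_mult mult.assoc)
    qed
  qed (auto simp: set_borel_measurable_def)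
next
  case False
  then show ?thesis by (simp add: set_integrable_def)
qed

text \<open>The Abelian direction. The margin \<open>\<gamma> / 2\<close> keeps both exponents
  \<open>\<gamma> - 1 - d\<close> and \<open>\<gamma> - 1 + d\<close> above -1, so the exponential
  weight is integrable against them.\<close>

lemma laplace_c_asymp:
  assumes k: "k > 0"
  shows "((\<lambda>t. (LINT x:{0<..}|lborel. exp (- (k * x)) * (c (t * x) / c t))) \<longlongrightarrow> Gamma \<gamma> * k powr (- \<gamma>)) at_top"
proof -
  define d where "d = \<gamma> / 2"
  have d: "d > 0" using gamma_gt by (simp add: d_def)
  have "((\<lambda>t. (LINT x:{0<..}|lborel. exp (- (k * x)) * (c (t * x) / c t))) \<longlongrightarrow> (LINT x:{0<..}|lborel. exp (- (k * x)) * x powr (\<gamma> - 1))) at_top"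
  proof (rule regularly_varying_dominated_convergence(1)[OF c_rv _ c_measurable c_int d, where W="\<lambda>x. exp (- (k * x))" and B=1])
    show "-1 < \<gamma> - 1" using gamma_gt by simp
    have "set_integrable lborel {0<..} (\<lambda>x. exp (- (k * x)) * x powr (\<gamma> / 2 - 1) + exp (- (k * x)) * x powr (3 * \<gamma> / 2 - 1))"
      using gamma_gt k by (intro set_integral_add exp_powr_integral) auto
    then show "set_integrable lborel {0<..} (\<lambda>x. exp (- (k * x)) * (x powr (\<gamma> - 1 - d) + x powr (\<gamma> - 1 + d)))"
      by (simp add: d_def distrib_left field_simps)
  qed (use k in auto)
  then show ?thesis using exp_powr_integral(2)[of \<gamma> k] gamma_gt k by simp
qed

text \<open>The relation between the transforms at \<open>k / t\<close> expresses the transform of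
  the rescaled \<alpha> as the reciprocal of the one of the rescaled \<open>c\<close>, whose limit
  is known.\<close>

lemma laplace_alpha_asymp:
  assumes k: "k > 0"
  shows "((\<lambda>t. (LINT x:{0<..}|lborel. exp (- (k * x)) * (t * c t * \<alpha> (t * x)))) \<longlongrightarrow> k powr (\<gamma> - 1) / Gamma \<gamma>) at_top"
proof -
  have G: "Gamma \<gamma> > 0" using gamma_gt by (intro Gamma_real_pos) auto
  have "((\<lambda>t. 1 / (k * (LINT x:{0<..}|lborel. exp (- (k * x)) * (c (t * x) / c t)))) \<longlongrightarrow> 1 / (k * (Gamma \<gamma> * k powr (- \<gamma>)))) at_top"
    using G k by (intro tendsto_intros laplace_c_asymp k) auto
  moreover have "1 / (k * (Gamma \<gamma> * k powr (- \<gamma>))) = k powr (\<gamma> - 1) / Gamma \<gamma>"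
    using k by (simp add: powr_diff powr_minus_divide)
  moreover have "eventually (\<lambda>t. 1 / (k * (LINT x:{0<..}|lborel. exp (- (k * x)) * (c (t * x) / c t)))
     = (LINT x:{0<..}|lborel. exp (- (k * x)) * (t * c t * \<alpha> (t * x)))) at_top"
    using eventually_gt_at_top[of 0]
  proof eventually_elim
    case (elim t)
    have y: "k / t > 0" using k elim by simp
    let ?C = "LINT s:{0<..}|lborel. exp (- (k / t * s)) * c s" and ?A = "LINT s:{0<..}|lborel. exp (- (k / t * s)) * \<alpha> s"
    have L: "k / t * ?C * ?A = 1" by (rule laplace(3)[OF y])
    have c0: "c t > 0" by (rule c_pos[OF elim])
    have 1: "(LINT x:{0<..}|lborel. exp (- (k * x)) * (c (t * x) / c t)) = ?C / (t * c t)"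
    proof -
      have "(LINT x:{0<..}|lborel. exp (- (k * x)) * (c (t * x) / c t)) = (LINT x:{0<..}|lborel. (exp (- (k / t * (t * x))) * c (t * x)) / c t)"
        using elim by (intro set_lebesgue_integral_cong) auto
      also have "\<dots> = (LINT x:{0<..}|lborel. exp (- (k / t * (t * x))) * c (t * x)) / c t" by simp
      also have "\<dots> = ?C / (t * c t)" using set_integral_scale[OF elim, of "\<lambda>s. exp (- (k / t * s)) * c s"] by simp
      finally show ?thesis .
    qed
    have 2: "(LINT x:{0<..}|lborel. exp (- (k * x)) * (t * c t * \<alpha> (t * x))) = c t * ?A"
    proof -
      have "(LINT x:{0<..}|lborel. exp (- (k * x)) * (t * c t * \<alpha> (t * x))) = (LINT x:{0<..}|lborel. (t * c t) * (exp (- (k / t * (t * x))) * \<alpha> (t * x)))"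
        using elim by (intro set_lebesgue_integral_cong) auto
      also have "\<dots> = (t * c t) * (LINT x:{0<..}|lborel. exp (- (k / t * (t * x))) * \<alpha> (t * x))" by (rule set_integral_mult_right)
      also have "\<dots> = c t * ?A" using set_integral_scale[OF elim, of "\<lambda>s. exp (- (k / t * s)) * \<alpha> s"] elim by simp
      finally show ?thesis .
    qed
    have "?C \<noteq> 0" using L by auto
    have "1 / (k * (?C / (t * c t))) = t * c t / (k * ?C)" by simp
    also have "\<dots> = c t * ?A" using L k elim \<open>?C \<noteq> 0\<close> c0 by (simp add: field_simps)
    finally show ?case unfolding 1 2 .
  qed
  ultimately show ?thesis by (simp add: tendsto_cong)
qed

text \<open>The Tauberian direction: the transforms at all positive integers converge to those of
  \<open>\<kappa> * x powr (- \<gamma>)\<close>, and the rescaled \<alpha> is decreasing. Reflection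
  identifies \<open>1 / (Gamma \<gamma> * Gamma (1 - \<gamma>))\<close> with \<kappa>.\<close>

lemma c_alpha_limit:
  assumes x: "x > 0"
  shows "((\<lambda>t. t * c t * \<alpha> (t * x)) \<longlongrightarrow> \<kappa> * x powr (- \<gamma>)) at_top"
proof (rule tendsto_at_topI_sequentially)
  fix X :: "nat \<Rightarrow> real" assume X: "filterlim X at_top sequentially"
  \<comment> \<open>Only large values matter for the limit; the cut at 1 makes the rescaled
    functions monotone and integrable for every \<open>n\<close>.\<close>
  define Y where "Y n = max 1 (X n)" for n
  have Y: "Y n > 0" for n by (simp add: Y_def)
  have Yt: "filterlim Y at_top sequentially" by (rule filterlim_at_top_mono[OF X]) (auto simp: Y_def)
  have G: "Gamma \<gamma> * Gamma (1 - \<gamma>) = 1 / \<kappa>" "Gamma \<gamma> > 0" "Gamma (1 - \<gamma>) > 0"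
    using Gamma_reflection_real[of \<gamma>] gamma_gt gamma_lt by (auto intro: Gamma_real_pos)
  have "(\<lambda>n. Y n * c (Y n) * \<alpha> (Y n * x)) \<longlonglongrightarrow> \<kappa> * x powr (- \<gamma>)"
  proof (rule laplace_pointwise_convergence[where f="\<lambda>n x. Y n * c (Y n) * \<alpha> (Y n * x)" and g="\<lambda>x. \<kappa> * x powr (- \<gamma>)" and x=x])
    show "set_integrable lborel {0<..} (\<lambda>t. exp (- t) * (Y n * c (Y n) * \<alpha> (Y n * t)))" for n
    proof -
      have "set_integrable lborel {0<..} (\<lambda>t. (Y n * c (Y n)) * (exp (- (1 / Y n * (Y n * t))) * \<alpha> (Y n * t)))"
        using Y[of n] by (intro set_integrable_mult_right set_integrable_scale laplace(2)) auto
      then show ?thesis using Y[of n] by (simp add: mult_ac)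
    qed
    show "0 \<le> Y n * c (Y n) * \<alpha> (Y n * t)" if "t > 0" for n t
      using Y[of n] that by (intro mult_nonneg_nonneg alpha_nonneg c_nonneg) auto
    show "Y n * c (Y n) * \<alpha> (Y n * t) \<le> Y n * c (Y n) * \<alpha> (Y n * s)" if "0 < s" "s \<le> t" for n s t
      using Y[of n] that by (intro mult_left_mono alpha_antimono mult_nonneg_nonneg c_nonneg) auto
    have e: "exp (- t) * (\<kappa> * t powr (- \<gamma>)) = \<kappa> * (exp (- (1 * t)) * t powr ((1 - \<gamma>) - 1))" for t by simp
    show "set_integrable lborel {0<..} (\<lambda>t. exp (- t) * (\<kappa> * t powr (- \<gamma>)))"
      unfolding e using gamma_lt by (intro set_integrable_mult_right exp_powr_integral) auto
    fix k :: nat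
    have k: "real (Suc k) > 0" by simp
    have ex: "exp (- t) ^ k * (exp (- t) * X) = exp (- (real (Suc k) * t)) * X" for t X :: real
      by (simp add: exp_of_nat_mult[symmetric] mult_exp_exp algebra_simps)
    have "(LINT t:{0<..}|lborel. exp (- t) ^ k * (exp (- t) * (\<kappa> * t powr (- \<gamma>)))) = \<kappa> * (LINT t:{0<..}|lborel. exp (- (real (Suc k) * t)) * t powr ((1 - \<gamma>) - 1))"
      unfolding ex set_integral_mult_right[symmetric] by (intro set_lebesgue_integral_cong) auto
    also have "\<dots> = \<kappa> * (Gamma (1 - \<gamma>) * real (Suc k) powr (- (1 - \<gamma>)))"
      using gamma_lt by (subst exp_powr_integral(2)) auto
    also have "\<dots> = real (Suc k) powr (\<gamma> - 1) / Gamma \<gamma>"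
    proof -
      have "\<kappa> * Gamma (1 - \<gamma>) = 1 / Gamma \<gamma>"
      proof -
        have "\<kappa> = 1 / (Gamma \<gamma> * Gamma (1 - \<gamma>))" unfolding G(1) by simp
        then show ?thesis using G(2,3) by simp
      qed
      then show ?thesis by (simp add: mult.assoc[symmetric])
    qed
    finally have v: "(LINT t:{0<..}|lborel. exp (- t) ^ k * (exp (- t) * (\<kappa> * t powr (- \<gamma>)))) = real (Suc k) powr (\<gamma> - 1) / Gamma \<gamma>" .
    show "(\<lambda>n. LINT t:{0<..}|lborel. exp (- t) ^ k * (exp (- t) * (Y n * c (Y n) * \<alpha> (Y n * t))))
      \<longlonglongrightarrow> (LINT t:{0<..}|lborel. exp (- t) ^ k * (exp (- t) * (\<kappa> * t powr (- \<gamma>))))"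
      unfolding v unfolding ex by (rule filterlim_compose[OF laplace_alpha_asymp[OF k] Yt])
  qed (use x in \<open>auto intro!: continuous_intros\<close>)
  moreover have "eventually (\<lambda>n. Y n * c (Y n) * \<alpha> (Y n * x) = X n * c (X n) * \<alpha> (X n * x)) sequentially"
    using X[unfolded filterlim_at_top, rule_format, of 1] by eventually_elim (simp add: Y_def max_def)
  ultimately show "(\<lambda>n. X n * c (X n) * \<alpha> (X n * x)) \<longlonglongrightarrow> \<kappa> * x powr (- \<gamma>)" by (rule Lim_transform_eventually)
qed

lemma c_alpha_limit_1: "((\<lambda>t. t * c t * \<alpha> t) \<longlongrightarrow> \<kappa>) at_top"
  using c_alpha_limit[of 1] by simp

text \<open>A decreasing function that is positive arbitrarily far out is positive
  everywhere.\<close>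

lemma alpha_pos: assumes s: "s > 0" shows "\<alpha> s > 0"
proof -
  have "eventually (\<lambda>t. t * c t * \<alpha> t > 0) at_top" by (rule order_tendstoD(1)[OF c_alpha_limit_1 kappa_pos])
  then obtain t where t: "t \<ge> max s 1" "t * c t * \<alpha> t > 0"
    using eventually_happens[OF eventually_conj[OF eventually_ge_at_top[of "max s 1"]]] by auto
  moreover have "t * c t > 0" using c_pos[of t] t by simp
  ultimately have "\<alpha> t > 0" by (metis zero_less_mult_pos)
  then show ?thesis using alpha_antimono[OF s, of t] t by simp
qed

text \<open>\<alpha> and its derivative are constrained on the positive half line only; the
  extension by 0 makes them Borel functions on the whole line.\<close>

definition A0 :: "real \<Rightarrow> real" where "A0 t = (if t > 0 then \<alpha> t else 0)"
definition a0 :: "real \<Rightarrow> real" where "a0 t = (if t > 0 then ar_coeff \<alpha> t else 0)"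

lemma A0_measurable [measurable]: "A0 \<in> borel_measurable borel"
proof -
  have "(\<lambda>t. indicator {0<..} t *\<^sub>R \<alpha> t) \<in> borel_measurable borel"
    using alpha_cont by (intro borel_measurable_continuous_on_indicator continuous_at_imp_continuous_on) auto
  moreover have "(\<lambda>t. indicator {0<..} t *\<^sub>R \<alpha> t) = A0" by (auto split: split_indicator simp: A0_def)
  ultimately show ?thesis by simp
qed

lemma A0_ratio: assumes x: "x > 0" shows "((\<lambda>t. A0 (t * x) / A0 t) \<longlongrightarrow> x powr (- \<gamma>)) at_top"
proof -
  have "((\<lambda>t. (t * c t * \<alpha> (t * x)) / (t * c t * \<alpha> t)) \<longlongrightarrow> (\<kappa> * x powr (- \<gamma>)) / \<kappa>) at_top"
    using kappa_pos by (intro tendsto_divide c_alpha_limit c_alpha_limit_1 x) auto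
  moreover have "eventually (\<lambda>t. (t * c t * \<alpha> (t * x)) / (t * c t * \<alpha> t) = A0 (t * x) / A0 t) at_top"
    using eventually_gt_at_top[of 0] by eventually_elim (use x c_pos in \<open>auto simp: A0_def less_imp_neq[symmetric]\<close>)
  ultimately show ?thesis using theta by (simp add: tendsto_cong)
qed

lemma A0_rv: "regularly_varying (- \<gamma>) A0"
  unfolding regularly_varying_def
  by (intro conjI allI impI A0_ratio exI[of _ 1]) (auto intro: measurable_restrict_space1 simp: A0_def alpha_pos)

lemma alpha_deriv: "t > 0 \<Longrightarrow> (\<alpha> has_real_derivative (- a0 t)) (at t)"
  using alpha_differentiable[of t] by (simp add: a0_def ar_coeff_def real_differentiable_def DERIV_imp_deriv)
    (metis DERIV_imp_deriv)

lemma right_quotient: assumes t: "t > 0" shows "((\<lambda>d. (\<alpha> t - \<alpha> (t + d)) / d) \<longlongrightarrow> a0 t) (at_right 0)"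
proof -
  have "((\<lambda>d. (\<alpha> (t + d) - \<alpha> t) / d) \<longlongrightarrow> - a0 t) (at 0)"
    using alpha_deriv[OF t] by (simp add: DERIV_def)
  then have "((\<lambda>d. (\<alpha> (t + d) - \<alpha> t) / d) \<longlongrightarrow> - a0 t) (at_right 0)"
    by (rule filterlim_mono) (auto simp: at_le)
  then have "((\<lambda>d. - ((\<alpha> (t + d) - \<alpha> t) / d)) \<longlongrightarrow> - (- a0 t)) (at_right 0)" by (rule tendsto_minus)
  then show ?thesis by (simp add: minus_divide_left)
qed

lemma a0_nonneg: "0 \<le> a0 t"
proof (cases "t > 0")
  case True
  show ?thesis
  proof (rule tendsto_lowerbound[OF right_quotient[OF True]])
    show "\<forall>\<^sub>F d in at_right 0. 0 \<le> (\<alpha> t - \<alpha> (t + d)) / d"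
      using eventually_at_right_less[of 0] by eventually_elim (use True alpha_antimono in auto)
  qed simp
qed (simp add: a0_def)

lemma a0_antimono: assumes "0 < s" "s \<le> t" shows "a0 t \<le> a0 s"
proof (rule tendsto_le[OF _ right_quotient right_quotient])
  show "\<forall>\<^sub>F d in at_right 0. (\<alpha> t - \<alpha> (t + d)) / d \<le> (\<alpha> s - \<alpha> (s + d)) / d"
    using eventually_at_right_less[of 0] by eventually_elim (use assms alpha_increments in \<open>auto intro!: divide_right_mono\<close>)
qed (use assms in auto)

lemma alpha_mvt: assumes "0 < s" "s < t"
  shows "(t - s) * a0 t \<le> \<alpha> s - \<alpha> t" "\<alpha> s - \<alpha> t \<le> (t - s) * a0 s"
proof -
  obtain z where z: "s < z" "z < t" "\<alpha> t - \<alpha> s = (t - s) * (- a0 z)"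
    using MVT2[of s t \<alpha> "\<lambda>t. - a0 t"] assms alpha_deriv by auto
  have "a0 t \<le> a0 z" "a0 z \<le> a0 s" using z assms by (auto intro!: a0_antimono)
  then have "(t - s) * a0 t \<le> (t - s) * a0 z" "(t - s) * a0 z \<le> (t - s) * a0 s" using assms by (auto intro!: mult_left_mono)
  then show "(t - s) * a0 t \<le> \<alpha> s - \<alpha> t" "\<alpha> s - \<alpha> t \<le> (t - s) * a0 s" using z(3) by auto
qed

text \<open>The monotone density theorem. Because \<open>a0\<close> decreases, the increment of
  \<alpha> between \<open>t\<close> and \<open>t * x\<close> bounds \<open>t * a0 t\<close> from
  below for \<open>x > 1\<close> and from above for \<open>x < 1\<close>. The bounds converge to
  difference quotients of \<open>x powr (- \<gamma>)\<close>, up to sign, and these tend to \<gamma>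
  as \<open>x\<close> tends to 1.\<close>

lemma a0_limit: "((\<lambda>t. t * a0 t / A0 t) \<longlongrightarrow> \<gamma>) at_top"
proof -
  have "((\<lambda>x. x powr (- \<gamma>)) has_real_derivative - \<gamma>) (at 1)"
    by (auto intro!: derivative_eq_intros)
  then have "((\<lambda>x. (x powr (- \<gamma>) - 1) / (x - 1)) \<longlongrightarrow> - \<gamma>) (at 1)" by (simp add: has_field_derivative_iff)
  then have "((\<lambda>x. - ((x powr (- \<gamma>) - 1) / (x - 1))) \<longlongrightarrow> - (- \<gamma>)) (at 1)" by (rule tendsto_minus)
  then have q: "((\<lambda>x. (1 - x powr (- \<gamma>)) / (x - 1)) \<longlongrightarrow> \<gamma>) (at 1)" by (simp add: minus_divide_left)
  have lim: "((\<lambda>t. (1 - A0 (t * x) / A0 t) / (x - 1)) \<longlongrightarrow> (1 - x powr (- \<gamma>)) / (x - 1)) at_top" if "x > 0" "x \<noteq> 1" for x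
    using that by (intro tendsto_intros A0_ratio) auto
  show ?thesis
  proof (rule order_tendstoI)
    fix y assume y: "y < \<gamma>"
    have "eventually (\<lambda>x. y < (1 - x powr (- \<gamma>)) / (x - 1)) (at_right 1)"
      using order_tendstoD(1)[OF q y] by (rule filter_leD[rotated]) (auto simp: at_le)
    then obtain x where x: "x > 1" "y < (1 - x powr (- \<gamma>)) / (x - 1)"
      using eventually_happens[OF eventually_conj[OF _ eventually_at_right_less[of "1::real"]]] by auto
    have xx: "x > 0" "x \<noteq> 1" using x by auto
    show "eventually (\<lambda>t. y < t * a0 t / A0 t) at_top"
      using order_tendstoD(1)[OF lim[OF xx] x(2)] eventually_gt_at_top[of 0]
    proof eventually_elim
      case (elim t)
      have p: "A0 t > 0" using elim alpha_pos by (simp add: A0_def)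
      have "\<alpha> t - \<alpha> (t * x) \<le> (t * x - t) * a0 t" using elim x by (intro alpha_mvt) auto
      then have "A0 t - A0 (t * x) \<le> (x - 1) * (t * a0 t)" using elim xx by (simp add: A0_def algebra_simps)
      then have "(A0 t - A0 (t * x)) / A0 t / (x - 1) \<le> (x - 1) * (t * a0 t) / A0 t / (x - 1)"
        using p x by (intro divide_right_mono) auto
      moreover have "(A0 t - A0 (t * x)) / A0 t = 1 - A0 (t * x) / A0 t" using p by (simp add: diff_divide_distrib)
      ultimately show ?case using elim(1) x by simp
    qed
  next
    fix y assume y: "y > \<gamma>"
    have "eventually (\<lambda>x. (1 - x powr (- \<gamma>)) / (x - 1) < y \<and> 0 < x) (at_left 1)"
    proof (rule eventually_conj)
      show "eventually (\<lambda>x. (1 - x powr (- \<gamma>)) / (x - 1) < y) (at_left 1)"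
        using order_tendstoD(2)[OF q y] by (rule filter_leD[rotated]) (auto simp: at_le)
      show "eventually (\<lambda>x::real. 0 < x) (at_left 1)"
        using eventually_at_left_real[of 0 "1::real"] by (auto elim!: eventually_mono)
    qed
    then obtain x where x: "x < 1" "0 < x" "(1 - x powr (- \<gamma>)) / (x - 1) < y"
      using eventually_happens[OF eventually_conj[OF _ eventually_at_left_real[of 0 "1::real"]]] by auto
    have xx: "x > 0" "x \<noteq> 1" using x by auto
    show "eventually (\<lambda>t. t * a0 t / A0 t < y) at_top"
      using order_tendstoD(2)[OF lim[OF xx] x(3)] eventually_gt_at_top[of 0]
    proof eventually_elim
      case (elim t)
      have p: "A0 t > 0" using elim alpha_pos by (simp add: A0_def)
      have "(t - t * x) * a0 t \<le> \<alpha> (t * x) - \<alpha> t" using elim x by (intro alpha_mvt) auto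
      then have "(1 - x) * (t * a0 t) \<le> A0 (t * x) - A0 t" using elim xx by (simp add: A0_def algebra_simps)
      then have "(1 - x) * (t * a0 t) / A0 t / (1 - x) \<le> (A0 (t * x) - A0 t) / A0 t / (1 - x)"
        using p x by (intro divide_right_mono) auto
      moreover have "(A0 (t * x) - A0 t) / A0 t / (1 - x) = (1 - A0 (t * x) / A0 t) / (x - 1)"
        using p x by (simp add: divide_simps) (simp add: algebra_simps)
      ultimately show ?case using elim(1) x by simp
    qed
  qed
qed

lemma a0_pos: assumes s: "s > 0" shows "a0 s > 0"
proof -
  have g: "0 < \<gamma>" using gamma_gt by simp
  have "eventually (\<lambda>t. t * a0 t / A0 t > 0) at_top" by (rule order_tendstoD(1)[OF a0_limit g])
  then obtain t where t: "t \<ge> max s 1" "t * a0 t / A0 t > 0"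
    using eventually_happens[OF eventually_conj[OF eventually_ge_at_top[of "max s 1"]]] by auto
  then have "a0 t \<noteq> 0" by auto
  then have "a0 t > 0" using a0_nonneg[of t] by simp
  then show ?thesis using a0_antimono[OF s, of t] t by simp
qed

lemma a0_measurable [measurable]: "a0 \<in> borel_measurable borel"
proof -
  have "mono_on {0<..} (\<lambda>t. - a0 t)" by (auto intro!: mono_onI a0_antimono)
  then have "(\<lambda>t. - a0 t) \<in> borel_measurable (restrict_space borel {0<..})" by (rule borel_measurable_mono_on_fnc)
  then have "(\<lambda>t. if t \<in> {0<..} then - a0 t else 0) \<in> borel_measurable borel"
    by (subst (asm) measurable_restrict_space_iff[where c=0]) auto
  then have "(\<lambda>t. - (if t \<in> {0<..} then - a0 t else 0)) \<in> borel_measurable borel" by measurable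
  moreover have "(\<lambda>t. - (if t \<in> {0<..} then - a0 t else 0)) = a0" by (auto simp: a0_def)
  ultimately show ?thesis by (simp only:)
qed

lemma a0_rv: "regularly_varying (- \<gamma> - 1) a0"
proof (rule regularly_varying_asymp)
  show "regularly_varying (- \<gamma> - 1) (\<lambda>t. A0 t * t powr (- 1))"
    using regularly_varying_mult[OF A0_rv regularly_varying_powr[of "- 1"]] by simp
  have "eventually (\<lambda>t. t * a0 t / A0 t = a0 t / (A0 t * t powr (- 1))) at_top"
    using eventually_gt_at_top[of 0] by eventually_elim (simp add: powr_minus_divide)
  then show "((\<lambda>t. a0 t / (A0 t * t powr (- 1))) \<longlongrightarrow> \<gamma>) at_top"
    by (rule Lim_transform_eventually[OF a0_limit])
qed (use gamma_gt in auto)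

lemma a0_tail: assumes s: "s > 0" shows "(\<integral>\<^sup>+v\<in>{s..}. ennreal (a0 v) \<partial>lborel) = ennreal (A0 s)"
proof -
  have "(\<integral>\<^sup>+v\<in>{s..}. ennreal (a0 v) \<partial>lborel) = ennreal (0 - (- \<alpha> s))"
  proof (rule nn_integral_FTC_atLeast)
    show "((\<lambda>t. - \<alpha> t) has_real_derivative a0 x) (at x)" if "s \<le> x" for x
      using DERIV_minus[OF alpha_deriv[of x]] that s by simp
    have "(A0 \<longlongrightarrow> 0) at_top" by (rule regularly_varying_tendsto_0[OF A0_rv]) (use gamma_gt in simp)
    moreover have "eventually (\<lambda>t. A0 t = \<alpha> t) at_top" using eventually_gt_at_top[of 0] by eventually_elim (simp add: A0_def)
    ultimately have "(\<alpha> \<longlongrightarrow> 0) at_top" by (rule Lim_transform_eventually)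
    then show "((\<lambda>t. - \<alpha> t) \<longlongrightarrow> 0) at_top" using tendsto_minus by fastforce
  qed (auto simp: a0_nonneg)
  then show ?thesis using s by (simp add: A0_def)
qed

lemma A0_int: "set_integrable lborel {0<..<r} A0"
proof (cases "r > 0")
  case True
  have "set_integrable lborel {0<..<r} (\<lambda>t. exp r * (exp (- (1 * t)) * \<alpha> t))"
    by (intro set_integrable_mult_right set_integrable_subset[OF laplace(2)]) auto
  then show ?thesis
  proof (rule set_integrable_bound)
    show "AE t in lborel. t \<in> {0<..<r} \<longrightarrow> norm (A0 t) \<le> norm (exp r * (exp (- (1 * t)) * \<alpha> t))"
    proof (intro AE_I2 impI)
      fix t assume t: "t \<in> {0<..<r}"
      then have "1 \<le> exp r * exp (- (1 * t))" by (simp add: mult_exp_exp)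
      moreover have "0 \<le> \<alpha> t" using t by (intro alpha_nonneg) auto
      ultimately have "1 * \<alpha> t \<le> (exp r * exp (- (1 * t))) * \<alpha> t" by (intro mult_right_mono) auto
      then show "norm (A0 t) \<le> norm (exp r * (exp (- (1 * t)) * \<alpha> t))"
        using t \<open>0 \<le> \<alpha> t\<close> by (simp add: abs_mult mult.assoc A0_def)
    qed
  qed (auto simp: set_borel_measurable_def)
next
  case False
  then show ?thesis by (simp add: set_integrable_def)
qed

lemma convolution_A0: assumes u: "u > 0" shows "(\<integral>\<^sup>+v\<in>{0<..<u}. ennreal (c (u - v) * A0 v) \<partial>lborel) \<le> 1"
proof -
  have "(\<integral>\<^sup>+v\<in>{0<..<u}. ennreal (c (u - v) * A0 v) \<partial>lborel) = (\<integral>\<^sup>+v\<in>{0<..<u}. ennreal (c (u - v) * \<alpha> v) \<partial>lborel)"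
    by (intro nn_integral_cong) (auto simp: A0_def split: split_indicator)
  then show ?thesis using convolution_le_1[OF u] by simp
qed

end

subsection \<open>The overshoot kernel\<close>

lemma powr_integrable_near_0:
  fixes q u :: real
  assumes "q > -1"
  shows "set_integrable lborel {0<..<u} (\<lambda>x. x powr q)"
proof (cases "u > 0")
  case True
  have "((\<lambda>x. x powr q) has_integral (u powr (q + 1) / (q + 1))) {0..u}"
    using assms True by (intro has_integral_powr_from_0) auto
  then have "(\<integral>\<^sup>+x. ennreal (indicator {0..u} x * x powr q) \<partial>lborel) = ennreal (u powr (q + 1) / (q + 1))"
    by (intro nn_integral_has_integral_lebesgue) auto
  then have "(\<integral>\<^sup>+x\<in>{0..u}. ennreal (x powr q) \<partial>lborel) < \<infinity>"
    by (simp add: indicator_mult_ennreal mult.commute flip: ennreal_indicator ennreal_mult'')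
  then have "set_integrable lborel {0..u} (\<lambda>x. x powr q)"
    by (intro set_integrable_nonneg_bound) (auto simp: set_borel_measurable_def)
  then show ?thesis by (rule set_integrable_subset) auto
qed (simp add: set_integrable_def)

lemma powr_integrable_at_top:
  fixes q a :: real
  assumes "q < -1" "a > 0"
  shows "set_integrable lborel {a..} (\<lambda>x. x powr q)"
proof -
  have "(\<integral>\<^sup>+u\<in>{a..}. ennreal (u powr (- (- q))) \<partial>lborel) = ennreal (a powr (1 - (- q)) / ((- q) - 1))"
    using assms by (intro powr_tail_nn_integral) auto
  then show ?thesis by (intro set_integrable_nonneg_bound) (auto simp: set_borel_measurable_def)
qed

lemma powr_piecewise_integrable:
  fixes q r a :: real
  assumes "q > -1" "r < -1" "a > 0"
  shows "set_integrable lborel {0<..} (\<lambda>x. if x < a then x powr q else x powr r)"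
proof -
  have "set_integrable lborel ({0<..<a} \<union> {a..}) (\<lambda>x. if x < a then x powr q else x powr r)"
  proof (rule set_integrable_Un)
    show "set_integrable lborel {0<..<a} (\<lambda>x. if x < a then x powr q else x powr r)"
      by (rule set_integrable_cong[THEN iffD1, OF refl refl _ powr_integrable_near_0[OF assms(1)]]) auto
    show "set_integrable lborel {a..} (\<lambda>x. if x < a then x powr q else x powr r)"
      by (rule set_integrable_cong[THEN iffD1, OF refl refl _ powr_integrable_at_top[OF assms(2,3)]]) auto
  qed auto
  moreover have "{0<..<a} \<union> {a..} = {0<..}" using assms by auto
  ultimately show ?thesis by simp
qed

lemma b_coeff_measurable:
  assumes [measurable]: "c \<in> borel_measurable borel" "a \<in> borel_measurable borel"
    and [measurable]: "f \<in> borel_measurable M" "g \<in> borel_measurable M"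
  shows "(\<lambda>x. b_coeff c a (f x) (g x)) \<in> borel_measurable M"
proof -
  have "(\<lambda>z. b_coeff c a (fst z) (snd z)) = (\<lambda>z. LINT v|lborel. (if 0 < v \<and> v < snd z then c (snd z - v) * a (fst z + v) else 0))"
    unfolding b_coeff_def set_lebesgue_integral_def by (intro ext Bochner_Integration.integral_cong) (auto split: split_indicator)
  also have "\<dots> \<in> borel_measurable (borel \<Otimes>\<^sub>M borel)" by measurable
  finally have "(\<lambda>z. b_coeff c a (fst z) (snd z)) \<in> borel_measurable (borel \<Otimes>\<^sub>M borel)" .
  from measurable_compose[OF measurable_Pair[OF assms(3,4)] this] show ?thesis by simp
qed

text \<open>Modelled on a subordinator with potential density \<open>c\<close>, jump density
  \<open>a\<close> and jump tail \<open>A\<close>: then \<open>b s u\<close> is the density of the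
  overshoot \<open>s\<close> beyond the level \<open>u\<close>, the integral summing over the last
  position \<open>u - v\<close> before the jump. The convolution hypothesis says that the overshoot
  has mass at most 1.\<close>

locale overshoot = stable_index \<gamma> for \<gamma> +
  fixes c a A :: "real \<Rightarrow> real"
  assumes c_m [measurable]: "c \<in> borel_measurable borel" and c_np: "\<And>t. t \<le> 0 \<Longrightarrow> c t = 0"
    and c_p: "\<And>t. t > 0 \<Longrightarrow> c t > 0" and c_anti: "\<And>s t. 0 < s \<Longrightarrow> s \<le> t \<Longrightarrow> c t \<le> c s"
    and c_i: "\<And>r. set_integrable lborel {0<..<r} c"
    and a_m [measurable]: "a \<in> borel_measurable borel"
    and a_nn: "\<And>t. 0 \<le> a t"
    and a_p: "\<And>t. t > 0 \<Longrightarrow> a t > 0" and a_anti: "\<And>s t. 0 < s \<Longrightarrow> s \<le> t \<Longrightarrow> a t \<le> a s"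
    and A_m [measurable]: "A \<in> borel_measurable borel"
    and A_p: "\<And>t. t > 0 \<Longrightarrow> A t > 0" and A_i: "\<And>r. set_integrable lborel {0<..<r} A"
    and a_tail: "\<And>s. s > 0 \<Longrightarrow> (\<integral>\<^sup>+v\<in>{s..}. ennreal (a v) \<partial>lborel) = ennreal (A s)"
    and conv: "\<And>u. u > 0 \<Longrightarrow> (\<integral>\<^sup>+v\<in>{0<..<u}. ennreal (c (u - v) * A v) \<partial>lborel) \<le> 1"
    and c_rv: "regularly_varying (\<gamma> - 1) c" and a_rv: "regularly_varying (- \<gamma> - 1) a"
    and A_rv: "regularly_varying (- \<gamma>) A"
    and cA_lim: "((\<lambda>t. t * c t * A t) \<longlongrightarrow> \<kappa>) at_top"
    and aA_lim: "((\<lambda>t. t * a t / A t) \<longlongrightarrow> \<gamma>) at_top"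
begin

abbreviation "b \<equiv> b_coeff c a"

lemma b_m [measurable (raw)]: "f \<in> borel_measurable M \<Longrightarrow> g \<in> borel_measurable M \<Longrightarrow> (\<lambda>x. b (f x) (g x)) \<in> borel_measurable M"
  by (rule b_coeff_measurable[OF c_m a_m])

lemma c_nn: "0 \<le> c t"
  using c_p[of t] c_np[of t] by (cases "t > 0") auto

lemma A_anti: assumes "0 < s" "s \<le> t" shows "A t \<le> A s"
proof -
  have "ennreal (A t) = (\<integral>\<^sup>+v\<in>{t..}. ennreal (a v) \<partial>lborel)" using assms by (subst a_tail) auto
  also have "\<dots> \<le> (\<integral>\<^sup>+v\<in>{s..}. ennreal (a v) \<partial>lborel)" using assms by (intro nn_integral_mono) (auto split: split_indicator)
  also have "\<dots> = ennreal (A s)" using assms by (subst a_tail) auto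
  finally show ?thesis using A_p[of s] assms by simp
qed

definition Cc :: "real \<Rightarrow> real" where "Cc u = (LINT v:{0<..<u}|lborel. c v)"

lemma Cc_nn: "0 \<le> Cc u"
  unfolding Cc_def set_lebesgue_integral_def using c_nn by (intro integral_nonneg_AE AE_I2) (auto split: split_indicator)

lemma nn_Cc: "(\<integral>\<^sup>+v\<in>{0<..<u}. ennreal (c v) \<partial>lborel) = ennreal (Cc u)"
  unfolding Cc_def by (rule nn_set_integral_eq_set_integral[OF c_i]) (rule c_nn)

lemma nn_Cc': "(\<integral>\<^sup>+v. ennreal (c (u - v)) * indicator {w<..} v \<partial>lborel) = ennreal (Cc (u - w))"
proof -
  have "ennreal (Cc (u - w)) = (\<integral>\<^sup>+z. ennreal (c z) * indicator {0<..<u - w} z \<partial>lborel)" by (rule nn_Cc[symmetric])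
  also have "\<dots> = ennreal \<bar>- 1\<bar> * (\<integral>\<^sup>+v. ennreal (c (u + (- 1) * v)) * indicator {0<..<u - w} (u + (- 1) * v) \<partial>lborel)"
    by (rule nn_integral_real_affine) auto
  also have "\<dots> = (\<integral>\<^sup>+v. ennreal (c (u - v)) * indicator {w<..} v \<partial>lborel)"
    by (simp, intro nn_integral_cong) (auto simp: indicator_def c_np)
  finally show ?thesis ..
qed

lemma Cc_mono: "u \<le> w \<Longrightarrow> Cc u \<le> Cc w"
proof -
  assume "u \<le> w"
  then have "(\<integral>\<^sup>+v\<in>{0<..<u}. ennreal (c v) \<partial>lborel) \<le> (\<integral>\<^sup>+v\<in>{0<..<w}. ennreal (c v) \<partial>lborel)"
    by (intro nn_integral_mono) (auto split: split_indicator)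
  then show ?thesis unfolding nn_Cc using Cc_nn by simp
qed

lemma Cc_m [measurable]: "Cc \<in> borel_measurable borel"
  by (rule borel_measurable_mono) (auto intro: monoI Cc_mono)

lemma Cc_ge: assumes u: "u > 0" shows "u * c u \<le> Cc u"
proof -
  have "ennreal (u * c u) = (\<integral>\<^sup>+v. ennreal (c u) * indicator {0<..<u} v \<partial>lborel)"
    using u c_nn by (simp add: nn_integral_cmult_indicator ennreal_mult[symmetric] mult.commute)
  also have "\<dots> \<le> (\<integral>\<^sup>+v\<in>{0<..<u}. ennreal (c v) \<partial>lborel)"
    by (intro nn_integral_mono) (auto split: split_indicator intro!: ennreal_leI c_anti)
  finally show ?thesis unfolding nn_Cc using Cc_nn by simp
qed

lemma Cc_p: "u > 0 \<Longrightarrow> Cc u > 0"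
  using Cc_ge[of u] mult_pos_pos[of u "c u"] c_p[of u] by linarith

lemma b_nn: "0 \<le> b s u"
  unfolding b_coeff_def set_lebesgue_integral_def using c_nn a_nn
  by (intro integral_nonneg_AE AE_I2) (auto split: split_indicator)

lemma nn_kernel_le: assumes s: "s > 0"
  shows "(\<integral>\<^sup>+v\<in>{0<..<u}. ennreal (c (u - v) * a (s + v)) \<partial>lborel) \<le> ennreal (a s * Cc u)"
proof -
  have "(\<integral>\<^sup>+v\<in>{0<..<u}. ennreal (c (u - v) * a (s + v)) \<partial>lborel) \<le> (\<integral>\<^sup>+v. ennreal (a s) * (ennreal (c (u - v)) * indicator {0<..} v) \<partial>lborel)"
    using s a_anti[of s] c_nn a_nn
    by (intro nn_integral_mono) (auto split: split_indicator simp: ennreal_mult[symmetric] mult.commute intro!: ennreal_leI mult_right_mono)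
  also have "\<dots> = ennreal (a s) * ennreal (Cc (u - 0))"
    unfolding nn_Cc'[symmetric] by (rule nn_integral_cmult) measurable
  finally show ?thesis using a_nn Cc_nn by (simp add: ennreal_mult)
qed

lemma b_integrable: assumes s: "s > 0"
  shows "set_integrable lborel {0<..<u} (\<lambda>v. c (u - v) * a (s + v))"
  using le_less_trans[OF nn_kernel_le[OF s, of u]] c_nn a_nn
  by (intro set_integrable_nonneg_bound) (auto simp: set_borel_measurable_def)

lemma nn_b: assumes s: "s > 0"
  shows "ennreal (b s u) = (\<integral>\<^sup>+v. ennreal (c (u - v)) * ennreal (a (s + v)) * indicator {0<..} v \<partial>lborel)"
proof -
  have "ennreal (b s u) = (\<integral>\<^sup>+v\<in>{0<..<u}. ennreal (c (u - v) * a (s + v)) \<partial>lborel)"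
    unfolding b_coeff_def using c_nn a_nn by (intro nn_set_integral_eq_set_integral[symmetric] b_integrable s) auto
  also have "\<dots> = (\<integral>\<^sup>+v. ennreal (c (u - v)) * ennreal (a (s + v)) * indicator {0<..} v \<partial>lborel)"
    using c_nn a_nn by (intro nn_integral_cong) (auto simp: indicator_def ennreal_mult c_np)
  finally show ?thesis .
qed

text \<open>Together with \<open>b_ge\<close> the monotonicity of \<open>a\<close> encloses
  \<open>b s u\<close> between \<open>a (s + u) * Cc u\<close> and \<open>a s * Cc u\<close>. For a
  fixed level the two agree asymptotically as \<open>s\<close> grows, which is the source of the
  normalisation by \<open>a t * Cc T\<close>.\<close>

lemma b_le: assumes s: "s > 0" shows "b s u \<le> a s * Cc u"
proof -
  have "ennreal (b s u) \<le> ennreal (a s * Cc u)"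
    using nn_kernel_le[OF s, of u] unfolding b_coeff_def
    using c_nn a_nn by (subst nn_set_integral_eq_set_integral[symmetric, OF b_integrable[OF s]]) auto
  then show ?thesis using a_nn Cc_nn by (subst (asm) ennreal_le_iff) auto
qed

lemma b_ge: assumes s: "s > 0" shows "a (s + u) * Cc u \<le> b s u"
proof -
  have "ennreal (a (s + u) * Cc u) = ennreal (a (s + u)) * ennreal (Cc (u - 0))"
    using a_nn Cc_nn by (simp add: ennreal_mult)
  also have "\<dots> = (\<integral>\<^sup>+v. ennreal (a (s + u)) * (ennreal (c (u - v)) * indicator {0<..} v) \<partial>lborel)"
    unfolding nn_Cc'[symmetric] by (rule nn_integral_cmult[symmetric]) measurable
  also have "\<dots> \<le> (\<integral>\<^sup>+v. ennreal (c (u - v)) * ennreal (a (s + v)) * indicator {0<..} v \<partial>lborel)"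
  proof (rule nn_integral_mono)
    fix v :: real
    show "ennreal (a (s + u)) * (ennreal (c (u - v)) * indicator {0<..} v) \<le> ennreal (c (u - v)) * ennreal (a (s + v)) * indicator {0<..} v"
    proof (cases "0 < v \<and> v < u")
      case True
      then have "a (s + u) \<le> a (s + v)" using s by (intro a_anti) auto
      then have "ennreal (c (u - v)) * ennreal (a (s + u)) \<le> ennreal (c (u - v)) * ennreal (a (s + v))"
        by (intro mult_left_mono ennreal_leI) auto
      then show ?thesis using True by (simp add: mult.commute)
    next
      case False
      then show ?thesis by (auto simp: indicator_def c_np)
    qed
  qed
  also have "\<dots> = ennreal (b s u)" by (rule nn_b[OF s, symmetric])
  finally show ?thesis using b_nn by simp
qed

lemma shift_tail: assumes "w + s > 0" shows "(\<integral>\<^sup>+v. ennreal (a (w + v)) * indicator {s<..} v \<partial>lborel) = ennreal (A (w + s))"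
proof -
  have "ennreal (A (w + s)) = (\<integral>\<^sup>+z. ennreal (a z) * indicator {w + s..} z \<partial>lborel)" by (rule a_tail[OF assms, symmetric])
  also have "\<dots> = (\<integral>\<^sup>+v. ennreal (a (w + 1 * v)) * indicator {w + s..} (w + 1 * v) \<partial>lborel)"
    by (subst nn_integral_real_affine[where c=1 and t=w]) auto
  also have "\<dots> = (\<integral>\<^sup>+v. ennreal (a (w + v)) * indicator {s<..} v \<partial>lborel)"
    using AE_lborel_singleton[of s] by (intro nn_integral_cong_AE) (auto elim!: eventually_mono simp: indicator_def)
  finally show ?thesis ..
qed

text \<open>For \<open>v \<le> u / 2\<close> the argument of \<open>c\<close> is at least
  \<open>u / 2\<close>, for larger \<open>v\<close> that of \<open>a\<close> is. Unlike
  \<open>b_le\<close> this bound remains useful when the level is large compared with the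
  overshoot.\<close>

lemma b_le_split: assumes s: "s > 0" and u: "u > 0"
  shows "b s u \<le> c (u / 2) * A s + a (u / 2) * Cc (u / 2)"
proof -
  have "ennreal (b s u) = (\<integral>\<^sup>+v. ennreal (c (u - v)) * ennreal (a (s + v)) * indicator {0<..} v \<partial>lborel)" by (rule nn_b[OF s])
  also have "\<dots> \<le> (\<integral>\<^sup>+v. ennreal (c (u / 2)) * (ennreal (a (s + v)) * indicator {0<..} v) + ennreal (a (u / 2)) * (ennreal (c (u - v)) * indicator {u / 2<..} v) \<partial>lborel)"
  proof (rule nn_integral_mono)
    fix v :: real
    show "ennreal (c (u - v)) * ennreal (a (s + v)) * indicator {0<..} v
      \<le> ennreal (c (u / 2)) * (ennreal (a (s + v)) * indicator {0<..} v) + ennreal (a (u / 2)) * (ennreal (c (u - v)) * indicator {u / 2<..} v)"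
    proof (cases "v > u / 2")
      case True
      have "a (s + v) \<le> a (u / 2)" using True s u by (intro a_anti) auto
      then have "ennreal (c (u - v)) * ennreal (a (s + v)) \<le> ennreal (c (u - v)) * ennreal (a (u / 2))"
        by (intro mult_left_mono ennreal_leI) auto
      also have "\<dots> \<le> ennreal (c (u / 2)) * (ennreal (a (s + v)) * indicator {0<..} v) + ennreal (c (u - v)) * ennreal (a (u / 2))" by simp
      finally show ?thesis using True u by (simp add: mult.commute)
    next
      case False
      show ?thesis
      proof (cases "v > 0")
        case v: True
        have "c (u - v) \<le> c (u / 2)" using False u by (intro c_anti) auto
        then have "ennreal (c (u - v)) * ennreal (a (s + v)) \<le> ennreal (c (u / 2)) * ennreal (a (s + v))"
          by (intro mult_right_mono ennreal_leI) auto
        then show ?thesis using v False by simp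
      qed simp
    qed
  qed
  also have "\<dots> = ennreal (c (u / 2)) * ennreal (A (s + 0)) + ennreal (a (u / 2)) * ennreal (Cc (u - u / 2))"
    unfolding nn_Cc'[symmetric] using s by (subst nn_integral_add, measurable) (simp add: nn_integral_cmult shift_tail[of s 0, simplified])
  also have "\<dots> = ennreal (c (u / 2) * A s + a (u / 2) * Cc (u / 2))"
    using c_nn a_nn Cc_nn less_imp_le[OF A_p[OF s]] by (simp add: ennreal_mult ennreal_plus)
  finally show ?thesis
    using c_nn[of "u / 2"] a_nn[of "u / 2"] Cc_nn[of "u / 2"] less_imp_le[OF A_p[OF s]] by (subst (asm) ennreal_le_iff) auto
qed

text \<open>Exchanging the integrals leaves \<open>c\<close> integrated over an interval of length
  at most \<open>t\<close>, and the tail of \<open>a\<close> beyond \<open>s\<close>.\<close>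

lemma b_integral_le: assumes s: "s > 0"
  shows "(\<integral>\<^sup>+u. ennreal (b s u) * indicator {..<t} u \<partial>lborel) \<le> ennreal (Cc t * A s)"
proof -
  have "(\<integral>\<^sup>+u. ennreal (b s u) * indicator {..<t} u \<partial>lborel)
    = (\<integral>\<^sup>+u. (\<integral>\<^sup>+v. ennreal (c (u - v)) * ennreal (a (s + v)) * indicator {0<..} v * indicator {..<t} u \<partial>lborel) \<partial>lborel)"
    by (intro nn_integral_cong) (simp add: nn_b[OF s] nn_integral_multc)
  also have "\<dots> = (\<integral>\<^sup>+v. (\<integral>\<^sup>+u. ennreal (c (u - v)) * ennreal (a (s + v)) * indicator {0<..} v * indicator {..<t} u \<partial>lborel) \<partial>lborel)"
    by (rule lborel_pair.Fubini') measurable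
  also have "\<dots> \<le> (\<integral>\<^sup>+v. ennreal (Cc t) * (ennreal (a (s + v)) * indicator {0<..} v) \<partial>lborel)"
  proof (rule nn_integral_mono)
    fix v :: real
    show "(\<integral>\<^sup>+u. ennreal (c (u - v)) * ennreal (a (s + v)) * indicator {0<..} v * indicator {..<t} u \<partial>lborel)
      \<le> ennreal (Cc t) * (ennreal (a (s + v)) * indicator {0<..} v)"
    proof (cases "v > 0")
      case True
      have "(\<integral>\<^sup>+u. ennreal (c (u - v)) * ennreal (a (s + v)) * indicator {0<..} v * indicator {..<t} u \<partial>lborel)
        = (\<integral>\<^sup>+u. ennreal (a (s + v)) * (ennreal (c (u - v)) * indicator {..<t} u) \<partial>lborel)"
        using True by (intro nn_integral_cong) (simp add: mult_ac)
      also have "\<dots> = ennreal (a (s + v)) * (\<integral>\<^sup>+u. ennreal (c (u - v)) * indicator {..<t} u \<partial>lborel)"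
        by (rule nn_integral_cmult) measurable
      also have "\<dots> \<le> ennreal (a (s + v)) * ennreal (Cc t)"
      proof (rule mult_left_mono)
        have "(\<integral>\<^sup>+u. ennreal (c (u - v)) * indicator {..<t} u \<partial>lborel) = (\<integral>\<^sup>+z. ennreal (c z) * indicator {0<..<t - v} z \<partial>lborel)"
          using nn_integral_real_affine[of "\<lambda>z. ennreal (c z) * indicator {0<..<t - v} z" 1 "- v"]
          by (simp, intro nn_integral_cong) (auto simp: indicator_def c_np)
        also have "\<dots> = ennreal (Cc (t - v))" by (rule nn_Cc)
        also have "\<dots> \<le> ennreal (Cc t)" using True by (intro ennreal_leI Cc_mono) auto
        finally show "(\<integral>\<^sup>+u. ennreal (c (u - v)) * indicator {..<t} u \<partial>lborel) \<le> ennreal (Cc t)" .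
      qed simp
      finally show ?thesis using True by (simp add: mult.commute)
    qed simp
  qed
  also have "\<dots> = ennreal (Cc t) * ennreal (A (s + 0))"
    using s by (subst nn_integral_cmult) (auto simp: shift_tail[of s 0, simplified])
  finally show ?thesis using Cc_nn less_imp_le[OF A_p[OF s]] by (simp add: ennreal_mult)
qed

text \<open>Integrating over the overshoot first turns \<open>a (s + v)\<close> into
  \<open>A v\<close>; what remains is the convolution of \<open>c\<close> with
  \<open>A\<close>.\<close>

lemma b_mass: assumes u: "u > 0"
  shows "(\<integral>\<^sup>+s. ennreal (b s u) * indicator {0<..} s \<partial>lborel) \<le> 1"
proof -
  have "(\<integral>\<^sup>+s. ennreal (b s u) * indicator {0<..} s \<partial>lborel)
    = (\<integral>\<^sup>+s. (\<integral>\<^sup>+v. ennreal (c (u - v)) * ennreal (a (s + v)) * indicator {0<..} v * indicator {0<..} s \<partial>lborel) \<partial>lborel)"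
  proof (intro nn_integral_cong)
    fix s :: real
    show "ennreal (b s u) * indicator {0<..} s = (\<integral>\<^sup>+v. ennreal (c (u - v)) * ennreal (a (s + v)) * indicator {0<..} v * indicator {0<..} s \<partial>lborel)"
      by (cases "s > 0") (simp_all add: nn_b)
  qed
  also have "\<dots> = (\<integral>\<^sup>+v. (\<integral>\<^sup>+s. ennreal (c (u - v)) * ennreal (a (s + v)) * indicator {0<..} v * indicator {0<..} s \<partial>lborel) \<partial>lborel)"
    by (rule lborel_pair.Fubini') measurable
  also have "\<dots> = (\<integral>\<^sup>+v\<in>{0<..<u}. ennreal (c (u - v) * A v) \<partial>lborel)"
  proof (intro nn_integral_cong)
    fix v :: real
    show "(\<integral>\<^sup>+s. ennreal (c (u - v)) * ennreal (a (s + v)) * indicator {0<..} v * indicator {0<..} s \<partial>lborel)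
      = ennreal (c (u - v) * A v) * indicator {0<..<u} v"
    proof (cases "0 < v \<and> v < u")
      case True
      have "(\<integral>\<^sup>+s. ennreal (c (u - v)) * ennreal (a (s + v)) * indicator {0<..} v * indicator {0<..} s \<partial>lborel)
        = (\<integral>\<^sup>+s. ennreal (c (u - v)) * (ennreal (a (v + s)) * indicator {0<..} s) \<partial>lborel)"
        using True by (intro nn_integral_cong) (simp add: mult_ac add.commute)
      also have "\<dots> = ennreal (c (u - v)) * ennreal (A (v + 0))"
        using True by (subst nn_integral_cmult) (auto simp: shift_tail[of v 0, simplified])
      finally show ?thesis using True c_nn less_imp_le[OF A_p[of v]] by (simp add: ennreal_mult)
    next
      case False
      then show ?thesis by (auto simp: indicator_def c_np)
    qed
  qed
  also have "\<dots> \<le> 1" by (rule conv[OF u])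
  finally show ?thesis .
qed

text \<open>Karamata's theorem, as dominated convergence with the indicator of the unit interval as
  weight; the limit is the integral of \<open>x powr (\<gamma> - 1)\<close> over it.\<close>

lemma Cc_limit: "((\<lambda>t. Cc t / (t * c t)) \<longlongrightarrow> 1 / \<gamma>) at_top"
proof -
  define d where "d = \<gamma> / 2"
  have d: "d > 0" using gamma_gt by (simp add: d_def)
  define w :: "real \<Rightarrow> real" where "w x = (if x < 1 then 1 else 0)" for x
  have "((\<lambda>t. (LINT x:{0<..}|lborel. w x * (c (t * x) / c t))) \<longlongrightarrow> (LINT x:{0<..}|lborel. w x * x powr (\<gamma> - 1))) at_top"
  proof (rule regularly_varying_dominated_convergence(1)[OF c_rv _ c_m c_i d, where W=w and B=1])
    show "-1 < \<gamma> - 1" using gamma_gt by simp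
    have i: "set_integrable lborel {0<..<1} (\<lambda>x. x powr (\<gamma> - 1 - d) + x powr (\<gamma> - 1 + d))"
      using gamma_gt by (intro set_integral_add powr_integrable_near_0) (auto simp: d_def)
    have "(\<lambda>x. indicator {0<..<1} x *\<^sub>R (x powr (\<gamma> - 1 - d) + x powr (\<gamma> - 1 + d))) = (\<lambda>x. indicator {0<..} x *\<^sub>R (w x * (x powr (\<gamma> - 1 - d) + x powr (\<gamma> - 1 + d))))"
      by (auto simp: w_def indicator_def)
    with i show "set_integrable lborel {0<..} (\<lambda>x. w x * (x powr (\<gamma> - 1 - d) + x powr (\<gamma> - 1 + d)))"
      unfolding set_integrable_def by simp
    show "w \<in> borel_measurable borel" "w \<in> borel_measurable borel" unfolding w_def by measurable
  qed (auto simp: w_def)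
  moreover have "(LINT x:{0<..}|lborel. w x * x powr (\<gamma> - 1)) = 1 / \<gamma>"
  proof -
    have "((\<lambda>x. x powr (\<gamma> - 1)) has_integral (1 powr (\<gamma> - 1 + 1) / (\<gamma> - 1 + 1))) {0..1::real}"
      using gamma_gt by (intro has_integral_powr_from_0) auto
    then have "((\<lambda>x. x powr (\<gamma> - 1)) has_integral (1 / \<gamma>)) {0<..<1::real}" by (simp add: has_integral_Icc_iff_Ioo)
    moreover have "(LINT x:{0<..}|lborel. w x * x powr (\<gamma> - 1)) = (LINT x:{0<..<1}|lborel. x powr (\<gamma> - 1))"
      unfolding set_lebesgue_integral_def by (intro Bochner_Integration.integral_cong) (auto simp: w_def indicator_def)
    moreover have "((\<lambda>x. x powr (\<gamma> - 1)) has_integral (LINT x:{0<..<1}|lborel. x powr (\<gamma> - 1))) {0<..<1::real}"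
      using gamma_gt set_borel_integral_eq_integral[OF powr_integrable_near_0[of "\<gamma> - 1" 1]] by (simp add: has_integral_iff)
    ultimately show ?thesis by (auto dest: has_integral_unique)
  qed
  moreover have "eventually (\<lambda>t. (LINT x:{0<..}|lborel. w x * (c (t * x) / c t)) = Cc t / (t * c t)) at_top"
    using eventually_gt_at_top[of 0]
  proof eventually_elim
    case (elim t)
    have "(LINT x:{0<..}|lborel. w x * (c (t * x) / c t)) = (LINT x:{0<..}|lborel. (indicator {..<t} (t * x) * c (t * x)) / c t)"
      using elim by (intro set_lebesgue_integral_cong) (auto simp: w_def indicator_def)
    also have "\<dots> = (LINT x:{0<..}|lborel. indicator {..<t} (t * x) * c (t * x)) / c t" by simp
    also have "(LINT x:{0<..}|lborel. indicator {..<t} (t * x) * c (t * x)) = (LINT s:{0<..}|lborel. indicator {..<t} s * c s) / t"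
      by (rule set_integral_scale[OF elim])
    also have "(LINT s:{0<..}|lborel. indicator {..<t} s * c s) = Cc t"
      unfolding Cc_def set_lebesgue_integral_def by (intro Bochner_Integration.integral_cong) (auto simp: indicator_def)
    finally show ?case by simp
  qed
  ultimately show ?thesis by (simp add: tendsto_cong)
qed

lemma Cc_rv: "regularly_varying \<gamma> Cc"
proof (rule regularly_varying_asymp[OF _ Cc_m Cc_limit])
  show "regularly_varying \<gamma> (\<lambda>t. t * c t)"
    using regularly_varying_mult[OF regularly_varying_ident c_rv] by simp
qed (use gamma_gt in simp)

lemma uniform_bounds:
  obtains K t0 where "K \<ge> 1" "t0 \<ge> 1"
    "\<And>t. t \<ge> t0 \<Longrightarrow> t * c t * A t \<le> K" "\<And>t. t \<ge> t0 \<Longrightarrow> Cc t \<le> K * (t * c t)"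
    "\<And>t. t \<ge> t0 \<Longrightarrow> t * a t \<le> K * A t" "\<And>t. t \<ge> t0 \<Longrightarrow> c (t / 2) \<le> K * c t"
    "\<And>t. t \<ge> t0 \<Longrightarrow> A (t / 2) \<le> K * A t" "\<And>t. t \<ge> t0 \<Longrightarrow> a t * Cc t \<le> K / t"
proof -
  define K1 where "K1 = max (max (\<kappa> + 1) (1 / \<gamma> + 1)) (max (\<gamma> + 1) (max ((1/2) powr (\<gamma> - 1) + 1) ((1/2) powr (- \<gamma>) + 1)))"
  have "eventually (\<lambda>t. t * c t * A t < K1 \<and> Cc t / (t * c t) < K1 \<and> t * a t / A t < K1 \<and> c (t * (1/2)) / c t < K1 \<and> A (t * (1/2)) / A t < K1) at_top"
  proof (intro eventually_conj)
    show "eventually (\<lambda>t. t * c t * A t < K1) at_top" by (rule order_tendstoD(2)[OF cA_lim]) (simp add: K1_def)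
    show "eventually (\<lambda>t. Cc t / (t * c t) < K1) at_top" by (rule order_tendstoD(2)[OF Cc_limit]) (simp add: K1_def)
    show "eventually (\<lambda>t. t * a t / A t < K1) at_top" by (rule order_tendstoD(2)[OF aA_lim]) (simp add: K1_def)
    show "eventually (\<lambda>t. c (t * (1/2)) / c t < K1) at_top" by (rule order_tendstoD(2)[OF regularly_varyingD(1)[OF c_rv]]) (auto simp: K1_def)
    show "eventually (\<lambda>t. A (t * (1/2)) / A t < K1) at_top" by (rule order_tendstoD(2)[OF regularly_varyingD(1)[OF A_rv]]) (auto simp: K1_def)
  qed
  then obtain N where N: "\<And>t. t \<ge> N \<Longrightarrow> t * c t * A t < K1 \<and> Cc t / (t * c t) < K1 \<and> t * a t / A t < K1 \<and> c (t * (1/2)) / c t < K1 \<and> A (t * (1/2)) / A t < K1"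
    by (auto simp: eventually_at_top_linorder)
  have K1: "K1 \<ge> 1" using gamma_gt by (simp add: K1_def)
  \<comment> \<open>The last of the bounds is a product of three of the others, so the cube of
    \<open>K1\<close> serves for all of them.\<close>
  have K13: "K1 \<le> K1 ^ 3" using K1 by (intro self_le_power) auto
  have main: "t * c t * A t \<le> K1 ^ 3 \<and> Cc t \<le> K1 ^ 3 * (t * c t) \<and> t * a t \<le> K1 ^ 3 * A t \<and> c (t / 2) \<le> K1 ^ 3 * c t \<and> A (t / 2) \<le> K1 ^ 3 * A t \<and> a t * Cc t \<le> K1 ^ 3 / t"
    if t: "t \<ge> max N 1" for t
  proof -
    have p: "t > 0" "c t > 0" "A t > 0" "t * c t > 0" using t c_p[of t] A_p[of t] by auto
    note n = N[of t]
    have 1: "t * c t * A t \<le> K1" "Cc t \<le> K1 * (t * c t)" "t * a t \<le> K1 * A t" "c (t / 2) \<le> K1 * c t" "A (t / 2) \<le> K1 * A t"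
      using n t p by (auto simp: pos_divide_less_eq)
    have up: "K1 * z \<le> K1 ^ 3 * z" if "z \<ge> 0" for z using K13 that by (rule mult_right_mono)
    have "(t * a t) * Cc t \<le> (K1 * A t) * (K1 * (t * c t))"
      by (rule mult_mono[OF 1(3) 1(2)]) (use p K1 Cc_nn[of t] in auto)
    also have "\<dots> = K1 * K1 * (t * c t * A t)" by (simp add: mult_ac)
    also have "\<dots> \<le> K1 * K1 * K1" using 1 K1 by (intro mult_left_mono) auto
    finally have "a t * Cc t \<le> K1 ^ 3 / t" using p by (simp add: pos_le_divide_eq power3_eq_cube mult_ac)
    moreover have "t * c t * A t \<le> K1 ^ 3" using 1(1) K13 by linarith
    moreover note order_trans[OF 1(2) up[OF less_imp_le[OF p(4)]]] order_trans[OF 1(3) up[OF less_imp_le[OF p(3)]]]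
      order_trans[OF 1(4) up[OF less_imp_le[OF p(2)]]] order_trans[OF 1(5) up[OF less_imp_le[OF p(3)]]]
    ultimately show ?thesis by blast
  qed
  show ?thesis by (rule that[of "K1 ^ 3" "max N 1"]) (use main K1 one_le_power[OF K1, of 3] in auto)
qed

end

text \<open>The integrand is, up to a constant, the derivative of the power \<gamma> of
  \<open>z / (x + u - z)\<close>, because the derivative of that quotient has the constant numerator
  \<open>x + u\<close>. The value is the shape of the limit kernel.\<close>

lemma stable_kernel_integral:
  fixes \<gamma> x u :: real
  assumes g: "0 < \<gamma>" and x: "x > 0" and u: "u > 0"
  shows "(LINT z:{0<..}|lborel. (if z < u then (x + u - z) powr (- \<gamma> - 1) else 0) * z powr (\<gamma> - 1)) = u powr \<gamma> * x powr (- \<gamma>) / (\<gamma> * (x + u))"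
proof -
  define F where "F z = z powr \<gamma> * (x + u - z) powr (- \<gamma>) / (\<gamma> * (x + u))" for z
  have xu: "x + u > 0" using x u by simp
  have "((\<lambda>z. (x + u - z) powr (- \<gamma> - 1) * z powr (\<gamma> - 1)) has_integral (F u - F 0)) {0..u}"
  proof (rule fundamental_theorem_of_calculus_interior)
    show "continuous_on {0..u} F"
      unfolding F_def using x u g by (intro continuous_intros continuous_on_powr') auto
    fix z :: real assume z: "z \<in> {0<..<u}"
    then have zp: "z > 0" "x + u - z > 0" using x by auto
    have "(F has_real_derivative
       (\<gamma> * z powr (\<gamma> - 1) * (x + u - z) powr (- \<gamma>) + z powr \<gamma> * (\<gamma> * (x + u - z) powr (- \<gamma> - 1))) / (\<gamma> * (x + u))) (at z)"
      unfolding F_def[abs_def] using zp xu g by (auto intro!: derivative_eq_intros)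
    moreover have "(\<gamma> * z powr (\<gamma> - 1) * (x + u - z) powr (- \<gamma>) + z powr \<gamma> * (\<gamma> * (x + u - z) powr (- \<gamma> - 1))) / (\<gamma> * (x + u))
      = (x + u - z) powr (- \<gamma> - 1) * z powr (\<gamma> - 1)"
    proof -
      define p where "p = z powr (\<gamma> - 1)"
      define q where "q = (x + u - z) powr (- \<gamma> - 1)"
      have 1: "z powr \<gamma> = z * p" using zp by (simp add: p_def powr_diff)
      have 2: "(x + u - z) powr (- \<gamma>) = (x + u - z) * q" using zp by (simp add: q_def powr_diff)
      have "\<gamma> * p * ((x + u - z) * q) + z * p * (\<gamma> * q) = (q * p) * (\<gamma> * (x + u))" by (simp add: algebra_simps)
      then show ?thesis unfolding 1 2 p_def[symmetric] q_def[symmetric] using g xu by simp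
    qed
    ultimately show "(F has_vector_derivative (x + u - z) powr (- \<gamma> - 1) * z powr (\<gamma> - 1)) (at z)"
      by (simp add: has_real_derivative_iff_has_vector_derivative)
  qed (use u in simp)
  then have hi: "((\<lambda>z. (x + u - z) powr (- \<gamma> - 1) * z powr (\<gamma> - 1)) has_integral F u) {0<..<u}"
    using g by (simp add: F_def has_integral_Icc_iff_Ioo)
  have F0: "0 \<le> F u" using g xu by (simp add: F_def)
  have "(\<integral>\<^sup>+z. ennreal (indicator {0<..<u} z * ((x + u - z) powr (- \<gamma> - 1) * z powr (\<gamma> - 1))) \<partial>lborel) = ennreal (F u)"
    by (rule nn_integral_has_integral_lebesgue[OF _ hi]) auto
  moreover have "(\<integral>\<^sup>+z\<in>{0<..}. ennreal ((if z < u then (x + u - z) powr (- \<gamma> - 1) else 0) * z powr (\<gamma> - 1)) \<partial>lborel)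
    = (\<integral>\<^sup>+z. ennreal (indicator {0<..<u} z * ((x + u - z) powr (- \<gamma> - 1) * z powr (\<gamma> - 1))) \<partial>lborel)"
    by (intro nn_integral_cong) (auto simp: indicator_def)
  ultimately have "(\<integral>\<^sup>+z\<in>{0<..}. ennreal ((if z < u then (x + u - z) powr (- \<gamma> - 1) else 0) * z powr (\<gamma> - 1)) \<partial>lborel) = ennreal (F u)" by simp
  from set_integral_eq_nn_integralI(2)[OF _ _ this F0] show ?thesis
    using x by (auto simp: F_def set_borel_measurable_def)
qed

section \<open>Scaling limit and contraction of the overshoot kernel\<close>

context overshoot
begin

text \<open>The substitution \<open>v = t * (u - z)\<close> makes \<open>c\<close> the regularly
  varying function of the integral and a ratio of \<open>a\<close> its weight; the two prefactors
  have the limits \<kappa> and \<gamma>.\<close>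

lemma b_scaling_eq:
  assumes t: "t > 0"
  shows "t * b (t * x) (t * u) = (t * c t * A t) * (t * a t / A t) *
    (LINT z:{0<..}|lborel. (if z < u then a (t * (x + u - z)) / a t else 0) * (c (t * z) / c t))"
proof -
  have ne: "A t \<noteq> 0" "a t \<noteq> 0" "c t \<noteq> 0" using A_p[OF t] a_p[OF t] c_p[OF t] by auto
  define F where "F v = indicator {0<..<t * u} v * (c (t * u - v) * a (t * x + v))" for v
  have "b (t * x) (t * u) = (LINT v|lborel. F v)" unfolding b_coeff_def set_lebesgue_integral_def F_def by simp
  also have "\<dots> = \<bar>- t\<bar> *\<^sub>R (LINT z|lborel. F (t * u + (- t) * z))"
    using t by (intro lborel_integral_real_affine) auto
  also have "(LINT z|lborel. F (t * u + (- t) * z))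
    = (LINT z|lborel. (a t * c t) * (indicator {0<..} z *\<^sub>R ((if z < u then a (t * (x + u - z)) / a t else 0) * (c (t * z) / c t))))"
  proof (intro Bochner_Integration.integral_cong refl)
    fix z :: real
    show "F (t * u + (- t) * z) = (a t * c t) * (indicator {0<..} z *\<^sub>R ((if z < u then a (t * (x + u - z)) / a t else 0) * (c (t * z) / c t)))"
    proof (cases "0 < z \<and> z < u")
      case True
      have "t * u + (- t) * z \<in> {0<..<t * u}" using True t by simp
      moreover have "t * u - (t * u + (- t) * z) = t * z" "t * x + (t * u + (- t) * z) = t * (x + u - z)" by (auto simp: algebra_simps)
      ultimately show ?thesis using True ne by (simp add: F_def)
    next
      case False
      have "t * u + (- t) * z \<notin> {0<..<t * u}"
      proof
        assume "t * u + (- t) * z \<in> {0<..<t * u}"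
        then have "t * z < t * u" "0 < t * z" by auto
        then show False using False t by (auto simp: zero_less_mult_iff)
      qed
      then show ?thesis using False by (auto simp: F_def indicator_def)
    qed
  qed
  finally show ?thesis using ne t by (simp add: set_lebesgue_integral_def)
qed

text \<open>The ratios of \<open>a\<close> are taken at points beyond \<open>t * x\<close>, where
  monotonicity bounds them uniformly; the possible singularity of \<open>c\<close> at 0 is left to
  the convergence theorem.\<close>

lemma b_limit:
  assumes x: "x > 0" and u: "u > 0"
  shows "((\<lambda>t. t * b (t * x) (t * u)) \<longlongrightarrow> \<beta> x u) at_top"
proof -
  define d where "d = \<gamma> / 2"
  have d: "d > 0" using gamma_gt by (simp add: d_def)
  define B where "B = x powr (- \<gamma> - 1) + 1"
  define W where "W z = (if z < u then B else 0)" for z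
  have Bp: "B \<ge> 0" by (simp add: B_def)
  have "((\<lambda>t. LINT z:{0<..}|lborel. (if z < u then a (t * (x + u - z)) / a t else 0) * (c (t * z) / c t)) \<longlongrightarrow>
    (LINT z:{0<..}|lborel. (if z < u then (x + u - z) powr (- \<gamma> - 1) else 0) * z powr (\<gamma> - 1))) at_top"
  proof (rule regularly_varying_dominated_convergence(1)[OF c_rv _ c_m c_i d, where W=W and B=B])
    show "-1 < \<gamma> - 1" using gamma_gt by simp
    show "(\<lambda>z. if z < u then a (t * (x + u - z)) / a t else 0) \<in> borel_measurable borel" for t by measurable
    show "(\<lambda>z. if z < u then (x + u - z) powr (- \<gamma> - 1) else 0) \<in> borel_measurable borel" by measurable
    show "((\<lambda>t. if z < u then a (t * (x + u - z)) / a t else 0) \<longlongrightarrow> (if z < u then (x + u - z) powr (- \<gamma> - 1) else 0)) at_top" if "z > 0" for z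
      using x by (auto intro!: regularly_varyingD(1)[OF a_rv])
    have "eventually (\<lambda>t. a (t * x) / a t < B) at_top"
      by (rule order_tendstoD(2)[OF regularly_varyingD(1)[OF a_rv x]]) (simp add: B_def)
    then show "\<forall>\<^sub>F t in at_top. \<forall>z>0. \<bar>if z < u then a (t * (x + u - z)) / a t else 0\<bar> \<le> W z"
      using eventually_gt_at_top[of 0]
    proof eventually_elim
      case (elim t)
      show ?case
      proof (intro allI impI)
        fix z :: real
        show "\<bar>if z < u then a (t * (x + u - z)) / a t else 0\<bar> \<le> W z"
        proof (cases "z < u")
          case True
          have "a (t * (x + u - z)) \<le> a (t * x)" using True elim x by (intro a_anti) auto
          then have "a (t * (x + u - z)) / a t \<le> a (t * x) / a t" using a_nn by (intro divide_right_mono) auto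
          then show ?thesis using True elim(1) a_nn by (simp add: W_def)
        qed (simp add: W_def)
      qed
    qed
    have i: "set_integrable lborel {0<..<u} (\<lambda>x. B * (x powr (\<gamma> - 1 - d) + x powr (\<gamma> - 1 + d)))"
      using gamma_gt by (intro set_integrable_mult_right set_integral_add powr_integrable_near_0) (auto simp: d_def)
    have "(\<lambda>x. indicator {0<..<u} x *\<^sub>R (B * (x powr (\<gamma> - 1 - d) + x powr (\<gamma> - 1 + d)))) = (\<lambda>x. indicator {0<..} x *\<^sub>R (W x * (x powr (\<gamma> - 1 - d) + x powr (\<gamma> - 1 + d))))"
      by (auto simp: W_def indicator_def)
    with i show "set_integrable lborel {0<..} (\<lambda>x. W x * (x powr (\<gamma> - 1 - d) + x powr (\<gamma> - 1 + d)))"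
      unfolding set_integrable_def by simp
  qed (use Bp in \<open>auto simp: W_def\<close>)
  from tendsto_mult[OF tendsto_mult[OF cA_lim aA_lim] this]
  have "((\<lambda>t. (t * c t * A t) * (t * a t / A t) * (LINT z:{0<..}|lborel. (if z < u then a (t * (x + u - z)) / a t else 0) * (c (t * z) / c t)))
    \<longlongrightarrow> \<kappa> * \<gamma> * (u powr \<gamma> * x powr (- \<gamma>) / (\<gamma> * (x + u)))) at_top"
    using gamma_gt by (subst (asm) stable_kernel_integral[OF _ x u]) auto
  moreover have "\<kappa> * \<gamma> * (u powr \<gamma> * x powr (- \<gamma>) / (\<gamma> * (x + u))) = \<beta> x u"
    using gamma_gt unfolding stable_overshoot_def by simp
  moreover have "eventually (\<lambda>t. (t * c t * A t) * (t * a t / A t) * (LINT z:{0<..}|lborel. (if z < u then a (t * (x + u - z)) / a t else 0) * (c (t * z) / c t)) = t * b (t * x) (t * u)) at_top"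
    using eventually_gt_at_top[of 0] by eventually_elim (rule b_scaling_eq[symmetric])
  ultimately show ?thesis by (simp only: tendsto_cong[symmetric])
qed

text \<open>\<open>b_le_split\<close> evaluates \<open>c\<close>, \<open>a\<close> and
  \<open>Cc\<close> at \<open>u / 2\<close> only, and \<open>u / 2 \<ge> t\<close>. The bound is
  uniform in these levels and dominates the far part of the integrals over \<open>u\<close>
  below.\<close>

lemma b_tail_bound:
  obtains K t0 where "K \<ge> 1" "t0 \<ge> 1"
    "\<And>t s u. t \<ge> t0 \<Longrightarrow> s > 0 \<Longrightarrow> u \<ge> 2 * t \<Longrightarrow> t * b s u \<le> K * (A s / A t) + K"
    "\<And>t. t \<ge> t0 \<Longrightarrow> t * (a t * Cc t) \<le> K"
proof -
  obtain K t0 where K: "K \<ge> 1" "t0 \<ge> 1"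
    "\<And>t. t \<ge> t0 \<Longrightarrow> t * c t * A t \<le> K" "\<And>t. t \<ge> t0 \<Longrightarrow> Cc t \<le> K * (t * c t)"
    "\<And>t. t \<ge> t0 \<Longrightarrow> t * a t \<le> K * A t" "\<And>t. t \<ge> t0 \<Longrightarrow> c (t / 2) \<le> K * c t"
    "\<And>t. t \<ge> t0 \<Longrightarrow> A (t / 2) \<le> K * A t" "\<And>t. t \<ge> t0 \<Longrightarrow> a t * Cc t \<le> K / t"
    by (rule uniform_bounds) blast
  have 1: "b s u \<le> c t * A s + 2 * K / u" if "t \<ge> t0" "s > 0" "u \<ge> 2 * t" for t s u
  proof -
    have u: "u > 0" "u / 2 \<ge> t0" "t > 0" using that K(2) by auto
    have "b s u \<le> c (u / 2) * A s + a (u / 2) * Cc (u / 2)" by (rule b_le_split[OF that(2) u(1)])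
    also have "c (u / 2) * A s \<le> c t * A s" using that u A_p[OF that(2)] by (intro mult_right_mono c_anti) auto
    also have "a (u / 2) * Cc (u / 2) \<le> K / (u / 2)" by (rule K(8)[OF u(2)])
    finally show ?thesis by (simp add: mult.commute)
  qed
  have 2: "t * b s u \<le> K * (A s / A t) + K" if t: "t \<ge> t0" and s: "s > 0" and u: "u \<ge> 2 * t" for t s u
  proof -
    have tp: "t > 0" "A t > 0" using t K(2) A_p[of t] by auto
    have "t * b s u \<le> t * (c t * A s + 2 * K / u)" using 1[OF t s u] tp by (intro mult_left_mono) auto
    also have "\<dots> = (t * c t * A t) * (A s / A t) + K * (2 * t / u)" using tp by (simp add: distrib_left)
    also have "\<dots> \<le> K * (A s / A t) + K * 1"
      using K(1) K(3)[OF t] tp u less_imp_le[OF A_p[OF s]] by (intro add_mono mult_right_mono mult_left_mono) auto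
    finally show ?thesis by simp
  qed
  have 3: "t * (a t * Cc t) \<le> K" if "t \<ge> t0" for t using K(8)[OF that] that K(2) by (simp add: field_simps)
  show ?thesis using K(1,2) 2 3 by (rule that)
qed

text \<open>The finite-time counterpart of \<open>beta_powr_eigen\<close>: for every rate above \<open>sin (pi \<gamma>)\<close>
  the truncated power is contracted far from the origin.\<close>
lemma lyapunov:
  obtains t0 where "t0 \<ge> 1"
    "\<And>s. s \<ge> t0 \<Longrightarrow> set_integrable lborel {0<..} (\<lambda>u. b s u * max u 1 powr (- \<gamma> - 1/2))"
    "\<And>s. s \<ge> t0 \<Longrightarrow> (LINT u:{0<..}|lborel. b s u * max u 1 powr (- \<gamma> - 1/2)) \<le> ((1 + \<theta>) / 2) * s powr (- \<gamma> - 1/2)"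
proof -
  obtain K t1 where K: "K \<ge> 1" "t1 \<ge> 1"
    "\<And>t s u. t \<ge> t1 \<Longrightarrow> s > 0 \<Longrightarrow> u \<ge> 2 * t \<Longrightarrow> t * b s u \<le> K * (A s / A t) + K"
    "\<And>t. t \<ge> t1 \<Longrightarrow> t * (a t * Cc t) \<le> K"
    by (rule b_tail_bound) blast
  \<comment> \<open>A quarter of the gap between \<gamma> and 1/2: two such margins still leave the
    exponent \<open>- \<gamma> - 1/2 + 2 * d\<close> at infinity below -1.\<close>
  define d where "d = (\<gamma> - 1/2) / 4"
  have d: "d > 0" using gamma_gt by (simp add: d_def)
  obtain X L where X: "X > 0" "L \<ge> 1"
    and pot: "\<And>x y. x \<ge> X \<Longrightarrow> y \<ge> x \<Longrightarrow> Cc y / Cc x \<le> L * (y / x) powr (\<gamma> + d) \<and> Cc x / Cc y \<le> L * (x / y) powr (\<gamma> - d)"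
    using regularly_varying_potter[OF Cc_rv d] by blast
  define q where "q u = max u 1 powr (- \<gamma> - 1/2)" for u :: real
  define f where "f u = Cc u * q u" for u
  have f_rv: "regularly_varying (- (1/2)) f"
  proof (rule regularly_varying_asymp)
    show "regularly_varying (- (1/2)) (\<lambda>t. Cc t * t powr (- \<gamma> - 1/2))"
      using regularly_varying_mult[OF Cc_rv regularly_varying_powr[of "- \<gamma> - 1/2"]] by simp
    have "eventually (\<lambda>t. f t / (Cc t * t powr (- \<gamma> - 1/2)) = 1) at_top"
      using eventually_ge_at_top[of 1]
    proof eventually_elim
      case (elim t)
      then have "Cc t * t powr (- \<gamma> - 1/2) \<noteq> 0" using Cc_p[of t] by simp
      then show ?case using elim by (simp add: f_def q_def max_def)
    qed
    then show "((\<lambda>t. f t / (Cc t * t powr (- \<gamma> - 1/2))) \<longlongrightarrow> 1) at_top" by (rule tendsto_eventually)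
    show "f \<in> borel_measurable borel" unfolding f_def q_def by measurable
  qed simp
  have f_i: "set_integrable lborel {0<..<r} f" for r
  proof (rule set_integrable_bound[of _ _ "\<lambda>_. Cc r"])
    show "set_integrable lborel {0<..<r} (\<lambda>_. Cc r)"
      using emeasure_bounded_finite[of "{0<..<r}"] unfolding set_integrable_def
      by (simp add: integrable_indicator_iff)
    show "set_borel_measurable lborel {0<..<r} f" unfolding set_borel_measurable_def f_def q_def by measurable
    show "AE x in lborel. x \<in> {0<..<r} \<longrightarrow> norm (f x) \<le> norm (Cc r)"
    proof (intro AE_I2 impI)
      fix x assume x: "x \<in> {0<..<r}"
      have "q x \<le> max x 1 powr 0" unfolding q_def using gamma_gt by (intro powr_mono) auto
      moreover have "max x 1 \<noteq> 0" by (simp add: max_def)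
      ultimately have "q x \<le> 1" by simp
      moreover have "0 \<le> q x" by (simp add: q_def)
      moreover have "Cc x \<le> Cc r" using x by (intro Cc_mono) auto
      ultimately have "f x \<le> Cc r * 1" unfolding f_def using Cc_nn by (intro mult_mono) auto
      then show "norm (f x) \<le> norm (Cc r)" using Cc_nn \<open>0 \<le> q x\<close> by (simp add: f_def)
    qed
  qed
  define w where "w s x = s * b s (s * x) * (Cc s / Cc (s * x))" for s x
  \<comment> \<open>Below 2 the bound comes from \<open>b_le\<close>, from 2 on it comes from
    \<open>b_tail_bound\<close> and Potter's bounds for \<open>Cc\<close>.\<close>
  define W where "W x = (if x < 2 then K else 2 * K * L * x powr (- \<gamma> + d))" for x :: real
  have wm: "w s \<in> borel_measurable borel" for s unfolding w_def by measurable
  have w0m: "(\<lambda>x. \<beta> 1 x * x powr (- \<gamma>)) \<in> borel_measurable borel" by measurable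
  have wl: "((\<lambda>s. w s x) \<longlongrightarrow> \<beta> 1 x * x powr (- \<gamma>)) at_top" if x: "x > 0" for x
  proof -
    have "((\<lambda>s. inverse (Cc (s * x) / Cc s)) \<longlongrightarrow> inverse (x powr \<gamma>)) at_top"
      using x by (intro tendsto_inverse regularly_varyingD(1)[OF Cc_rv]) auto
    then have "((\<lambda>s. Cc s / Cc (s * x)) \<longlongrightarrow> x powr (- \<gamma>)) at_top" by (simp add: powr_minus)
    moreover have "((\<lambda>s. s * b (s * 1) (s * x)) \<longlongrightarrow> \<beta> 1 x) at_top" by (rule b_limit) (use x in auto)
    ultimately show ?thesis unfolding w_def by (intro tendsto_mult) auto
  qed
  have wb: "eventually (\<lambda>s. \<forall>x>0. \<bar>w s x\<bar> \<le> W x) at_top"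
    using eventually_ge_at_top[of "max X t1"]
  proof eventually_elim
    case (elim s)
    then have s: "s > 0" "s \<ge> t1" "s \<ge> X" using K(2) by auto
    show ?case
    proof (intro allI impI)
      fix x :: real assume x: "x > 0"
      have C: "Cc (s * x) > 0" "Cc s > 0" using s x by (auto intro: Cc_p)
      have w0: "0 \<le> w s x" unfolding w_def using s C b_nn by auto
      have "w s x \<le> W x"
      proof (cases "x < 2")
        case True
        have "s * b s (s * x) \<le> s * (a s * Cc (s * x))" using s by (intro mult_left_mono b_le) auto
        then have "w s x \<le> s * (a s * Cc (s * x)) * (Cc s / Cc (s * x))" unfolding w_def using C by (intro mult_right_mono) auto
        also have "\<dots> = s * (a s * Cc s)" using C by simp
        also have "\<dots> \<le> K" by (rule K(4)[OF s(2)])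
        finally show ?thesis using True by (simp add: W_def)
      next
        case False
        have "s * 2 \<le> s * x" using False s by (intro mult_left_mono) auto
        then have "s * b s (s * x) \<le> K * (A s / A s) + K" using s by (intro K(3)) auto
        then have 1: "s * b s (s * x) \<le> 2 * K" using A_p[OF s(1)] by simp
        have "s \<le> s * x" using False s by simp
        then have "Cc s / Cc (s * x) \<le> L * (s / (s * x)) powr (\<gamma> - d)" using pot[of s "s * x"] s by blast
        also have "(s / (s * x)) powr (\<gamma> - d) = x powr (- \<gamma> + d)"
        proof -
          have "s / (s * x) = inverse x" using s by (simp add: field_simps)
          moreover have "x powr (- \<gamma> + d) = inverse (x powr (\<gamma> - d))"
            using powr_minus[of x "\<gamma> - d"] by simp
          ultimately show ?thesis using x by (simp add: inverse_powr)
        qed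
        finally have 2: "Cc s / Cc (s * x) \<le> L * x powr (- \<gamma> + d)" .
        have "w s x \<le> (2 * K) * (L * x powr (- \<gamma> + d))"
          unfolding w_def by (rule mult_mono[OF 1 2]) (use K C in auto)
        then show ?thesis using False by (simp add: W_def mult_ac)
      qed
      then show "\<bar>w s x\<bar> \<le> W x" using w0 by simp
    qed
  qed
  have dl: "- 1 < - (1/2) - d" "- \<gamma> + d - 1/2 + d < - 1" "- 1 < - (1/2) + d" "- \<gamma> + d - 1/2 - d < - 1"
    using d d_def gamma_gt gamma_lt by simp_all
  have Wi: "set_integrable lborel {0<..} (\<lambda>x. W x * (x powr (- (1/2) - d) + x powr (- (1/2) + d)))"
  proof -
    have 1: "set_integrable lborel {0<..} (\<lambda>x::real. if x < 2 then x powr (- (1/2) - d) else x powr (- \<gamma> + d - 1/2 - d))"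
      by (rule powr_piecewise_integrable[OF dl(1,4)]) simp
    have 2: "set_integrable lborel {0<..} (\<lambda>x::real. if x < 2 then x powr (- (1/2) + d) else x powr (- \<gamma> + d - 1/2 + d))"
      by (rule powr_piecewise_integrable[OF dl(3,2)]) simp
    have i: "set_integrable lborel {0<..} (\<lambda>x::real. (2 * K * L) * ((if x < 2 then x powr (- (1/2) - d) else x powr (- \<gamma> + d - 1/2 - d))
      + (if x < 2 then x powr (- (1/2) + d) else x powr (- \<gamma> + d - 1/2 + d))))"
      by (intro set_integrable_mult_right set_integral_add 1 2)
    show ?thesis
    proof (rule set_integrable_bound[OF i])
      show "set_borel_measurable lborel {0<..} (\<lambda>x. W x * (x powr (- (1/2) - d) + x powr (- (1/2) + d)))"
        unfolding set_borel_measurable_def W_def by measurable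
      show "AE x in lborel. x \<in> {0<..} \<longrightarrow> norm (W x * (x powr (- (1/2) - d) + x powr (- (1/2) + d)))
        \<le> norm ((2 * K * L) * ((if x < 2 then x powr (- (1/2) - d) else x powr (- \<gamma> + d - 1/2 - d))
      + (if x < 2 then x powr (- (1/2) + d) else x powr (- \<gamma> + d - 1/2 + d))))"
      proof (intro AE_I2 impI)
        fix x :: real
        show "norm (W x * (x powr (- (1/2) - d) + x powr (- (1/2) + d)))
        \<le> norm ((2 * K * L) * ((if x < 2 then x powr (- (1/2) - d) else x powr (- \<gamma> + d - 1/2 - d))
            + (if x < 2 then x powr (- (1/2) + d) else x powr (- \<gamma> + d - 1/2 + d))))"
        proof (cases "x < 2")
          case True
          have "K * 1 \<le> K * (2 * L)" using K X by (intro mult_left_mono) auto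
          then have "K * (x powr (- (1/2) - d) + x powr (- (1/2) + d)) \<le> (2 * K * L) * (x powr (- (1/2) - d) + x powr (- (1/2) + d))"
            by (intro mult_right_mono) auto
          then show ?thesis using True K X by (simp add: W_def abs_mult)
        next
          case False
          have "x powr (- \<gamma> + d) * (x powr (- (1/2) - d) + x powr (- (1/2) + d)) = x powr (- \<gamma> + d - 1/2 - d) + x powr (- \<gamma> + d - 1/2 + d)"
            unfolding distrib_left powr_add[symmetric] by (simp add: algebra_simps)
          then have "2 * K * L * x powr (- \<gamma> + d) * (x powr (- (1/2) - d) + x powr (- (1/2) + d)) = (2 * K * L) * (x powr (- \<gamma> + d - 1/2 - d) + x powr (- \<gamma> + d - 1/2 + d))"
            by (simp only: mult.assoc)
          then show ?thesis using False by (simp only: W_def if_False)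
        qed
      qed
    qed
  qed
  have WB: "W x \<le> K" if "0 < x" "x \<le> 1" for x using that by (simp add: W_def)
  have fm: "f \<in> borel_measurable borel" unfolding f_def q_def by measurable
  note dct = regularly_varying_dominated_convergence[OF f_rv _ fm f_i d wm w0m wl wb WB Wi]
  have lim: "((\<lambda>s. LINT x:{0<..}|lborel. w s x * (f (s * x) / f s)) \<longlongrightarrow> (LINT x:{0<..}|lborel. (\<beta> 1 x * x powr (- \<gamma>)) * x powr (- (1/2)))) at_top"
    by (rule dct(1)) auto
  have ev: "eventually (\<lambda>s. set_integrable lborel {0<..} (\<lambda>x. w s x * (f (s * x) / f s))) at_top"
    by (rule dct(2)) auto
  have v: "(LINT x:{0<..}|lborel. (\<beta> 1 x * x powr (- \<gamma>)) * x powr (- (1/2))) = \<theta>"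
  proof -
    have "(\<beta> 1 x * x powr (- \<gamma>)) * x powr (- (1/2)) = \<beta> 1 x * x powr (- \<gamma> - 1/2)" for x
      by (simp add: powr_add[symmetric])
    then show ?thesis using beta_powr_eigen(2)[of 1] by (simp only: powr_one_eq_one zero_less_one mult_1_right)
  qed
  have e: "w s x * (f (s * x) / f s) = s powr (\<gamma> + 1/2) * (s * (b s (s * x) * q (s * x)))" if s: "s \<ge> 1" and x: "x > 0" for s x
  proof -
    have C: "Cc (s * x) > 0" "Cc s > 0" using s x by (auto intro: Cc_p)
    have "- (\<gamma> + 1/2) = - \<gamma> - 1/2" by simp
    then have "q s = inverse (s powr (\<gamma> + 1/2))"
      using s powr_minus[of s "\<gamma> + 1/2"] by (simp add: q_def max_def)
    then have "s powr (\<gamma> + 1/2) = 1 / q s" by (simp add: inverse_eq_divide)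
    then show ?thesis using C unfolding w_def f_def by simp
  qed
  \<comment> \<open>The limit is \<theta>; the midpoint between \<theta> and 1 is a rate that holds
    from some finite \<open>s\<close> on.\<close>
  have "eventually (\<lambda>s. (LINT x:{0<..}|lborel. w s x * (f (s * x) / f s)) < (1 + \<theta>) / 2) at_top"
    using theta unfolding v[symmetric] by (intro order_tendstoD(2)[OF lim]) (simp add: v)
  then have "eventually (\<lambda>s. set_integrable lborel {0<..} (\<lambda>u. b s u * q u) \<and> (LINT u:{0<..}|lborel. b s u * q u) \<le> ((1 + \<theta>) / 2) * s powr (- \<gamma> - 1/2)) at_top"
    using ev eventually_ge_at_top[of 1]
  proof eventually_elim
    case (elim s)
    have s: "s > 0" using elim by simp
    have i1: "set_integrable lborel {0<..} (\<lambda>x. s powr (\<gamma> + 1/2) * (s * (b s (s * x) * q (s * x))))"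
      by (rule set_integrable_cong[THEN iffD1, OF refl refl _ elim(2)]) (use e[OF elim(3)] in auto)
    have i2: "set_integrable lborel {0<..} (\<lambda>x. b s (s * x) * q (s * x))"
      using set_integrable_mult_right[OF i1, of "inverse (s powr (\<gamma> + 1/2) * s)"] s by (simp add: field_simps)
    have i3: "set_integrable lborel {0<..} (\<lambda>u. b s u * q u)"
    proof -
      have "1 / s > 0" using s by simp
      from set_integrable_scale[OF this i2] show ?thesis using s by simp
    qed
    have "(LINT x:{0<..}|lborel. w s x * (f (s * x) / f s)) = (LINT x:{0<..}|lborel. (s powr (\<gamma> + 1/2) * s) * (b s (s * x) * q (s * x)))"
      using e[OF elim(3)] by (intro set_lebesgue_integral_cong) (auto simp: mult.assoc)
    also have "\<dots> = (s powr (\<gamma> + 1/2) * s) * ((LINT u:{0<..}|lborel. b s u * q u) / s)"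
      unfolding set_integral_mult_right using set_integral_scale[OF s, of "\<lambda>u. b s u * q u"] by simp
    also have "\<dots> = s powr (\<gamma> + 1/2) * (LINT u:{0<..}|lborel. b s u * q u)" using s by simp
    finally have "s powr (\<gamma> + 1/2) * (LINT u:{0<..}|lborel. b s u * q u) < (1 + \<theta>) / 2" using elim(1) by simp
    then have "s powr (- (\<gamma> + 1/2)) * (s powr (\<gamma> + 1/2) * (LINT u:{0<..}|lborel. b s u * q u)) \<le> s powr (- (\<gamma> + 1/2)) * ((1 + \<theta>) / 2)"
      by (intro mult_left_mono) auto
    moreover have "s powr (- (\<gamma> + 1/2)) * s powr (\<gamma> + 1/2) = 1" using s by (simp add: powr_add[symmetric])
    moreover have "- (\<gamma> + 1/2) = - \<gamma> - 1/2" by simp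
    ultimately have "(LINT u:{0<..}|lborel. b s u * q u) \<le> ((1 + \<theta>) / 2) * s powr (- \<gamma> - 1/2)"
      by (simp only: mult.assoc[symmetric] mult_1_left mult.commute[of "s powr (- \<gamma> - 1/2)" "(1 + \<theta>) / 2"])
    then show ?case using i3 by blast
  qed
  then obtain N where "\<And>s. s \<ge> N \<Longrightarrow> set_integrable lborel {0<..} (\<lambda>u. b s u * q u) \<and> (LINT u:{0<..}|lborel. b s u * q u) \<le> ((1 + \<theta>) / 2) * s powr (- \<gamma> - 1/2)"
    by (auto simp: eventually_at_top_linorder)
  then show ?thesis by (intro that[of "max N 1"]) (auto simp: q_def)
qed

end

context overshoot
begin

text \<open>For landing points \<open>s \<le> t\<close> the estimate loses the factor
  \<open>A s / A t\<close>, the singularity at 0 that one application of the kernel leaves behind.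
  Levels below \<open>2 * t\<close> are handled by \<open>b_integral_le\<close>, higher ones by
  \<open>b_tail_bound\<close>, where \<open>p > 1\<close> makes the power integrable.\<close>

lemma landing_bound:
  obtains K t0 where "K \<ge> 1" "t0 \<ge> 1"
    "\<And>t s. t \<ge> t0 \<Longrightarrow> 0 < s \<Longrightarrow> s \<le> t \<Longrightarrow> set_integrable lborel {0<..} (\<lambda>u. b s u * (t + u) powr (- \<gamma> - 1/2))"
    "\<And>t s. t \<ge> t0 \<Longrightarrow> 0 < s \<Longrightarrow> s \<le> t \<Longrightarrow> (LINT u:{0<..}|lborel. b s u * (t + u) powr (- \<gamma> - 1/2)) \<le> K * (A s / A t) * t powr (- \<gamma> - 1/2)"
proof -
  obtain K1 t1 where K1: "K1 \<ge> 1" "t1 \<ge> 1"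
    "\<And>t. t \<ge> t1 \<Longrightarrow> t * c t * A t \<le> K1" "\<And>t. t \<ge> t1 \<Longrightarrow> Cc t \<le> K1 * (t * c t)"
    "\<And>t. t \<ge> t1 \<Longrightarrow> t * a t \<le> K1 * A t" "\<And>t. t \<ge> t1 \<Longrightarrow> c (t / 2) \<le> K1 * c t"
    "\<And>t. t \<ge> t1 \<Longrightarrow> A (t / 2) \<le> K1 * A t" "\<And>t. t \<ge> t1 \<Longrightarrow> a t * Cc t \<le> K1 / t"
    by (rule uniform_bounds) blast
  obtain K2 t2 where K2: "K2 \<ge> 1" "t2 \<ge> 1"
    "\<And>t s u. t \<ge> t2 \<Longrightarrow> s > 0 \<Longrightarrow> u \<ge> 2 * t \<Longrightarrow> t * b s u \<le> K2 * (A s / A t) + K2"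
    by (rule b_tail_bound) blast
  define p where "p = \<gamma> + 1/2"
  have p: "p > 1" "- \<gamma> - 1/2 = - p" using gamma_gt by (auto simp: p_def)
  define K where "K = K1 * (K1 * K1) + 2 * K2 / (p - 1)"
  have K: "K \<ge> 1"
  proof -
    have "1 * (1 * 1) \<le> K1 * (K1 * K1)" using K1(1) by (intro mult_mono) auto
    moreover have "0 \<le> 2 * K2 / (p - 1)" using K2(1) p by simp
    ultimately show ?thesis unfolding K_def by linarith
  qed
  have nn: "(\<integral>\<^sup>+u\<in>{0<..}. ennreal (b s u * (t + u) powr (- p)) \<partial>lborel) \<le> ennreal (K * (A s / A t) * t powr (- p))"
    if t: "t \<ge> max t1 t2" and s: "0 < s" "s \<le> t" for s t
  proof -
    have tp: "t > 0" "t \<ge> t1" "t \<ge> t2" using t K1(2) by auto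
    have Ap: "A t > 0" "A s > 0" "A (2 * t) > 0" using s tp by (auto intro: A_p)
    define Q where "Q = A s / A t"
    have Q1: "Q \<ge> 1" using A_anti[OF s] Ap by (simp add: Q_def)
    \<comment> \<open>Both factors are compared at the common time \<open>2 * t\<close>, where the
      product of the bounds involves \<open>c\<close> and \<open>A\<close> only through their
      bounded combination.\<close>
    have C2: "Cc (2 * t) * A t \<le> K1 * (K1 * K1)"
    proof -
      have "Cc (2 * t) * A t \<le> (K1 * (2 * t * c (2 * t))) * (K1 * A (2 * t))"
        using K1(4)[of "2 * t"] K1(7)[of "2 * t"] tp Ap Cc_nn K1(1) c_nn by (intro mult_mono) auto
      also have "\<dots> = K1 * (K1 * (2 * t * c (2 * t) * A (2 * t)))" by (simp add: mult_ac)
      also have "\<dots> \<le> K1 * (K1 * K1)" using K1(1) K1(3)[of "2 * t"] tp by (intro mult_left_mono) auto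
      finally show ?thesis .
    qed
    have pw: "ennreal (b s u * (t + u) powr (- p)) * indicator {0<..} u
      \<le> ennreal (t powr (- p)) * (ennreal (b s u) * indicator {..<2 * t} u) + ennreal (2 * K2 * Q / t) * (ennreal (u powr (- p)) * indicator {2 * t..} u)" for u
    proof (cases "u > 0")
      case u: True
      show ?thesis
      proof (cases "u < 2 * t")
        case True
        have "b s u * (t + u) powr (- p) \<le> b s u * t powr (- p)"
          using tp u p b_nn by (intro mult_left_mono powr_mono2') auto
        also have "\<dots> = t powr (- p) * b s u" by simp
        finally have "ennreal (b s u * (t + u) powr (- p)) \<le> ennreal (t powr (- p)) * ennreal (b s u)"
          using b_nn by (subst ennreal_mult[symmetric]) (auto intro!: ennreal_leI)
        then show ?thesis using True u by simp
      next
        case False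
        have "t * b s u \<le> K2 * Q + K2" unfolding Q_def using False by (intro K2(3) tp s) auto
        also have "\<dots> \<le> 2 * K2 * Q" using mult_left_mono[OF Q1, of K2] K2(1) by simp
        finally have 1: "b s u \<le> 2 * K2 * Q / t" using tp by (simp add: field_simps)
        have "(t + u) powr (- p) \<le> u powr (- p)" using tp u p by (intro powr_mono2') auto
        with 1 have "b s u * (t + u) powr (- p) \<le> (2 * K2 * Q / t) * u powr (- p)"
          using b_nn K2(1) Q1 tp by (intro mult_mono) auto
        then have "ennreal (b s u * (t + u) powr (- p)) \<le> ennreal (2 * K2 * Q / t) * ennreal (u powr (- p))"
          using K2(1) Q1 tp by (subst ennreal_mult[symmetric]) (auto intro!: ennreal_leI)
        then show ?thesis using False u by simp
      qed
    qed simp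
    have "(\<integral>\<^sup>+u\<in>{0<..}. ennreal (b s u * (t + u) powr (- p)) \<partial>lborel)
      \<le> (\<integral>\<^sup>+u. ennreal (t powr (- p)) * (ennreal (b s u) * indicator {..<2 * t} u) + ennreal (2 * K2 * Q / t) * (ennreal (u powr (- p)) * indicator {2 * t..} u) \<partial>lborel)"
      by (rule nn_integral_mono) (rule pw)
    also have "\<dots> = ennreal (t powr (- p)) * (\<integral>\<^sup>+u. ennreal (b s u) * indicator {..<2 * t} u \<partial>lborel)
       + ennreal (2 * K2 * Q / t) * (\<integral>\<^sup>+u. ennreal (u powr (- p)) * indicator {2 * t..} u \<partial>lborel)"
      by (subst nn_integral_add) (auto simp: nn_integral_cmult)
    also have "(\<integral>\<^sup>+u. ennreal (u powr (- p)) * indicator {2 * t..} u \<partial>lborel) = ennreal ((2 * t) powr (1 - p) / (p - 1))"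
      using tp p by (intro powr_tail_nn_integral) auto
    also have "ennreal (t powr (- p)) * (\<integral>\<^sup>+u. ennreal (b s u) * indicator {..<2 * t} u \<partial>lborel) + ennreal (2 * K2 * Q / t) * ennreal ((2 * t) powr (1 - p) / (p - 1))
      \<le> ennreal (t powr (- p)) * ennreal (Cc (2 * t) * A s) + ennreal (2 * K2 * Q / t) * ennreal ((2 * t) powr (1 - p) / (p - 1))"
      by (intro add_mono mult_left_mono b_integral_le s) auto
    also have "\<dots> = ennreal (t powr (- p) * (Cc (2 * t) * A s) + (2 * K2 * Q / t) * ((2 * t) powr (1 - p) / (p - 1)))"
    proof -
      have 1: "0 \<le> Cc (2 * t) * A s" using Cc_nn Ap by simp
      have 2: "0 \<le> 2 * K2 * Q / t" "0 \<le> (2 * t) powr (1 - p) / (p - 1)" using K2(1) Q1 tp p by auto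
      have "0 \<le> t powr (- p) * (Cc (2 * t) * A s)" using 1 by simp
      moreover have "0 \<le> (2 * K2 * Q / t) * ((2 * t) powr (1 - p) / (p - 1))" using 2 by (rule mult_nonneg_nonneg)
      ultimately have "ennreal (t powr (- p) * (Cc (2 * t) * A s) + (2 * K2 * Q / t) * ((2 * t) powr (1 - p) / (p - 1)))
        = ennreal (t powr (- p) * (Cc (2 * t) * A s)) + ennreal ((2 * K2 * Q / t) * ((2 * t) powr (1 - p) / (p - 1)))"
        by (rule ennreal_plus)
      then show ?thesis by (simp only: ennreal_mult[OF powr_ge_zero 1] ennreal_mult[OF 2])
    qed
    also have "\<dots> \<le> ennreal (K * Q * t powr (- p))"
    proof (rule ennreal_leI)
      have "Cc (2 * t) * A s = (Cc (2 * t) * A t) * Q" using Ap by (simp add: Q_def)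
      also have "\<dots> \<le> (K1 * (K1 * K1)) * Q" using C2 Q1 by (intro mult_right_mono) auto
      finally have "t powr (- p) * (Cc (2 * t) * A s) \<le> t powr (- p) * ((K1 * (K1 * K1)) * Q)" by (intro mult_left_mono) auto
      moreover have "(2 * K2 * Q / t) * ((2 * t) powr (1 - p) / (p - 1)) \<le> (2 * K2 * Q / t) * (t powr (1 - p) / (p - 1))"
        using K2(1) Q1 tp p by (intro mult_left_mono divide_right_mono powr_mono2') auto
      moreover have "(2 * K2 * Q / t) * (t powr (1 - p) / (p - 1)) = (2 * K2 / (p - 1)) * Q * t powr (- p)"
        using tp by (simp add: powr_diff powr_minus field_simps)
      ultimately show "t powr (- p) * (Cc (2 * t) * A s) + (2 * K2 * Q / t) * ((2 * t) powr (1 - p) / (p - 1)) \<le> K * Q * t powr (- p)"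
        unfolding K_def by (simp add: algebra_simps)
    qed
    finally show ?thesis unfolding Q_def .
  qed
  have i: "set_integrable lborel {0<..} (\<lambda>u. b s u * (t + u) powr (- p))" if t: "t \<ge> max t1 t2" and s: "0 < s" "s \<le> t" for s t
  proof (rule set_integrable_nonneg_bound)
    show "(\<integral>\<^sup>+u\<in>{0<..}. ennreal (b s u * (t + u) powr (- p)) \<partial>lborel) < \<infinity>"
      using nn[OF that] by (rule le_less_trans) simp
  qed (auto simp: set_borel_measurable_def b_nn)
  show ?thesis
  proof (rule that[OF K, of "max t1 t2"])
    show "max t1 t2 \<ge> 1" using K1(2) by simp
    fix t s assume t: "t \<ge> max t1 t2" and s: "0 < s" "s \<le> t"
    show "set_integrable lborel {0<..} (\<lambda>u. b s u * (t + u) powr (- \<gamma> - 1/2))" unfolding p(2) by (rule i[OF t s])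
    have "0 \<le> K * (A s / A t) * t powr (- p)" using K A_p[of s] A_p[of t] s by (intro mult_nonneg_nonneg) auto
    moreover have "ennreal (LINT u:{0<..}|lborel. b s u * (t + u) powr (- p)) \<le> ennreal (K * (A s / A t) * t powr (- p))"
      using nn[OF t s] by (subst nn_set_integral_eq_set_integral[symmetric, OF i[OF t s]]) (auto simp: b_nn)
    ultimately show "(LINT u:{0<..}|lborel. b s u * (t + u) powr (- \<gamma> - 1/2)) \<le> K * (A s / A t) * t powr (- \<gamma> - 1/2)"
      unfolding p(2) by (simp add: ennreal_le_iff)
  qed
qed

end

subsection \<open>The rescaled iterates\<close>

locale overshoot_horizon = overshoot +
  fixes T :: real
  assumes T: "T > 0"
begin

abbreviation bi :: "nat \<Rightarrow> real \<Rightarrow> real \<Rightarrow> real" where "bi k s t \<equiv> b_iter c a k s T t"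
abbreviation \<theta>' where "\<theta>' \<equiv> (1 + \<theta>) / 2"

lemma theta': "0 < \<theta>'" "\<theta>' < 1" using theta by auto

lemma bi_m [measurable]: "(\<lambda>s. bi k s t) \<in> borel_measurable borel"
proof (induction k)
  case (Suc k)
  show ?case
  proof (cases k)
    case (Suc j)
    have [measurable]: "(\<lambda>s. bi (Suc j) s t) \<in> borel_measurable borel" using Suc.IH Suc by simp
    show ?thesis unfolding Suc b_iter.simps(3)[abs_def] set_lebesgue_integral_def by measurable
  qed simp
qed simp

lemma bi_nn: "0 \<le> bi k s t"
proof (induction k arbitrary: s)
  case (Suc k)
  show ?case
  proof (cases k)
    case (Suc j)
    have "0 \<le> bi (Suc j) s t" for s using Suc.IH[of s] Suc by simp
    then show ?thesis unfolding Suc b_iter.simps(3) set_lebesgue_integral_def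
      by (intro integral_nonneg_AE AE_I2) (auto simp: b_nn split: split_indicator)
  qed (simp add: b_nn)
qed simp

text \<open>The index is shifted: \<open>R 0\<close> is the rescaled first iterate. For fixed
  \<open>x\<close> the divisor has the exact order of \<open>b (t * x) T\<close>, and the horizon
  \<open>T\<close> survives in the limit through this divisor alone.\<close>

definition R :: "nat \<Rightarrow> real \<Rightarrow> real \<Rightarrow> real" where
  "R k t x = bi (Suc k) (t * x) t / (a t * Cc T)"

lemma R_m [measurable]: "R k t \<in> borel_measurable borel"
  unfolding R_def[abs_def] by measurable

lemma R_nn: "0 \<le> R k t x"
  unfolding R_def using bi_nn a_nn Cc_nn by simp

lemma N_pos: "t > 0 \<Longrightarrow> a t * Cc T > 0"
  using a_p Cc_p T by simp

lemma R_Suc: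
  assumes t: "t > 0"
  shows "R (Suc k) t x = (LINT u:{0<..}|lborel. (t * b (t * x) (t * u)) * R k t (1 + u))"
proof -
  have "(LINT u:{0<..}|lborel. (t * b (t * x) (t * u)) * R k t (1 + u))
    = (LINT u:{0<..}|lborel. (t / (a t * Cc T)) * (b (t * x) (t * u) * bi (Suc k) (t + t * u) t))"
    unfolding R_def by (intro set_lebesgue_integral_cong) (auto simp: distrib_left)
  also have "\<dots> = (t / (a t * Cc T)) * (LINT u:{0<..}|lborel. b (t * x) (t * u) * bi (Suc k) (t + t * u) t)"
    by (rule set_integral_mult_right)
  also have "(LINT u:{0<..}|lborel. b (t * x) (t * u) * bi (Suc k) (t + t * u) t) = (LINT u:{0<..}|lborel. b (t * x) u * bi (Suc k) (t + u) t) / t"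
    using set_integral_scale[OF t, of "\<lambda>u. b (t * x) u * bi (Suc k) (t + u) t"] by simp
  also have "(t / (a t * Cc T)) * ((LINT u:{0<..}|lborel. b (t * x) u * bi (Suc k) (t + u) t) / t) = R (Suc k) t x"
    using t by (simp add: R_def)
  finally show ?thesis ..
qed

text \<open>Counterpart of \<open>phi_bounds\<close> at finite \<open>t\<close>, with the rate
  \<open>\<theta>'\<close>. Beyond the interval the Lyapunov inequality is iterated; inside it one
  more application of the kernel is estimated by \<open>landing_bound\<close>. The second bound
  starts at \<open>Suc k\<close> because the zeroth term carries the stronger singularity of
  \<open>a\<close> at 0.\<close>

lemma R_bounds:
  obtains K t0 where "K \<ge> 1" "t0 \<ge> 1"
    "\<And>t x k. t \<ge> t0 \<Longrightarrow> x \<ge> 1 \<Longrightarrow> R k t x \<le> K * \<theta>' ^ k * x powr (- \<gamma> - 1/2)"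
    "\<And>t x k. t \<ge> t0 \<Longrightarrow> 0 < x \<Longrightarrow> x \<le> 1 \<Longrightarrow> R (Suc k) t x \<le> K * \<theta>' ^ k * (A (t * x) / A t)"
proof -
  obtain t1 where t1: "t1 \<ge> 1"
    "\<And>s. s \<ge> t1 \<Longrightarrow> set_integrable lborel {0<..} (\<lambda>u. b s u * max u 1 powr (- \<gamma> - 1/2))"
    "\<And>s. s \<ge> t1 \<Longrightarrow> (LINT u:{0<..}|lborel. b s u * max u 1 powr (- \<gamma> - 1/2)) \<le> \<theta>' * s powr (- \<gamma> - 1/2)"
    by (rule lyapunov) blast
  obtain K2 t2 where K2: "K2 \<ge> 1" "t2 \<ge> 1"
    "\<And>t s. t \<ge> t2 \<Longrightarrow> 0 < s \<Longrightarrow> s \<le> t \<Longrightarrow> set_integrable lborel {0<..} (\<lambda>u. b s u * (t + u) powr (- \<gamma> - 1/2))"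
    "\<And>t s. t \<ge> t2 \<Longrightarrow> 0 < s \<Longrightarrow> s \<le> t \<Longrightarrow> (LINT u:{0<..}|lborel. b s u * (t + u) powr (- \<gamma> - 1/2)) \<le> K2 * (A s / A t) * t powr (- \<gamma> - 1/2)"
    by (rule landing_bound) blast
  \<comment> \<open>The margin 1/2 turns the index \<open>- \<gamma> - 1\<close> of \<open>a\<close>
    into the Lyapunov exponent \<open>- \<gamma> - 1/2\<close>.\<close>
  have half: "(1/2::real) > 0" by simp
  obtain X K where X: "X > 0" "K \<ge> 1"
    and pot: "\<And>x y. x \<ge> X \<Longrightarrow> y \<ge> x \<Longrightarrow> a y / a x \<le> K * (y / x) powr (- \<gamma> - 1 + 1/2) \<and> a x / a y \<le> K * (x / y) powr (- \<gamma> - 1 - 1/2)"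
    using regularly_varying_potter[OF a_rv half] by blast
  define q where "q = - \<gamma> - 1/2"
  have q: "q < 0" "- \<gamma> - 1 + 1/2 = q" using gamma_gt by (auto simp: q_def)
  define t0 where "t0 = max (max t1 t2) X"
  \<comment> \<open>The next iterate reads its predecessor only at \<open>t + u\<close>, so a bound
    beyond \<open>t\<close> is enough to control it everywhere.\<close>
  have dom: "set_integrable lborel {0<..} (\<lambda>u. b s u * bi (Suc k) (t + u) t)
      \<and> bi (Suc (Suc k)) s t \<le> D * (LINT u:{0<..}|lborel. b s u * (t + u) powr q)"
    if D: "0 \<le> D" "\<And>s. s \<ge> t \<Longrightarrow> bi (Suc k) s t \<le> D * s powr q"
      and i: "set_integrable lborel {0<..} (\<lambda>u. b s u * (t + u) powr q)" for D k t s
  proof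
    have le: "b s u * bi (Suc k) (t + u) t \<le> D * (b s u * (t + u) powr q)" if "u > 0" for u
      using mult_left_mono[OF D(2)[of "t + u"] b_nn[of s u]] that by (simp add: mult_ac)
    have i': "set_integrable lborel {0<..} (\<lambda>u. D * (b s u * (t + u) powr q))" by (intro set_integrable_mult_right i)
    show 1: "set_integrable lborel {0<..} (\<lambda>u. b s u * bi (Suc k) (t + u) t)"
    proof (rule set_integrable_bound[OF i'])
      show "AE u in lborel. u \<in> {0<..} \<longrightarrow> norm (b s u * bi (Suc k) (t + u) t) \<le> norm (D * (b s u * (t + u) powr q))"
      proof (intro AE_I2 impI)
        fix u :: real assume "u \<in> {0<..}"
        then have "b s u * bi (Suc k) (t + u) t \<le> D * (b s u * (t + u) powr q)" using le by simp
        moreover have "0 \<le> b s u * bi (Suc k) (t + u) t" by (intro mult_nonneg_nonneg b_nn bi_nn)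
        ultimately show "norm (b s u * bi (Suc k) (t + u) t) \<le> norm (D * (b s u * (t + u) powr q))" by (simp only: real_norm_def)
      qed
    qed (simp add: set_borel_measurable_def)
    show "bi (Suc (Suc k)) s t \<le> D * (LINT u:{0<..}|lborel. b s u * (t + u) powr q)"
      unfolding b_iter.simps(3) set_integral_mult_right[symmetric]
      by (rule set_integral_mono[OF 1 i']) (use le in auto)
  qed
  have far: "bi (Suc k) s t \<le> (K * (Cc T * a t) * t powr (- q)) * \<theta>' ^ k * s powr q" if t: "t \<ge> t0" and s: "s \<ge> t" for k t s
    using s
  proof (induction k arbitrary: s)
    case 0
    have tp: "t > 0" "t \<ge> X" "a t > 0" using t X by (auto simp: t0_def intro: a_p)
    have "bi (Suc 0) s t \<le> a s * Cc T" using b_le[of s T] 0 tp by simp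
    also have "a s = (a s / a t) * a t" using tp by simp
    also have "\<dots> * Cc T \<le> (K * (s / t) powr q) * a t * Cc T"
      using pot[OF tp(2) 0] unfolding q(2) using tp Cc_nn by (intro mult_right_mono) auto
    also have "(s / t) powr q = s powr q * t powr (- q)"
      using tp 0 by (simp add: powr_divide powr_minus_divide)
    finally show ?case by (simp add: mult_ac)
  next
    case (Suc k)
    have tp: "t > 0" "t \<ge> t1" "t \<ge> 1" "a t > 0" using t X t1(1) by (auto simp: t0_def intro: a_p)
    have s1: "s \<ge> t1" using Suc.prems tp by simp
    define D where "D = (K * (Cc T * a t) * t powr (- q)) * \<theta>' ^ k"
    have D: "0 \<le> D" unfolding D_def using X Cc_nn a_nn theta' by (intro mult_nonneg_nonneg zero_le_power) auto
    \<comment> \<open>Since \<open>t \<ge> 1\<close> and \<open>q < 0\<close>, the point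
      \<open>t + u\<close> may be replaced by the truncation for which the Lyapunov inequality is
      stated.\<close>
    have le: "b s u * (t + u) powr q \<le> b s u * max u 1 powr q" if "u > 0" for u
      using that tp q b_nn by (intro mult_left_mono powr_mono2') auto
    have mi: "set_integrable lborel {0<..} (\<lambda>u. b s u * max u 1 powr q)" unfolding q_def by (rule t1(2)[OF s1])
    have i: "set_integrable lborel {0<..} (\<lambda>u. b s u * (t + u) powr q)"
    proof (rule set_integrable_bound[OF mi])
      show "AE u in lborel. u \<in> {0<..} \<longrightarrow> norm (b s u * (t + u) powr q) \<le> norm (b s u * max u 1 powr q)"
        using le b_nn by (intro AE_I2 impI) (simp add: abs_mult)
    qed (simp add: set_borel_measurable_def)
    have "bi (Suc (Suc k)) s t \<le> D * (LINT u:{0<..}|lborel. b s u * (t + u) powr q)"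
      using dom[OF D _ i, of k] Suc.IH unfolding D_def by blast
    also have "\<dots> \<le> D * (LINT u:{0<..}|lborel. b s u * max u 1 powr q)"
      by (rule mult_left_mono[OF set_integral_mono[OF i mi] D]) (use le in auto)
    also have "\<dots> \<le> D * (\<theta>' * s powr q)" using t1(3)[OF s1] D unfolding q_def by (intro mult_left_mono)
    finally show ?case by (simp add: D_def mult_ac)
  qed
  have near: "bi (Suc (Suc k)) s t \<le> K * (Cc T * a t) * \<theta>' ^ k * (K2 * (A s / A t))" if t: "t \<ge> t0" and s: "0 < s" "s \<le> t" for k t s
  proof -
    have tp: "t > 0" "t \<ge> t2" using t X by (auto simp: t0_def)
    define D where "D = (K * (Cc T * a t) * t powr (- q)) * \<theta>' ^ k"
    have D: "0 \<le> D" unfolding D_def using X Cc_nn a_nn theta' by (intro mult_nonneg_nonneg zero_le_power) auto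
    have i: "set_integrable lborel {0<..} (\<lambda>u. b s u * (t + u) powr q)" unfolding q_def by (rule K2(3)[OF tp(2) s])
    have "bi (Suc (Suc k)) s t \<le> D * (LINT u:{0<..}|lborel. b s u * (t + u) powr q)"
      using dom[OF D _ i, of k] far[OF t] unfolding D_def by blast
    also have "\<dots> \<le> D * (K2 * (A s / A t) * t powr q)" using K2(4)[OF tp(2) s] D unfolding q_def by (intro mult_left_mono)
    also have "\<dots> = K * (Cc T * a t) * \<theta>' ^ k * (K2 * (A s / A t)) * (t powr (- q) * t powr q)" by (simp add: D_def mult_ac)
    also have "t powr (- q) * t powr q = 1" using tp by (simp add: powr_add[symmetric])
    finally show ?thesis by simp
  qed
  show ?thesis
  proof (rule that[of "K * K2" t0])
    show "K * K2 \<ge> 1" using mult_mono[of 1 K 1 K2] X K2(1) by simp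
    show "t0 \<ge> 1" using t1(1) by (simp add: t0_def)
    fix t x :: real and k assume t: "t \<ge> t0"
    have tp: "t > 0" using t X by (simp add: t0_def)
    note N = N_pos[OF tp]
    {
      assume x: "x \<ge> 1"
      have "bi (Suc k) (t * x) t \<le> (K * (Cc T * a t) * t powr (- q)) * \<theta>' ^ k * (t * x) powr q"
        using x tp by (intro far[OF t]) auto
      also have "\<dots> = (K * \<theta>' ^ k * x powr q) * (t powr (- q) * t powr q) * (a t * Cc T)" using tp x by (simp add: powr_mult mult_ac)
      also have "t powr (- q) * t powr q = 1" using tp by (simp add: powr_add[symmetric])
      finally have "R k t x \<le> K * \<theta>' ^ k * x powr q" unfolding R_def using N by (subst pos_divide_le_eq) auto
      also have "\<dots> \<le> (K * K2) * \<theta>' ^ k * x powr q" using X K2(1) theta' by (intro mult_right_mono) auto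
      finally show "R k t x \<le> (K * K2) * \<theta>' ^ k * x powr (- \<gamma> - 1/2)" unfolding q_def .
    }
    {
      assume x: "0 < x" "x \<le> 1"
      have "bi (Suc (Suc k)) (t * x) t \<le> K * (Cc T * a t) * \<theta>' ^ k * (K2 * (A (t * x) / A t))"
        using x tp by (intro near[OF t]) auto
      also have "\<dots> = ((K * K2) * \<theta>' ^ k * (A (t * x) / A t)) * (a t * Cc T)" by (simp add: mult_ac)
      finally show "R (Suc k) t x \<le> (K * K2) * \<theta>' ^ k * (A (t * x) / A t)" unfolding R_def using N by (subst pos_divide_le_eq) auto
    }
  qed
qed

text \<open>The start is squeezed between \<open>a (t * x + T) / a t\<close> and
  \<open>a (t * x) / a t\<close>, because \<open>T / t\<close> tends to 0. In the induction step the
  rescaled kernel is bounded uniformly in \<open>u\<close>, and the decay of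
  \<open>R k t (1 + u)\<close> from \<open>R_bounds\<close> supplies an integrable majorant.\<close>

lemma R_limit:
  "x > 0 \<Longrightarrow> ((\<lambda>t. R k t x) \<longlongrightarrow> \<phi> k x) at_top"
proof (induction k arbitrary: x)
  case 0
  have up: "((\<lambda>t. a (t * x) / a t) \<longlongrightarrow> \<phi> 0 x) at_top" using regularly_varyingD(1)[OF a_rv 0] by simp
  have "((\<lambda>t. x + T / t) \<longlongrightarrow> x + 0) at_top"
    by (intro tendsto_add tendsto_const tendsto_divide_0[OF tendsto_const]) (rule filterlim_at_top_imp_at_infinity[OF filterlim_ident])
  then have "((\<lambda>t. x + T / t) \<longlongrightarrow> x) at_top" by simp
  from regularly_varying_tendsto_compose[OF a_rv this filterlim_ident 0]
  have lo: "((\<lambda>t. a (t * (x + T / t)) / a t) \<longlongrightarrow> \<phi> 0 x) at_top" by simp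
  have "eventually (\<lambda>t. a (t * (x + T / t)) / a t \<le> R 0 t x \<and> R 0 t x \<le> a (t * x) / a t) at_top"
    using eventually_gt_at_top[of 0]
  proof eventually_elim
    case (elim t)
    have tx: "t * x > 0" using elim 0 by simp
    have e: "t * (x + T / t) = t * x + T" using elim by (simp add: distrib_left)
    have "a t > 0" "Cc T > 0" using elim T by (auto intro: a_p Cc_p)
    then show ?case using b_le[OF tx, of T] b_ge[OF tx, of T] unfolding e by (simp add: R_def field_simps)
  qed
  then show ?case
    by (intro tendsto_sandwich[OF _ _ lo up]) (auto elim: eventually_mono)
next
  case (Suc k)
  note x = Suc.prems
  obtain K t0 where K: "K \<ge> 1" "t0 \<ge> 1"
    "\<And>t x k. t \<ge> t0 \<Longrightarrow> x \<ge> 1 \<Longrightarrow> R k t x \<le> K * \<theta>' ^ k * x powr (- \<gamma> - 1/2)"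
    by (rule R_bounds) blast
  obtain K2 t2 where K2: "K2 \<ge> 1" "t2 \<ge> 1"
    "\<And>t s u. t \<ge> t2 \<Longrightarrow> s > 0 \<Longrightarrow> u \<ge> 2 * t \<Longrightarrow> t * b s u \<le> K2 * (A s / A t) + K2"
    "\<And>t. t \<ge> t2 \<Longrightarrow> t * (a t * Cc t) \<le> K2"
    by (rule b_tail_bound) blast
  \<comment> \<open>The first summand bounds the rescaled kernel for \<open>u < 2\<close>, the
    second for larger \<open>u\<close>.\<close>
  define M where "M = K2 * ((x powr (- \<gamma> - 1) + 1) * (2 powr \<gamma> + 1)) + (K2 * (x powr (- \<gamma>) + 1) + K2)"
  define w where "w u = indicator {0<..} u *\<^sub>R (M * (K * \<theta>' ^ k) * (1 + u) powr (- \<gamma> - 1/2))" for u :: real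
  have wi: "integrable lborel w"
  proof -
    have e: "- (\<gamma> + 1/2) = - \<gamma> - 1/2" by simp
    have "1 < \<gamma> + 1/2" using gamma_gt by simp
    from set_integrable_mult_right[OF powr_shift_integrable[OF this], of "M * (K * \<theta>' ^ k)"]
    show ?thesis unfolding w_def[abs_def] set_integrable_def e .
  qed
  have ev1: "eventually (\<lambda>t. a (t * x) / a t < x powr (- \<gamma> - 1) + 1) at_top"
    by (rule order_tendstoD(2)[OF regularly_varyingD(1)[OF a_rv x]]) simp
  have ev2: "eventually (\<lambda>t. A (t * x) / A t < x powr (- \<gamma>) + 1) at_top"
    by (rule order_tendstoD(2)[OF regularly_varyingD(1)[OF A_rv x]]) simp
  have ev3: "eventually (\<lambda>t. Cc (t * 2) / Cc t < 2 powr \<gamma> + 1) at_top"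
    by (rule order_tendstoD(2)[OF regularly_varyingD(1)[OF Cc_rv]]) simp_all
  have bnd: "eventually (\<lambda>t. AE u in lborel. norm (indicator {0<..} u *\<^sub>R ((t * b (t * x) (t * u)) * R k t (1 + u))) \<le> w u) at_top"
    using ev1 ev2 ev3 eventually_ge_at_top[of "max t0 t2"]
  proof eventually_elim
    case (elim t)
    then have t: "t > 0" "t \<ge> t0" "t \<ge> t2" using K by auto
    have pos: "a t > 0" "Cc t > 0" "A t > 0" using t by (auto intro: a_p Cc_p A_p)
    have tx: "t * x > 0" using t x by simp
    have M0: "0 \<le> K2 * (x powr (- \<gamma>) + 1) + K2" "0 \<le> K2 * ((x powr (- \<gamma> - 1) + 1) * (2 powr \<gamma> + 1))"
      using K2(1) by (auto intro!: add_nonneg_nonneg mult_nonneg_nonneg)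
    have bM: "t * b (t * x) (t * u) \<le> M" if u: "u > 0" for u
    proof (cases "u < 2")
      case True
      have "t * b (t * x) (t * u) \<le> t * (a (t * x) * Cc (t * u))" using t tx by (intro mult_left_mono b_le) auto
      also have "\<dots> \<le> t * (a (t * x) * Cc (t * 2))" using True t a_nn by (intro mult_left_mono Cc_mono) auto
      also have "\<dots> = (t * (a t * Cc t)) * ((a (t * x) / a t) * (Cc (t * 2) / Cc t))" using pos by simp
      also have "\<dots> \<le> K2 * ((x powr (- \<gamma> - 1) + 1) * (2 powr \<gamma> + 1))"
      proof (rule mult_mono[OF K2(4)[OF t(3)]])
        show "(a (t * x) / a t) * (Cc (t * 2) / Cc t) \<le> (x powr (- \<gamma> - 1) + 1) * (2 powr \<gamma> + 1)"
          by (rule mult_mono) (use elim pos a_nn Cc_nn in auto)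
      qed (use K2(1) pos a_nn Cc_nn in auto)
      finally show ?thesis unfolding M_def using M0 by linarith
    next
      case False
      have "t * b (t * x) (t * u) \<le> K2 * (A (t * x) / A t) + K2" using False t by (intro K2(3) tx) auto
      also have "\<dots> \<le> K2 * (x powr (- \<gamma>) + 1) + K2" using elim K2(1) by (intro add_right_mono mult_left_mono) auto
      finally show ?thesis unfolding M_def using M0 by linarith
    qed
    show ?case
    proof (intro AE_I2)
      fix u :: real
      show "norm (indicator {0<..} u *\<^sub>R ((t * b (t * x) (t * u)) * R k t (1 + u))) \<le> w u"
      proof (cases "u > 0")
        case True
        have "(t * b (t * x) (t * u)) * R k t (1 + u) \<le> M * (K * \<theta>' ^ k * (1 + u) powr (- \<gamma> - 1/2))"
        proof (rule mult_mono[OF bM[OF True]])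
          show "R k t (1 + u) \<le> K * \<theta>' ^ k * (1 + u) powr (- \<gamma> - 1/2)" using True t by (intro K(3)) auto
          show "0 \<le> M" unfolding M_def using M0 by linarith
        qed (rule R_nn)
        moreover have "0 \<le> (t * b (t * x) (t * u)) * R k t (1 + u)" using t b_nn R_nn by simp
        moreover have "w u = M * (K * \<theta>' ^ k * (1 + u) powr (- \<gamma> - 1/2))"
          using True unfolding w_def by (simp only: mult.assoc) simp
        moreover have "indicator {0<..} u *\<^sub>R ((t * b (t * x) (t * u)) * R k t (1 + u)) = (t * b (t * x) (t * u)) * R k t (1 + u)"
          using True by simp
        ultimately show ?thesis by (simp only: real_norm_def abs_of_nonneg)
      qed (simp add: w_def)
    qed
  qed
  have "((\<lambda>t. LINT u|lborel. indicator {0<..} u *\<^sub>R ((t * b (t * x) (t * u)) * R k t (1 + u)))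
     \<longlongrightarrow> (LINT u|lborel. indicator {0<..} u *\<^sub>R (\<beta> x u * \<phi> k (1 + u)))) at_top"
  proof (rule integral_dominated_convergence_at_top[OF _ _ wi _ bnd])
    show "AE u in lborel. ((\<lambda>t. indicator {0<..} u *\<^sub>R ((t * b (t * x) (t * u)) * R k t (1 + u))) \<longlongrightarrow> indicator {0<..} u *\<^sub>R (\<beta> x u * \<phi> k (1 + u))) at_top"
    proof (intro AE_I2)
      fix u :: real
      show "((\<lambda>t. indicator {0<..} u *\<^sub>R ((t * b (t * x) (t * u)) * R k t (1 + u))) \<longlongrightarrow> indicator {0<..} u *\<^sub>R (\<beta> x u * \<phi> k (1 + u))) at_top"
      proof (cases "u > 0")
        case True
        then show ?thesis by (intro tendsto_intros b_limit x Suc.IH) auto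
      qed simp
    qed
  qed measurable
  moreover have "eventually (\<lambda>t. (LINT u|lborel. indicator {0<..} u *\<^sub>R ((t * b (t * x) (t * u)) * R k t (1 + u))) = R (Suc k) t x) at_top"
    using eventually_gt_at_top[of 0] by eventually_elim (simp only: R_Suc set_lebesgue_integral_def)
  ultimately show ?case
    unfolding stable_iter.simps(2) set_lebesgue_integral_def by (simp only: tendsto_cong)
qed

end

text \<open>Folding the unit interval at 1/2 brings its right end to 0, where the convergence
  theorems above admit a singularity.\<close>

lemma set_integral_split_half:
  fixes F :: "real \<Rightarrow> real"
  assumes [measurable]: "F \<in> borel_measurable borel"
    and 1: "set_integrable lborel {0<..} (\<lambda>x. if x < 1/2 then F x else 0)"
    and 2: "set_integrable lborel {0<..} (\<lambda>y. if y < 1/2 then F (1 - y) else 0)"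
  shows "set_integrable lborel {0<..<1} F"
    and "(LINT x:{0<..<1}|lborel. F x) = (LINT x:{0<..}|lborel. if x < 1/2 then F x else 0) + (LINT y:{0<..}|lborel. if y < 1/2 then F (1 - y) else 0)"
proof -
  define G1 where "G1 x = indicator {0<..} x *\<^sub>R (if x < 1/2 then F x else 0)" for x
  define G2 where "G2 y = indicator {0<..} y *\<^sub>R (if y < 1/2 then F (1 - y) else 0)" for y
  have i: "integrable lborel G1" "integrable lborel G2" using 1 2 unfolding set_integrable_def G1_def G2_def .
  have i2: "integrable lborel (\<lambda>x. G2 (1 + (- 1) * x))" using i(2) by (subst lborel_integrable_real_affine_iff) auto
  have e2: "(LINT x|lborel. G2 (1 + (- 1) * x)) = (LINT y|lborel. G2 y)"
    using lborel_integral_real_affine[of "- 1" G2 1] by simp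
  have ae: "AE x in lborel. indicator {0<..<1} x *\<^sub>R F x = G1 x + G2 (1 + (- 1) * x)"
    using AE_lborel_singleton[of "1/2"] by eventually_elim (auto simp: G1_def G2_def indicator_def)
  have m: "(\<lambda>x. indicator {0<..<1} x *\<^sub>R F x) \<in> borel_measurable lborel" "G1 \<in> borel_measurable lborel" "G2 \<in> borel_measurable lborel"
    unfolding G1_def G2_def by measurable
  show "set_integrable lborel {0<..<1} F" unfolding set_integrable_def
    by (subst integrable_cong_AE[OF m(1) _ ae]) (use i i2 m in auto)
  have "(LINT x|lborel. indicator {0<..<1} x *\<^sub>R F x) = (LINT x|lborel. G1 x + G2 (1 + (- 1) * x))"
    by (rule integral_cong_AE[OF m(1) _ ae]) (use i i2 in \<open>intro borel_measurable_integrable Bochner_Integration.integrable_add\<close>)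
  also have "\<dots> = (LINT x|lborel. G1 x) + (LINT y|lborel. G2 y)"
    using i i2 e2 by (simp add: Bochner_Integration.integral_add)
  finally show "(LINT x:{0<..<1}|lborel. F x) = (LINT x:{0<..}|lborel. if x < 1/2 then F x else 0) + (LINT y:{0<..}|lborel. if y < 1/2 then F (1 - y) else 0)"
    unfolding set_lebesgue_integral_def G1_def G2_def .
qed

lemma set_integrable_split_half:
  fixes F :: "real \<Rightarrow> real"
  assumes F: "set_integrable lborel {0<..<1} F"
  shows "set_integrable lborel {0<..} (\<lambda>x. if x < 1/2 then F x else 0)"
    and "set_integrable lborel {0<..} (\<lambda>y. if y < 1/2 then F (1 - y) else 0)"
proof -
  have "set_integrable lborel {0<..<1/2} F" by (rule set_integrable_subset[OF F]) auto
  moreover have "set_integrable lborel {1/2<..<1} F" by (rule set_integrable_subset[OF F]) auto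
  moreover have "indicator {0<..<1/2} x *\<^sub>R F x = indicator {0<..} x *\<^sub>R (if x < 1/2 then F x else 0)" for x
    by (simp add: indicator_def)
  moreover have "indicator {1/2<..<1} (1 + (- 1) * y) *\<^sub>R F (1 + (- 1) * y) = indicator {0<..} y *\<^sub>R (if y < 1/2 then F (1 - y) else 0)" for y
    by (auto simp: indicator_def)
  ultimately show "set_integrable lborel {0<..} (\<lambda>x. if x < 1/2 then F x else 0)"
      "set_integrable lborel {0<..} (\<lambda>y. if y < 1/2 then F (1 - y) else 0)"
    using lborel_integrable_real_affine_iff[of "- 1" "\<lambda>x. indicator {1/2<..<1} x *\<^sub>R F x" 1]
    unfolding set_integrable_def by auto
qed

section \<open>Alternating sums of the limit chain\<close>

context stable_index
begin

text \<open>\<open>\<phi>s 0\<close> collects the odd indices and \<open>\<phi>s 1\<close> the even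
  ones from 2 on: the landings read from the two ends of the interval. Index 0, which corresponds to
  the infinite past, is left out.\<close>

definition \<phi>s :: "nat \<Rightarrow> real \<Rightarrow> real" where "\<phi>s j x = (\<Sum>k. \<phi> (2 * k + Suc j) x)"

lemma phis_m [measurable]: "\<phi>s j \<in> borel_measurable borel"
  unfolding \<phi>s_def[abs_def] by measurable

lemma phi_summable: assumes x: "x > 0" shows "summable (\<lambda>k. \<phi> (2 * k + Suc j) x)"
proof (rule summable_comparison_test')
  show "summable (\<lambda>k. \<theta> ^ k * x powr (- \<gamma> - 1/2))"
    using theta by (intro summable_mult2 summable_geometric) auto
  fix k :: nat
  have "\<phi> (2 * k + Suc j) x \<le> \<theta> ^ (2 * k + Suc j) * x powr (- \<gamma> - 1/2)" using x by (intro phi_bounds(2)) auto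
  also have "\<dots> \<le> \<theta> ^ k * x powr (- \<gamma> - 1/2)" using theta by (intro mult_right_mono power_decreasing) auto
  finally show "norm (\<phi> (2 * k + Suc j) x) \<le> \<theta> ^ k * x powr (- \<gamma> - 1/2)"
    using phi_bounds(1)[OF x, of "2 * k + Suc j"] by (simp only: real_norm_def abs_of_nonneg)
qed

lemma phis_nn: "x > 0 \<Longrightarrow> 0 \<le> \<phi>s j x"
  unfolding \<phi>s_def by (rule suminf_nonneg[OF phi_summable phi_bounds(1)])

text \<open>The sum of the two parts is the landing density, whose moment is known, and
  nonnegativity makes each part integrable on its own. The strict positivity of the constant is read
  off a lower bound for the density rather than from the Beta function.\<close>

lemma phis_integral:
  assumes r: "\<gamma> - 1 < \<rho>" "\<rho> < \<gamma>"
  shows "set_integrable lborel {0<..<1} (\<lambda>x. \<phi>s 1 x * x powr \<rho>)"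
    and "set_integrable lborel {0<..<1} (\<lambda>x. \<phi>s 0 (1 - x) * x powr \<rho>)"
    and "(LINT x:{0<..<1}|lborel. \<phi>s 1 x * x powr \<rho>) + (LINT x:{0<..<1}|lborel. \<phi>s 0 (1 - x) * x powr \<rho>)
      = (1 - \<rho> * Beta (1 - \<gamma> + \<rho>) (1 - \<gamma>) * ((1 - \<gamma>) / \<gamma>)) / (\<gamma> - \<rho>)"
    and "0 < 1 - \<rho> * Beta (1 - \<gamma> + \<rho>) (1 - \<gamma>) * ((1 - \<gamma>) / \<gamma>)"
proof -
  define V where "V = 1 - \<rho> * Beta (1 - \<gamma> + \<rho>) (1 - \<gamma>) * ((1 - \<gamma>) / \<gamma>)"
  define h where "h y = (y * (1 - y)) powr (- \<gamma>) * ((1 - (1 - y) powr \<gamma>) / y - (2 * \<gamma> - 1) / \<gamma>)" for y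
  define F where "F y = \<phi>s 1 y * y powr \<rho> + \<phi>s 0 (1 - y) * y powr \<rho>" for y
  have h: "F y = h y * y powr \<rho>" if y: "0 < y" "y < 1" for y
  proof -
    have s: "summable (\<lambda>k. \<phi> (2 * k + 1) (1 - y))" "summable (\<lambda>k. \<phi> (2 * k + 2) y)"
      using phi_summable[of "1 - y" 0] phi_summable[of y 1] y by simp_all
    have "(\<Sum>k. \<phi> (2 * k + 1) (1 - y)) + (\<Sum>k. \<phi> (2 * k + 2) y) = h y"
      using suminf_add[OF s] sums_unique[OF phi_sums[OF y]] unfolding h_def by simp
    then have "\<phi>s 0 (1 - y) + \<phi>s 1 y = h y" unfolding \<phi>s_def by simp
    then show ?thesis unfolding F_def by (metis add.commute distrib_right)
  qed
  have hi: "((\<lambda>y. h y * y powr \<rho>) has_integral V / (\<gamma> - \<rho>)) {0<..<1}"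
    using has_integral_landing_powr[OF gamma_gt gamma_lt r] unfolding h_def V_def by (simp add: has_integral_Icc_iff_Ioo)
  have Fi: "(F has_integral V / (\<gamma> - \<rho>)) {0<..<1}"
    by (rule has_integral_eq[OF _ hi]) (use h in auto)
  have nn: "0 \<le> \<phi>s 1 y * y powr \<rho>" "0 \<le> \<phi>s 0 (1 - y) * y powr \<rho>" if "y \<in> {0<..<1}" for y
    using that by (auto intro!: mult_nonneg_nonneg phis_nn)
  have Fnn: "0 \<le> F y" if "y \<in> {0<..<1}" for y unfolding F_def using nn[OF that] by simp
  have V0: "0 \<le> V / (\<gamma> - \<rho>)" using has_integral_nonneg[OF Fi] Fnn by blast
  have [measurable]: "F \<in> borel_measurable borel" unfolding F_def by measurable
  have e: "(\<integral>\<^sup>+x\<in>{0<..<1}. ennreal (F x) \<partial>lborel) = (\<integral>\<^sup>+x. ennreal (indicator {0<..<1} x * F x) \<partial>lborel)"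
    by (intro nn_integral_cong) (simp add: indicator_def)
  have "(\<integral>\<^sup>+x\<in>{0<..<1}. ennreal (F x) \<partial>lborel) = ennreal (V / (\<gamma> - \<rho>))"
    unfolding e by (rule nn_integral_has_integral_lebesgue[OF Fnn Fi])
  from set_integral_eq_nn_integralI[OF _ Fnn this V0]
  have F1: "set_integrable lborel {0<..<1} F" "(LINT x:{0<..<1}|lborel. F x) = V / (\<gamma> - \<rho>)"
    by (auto simp: set_borel_measurable_def)
  show i1: "set_integrable lborel {0<..<1} (\<lambda>x. \<phi>s 1 x * x powr \<rho>)"
  proof (rule set_integrable_bound[OF F1(1)])
    show "AE x in lborel. x \<in> {0<..<1} \<longrightarrow> norm (\<phi>s 1 x * x powr \<rho>) \<le> norm (F x)"
    proof (intro AE_I2 impI)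
      fix x :: real assume "x \<in> {0<..<1}"
      from nn[OF this] show "norm (\<phi>s 1 x * x powr \<rho>) \<le> norm (F x)" unfolding F_def real_norm_def by linarith
    qed
  qed (simp add: set_borel_measurable_def)
  show i2: "set_integrable lborel {0<..<1} (\<lambda>x. \<phi>s 0 (1 - x) * x powr \<rho>)"
  proof (rule set_integrable_bound[OF F1(1)])
    show "AE x in lborel. x \<in> {0<..<1} \<longrightarrow> norm (\<phi>s 0 (1 - x) * x powr \<rho>) \<le> norm (F x)"
    proof (intro AE_I2 impI)
      fix x :: real assume "x \<in> {0<..<1}"
      from nn[OF this] show "norm (\<phi>s 0 (1 - x) * x powr \<rho>) \<le> norm (F x)" unfolding F_def real_norm_def by linarith
    qed
  qed (simp add: set_borel_measurable_def)
  show "(LINT x:{0<..<1}|lborel. \<phi>s 1 x * x powr \<rho>) + (LINT x:{0<..<1}|lborel. \<phi>s 0 (1 - x) * x powr \<rho>)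
      = (1 - \<rho> * Beta (1 - \<gamma> + \<rho>) (1 - \<gamma>) * ((1 - \<gamma>) / \<gamma>)) / (\<gamma> - \<rho>)"
    using F1(2) unfolding F_def V_def[symmetric] by (subst (asm) set_integral_add(2)[OF i1 i2])
  \<comment> \<open>The weighted inequality of arithmetic and geometric means gives
    \<open>\<gamma> * y \<le> 1 - (1 - y) powr \<gamma>\<close>, so the bracket in \<open>h\<close>
    is at least \<open>\<gamma> - (2 * \<gamma> - 1) / \<gamma>\<close>, which equals this
    \<open>m\<close>.\<close>
  define m where "m = (1 - \<gamma>)\<^sup>2 / \<gamma>"
  have m: "m > 0" unfolding m_def using gamma_gt gamma_lt by simp
  have lb: "m * y powr \<rho> \<le> h y * y powr \<rho>" if y: "y \<in> {0<..<1}" for y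
  proof -
    have "(1 - y) powr \<gamma> * 1 powr (1 - \<gamma>) \<le> \<gamma> * (1 - y) + (1 - \<gamma>) * 1"
      using y gamma_gt gamma_lt by (intro Youngs_inequality_0) auto
    then have "\<gamma> * y \<le> 1 - (1 - y) powr \<gamma>" by (simp add: algebra_simps)
    then have "\<gamma> \<le> (1 - (1 - y) powr \<gamma>) / y" using y by (simp add: field_simps)
    moreover have "m = \<gamma> - (2 * \<gamma> - 1) / \<gamma>" unfolding m_def using gamma_gt by (simp add: field_simps power2_eq_square)
    ultimately have 1: "m \<le> (1 - (1 - y) powr \<gamma>) / y - (2 * \<gamma> - 1) / \<gamma>" by simp
    have "y * (1 - y) \<le> 1 * 1" using y by (intro mult_mono) auto
    then have "1 powr (- \<gamma>) \<le> (y * (1 - y)) powr (- \<gamma>)" using y gamma_gt by (intro powr_mono2') auto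
    then have "1 * m \<le> h y" unfolding h_def using 1 m by (intro mult_mono) auto
    then show ?thesis by (intro mult_right_mono) auto
  qed
  have r1: "\<rho> > -1" using r gamma_gt by simp
  have "((\<lambda>x. x powr \<rho>) has_integral (1 powr (\<rho> + 1) / (\<rho> + 1))) {0..1}"
    using r1 by (intro has_integral_powr_from_0) auto
  then have "((\<lambda>x. m * x powr \<rho>) has_integral m * (1 / (\<rho> + 1))) {0<..<1}"
    by (intro has_integral_mult_right) (simp add: has_integral_Icc_iff_Ioo)
  from has_integral_le[OF this hi lb] have "m * (1 / (\<rho> + 1)) \<le> V / (\<gamma> - \<rho>)" by simp
  moreover have "0 < m * (1 / (\<rho> + 1))" using m r1 by simp
  ultimately have "0 < V / (\<gamma> - \<rho>)" by linarith
  then show "0 < 1 - \<rho> * Beta (1 - \<gamma> + \<rho>) (1 - \<gamma>) * ((1 - \<gamma>) / \<gamma>)"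
    using r unfolding V_def[symmetric] by (simp add: zero_less_divide_iff)
qed

end

section \<open>Alternating sums of the rescaled iterates\<close>

context overshoot_horizon
begin

definition Rs :: "nat \<Rightarrow> real \<Rightarrow> real \<Rightarrow> real" where "Rs j t x = (\<Sum>k. R (2 * k + Suc j) t x)"

lemma Rs_m [measurable]: "Rs j t \<in> borel_measurable borel"
  unfolding Rs_def[abs_def] by measurable

lemma Rs_bounds:
  obtains K t0 where "K \<ge> 1" "t0 \<ge> 1"
    "\<And>t x j k. t \<ge> t0 \<Longrightarrow> 0 < x \<Longrightarrow> x \<le> 1 \<Longrightarrow> R (2 * k + Suc j) t x \<le> K * \<theta>' ^ k * (A (t * x) / A t)"
    "\<And>t x j. t \<ge> t0 \<Longrightarrow> 0 < x \<Longrightarrow> x \<le> 1 \<Longrightarrow> summable (\<lambda>k. R (2 * k + Suc j) t x)"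
    "\<And>t x j. t \<ge> t0 \<Longrightarrow> 0 < x \<Longrightarrow> x \<le> 1 \<Longrightarrow> 0 \<le> Rs j t x \<and> Rs j t x \<le> K * (A (t * x) / A t)"
proof -
  obtain K t0 where K: "K \<ge> 1" "t0 \<ge> 1"
    "\<And>t x k. t \<ge> t0 \<Longrightarrow> 0 < x \<Longrightarrow> x \<le> 1 \<Longrightarrow> R (Suc k) t x \<le> K * \<theta>' ^ k * (A (t * x) / A t)"
    by (rule R_bounds) blast
  define L where "L = K / (1 - \<theta>')"
  have LK: "L \<ge> K"
  proof -
    have "K / 1 \<le> K / (1 - \<theta>')" using K(1) theta' by (intro divide_left_mono) auto
    then show ?thesis by (simp add: L_def)
  qed
  have 1: "R (2 * k + Suc j) t x \<le> K * \<theta>' ^ k * (A (t * x) / A t)" and Q: "0 \<le> A (t * x) / A t"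
    if t: "t \<ge> t0" and x: "0 < x" "x \<le> 1" for t x j k
  proof -
    have tp: "t > 0" "t * x > 0" using t K(2) x by auto
    show Q: "0 \<le> A (t * x) / A t" using A_p[of t] A_p[of "t * x"] tp by simp
    have "R (2 * k + Suc j) t x \<le> K * \<theta>' ^ (2 * k + j) * (A (t * x) / A t)" using K(3)[OF t x, of "2 * k + j"] by simp
    also have "\<dots> \<le> K * \<theta>' ^ k * (A (t * x) / A t)"
      using theta' K(1) Q by (intro mult_right_mono mult_left_mono power_decreasing) auto
    finally show "R (2 * k + Suc j) t x \<le> K * \<theta>' ^ k * (A (t * x) / A t)" .
  qed
  have g: "(\<lambda>k. K * \<theta>' ^ k * Q) sums (L * Q)" for Q
    using sums_mult2[OF sums_mult[OF geometric_sums[of \<theta>']], of K Q] theta' by (simp add: L_def)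
  have 2: "summable (\<lambda>k. R (2 * k + Suc j) t x)" if t: "t \<ge> t0" and x: "0 < x" "x \<le> 1" for t x j
    by (rule summable_comparison_test'[OF sums_summable[OF g[of "A (t * x) / A t"]], of 0]) (use 1[OF that] R_nn in auto)
  have 3: "0 \<le> Rs j t x" "Rs j t x \<le> L * (A (t * x) / A t)" if t: "t \<ge> t0" and x: "0 < x" "x \<le> 1" for t x j
  proof -
    show "0 \<le> Rs j t x" unfolding Rs_def by (rule suminf_nonneg[OF 2[OF that] R_nn])
    have "Rs j t x \<le> (\<Sum>k. K * \<theta>' ^ k * (A (t * x) / A t))"
      unfolding Rs_def by (rule suminf_le[OF 1[OF that] 2[OF that] sums_summable[OF g]])
    then show "Rs j t x \<le> L * (A (t * x) / A t)" using sums_unique[OF g] by metis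
  qed
  have 4: "R (2 * k + Suc j) t x \<le> L * \<theta>' ^ k * (A (t * x) / A t)" if t: "t \<ge> t0" and x: "0 < x" "x \<le> 1" for t x j k
  proof -
    have "K * \<theta>' ^ k * (A (t * x) / A t) \<le> L * \<theta>' ^ k * (A (t * x) / A t)"
      using LK theta' Q[OF that] by (intro mult_right_mono) auto
    with 1[OF that, of k j] show ?thesis by linarith
  qed
  show ?thesis
  proof (rule that[of L t0])
    show "L \<ge> 1" using LK K(1) by linarith
  qed (use K(2) 2 3 4 in auto)
qed

text \<open>Tannery's theorem: for fixed \<open>x\<close> the ratio \<open>A (t * x) / A t\<close>
  converges, so a single geometric series dominates the terms for all large
  \<open>t\<close>.\<close>

lemma Rs_limit:
  assumes x: "0 < x" "x \<le> 1"
  shows "((\<lambda>t. Rs j t x) \<longlongrightarrow> \<phi>s j x) at_top"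
proof -
  obtain K t0 where K: "K \<ge> 1" "t0 \<ge> 1"
    "\<And>t x j k. t \<ge> t0 \<Longrightarrow> 0 < x \<Longrightarrow> x \<le> 1 \<Longrightarrow> R (2 * k + Suc j) t x \<le> K * \<theta>' ^ k * (A (t * x) / A t)"
    by (rule Rs_bounds) blast
  have "eventually (\<lambda>t. A (t * x) / A t < x powr (- \<gamma>) + 1) at_top"
    by (rule order_tendstoD(2)[OF regularly_varyingD(1)[OF A_rv x(1)]]) simp
  then have ev: "eventually (\<lambda>t. \<forall>k. norm (R (2 * k + Suc j) t x) \<le> K * \<theta>' ^ k * (x powr (- \<gamma>) + 1)) at_top"
    using eventually_ge_at_top[of t0]
  proof eventually_elim
    case (elim t)
    show ?case
    proof
      fix k
      have "R (2 * k + Suc j) t x \<le> K * \<theta>' ^ k * (A (t * x) / A t)" by (rule K(3)[OF elim(2) x])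
      also have "\<dots> \<le> K * \<theta>' ^ k * (x powr (- \<gamma>) + 1)" using elim K(1) theta' by (intro mult_left_mono) auto
      finally show "norm (R (2 * k + Suc j) t x) \<le> K * \<theta>' ^ k * (x powr (- \<gamma>) + 1)" using R_nn by simp
    qed
  qed
  have "((\<lambda>t. \<Sum>k. R (2 * k + Suc j) t x) \<longlongrightarrow> (\<Sum>k. \<phi> (2 * k + Suc j) x)) at_top"
  proof (rule tannerys_theorem[THEN conjunct2, THEN conjunct2])
    show "((\<lambda>t. R (2 * k + Suc j) t x) \<longlongrightarrow> \<phi> (2 * k + Suc j) x) at_top" for k by (rule R_limit[OF x(1)])
    have "eventually (\<lambda>z. True \<and> (\<forall>k. norm (R (2 * k + Suc j) (snd z) x) \<le> K * \<theta>' ^ k * (x powr (- \<gamma>) + 1))) (at_top \<times>\<^sub>F at_top :: (nat \<times> real) filter)"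
      by (rule eventually_prodI[OF eventually_True ev])
    then show "eventually (\<lambda>(k, t). norm (R (2 * k + Suc j) t x) \<le> K * \<theta>' ^ k * (x powr (- \<gamma>) + 1)) (at_top \<times>\<^sub>F at_top)"
      by eventually_elim (simp add: case_prod_beta)
    show "summable (\<lambda>k. K * \<theta>' ^ k * (x powr (- \<gamma>) + 1))"
      using theta' by (intro summable_mult2 summable_mult summable_geometric) auto
  qed simp
  then show ?thesis unfolding Rs_def \<phi>s_def .
qed

text \<open>The first term of the part read at \<open>s\<close> is \<open>b s T\<close>, the
  infinite-past coefficient itself. Without it the series starts with \<open>R 2\<close> at
  \<open>x\<close> and with \<open>R 1\<close> at \<open>1 - x\<close>.\<close>

lemma psi_diff:
  obtains t0 where "t0 \<ge> 1"
    "\<And>t x. t \<ge> t0 \<Longrightarrow> 0 < x \<Longrightarrow> x < 1 \<Longrightarrow>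
      psi_fin c a (t * x) T t - psi_inf c a (t * x) T = a t * Cc T * (Rs 1 t x + Rs 0 t (1 - x))"
proof -
  obtain K t0 where K: "K \<ge> 1" "t0 \<ge> 1"
    "\<And>t x j k. t \<ge> t0 \<Longrightarrow> 0 < x \<Longrightarrow> x \<le> 1 \<Longrightarrow> R (2 * k + Suc j) t x \<le> K * \<theta>' ^ k * (A (t * x) / A t)"
    "\<And>t x j. t \<ge> t0 \<Longrightarrow> 0 < x \<Longrightarrow> x \<le> 1 \<Longrightarrow> summable (\<lambda>k. R (2 * k + Suc j) t x)"
    "\<And>t x j. t \<ge> t0 \<Longrightarrow> 0 < x \<Longrightarrow> x \<le> 1 \<Longrightarrow> 0 \<le> Rs j t x \<and> Rs j t x \<le> K * (A (t * x) / A t)"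
    by (rule Rs_bounds) blast
  have "psi_fin c a (t * x) T t - psi_inf c a (t * x) T = a t * Cc T * (Rs 1 t x + Rs 0 t (1 - x))"
    if t: "t \<ge> t0" and x: "0 < x" "x < 1" for t x
  proof -
    define N where "N = a t * Cc T"
    have N: "N > 0" unfolding N_def using t K(2) by (intro N_pos) simp
    have bR: "bi (Suc k) (t * y) t = N * R k t y" for k y
      using less_imp_neq[OF N] unfolding R_def N_def[symmetric] by simp
    have s1: "summable (\<lambda>k. R (2 * k + 2) t x)" using K(4)[OF t x(1), of 1] x by simp
    then have s1': "summable (\<lambda>k. R (2 * k) t x)" using summable_Suc_iff[of "\<lambda>k. R (2 * k) t x"] by simp
    have s2: "summable (\<lambda>k. R (2 * k + 1) t (1 - x))" using K(4)[OF t, of "1 - x" 0] x by simp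
    have "t * x + t * (1 - x) = t" by (simp add: algebra_simps)
    then have e: "t - t * x = t * (1 - x)" by simp
    have "psi_fin c a (t * x) T t = (\<Sum>k. N * R (2 * k) t x + N * R (2 * k + 1) t (1 - x))"
      unfolding psi_fin_def e using bR[of "2 * k" x for k] bR[of "2 * k + 1" "1 - x" for k] by simp
    also have "\<dots> = N * (\<Sum>k. R (2 * k) t x) + N * (\<Sum>k. R (2 * k + 1) t (1 - x))"
      using s1' s2 by (simp add: suminf_add[symmetric] suminf_mult summable_mult)
    also have "(\<Sum>k. R (2 * k) t x) = R 0 t x + (\<Sum>k. R (2 * k + 2) t x)"
      using suminf_split_head[OF s1'] by simp
    also have "N * (R 0 t x + (\<Sum>k. R (2 * k + 2) t x)) + N * (\<Sum>k. R (2 * k + 1) t (1 - x)) = N * R 0 t x + N * (Rs 1 t x + Rs 0 t (1 - x))"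
      unfolding Rs_def by (simp add: distrib_left)
    also have "N * R 0 t x = psi_inf c a (t * x) T" unfolding bR[symmetric] by (simp add: psi_inf_def)
    finally show ?thesis by (simp add: N_def)
  qed
  with K(2) show ?thesis by (rule that)
qed

text \<open>The bound \<open>A (t x) / A t\<close> of \<open>Rs\<close> is not uniform near \<open>x = 0\<close>; multiplying and dividing by it
  turns the integral into one against the regularly varying function \<open>A f\<close>.\<close>
lemma Rs_dominated_convergence:
  fixes f vlim :: "real \<Rightarrow> real" and v :: "real \<Rightarrow> real \<Rightarrow> real"
  assumes e: "0 < e" "e \<le> 1" and f_rv: "regularly_varying \<sigma> f" and sg: "\<sigma> > \<gamma> - 1"
    and [measurable]: "f \<in> borel_measurable borel" "\<And>t. v t \<in> borel_measurable borel" "vlim \<in> borel_measurable borel"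
    and fb: "\<And>r. \<exists>B. \<forall>x. 0 < x \<longrightarrow> x < r \<longrightarrow> \<bar>f x\<bar> \<le> B"
    and vl: "\<And>x. 0 < x \<Longrightarrow> x < e \<Longrightarrow> ((\<lambda>t. v t x) \<longlongrightarrow> vlim x) at_top"
    and vb: "eventually (\<lambda>t. \<forall>x. 0 < x \<longrightarrow> x < e \<longrightarrow> \<bar>v t x\<bar> \<le> B) at_top"
  shows "((\<lambda>t. LINT x:{0<..}|lborel. (if x < e then Rs j t x * v t x else 0) * (f (t * x) / f t))
      \<longlongrightarrow> (LINT x:{0<..}|lborel. (if x < e then \<phi>s j x * vlim x else 0) * x powr \<sigma>)) at_top"
    and "eventually (\<lambda>t. set_integrable lborel {0<..} (\<lambda>x. (if x < e then Rs j t x * v t x else 0) * (f (t * x) / f t))) at_top"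
proof -
  obtain K t0 where K: "K \<ge> 1" "t0 \<ge> 1"
    "\<And>t x j. t \<ge> t0 \<Longrightarrow> 0 < x \<Longrightarrow> x \<le> 1 \<Longrightarrow> 0 \<le> Rs j t x \<and> Rs j t x \<le> K * (A (t * x) / A t)"
    by (rule Rs_bounds) blast
  \<comment> \<open>Half of the gap between \<sigma> and \<open>\<gamma> - 1\<close>, so that both
    exponents of the majorant stay above -1.\<close>
  define d where "d = (\<sigma> - (\<gamma> - 1)) / 2"
  have d: "d > 0" "- \<gamma> + \<sigma> - d > -1" "- \<gamma> + \<sigma> + d > -1" using sg by (auto simp: d_def field_simps)
  define F where "F x = A x * f x" for x
  define w where "w t x = (if x < e then Rs j t x * v t x * (A t / A (t * x)) else 0)" for t x
  define w0 where "w0 x = (if x < e then \<phi>s j x * vlim x * x powr \<gamma> else 0)" for x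
  define W where "W x = (if x < e then K * \<bar>B\<bar> else 0)" for x :: real
  have F_rv: "regularly_varying (- \<gamma> + \<sigma>) F" unfolding F_def[abs_def] by (rule regularly_varying_mult[OF A_rv f_rv])
  have Fm: "F \<in> borel_measurable borel" unfolding F_def by measurable
  have Fi: "set_integrable lborel {0<..<r} F" for r
  proof -
    obtain B' where B': "\<And>x. 0 < x \<Longrightarrow> x < r \<Longrightarrow> \<bar>f x\<bar> \<le> B'" using fb by blast
    show ?thesis
    proof (rule set_integrable_bound)
      show "set_integrable lborel {0<..<r} (\<lambda>x. \<bar>B'\<bar> * A x)" by (intro set_integrable_mult_right A_i)
      show "set_borel_measurable lborel {0<..<r} F" unfolding set_borel_measurable_def F_def by measurable
      show "AE x in lborel. x \<in> {0<..<r} \<longrightarrow> norm (F x) \<le> norm (\<bar>B'\<bar> * A x)"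
      proof (intro AE_I2 impI)
        fix x assume x: "x \<in> {0<..<r}"
        then have "\<bar>f x\<bar> \<le> \<bar>B'\<bar>" using B'[of x] by auto
        then have "\<bar>A x\<bar> * \<bar>f x\<bar> \<le> \<bar>A x\<bar> * \<bar>B'\<bar>" by (intro mult_left_mono) auto
        then show "norm (F x) \<le> norm (\<bar>B'\<bar> * A x)" by (simp add: F_def abs_mult mult.commute)
      qed
    qed
  qed
  have wm: "w t \<in> borel_measurable borel" for t unfolding w_def by measurable
  have w0m: "w0 \<in> borel_measurable borel" unfolding w0_def by measurable
  have wl: "((\<lambda>t. w t x) \<longlongrightarrow> w0 x) at_top" if x: "x > 0" for x
  proof (cases "x < e")
    case True
    have "((\<lambda>t. inverse (A (t * x) / A t)) \<longlongrightarrow> inverse (x powr (- \<gamma>))) at_top"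
      using x by (intro tendsto_inverse regularly_varyingD(1)[OF A_rv]) auto
    then have "((\<lambda>t. A t / A (t * x)) \<longlongrightarrow> x powr \<gamma>) at_top" using x by (simp add: powr_minus)
    then have "((\<lambda>t. Rs j t x * v t x * (A t / A (t * x))) \<longlongrightarrow> \<phi>s j x * vlim x * x powr \<gamma>) at_top"
      by (intro tendsto_mult Rs_limit vl) (use True x e in auto)
    then show ?thesis unfolding w_def w0_def using True by simp
  qed (simp add: w_def w0_def)
  have wb: "eventually (\<lambda>t. \<forall>x>0. \<bar>w t x\<bar> \<le> W x) at_top"
    using vb eventually_ge_at_top[of t0]
  proof eventually_elim
    case (elim t)
    show ?case
    proof (intro allI impI)
      fix x :: real assume x: "x > 0"
      show "\<bar>w t x\<bar> \<le> W x"
      proof (cases "x < e")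
        case True
        have p: "A t > 0" "A (t * x) > 0" using elim K(2) x by (auto intro!: A_p)
        have r: "0 \<le> Rs j t x" "Rs j t x \<le> K * (A (t * x) / A t)" using K(3)[OF elim(2) x, of j] True e by auto
        have "Rs j t x * (A t / A (t * x)) \<le> K * (A (t * x) / A t) * (A t / A (t * x))" using r p by (intro mult_right_mono) auto
        also have "\<dots> = K" using p by simp
        finally have 1: "Rs j t x * (A t / A (t * x)) \<le> K" .
        have 2: "\<bar>v t x\<bar> \<le> \<bar>B\<bar>" using elim(1) x True by fastforce
        have "\<bar>w t x\<bar> = (Rs j t x * (A t / A (t * x))) * \<bar>v t x\<bar>" using True r p by (simp add: w_def abs_mult)
        also have "\<dots> \<le> K * \<bar>B\<bar>" by (rule mult_mono[OF 1 2]) (use K(1) in auto)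
        finally show ?thesis using True by (simp add: W_def)
      qed (simp add: w_def W_def)
    qed
  qed
  have WB: "W x \<le> K * \<bar>B\<bar>" if "0 < x" "x \<le> 1" for x using K(1) by (simp add: W_def)
  have Wi: "set_integrable lborel {0<..} (\<lambda>x. W x * (x powr (- \<gamma> + \<sigma> - d) + x powr (- \<gamma> + \<sigma> + d)))"
  proof -
    have "set_integrable lborel {0<..<e} (\<lambda>x. K * \<bar>B\<bar> * (x powr (- \<gamma> + \<sigma> - d) + x powr (- \<gamma> + \<sigma> + d)))"
      by (intro set_integrable_mult_right set_integral_add powr_integrable_near_0 d)
    moreover have "(\<lambda>x. indicator {0<..<e} x *\<^sub>R (K * \<bar>B\<bar> * (x powr (- \<gamma> + \<sigma> - d) + x powr (- \<gamma> + \<sigma> + d))))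
      = (\<lambda>x. indicator {0<..} x *\<^sub>R (W x * (x powr (- \<gamma> + \<sigma> - d) + x powr (- \<gamma> + \<sigma> + d))))"
      by (auto simp: W_def indicator_def)
    ultimately show ?thesis unfolding set_integrable_def by simp
  qed
  have r1: "- \<gamma> + \<sigma> > -1" using sg by simp
  note dct = regularly_varying_dominated_convergence[OF F_rv r1 Fm Fi d(1) wm w0m wl wb WB Wi]
  have d1: "((\<lambda>t. LINT x:{0<..}|lborel. w t x * (F (t * x) / F t)) \<longlongrightarrow> (LINT x:{0<..}|lborel. w0 x * x powr (- \<gamma> + \<sigma>))) at_top"
    by (rule dct(1)) auto
  have d2: "eventually (\<lambda>t. set_integrable lborel {0<..} (\<lambda>x. w t x * (F (t * x) / F t))) at_top"
    by (rule dct(2)) auto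
  have eq: "w t x * (F (t * x) / F t) = (if x < e then Rs j t x * v t x else 0) * (f (t * x) / f t)" if "t > 0" "x > 0" for t x
  proof -
    have "A t > 0" "A (t * x) > 0" using that by (auto intro!: A_p)
    then show ?thesis by (simp add: w_def F_def)
  qed
  have lim: "(LINT x:{0<..}|lborel. w0 x * x powr (- \<gamma> + \<sigma>)) = (LINT x:{0<..}|lborel. (if x < e then \<phi>s j x * vlim x else 0) * x powr \<sigma>)"
  proof (intro set_lebesgue_integral_cong allI impI)
    fix x :: real
    have "x powr \<gamma> * x powr (- \<gamma> + \<sigma>) = x powr \<sigma>" unfolding powr_add[symmetric] by simp
    then show "w0 x * x powr (- \<gamma> + \<sigma>) = (if x < e then \<phi>s j x * vlim x else 0) * x powr \<sigma>"
      by (simp only: w0_def mult.assoc if_distribR) (simp add: mult.assoc)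
  qed simp
  have ev: "eventually (\<lambda>t. (LINT x:{0<..}|lborel. w t x * (F (t * x) / F t)) = (LINT x:{0<..}|lborel. (if x < e then Rs j t x * v t x else 0) * (f (t * x) / f t))) at_top"
    using eventually_gt_at_top[of 0] by eventually_elim (intro set_lebesgue_integral_cong allI impI, simp, rule eq, auto)
  show "((\<lambda>t. LINT x:{0<..}|lborel. (if x < e then Rs j t x * v t x else 0) * (f (t * x) / f t))
      \<longlongrightarrow> (LINT x:{0<..}|lborel. (if x < e then \<phi>s j x * vlim x else 0) * x powr \<sigma>)) at_top"
    using d1 unfolding lim by (simp only: tendsto_cong[OF ev])
  show "eventually (\<lambda>t. set_integrable lborel {0<..} (\<lambda>x. (if x < e then Rs j t x * v t x else 0) * (f (t * x) / f t))) at_top"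
    using d2 eventually_gt_at_top[of 0]
  proof eventually_elim
    case (elim t)
    show ?case by (rule set_integrable_cong[THEN iffD1, OF refl refl _ elim(1)]) (use eq[OF elim(2)] in auto)
  qed
qed

end

subsection \<open>The prediction integrals\<close>

lemma ennreal_set_integral_le:
  fixes f :: "'a \<Rightarrow> real"
  assumes "\<And>x. x \<in> A \<Longrightarrow> 0 \<le> f x"
  shows "ennreal (LINT x:A|M. f x) \<le> (\<integral>\<^sup>+x\<in>A. ennreal (f x) \<partial>M)"
proof (cases "set_integrable M A f")
  case True
  from nn_set_integral_eq_set_integral[OF this assms] show ?thesis by simp
next
  case False
  then have "(LINT x:A|M. f x) = 0"
    unfolding set_integrable_def set_lebesgue_integral_def by (rule not_integrable_integral_eq)
  then show ?thesis by simp
qed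

lemma regularly_varying_const: "regularly_varying 0 (\<lambda>_. 1)"
  unfolding regularly_varying_def by (auto intro!: exI[of _ 0])

context overshoot_horizon
begin

context
  fixes g :: "real \<Rightarrow> real" and \<rho> :: real
  assumes g_m [measurable]: "g \<in> borel_measurable borel"
    and g_b: "\<And>r. \<exists>B. \<forall>x. 0 < x \<longrightarrow> x < r \<longrightarrow> \<bar>g x\<bar> \<le> B"
    and g_rv: "regularly_varying \<rho> g" and rho: "\<gamma> - 1 < \<rho>" "\<rho> < \<gamma>"
begin

lemma g_i: "set_integrable lborel {0<..<r} g"
proof -
  obtain B where B: "\<And>x. 0 < x \<Longrightarrow> x < r \<Longrightarrow> \<bar>g x\<bar> \<le> B" using g_b by blast
  have i: "set_integrable lborel {0<..<r} (\<lambda>_. B)"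
    using emeasure_bounded_finite[of "{0<..<r}"] unfolding set_integrable_def
    by (simp add: integrable_indicator_iff)
  show ?thesis
  proof (rule set_integrable_bound[OF i])
    show "AE x in lborel. x \<in> {0<..<r} \<longrightarrow> norm (g x) \<le> norm B"
      using B by (intro AE_I2 impI) fastforce
  qed (simp add: set_borel_measurable_def)
qed

text \<open>\<open>Rs 1\<close> is singular at 0, as \<open>g\<close> may be, and is treated in one
  piece. \<open>Rs 0 t (1 - x)\<close> is singular at the other end, so it is split at 1/2: on the
  left half it is a bounded weight for the regularly varying \<open>g\<close>; on the right half,
  after reflection, the ratio of \<open>g\<close> is the bounded weight and the constant 1 takes the
  place of the regularly varying function.\<close>

lemma finite_past_integral_limit:
  "((\<lambda>t. (LINT s:{0<..<t}|lborel. (psi_fin c a s T t - psi_inf c a s T) * g s) / (t * (a t * Cc T) * g t))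
    \<longlongrightarrow> (1 - \<rho> * Beta (1 - \<gamma> + \<rho>) (1 - \<gamma>) * ((1 - \<gamma>) / \<gamma>)) / (\<gamma> - \<rho>)) at_top"
proof -
  obtain K t0 where K: "K \<ge> 1" "t0 \<ge> 1"
    "\<And>t x j. t \<ge> t0 \<Longrightarrow> 0 < x \<Longrightarrow> x \<le> 1 \<Longrightarrow> 0 \<le> Rs j t x \<and> Rs j t x \<le> K * (A (t * x) / A t)"
    by (rule Rs_bounds) blast
  obtain t1 where t1: "t1 \<ge> 1" "\<And>t x. t \<ge> t1 \<Longrightarrow> 0 < x \<Longrightarrow> x < 1 \<Longrightarrow>
      psi_fin c a (t * x) T t - psi_inf c a (t * x) T = a t * Cc T * (Rs 1 t x + Rs 0 t (1 - x))"
    by (rule psi_diff) blast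
  define V where "V = (1 - \<rho> * Beta (1 - \<gamma> + \<rho>) (1 - \<gamma>) * ((1 - \<gamma>) / \<gamma>)) / (\<gamma> - \<rho>)"
  define J1 where "J1 t = (LINT x:{0<..}|lborel. (if x < 1 then Rs 1 t x * 1 else 0) * (g (t * x) / g t))" for t
  define J2 where "J2 t = (LINT x:{0<..}|lborel. (if x < 1/2 then Rs 0 t (1 - x) else 0) * (g (t * x) / g t))" for t
  define J3 where "J3 t = (LINT y:{0<..}|lborel. (if y < 1/2 then Rs 0 t y * (g (t * (1 - y)) / g t) else 0) * (1 / 1))" for t
  note piece1 = Rs_dominated_convergence[where e=1 and f=g and \<sigma>=\<rho> and v="\<lambda>_ _. 1" and vlim="\<lambda>_. 1" and B=1 and j=1]
  have l1: "(J1 \<longlongrightarrow> (LINT x:{0<..}|lborel. (if x < 1 then \<phi>s 1 x * 1 else 0) * x powr \<rho>)) at_top"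
    unfolding J1_def[abs_def] by (rule piece1(1)) (use g_b g_rv rho in auto)
  have i1: "eventually (\<lambda>t. set_integrable lborel {0<..} (\<lambda>x. (if x < 1 then Rs 1 t x * 1 else 0) * (g (t * x) / g t))) at_top"
    by (rule piece1(2)) (use g_b g_rv rho in auto)
  have vb: "\<exists>B. eventually (\<lambda>t. \<forall>y. 0 < y \<longrightarrow> y < 1/2 \<longrightarrow> \<bar>g (t * (1 - y)) / g t\<bar> \<le> B) at_top"
  proof -
    obtain X L where X: "X > 0" "L \<ge> 1" "\<And>x. x \<ge> X \<Longrightarrow> g x > 0"
      and pot: "\<And>x y. x \<ge> X \<Longrightarrow> y \<ge> x \<Longrightarrow> g y / g x \<le> L * (y / x) powr (\<rho> + 1) \<and> g x / g y \<le> L * (x / y) powr (\<rho> - 1)"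
      using regularly_varying_potter[OF g_rv zero_less_one] by blast
    \<comment> \<open>Potter's bound between \<open>t * (1 - y)\<close> and \<open>t\<close>; its
      exponent \<open>\<rho> - 1\<close> is negative, so the worst case is
      \<open>y = 1/2\<close>.\<close>
    have "eventually (\<lambda>t. \<forall>y. 0 < y \<longrightarrow> y < 1/2 \<longrightarrow> \<bar>g (t * (1 - y)) / g t\<bar> \<le> L * (1/2) powr (\<rho> - 1)) at_top"
      using eventually_ge_at_top[of "2 * X"]
    proof eventually_elim
      case (elim t)
      show ?case
      proof (intro allI impI)
        fix y :: real assume y: "0 < y" "y < 1/2"
        have tp: "t > 0" using elim X by linarith
        have "t * (1/2) \<le> t * (1 - y)" using y tp by (intro mult_left_mono) auto
        then have tX: "t * (1 - y) \<ge> X" using elim by linarith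
        have tt: "t * (1 - y) \<le> t" using y tp by simp
        have "g (t * (1 - y)) / g t \<le> L * ((t * (1 - y)) / t) powr (\<rho> - 1)" using pot[OF tX tt] by blast
        also have "(t * (1 - y)) / t = 1 - y" using tp by simp
        also have "L * (1 - y) powr (\<rho> - 1) \<le> L * (1/2) powr (\<rho> - 1)"
          using y X rho gamma_lt by (intro mult_left_mono powr_mono2') auto
        finally have "g (t * (1 - y)) / g t \<le> L * (1/2) powr (\<rho> - 1)" .
        moreover have "0 \<le> g (t * (1 - y)) / g t" using X(3)[OF tX] X(3)[of t] tX tt by simp
        ultimately show "\<bar>g (t * (1 - y)) / g t\<bar> \<le> L * (1/2) powr (\<rho> - 1)" by simp
      qed
    qed
    then show ?thesis by blast
  qed
  then obtain B where B: "eventually (\<lambda>t. \<forall>y. 0 < y \<longrightarrow> y < 1/2 \<longrightarrow> \<bar>g (t * (1 - y)) / g t\<bar> \<le> B) at_top" by blast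
  have half: "(0::real) < 1/2" "(1/2::real) \<le> 1" and g0: "0 > \<gamma> - 1" using gamma_lt by auto
  have vl: "((\<lambda>t. g (t * (1 - y)) / g t) \<longlongrightarrow> (1 - y) powr \<rho>) at_top" if "0 < y" "y < 1/2" for y
    using that by (intro regularly_varyingD(1)[OF g_rv]) auto
  have gm2: "(\<lambda>y. g (t * (1 - y)) / g t) \<in> borel_measurable borel" "(\<lambda>y. (1 - y) powr \<rho>) \<in> borel_measurable borel" for t
    by measurable
  have cb: "\<exists>B. \<forall>x. 0 < x \<longrightarrow> x < r \<longrightarrow> \<bar>1::real\<bar> \<le> B" for r :: real by (intro exI[of _ 1]) simp
  note piece3 = Rs_dominated_convergence[where e="1/2" and f="\<lambda>_. 1" and \<sigma>=0 and v="\<lambda>t y. g (t * (1 - y)) / g t"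
    and vlim="\<lambda>y. (1 - y) powr \<rho>" and B=B and j=0, OF half regularly_varying_const g0 _ gm2 cb vl B]
  have l3: "(J3 \<longlongrightarrow> (LINT y:{0<..}|lborel. (if y < 1/2 then \<phi>s 0 y * (1 - y) powr \<rho> else 0) * y powr 0)) at_top"
    unfolding J3_def[abs_def] by (rule piece3(1)) auto
  have i3: "eventually (\<lambda>t. set_integrable lborel {0<..} (\<lambda>y. (if y < 1/2 then Rs 0 t y * (g (t * (1 - y)) / g t) else 0) * (1 / 1))) at_top"
    by (rule piece3(2)) auto
  \<comment> \<open>On the left half the argument \<open>1 - x\<close> exceeds 1/2, and monotonicity
    of \<open>A\<close> bounds \<open>Rs 0\<close> there.\<close>
  define M where "M = K * ((1/2) powr (- \<gamma>) + 1)"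
  have M: "M \<ge> 0" using K(1) by (simp add: M_def)
  define d where "d = (\<rho> + 1) / 2"
  have d: "d > 0" "\<rho> - d > -1" "\<rho> + d > -1" "\<rho> > -1" using rho gamma_gt by (auto simp: d_def field_simps)
  define W where "W x = (if x < 1/2 then M else 0)" for x :: real
  have wm: "(\<lambda>x. if x < 1/2 then Rs 0 t (1 - x) else 0) \<in> borel_measurable borel" "(\<lambda>x. if x < 1/2 then \<phi>s 0 (1 - x) else 0) \<in> borel_measurable borel" for t
    by measurable
  have wl: "((\<lambda>t. if x < 1/2 then Rs 0 t (1 - x) else 0) \<longlongrightarrow> (if x < 1/2 then \<phi>s 0 (1 - x) else 0)) at_top" if "x > 0" for x :: real
    using that by (auto intro!: Rs_limit)
  have wb: "eventually (\<lambda>t. \<forall>x>0. \<bar>if x < 1/2 then Rs 0 t (1 - x) else 0\<bar> \<le> W x) at_top"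
  proof -
    have "eventually (\<lambda>t. A (t * (1/2)) / A t < (1/2) powr (- \<gamma>) + 1) at_top"
      by (rule order_tendstoD(2)[OF regularly_varyingD(1)[OF A_rv]]) auto
    then show ?thesis using eventually_ge_at_top[of t0]
    proof eventually_elim
      case (elim t)
      show ?case
      proof (intro allI impI)
        fix x :: real assume x: "x > 0"
        show "\<bar>if x < 1/2 then Rs 0 t (1 - x) else 0\<bar> \<le> W x"
        proof (cases "x < 1/2")
          case True
          have tp: "t > 0" "A t > 0" using elim K(2) by (auto intro: A_p)
          have r: "0 \<le> Rs 0 t (1 - x)" "Rs 0 t (1 - x) \<le> K * (A (t * (1 - x)) / A t)"
            using K(3)[OF elim(2), of "1 - x" 0] x True by auto
          have "A (t * (1 - x)) \<le> A (t * (1/2))" using tp True by (intro A_anti mult_left_mono) auto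
          then have "A (t * (1 - x)) / A t \<le> A (t * (1/2)) / A t" using tp by (intro divide_right_mono) auto
          then have "A (t * (1 - x)) / A t \<le> (1/2) powr (- \<gamma>) + 1" using elim(1) by linarith
          then have "K * (A (t * (1 - x)) / A t) \<le> M" unfolding M_def using K(1) by (intro mult_left_mono) auto
          then have "Rs 0 t (1 - x) \<le> M" using r by linarith
          then show ?thesis using r True by (simp add: W_def)
        qed (simp add: W_def)
      qed
    qed
  qed
  have WB: "W x \<le> M" if "0 < x" "x \<le> 1" for x using M by (simp add: W_def)
  have Wi: "set_integrable lborel {0<..} (\<lambda>x. W x * (x powr (\<rho> - d) + x powr (\<rho> + d)))"
  proof -
    have "set_integrable lborel {0<..<1/2} (\<lambda>x. M * (x powr (\<rho> - d) + x powr (\<rho> + d)))"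
      by (intro set_integrable_mult_right set_integral_add powr_integrable_near_0 d)
    moreover have "(\<lambda>x. indicator {0<..<1/2} x *\<^sub>R (M * (x powr (\<rho> - d) + x powr (\<rho> + d))))
      = (\<lambda>x. indicator {0<..} x *\<^sub>R (W x * (x powr (\<rho> - d) + x powr (\<rho> + d))))"
      by (auto simp: W_def indicator_def)
    ultimately show ?thesis unfolding set_integrable_def by simp
  qed
  note piece2 = regularly_varying_dominated_convergence[OF g_rv d(4) g_m g_i d(1) wm wl wb WB Wi]
  have l2: "(J2 \<longlongrightarrow> (LINT x:{0<..}|lborel. (if x < 1/2 then \<phi>s 0 (1 - x) else 0) * x powr \<rho>)) at_top"
    unfolding J2_def[abs_def] by (rule piece2(1)) auto
  have i2: "eventually (\<lambda>t. set_integrable lborel {0<..} (\<lambda>x. (if x < 1/2 then Rs 0 t (1 - x) else 0) * (g (t * x) / g t))) at_top"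
    by (rule piece2(2)) auto
  note pI = phis_integral[OF rho]
  have lim: "(LINT x:{0<..}|lborel. (if x < 1 then \<phi>s 1 x * 1 else 0) * x powr \<rho>)
    + ((LINT x:{0<..}|lborel. (if x < 1/2 then \<phi>s 0 (1 - x) else 0) * x powr \<rho>)
    + (LINT y:{0<..}|lborel. (if y < 1/2 then \<phi>s 0 y * (1 - y) powr \<rho> else 0) * y powr 0)) = V"
  proof -
    have a: "(LINT x:{0<..}|lborel. (if x < 1 then \<phi>s 1 x * 1 else 0) * x powr \<rho>) = (LINT x:{0<..<1}|lborel. \<phi>s 1 x * x powr \<rho>)"
      unfolding set_lebesgue_integral_def by (intro Bochner_Integration.integral_cong) (auto simp: indicator_def)
    have m: "(\<lambda>x. \<phi>s 0 (1 - x) * x powr \<rho>) \<in> borel_measurable borel" by measurable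
    have b: "(LINT x:{0<..<1}|lborel. \<phi>s 0 (1 - x) * x powr \<rho>) = (LINT x:{0<..}|lborel. if x < 1/2 then \<phi>s 0 (1 - x) * x powr \<rho> else 0)
       + (LINT y:{0<..}|lborel. if y < 1/2 then \<phi>s 0 (1 - (1 - y)) * (1 - y) powr \<rho> else 0)"
      by (rule set_integral_split_half(2)[OF m]) (rule set_integrable_split_half[OF pI(2)])+
    have c: "(LINT x:{0<..}|lborel. (if x < 1/2 then \<phi>s 0 (1 - x) else 0) * x powr \<rho>) = (LINT x:{0<..}|lborel. if x < 1/2 then \<phi>s 0 (1 - x) * x powr \<rho> else 0)"
      by (intro set_lebesgue_integral_cong) auto
    have d: "(LINT y:{0<..}|lborel. (if y < 1/2 then \<phi>s 0 y * (1 - y) powr \<rho> else 0) * y powr 0) = (LINT y:{0<..}|lborel. if y < 1/2 then \<phi>s 0 (1 - (1 - y)) * (1 - y) powr \<rho> else 0)"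
      by (intro set_lebesgue_integral_cong) auto
    show ?thesis unfolding a c d b[symmetric] V_def by (rule pI(3))
  qed
  have L: "((\<lambda>t. J1 t + (J2 t + J3 t)) \<longlongrightarrow> V) at_top"
    unfolding lim[symmetric] by (intro tendsto_add l1 l2 l3)
  have "eventually (\<lambda>t. J1 t + (J2 t + J3 t) = (LINT s:{0<..<t}|lborel. (psi_fin c a s T t - psi_inf c a s T) * g s) / (t * (a t * Cc T) * g t)) at_top"
    using i1 i2 i3 eventually_ge_at_top[of t1] regularly_varyingD(2)[OF g_rv]
  proof eventually_elim
    case (elim t)
    have tp: "t > 0" using elim(4) t1(1) by linarith
    define N where "N = a t * Cc T"
    have N: "N > 0" unfolding N_def by (rule N_pos[OF tp])
    define F where "F x = Rs 0 t (1 - x) * (g (t * x) / g t)" for x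
    have Fm: "F \<in> borel_measurable borel" unfolding F_def by measurable
    have h1: "set_integrable lborel {0<..} (\<lambda>x. if x < 1/2 then F x else 0)"
      by (rule set_integrable_cong[THEN iffD1, OF refl refl _ elim(2)]) (auto simp: F_def)
    have h2: "set_integrable lborel {0<..} (\<lambda>y. if y < 1/2 then F (1 - y) else 0)"
      by (rule set_integrable_cong[THEN iffD1, OF refl refl _ elim(3)]) (auto simp: F_def)
    have e2: "J2 t = (LINT x:{0<..}|lborel. if x < 1/2 then F x else 0)"
      unfolding J2_def by (intro set_lebesgue_integral_cong) (auto simp: F_def)
    have e3: "J3 t = (LINT y:{0<..}|lborel. if y < 1/2 then F (1 - y) else 0)"
      unfolding J3_def by (intro set_lebesgue_integral_cong) (auto simp: F_def)
    note sp = set_integral_split_half[OF Fm h1 h2]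
    define G where "G x = (if x < 1 then F x else 0)" for x
    have Gi: "set_integrable lborel {0<..} G" and Ge: "(LINT x:{0<..}|lborel. G x) = J2 t + J3 t"
    proof -
      have "indicator {0<..<1} x *\<^sub>R F x = indicator {0<..} x *\<^sub>R G x" for x by (simp add: G_def indicator_def)
      then show "set_integrable lborel {0<..} G" "(LINT x:{0<..}|lborel. G x) = J2 t + J3 t"
        using sp unfolding set_integrable_def set_lebesgue_integral_def e2 e3 by simp_all
    qed
    define f1 where "f1 s = (if s < t then (psi_fin c a s T t - psi_inf c a s T) * g s else 0)" for s
    have pt: "f1 (t * x) = (N * g t) * ((if x < 1 then Rs 1 t x * 1 else 0) * (g (t * x) / g t) + G x)" if "x > 0" for x
    proof (cases "x < 1")
      case True
      have "f1 (t * x) = N * (Rs 1 t x + Rs 0 t (1 - x)) * g (t * x)"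
        using True tp t1(2)[OF elim(4) that True] by (simp add: f1_def N_def)
      also have "\<dots> = (N * g t) * (Rs 1 t x * (g (t * x) / g t) + F x)"
        using elim(5) by (simp add: F_def field_simps)
      finally show ?thesis using True by (simp add: G_def)
    next
      case False
      then show ?thesis using tp by (simp add: f1_def G_def)
    qed
    have "(LINT s:{0<..<t}|lborel. (psi_fin c a s T t - psi_inf c a s T) * g s) = (LINT s:{0<..}|lborel. f1 s)"
      unfolding set_lebesgue_integral_def by (intro Bochner_Integration.integral_cong) (auto simp: f1_def indicator_def)
    also have "\<dots> = t * (LINT x:{0<..}|lborel. f1 (t * x))"
      unfolding set_integral_scale[OF tp] using tp by simp
    also have "(LINT x:{0<..}|lborel. f1 (t * x)) = (LINT x:{0<..}|lborel. (N * g t) * ((if x < 1 then Rs 1 t x * 1 else 0) * (g (t * x) / g t) + G x))"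
      by (intro set_lebesgue_integral_cong allI impI) (simp, rule pt, simp)
    also have "\<dots> = (N * g t) * (J1 t + (J2 t + J3 t))"
      unfolding set_integral_mult_right set_integral_add(2)[OF elim(1) Gi] Ge J1_def by simp
    finally have "(LINT s:{0<..<t}|lborel. (psi_fin c a s T t - psi_inf c a s T) * g s) = t * ((N * g t) * (J1 t + (J2 t + J3 t)))" .
    then show ?case unfolding N_def[symmetric] using N tp elim(5) by (simp only:) simp
  qed
  then show ?thesis using L unfolding V_def[symmetric] by (simp only: tendsto_cong)
qed

text \<open>Only the first iterate occurs here, and the weight vanishes for
  \<open>x \<le> 1\<close>. Potter's bounds for \<open>a\<close> and \<open>g\<close>, each with a
  margin below half of \<open>\<gamma> - \<rho>\<close>, give an integrable majorant; the limit is
  the integral of \<open>x powr (\<rho> - \<gamma> - 1)\<close> beyond 1.\<close>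

lemma infinite_past_tail_limit:
  "((\<lambda>t. (LINT s:{t<..}|lborel. psi_inf c a s T * g s) / (t * (a t * Cc T) * g t)) \<longlongrightarrow> 1 / (\<gamma> - \<rho>)) at_top"
  "eventually (\<lambda>t. set_integrable lborel {t<..} (\<lambda>s. psi_inf c a s T * g s)) at_top"
proof -
  define d where "d = min ((\<gamma> - \<rho>) / 3) 1"
  have d: "d > 0" "- \<gamma> - 1 + d + (\<rho> - d) < -1" "- \<gamma> - 1 + d + (\<rho> + d) < -1"
    using rho by (auto simp: d_def min_def field_simps)
  have r1: "\<rho> > -1" using rho gamma_gt by simp
  obtain X L where X: "X > 0" "L \<ge> 1"
    and pot: "\<And>x y. x \<ge> X \<Longrightarrow> y \<ge> x \<Longrightarrow> a y / a x \<le> L * (y / x) powr (- \<gamma> - 1 + d) \<and> a x / a y \<le> L * (x / y) powr (- \<gamma> - 1 - d)"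
    using regularly_varying_potter[OF a_rv d(1)] by blast
  define w where "w t x = (if x > 1 then R 0 t x else 0)" for t x
  define w0 where "w0 x = (if x > 1 then x powr (- \<gamma> - 1) else 0)" for x :: real
  define W where "W x = (if x > 1 then L * x powr (- \<gamma> - 1 + d) else 0)" for x :: real
  have wm: "w t \<in> borel_measurable borel" "w0 \<in> borel_measurable borel" for t unfolding w_def w0_def by measurable
  have wl: "((\<lambda>t. w t x) \<longlongrightarrow> w0 x) at_top" if "x > 0" for x
    using R_limit[OF that, of 0] by (simp add: w_def w0_def)
  have wb: "eventually (\<lambda>t. \<forall>x>0. \<bar>w t x\<bar> \<le> W x) at_top"
    using eventually_ge_at_top[of X]
  proof eventually_elim
    case (elim t)
    show ?case
    proof (intro allI impI)
      fix x :: real assume x: "x > 0"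
      show "\<bar>w t x\<bar> \<le> W x"
      proof (cases "x > 1")
        case True
        have tp: "t > 0" "a t > 0" "Cc T > 0" using elim X T by (auto intro: a_p Cc_p)
        have "t \<le> t * x" using True tp by simp
        have "R 0 t x \<le> a (t * x) / a t" using b_le[of "t * x" T] tp x by (simp add: R_def field_simps)
        also have "\<dots> \<le> L * ((t * x) / t) powr (- \<gamma> - 1 + d)" using pot[OF elim \<open>t \<le> t * x\<close>] by blast
        also have "(t * x) / t = x" using tp by simp
        finally show ?thesis using True R_nn by (simp add: w_def W_def)
      qed (simp add: w_def W_def)
    qed
  qed
  have WB: "W x \<le> 0" if "0 < x" "x \<le> 1" for x using that by (simp add: W_def)
  have Wi: "set_integrable lborel {0<..} (\<lambda>x. W x * (x powr (\<rho> - d) + x powr (\<rho> + d)))"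
  proof -
    have "set_integrable lborel {1..} (\<lambda>x::real. L * (x powr (- \<gamma> - 1 + d + (\<rho> - d)) + x powr (- \<gamma> - 1 + d + (\<rho> + d))))"
      by (intro set_integrable_mult_right set_integral_add powr_integrable_at_top d) auto
    then have i: "set_integrable lborel {1<..} (\<lambda>x::real. L * (x powr (- \<gamma> - 1 + d + (\<rho> - d)) + x powr (- \<gamma> - 1 + d + (\<rho> + d))))"
      by (rule set_integrable_subset) auto
    have e: "indicator {1<..} x *\<^sub>R (L * (x powr (- \<gamma> - 1 + d + (\<rho> - d)) + x powr (- \<gamma> - 1 + d + (\<rho> + d))))
      = indicator {0<..} x *\<^sub>R (W x * (x powr (\<rho> - d) + x powr (\<rho> + d)))" for x :: real
      unfolding powr_add[of x "- \<gamma> - 1 + d"] W_def by (simp add: indicator_def distrib_left mult.assoc)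
    show ?thesis using i unfolding set_integrable_def e .
  qed
  note dct = regularly_varying_dominated_convergence[OF g_rv r1 g_m g_i d(1) wm wl wb WB Wi]
  have d1: "((\<lambda>t. LINT x:{0<..}|lborel. w t x * (g (t * x) / g t)) \<longlongrightarrow> (LINT x:{0<..}|lborel. w0 x * x powr \<rho>)) at_top"
    by (rule dct(1)) auto
  have d2: "eventually (\<lambda>t. set_integrable lborel {0<..} (\<lambda>x. w t x * (g (t * x) / g t))) at_top"
    by (rule dct(2)) auto
  have v: "(LINT x:{0<..}|lborel. w0 x * x powr \<rho>) = 1 / (\<gamma> - \<rho>)"
  proof (rule set_integral_eq_nn_integralI(2))
    have "(\<integral>\<^sup>+x\<in>{0<..}. ennreal (w0 x * x powr \<rho>) \<partial>lborel) = (\<integral>\<^sup>+u\<in>{1..}. ennreal (u powr (- (\<gamma> + 1 - \<rho>))) \<partial>lborel)"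
    proof (rule nn_integral_cong_AE)
      have e: "x powr (- \<gamma> - 1) * x powr \<rho> = x powr (- (\<gamma> + 1 - \<rho>))" for x :: real
        unfolding powr_add[symmetric] by (simp add: algebra_simps)
      show "AE x in lborel. ennreal (w0 x * x powr \<rho>) * indicator {0<..} x = ennreal (x powr (- (\<gamma> + 1 - \<rho>))) * indicator {1..} x"
        using AE_lborel_singleton[of 1] by eventually_elim (auto simp: w0_def e indicator_def)
    qed
    also have "\<dots> = ennreal (1 / (\<gamma> - \<rho>))" using rho by (subst powr_tail_nn_integral) auto
    finally show "(\<integral>\<^sup>+x\<in>{0<..}. ennreal (w0 x * x powr \<rho>) \<partial>lborel) = ennreal (1 / (\<gamma> - \<rho>))" .
  qed (use rho in \<open>auto simp: w0_def set_borel_measurable_def\<close>)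
  define f1 where "f1 t s = (if s > t then psi_inf c a s T * g s else 0)" for t s
  have pt: "f1 t (t * x) = (a t * Cc T * g t) * (w t x * (g (t * x) / g t))" if "t > 0" "g t > 0" for t x
  proof -
    have "(a t * Cc T) * R 0 t x = psi_inf c a (t * x) T"
      using less_imp_neq[OF N_pos[OF that(1)]] by (simp add: R_def psi_inf_def)
    moreover have "(t * x > t) = (x > 1)" using that by simp
    ultimately show ?thesis using that by (simp add: f1_def w_def)
  qed
  have f1: "indicator {t<..} s *\<^sub>R (psi_inf c a s T * g s) = indicator {0<..} s *\<^sub>R f1 t s" if "t > 0" for s t
    using that by (simp add: f1_def indicator_def)
  have "eventually (\<lambda>t. (LINT x:{0<..}|lborel. w t x * (g (t * x) / g t)) = (LINT s:{t<..}|lborel. psi_inf c a s T * g s) / (t * (a t * Cc T) * g t)) at_top"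
    using eventually_gt_at_top[of 0] regularly_varyingD(2)[OF g_rv]
  proof eventually_elim
    case (elim t)
    have "(LINT s:{t<..}|lborel. psi_inf c a s T * g s) = t * (LINT x:{0<..}|lborel. f1 t (t * x))"
      unfolding set_integral_scale[OF elim(1)] using elim f1[OF elim(1)] by (simp add: set_lebesgue_integral_def)
    also have "\<dots> = t * ((a t * Cc T * g t) * (LINT x:{0<..}|lborel. w t x * (g (t * x) / g t)))"
      unfolding pt[OF elim] set_integral_mult_right ..
    finally show ?case using elim a_p[OF elim(1)] Cc_p[OF T] by (simp only:) simp
  qed
  then show "((\<lambda>t. (LINT s:{t<..}|lborel. psi_inf c a s T * g s) / (t * (a t * Cc T) * g t)) \<longlongrightarrow> 1 / (\<gamma> - \<rho>)) at_top"
    using d1 unfolding v by (simp only: tendsto_cong)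
  show "eventually (\<lambda>t. set_integrable lborel {t<..} (\<lambda>s. psi_inf c a s T * g s)) at_top"
    using d2 eventually_gt_at_top[of 0] regularly_varyingD(2)[OF g_rv]
  proof eventually_elim
    case (elim t)
    have "set_integrable lborel {0<..} (\<lambda>x. f1 t (t * x))"
      unfolding pt[OF elim(2,3)] by (intro set_integrable_mult_right elim(1))
    from set_integrable_scale[OF _ this, of "1 / t"] have "set_integrable lborel {0<..} (f1 t)" using elim(2) by simp
    then show ?case unfolding set_integrable_def f1[OF elim(2)] .
  qed
qed

text \<open>Both integrals have the order \<open>t * (a t * Cc T) * g t\<close>, which cancels; the
  strict positivity of \<open>C\<close> makes the quotient of the limits meaningful.\<close>

lemma prediction_ratio_limit:
  assumes C: "C = 1 - \<rho> * Beta (1 - \<gamma> + \<rho>) (1 - \<gamma>) * ((1 - \<gamma>) / \<gamma>)"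
  shows "((\<lambda>t. (LINT s:{0<..<t}|lborel. (psi_fin c a s T t - psi_inf c a s T) * g s)
      / (C * (LINT s:{t<..}|lborel. psi_inf c a s T * g s))) \<longlongrightarrow> 1) at_top"
proof -
  have C0: "C > 0" unfolding C by (rule phis_integral(4)[OF rho])
  let ?E = "\<lambda>t. LINT s:{0<..<t}|lborel. (psi_fin c a s T t - psi_inf c a s T) * g s"
  let ?F = "\<lambda>t. LINT s:{t<..}|lborel. psi_inf c a s T * g s"
  have "((\<lambda>t. (?E t / (t * (a t * Cc T) * g t)) / (C * (?F t / (t * (a t * Cc T) * g t)))) \<longlongrightarrow> (C / (\<gamma> - \<rho>)) / (C * (1 / (\<gamma> - \<rho>)))) at_top"
    by (rule tendsto_divide[OF finite_past_integral_limit[folded C] tendsto_mult[OF tendsto_const infinite_past_tail_limit(1)]])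
      (use rho C0 in auto)
  moreover have "(C / (\<gamma> - \<rho>)) / (C * (1 / (\<gamma> - \<rho>))) = 1" using C0 rho by simp
  moreover have "eventually (\<lambda>t. (?E t / (t * (a t * Cc T) * g t)) / (C * (?F t / (t * (a t * Cc T) * g t))) = ?E t / (C * ?F t)) at_top"
    using eventually_gt_at_top[of 0] regularly_varyingD(2)[OF g_rv]
  proof eventually_elim
    case (elim t)
    have "t * (a t * Cc T) * g t \<noteq> 0" using elim N_pos[OF elim(1)] by auto
    then show ?case by simp
  qed
  ultimately show ?thesis by (simp only: tendsto_cong)
qed

end

text \<open>The mass that an iterate puts on \<open>(0, t)\<close> is not passed on to the next iterate, so the
  masses on \<open>(0, t)\<close> telescope.\<close>
lemma psi_fin_mass:
  assumes t: "t > 0"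
  shows "(\<integral>\<^sup>+s\<in>{0<..<t}. ennreal (psi_fin c a s T t) \<partial>lborel) \<le> 1"
proof -
  define L where "L k = (\<integral>\<^sup>+s\<in>{0<..<t}. ennreal (bi k s t) \<partial>lborel)" for k
  define U where "U k = (\<integral>\<^sup>+s\<in>{t..}. ennreal (bi k s t) \<partial>lborel)" for k
  have LU: "L k + U k = (\<integral>\<^sup>+s\<in>{0<..}. ennreal (bi k s t) \<partial>lborel)" for k
  proof -
    have "L k + U k = (\<integral>\<^sup>+s. ennreal (bi k s t) * indicator {0<..<t} s + ennreal (bi k s t) * indicator {t..} s \<partial>lborel)"
      unfolding L_def U_def by (rule nn_integral_add[symmetric]) measurable
    also have "\<dots> = (\<integral>\<^sup>+s\<in>{0<..}. ennreal (bi k s t) \<partial>lborel)"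
      using t by (intro nn_integral_cong) (auto simp: indicator_def)
    finally show ?thesis .
  qed
  \<comment> \<open>By \<open>b_mass\<close> an application of the kernel creates no mass, and it
    reads the previous iterate at the points \<open>t + u\<close> only.\<close>
  have step: "L (Suc (Suc k)) + U (Suc (Suc k)) \<le> U (Suc k)" for k
  proof -
    have "L (Suc (Suc k)) + U (Suc (Suc k)) \<le> (\<integral>\<^sup>+s. (\<integral>\<^sup>+u. ennreal (b s u) * indicator {0<..} s * (ennreal (bi (Suc k) (t + u) t) * indicator {0<..} u) \<partial>lborel) \<partial>lborel)"
      unfolding LU
    proof (rule nn_integral_mono)
      fix s :: real
      have "ennreal (bi (Suc (Suc k)) s t) \<le> (\<integral>\<^sup>+u\<in>{0<..}. ennreal (b s u * bi (Suc k) (t + u) t) \<partial>lborel)"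
        unfolding b_iter.simps(3) by (rule ennreal_set_integral_le) (intro mult_nonneg_nonneg b_nn bi_nn)
      also have "\<dots> = (\<integral>\<^sup>+u. ennreal (b s u) * (ennreal (bi (Suc k) (t + u) t) * indicator {0<..} u) \<partial>lborel)"
        by (intro nn_integral_cong) (simp add: ennreal_mult b_nn bi_nn mult.assoc)
      finally show "ennreal (bi (Suc (Suc k)) s t) * indicator {0<..} s
        \<le> (\<integral>\<^sup>+u. ennreal (b s u) * indicator {0<..} s * (ennreal (bi (Suc k) (t + u) t) * indicator {0<..} u) \<partial>lborel)"
        by (cases "s > 0") auto
    qed
    also have "\<dots> = (\<integral>\<^sup>+u. (\<integral>\<^sup>+s. ennreal (b s u) * indicator {0<..} s * (ennreal (bi (Suc k) (t + u) t) * indicator {0<..} u) \<partial>lborel) \<partial>lborel)"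
      by (rule lborel_pair.Fubini') measurable
    also have "\<dots> \<le> (\<integral>\<^sup>+u. ennreal (bi (Suc k) (t + u) t) * indicator {0<..} u \<partial>lborel)"
    proof (rule nn_integral_mono)
      fix u :: real
      have "(\<integral>\<^sup>+s. ennreal (b s u) * indicator {0<..} s * (ennreal (bi (Suc k) (t + u) t) * indicator {0<..} u) \<partial>lborel)
        = (\<integral>\<^sup>+s. ennreal (b s u) * indicator {0<..} s \<partial>lborel) * (ennreal (bi (Suc k) (t + u) t) * indicator {0<..} u)"
        by (rule nn_integral_multc) measurable
      also have "\<dots> \<le> ennreal (bi (Suc k) (t + u) t) * indicator {0<..} u"
      proof (cases "u > 0")
        case True
        from mult_right_mono[OF b_mass[OF this], of "ennreal (bi (Suc k) (t + u) t) * indicator {0<..} u"] show ?thesis by simp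
      qed simp
      finally show "(\<integral>\<^sup>+s. ennreal (b s u) * indicator {0<..} s * (ennreal (bi (Suc k) (t + u) t) * indicator {0<..} u) \<partial>lborel)
        \<le> ennreal (bi (Suc k) (t + u) t) * indicator {0<..} u" .
    qed
    also have "\<dots> \<le> (\<integral>\<^sup>+u. ennreal (bi (Suc k) (t + 1 * u) t) * indicator {t..} (t + 1 * u) \<partial>lborel)"
      by (intro nn_integral_mono) (auto simp: indicator_def)
    also have "\<dots> = U (Suc k)"
      unfolding U_def using nn_integral_real_affine[of "\<lambda>s. ennreal (bi (Suc k) s t) * indicator {t..} s" 1 t] by simp
    finally show ?thesis .
  qed
  have tele: "(\<Sum>j<Suc n. L (Suc j)) + U (Suc n) \<le> 1" for n
  proof (induction n)
    case 0
    have "L (Suc 0) + U (Suc 0) \<le> 1" unfolding LU using b_mass[OF T] by simp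
    then show ?case by simp
  next
    case (Suc n)
    have "(\<Sum>j<Suc (Suc n). L (Suc j)) + U (Suc (Suc n)) = (\<Sum>j<Suc n. L (Suc j)) + (L (Suc (Suc n)) + U (Suc (Suc n)))"
      by (simp add: add.assoc)
    also have "\<dots> \<le> (\<Sum>j<Suc n. L (Suc j)) + U (Suc n)" by (intro add_left_mono step)
    finally show ?case using Suc by (rule order_trans)
  qed
  have part: "(\<Sum>j<n. L (Suc j)) \<le> 1" for n
  proof (cases n)
    case (Suc m)
    have "(\<Sum>j<n. L (Suc j)) \<le> (\<Sum>j<Suc m. L (Suc j)) + U (Suc m)" unfolding Suc by simp
    then show ?thesis using tele by (rule order_trans)
  qed simp
  \<comment> \<open>The odd iterates at \<open>s\<close> and the even ones at \<open>t - s\<close>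
    together account for the mass of every iterate on the interval exactly once.\<close>
  have pair: "(\<Sum>k<n. L (2 * k + 1) + L (2 * k + 2)) = (\<Sum>j<2 * n. L (Suc j))" for n
    by (induction n) (simp_all add: add.assoc)
  have refl: "(\<integral>\<^sup>+s\<in>{0<..<t}. ennreal (bi k (t - s) t) \<partial>lborel) = L k" for k
  proof -
    have "L k = (\<integral>\<^sup>+s. ennreal (bi k (t + (- 1) * s) t) * indicator {0<..<t} (t + (- 1) * s) \<partial>lborel)"
      unfolding L_def using nn_integral_real_affine[of "\<lambda>s. ennreal (bi k s t) * indicator {0<..<t} s" "- 1" t] by simp
    also have "\<dots> = (\<integral>\<^sup>+s\<in>{0<..<t}. ennreal (bi k (t - s) t) \<partial>lborel)"
      by (intro nn_integral_cong) (auto simp: indicator_def)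
    finally show ?thesis ..
  qed
  have "(\<integral>\<^sup>+s\<in>{0<..<t}. ennreal (psi_fin c a s T t) \<partial>lborel)
    \<le> (\<integral>\<^sup>+s. (\<Sum>k. ennreal (bi (2 * k + 1) s t) * indicator {0<..<t} s + ennreal (bi (2 * k + 2) (t - s) t) * indicator {0<..<t} s) \<partial>lborel)"
  proof (rule nn_integral_mono)
    fix s :: real
    define f where "f k = bi (2 * k + 1) s t + bi (2 * k + 2) (t - s) t" for k
    have f: "0 \<le> f k" for k unfolding f_def by (intro add_nonneg_nonneg bi_nn)
    \<comment> \<open>Where the series diverges, the value of \<open>psi_fin\<close> is unspecified,
      but then the right-hand side is infinite.\<close>
    have "ennreal (psi_fin c a s T t) \<le> (\<Sum>k. ennreal (f k))"
    proof (cases "(\<Sum>k. ennreal (f k)) = top")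
      case False
      from suminf_ennreal[OF f this] show ?thesis by (simp add: psi_fin_def f_def)
    qed simp
    also have "(\<lambda>k. ennreal (f k)) = (\<lambda>k. ennreal (bi (2 * k + 1) s t) + ennreal (bi (2 * k + 2) (t - s) t))"
      unfolding f_def by (intro ext ennreal_plus bi_nn)
    finally show "ennreal (psi_fin c a s T t) * indicator {0<..<t} s
      \<le> (\<Sum>k. ennreal (bi (2 * k + 1) s t) * indicator {0<..<t} s + ennreal (bi (2 * k + 2) (t - s) t) * indicator {0<..<t} s)"
      by (cases "s \<in> {0<..<t}") simp_all
  qed
  also have "\<dots> = (\<Sum>k. \<integral>\<^sup>+s. ennreal (bi (2 * k + 1) s t) * indicator {0<..<t} s + ennreal (bi (2 * k + 2) (t - s) t) * indicator {0<..<t} s \<partial>lborel)"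
    by (rule nn_integral_suminf) measurable
  also have "\<dots> = (\<Sum>k. L (2 * k + 1) + L (2 * k + 2))"
    by (intro suminf_cong) (subst nn_integral_add, simp_all only: refl L_def[symmetric], measurable)
  also have "\<dots> \<le> 1"
    by (rule suminf_le_const[OF summableI]) (unfold pair, rule part)
  finally show ?thesis .
qed

text \<open>From some \<open>t2\<close> on, the limit of the ratio yields the factor
  \<open>2 * C\<close>. For \<open>1 < t \<le> t2\<close> the left side is at most a bound
  \<open>G\<close> of \<open>g\<close>, because the finite-past coefficients have mass at most 1;
  the tail integral decreases in \<open>t\<close> since \<open>g\<close> is nonnegative, so it is at
  least its positive value at \<open>t2\<close>.\<close>

lemma prediction_ratio_bound:
  fixes g :: "real \<Rightarrow> real" and \<rho> :: real
  assumes g_m [measurable]: "g \<in> borel_measurable borel"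
    and g_b: "\<And>r. \<exists>B. \<forall>x. 0 < x \<longrightarrow> x < r \<longrightarrow> \<bar>g x\<bar> \<le> B"
    and g_rv: "regularly_varying \<rho> g" and rho: "\<gamma> - 1 < \<rho>" "\<rho> < \<gamma>"
    and g_nn: "\<And>s. s > 0 \<Longrightarrow> 0 \<le> g s"
  shows "\<exists>M>0. \<forall>t>1. (LINT s:{0<..<t}|lborel. (psi_fin c a s T t - psi_inf c a s T) * g s)
    \<le> M * (LINT s:{t<..}|lborel. psi_inf c a s T * g s)"
proof -
  define C where "C = 1 - \<rho> * Beta (1 - \<gamma> + \<rho>) (1 - \<gamma>) * ((1 - \<gamma>) / \<gamma>)"
  have C: "C > 0" unfolding C_def by (rule phis_integral(4)[OF rho])
  define E where "E t = (LINT s:{0<..<t}|lborel. (psi_fin c a s T t - psi_inf c a s T) * g s)" for t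
  define F where "F t = (LINT s:{t<..}|lborel. psi_inf c a s T * g s)" for t
  note tl = infinite_past_tail_limit[OF g_m g_b g_rv rho]
  have ratio: "((\<lambda>t. E t / (C * F t)) \<longlongrightarrow> 1) at_top"
    unfolding E_def F_def by (rule prediction_ratio_limit[OF g_m g_b g_rv rho C_def])
  have "eventually (\<lambda>t. 0 < F t / (t * (a t * Cc T) * g t)) at_top"
    unfolding F_def using rho by (intro order_tendstoD(1)[OF tl(1)]) auto
  then have "eventually (\<lambda>t. F t > 0 \<and> set_integrable lborel {t<..} (\<lambda>s. psi_inf c a s T * g s) \<and> E t / (C * F t) < 2) at_top"
    using tl(2) order_tendstoD(2)[OF ratio, of 2, simplified] eventually_gt_at_top[of 0] regularly_varyingD(2)[OF g_rv]
  proof eventually_elim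
    case (elim t)
    have "0 < t * (a t * Cc T) * g t" using elim N_pos[of t] by simp
    then show ?case using elim by (simp add: zero_less_divide_iff)
  qed
  then obtain t2' where t2': "\<And>t. t \<ge> t2' \<Longrightarrow> F t > 0 \<and> set_integrable lborel {t<..} (\<lambda>s. psi_inf c a s T * g s) \<and> E t / (C * F t) < 2"
    by (auto simp: eventually_at_top_linorder)
  define t2 where "t2 = max t2' 2"
  have t2: "t2 > 1" "\<And>t. t \<ge> t2 \<Longrightarrow> F t > 0" "\<And>t. t \<ge> t2 \<Longrightarrow> E t / (C * F t) < 2"
    and i2: "set_integrable lborel {t2<..} (\<lambda>s. psi_inf c a s T * g s)"
    using t2' by (auto simp: t2_def)
  obtain G' where G': "\<And>x. 0 < x \<Longrightarrow> x < t2 + 1 \<Longrightarrow> \<bar>g x\<bar> \<le> G'" using g_b by blast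
  define G where "G = \<bar>G'\<bar>"
  have G: "G \<ge> 0" "\<And>x. 0 < x \<Longrightarrow> x \<le> t2 \<Longrightarrow> g x \<le> G" using G' unfolding G_def by (auto, smt (verit))
  have nn: "0 \<le> psi_inf c a s T * g s" if "s > 0" for s
    unfolding psi_inf_def using b_nn g_nn[OF that] by simp
  have i1: "set_integrable lborel {1<..} (\<lambda>s. psi_inf c a s T * g s)"
  proof -
    have "set_integrable lborel {1<..t2} (\<lambda>s. psi_inf c a s T * g s)"
    proof (rule set_integrable_bound)
      show "set_integrable lborel {1<..t2} (\<lambda>_. (a 1 * Cc T) * G)"
        using emeasure_bounded_finite[of "{1<..t2}"] unfolding set_integrable_def by (simp add: integrable_indicator_iff)
      show "set_borel_measurable lborel {1<..t2} (\<lambda>s. psi_inf c a s T * g s)"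
        unfolding set_borel_measurable_def psi_inf_def by measurable
      show "AE s in lborel. s \<in> {1<..t2} \<longrightarrow> norm (psi_inf c a s T * g s) \<le> norm ((a 1 * Cc T) * G)"
      proof (intro AE_I2 impI)
        fix s assume s: "s \<in> {1<..t2}"
        have "psi_inf c a s T \<le> a s * Cc T" unfolding psi_inf_def using s by (intro b_le) auto
        also have "\<dots> \<le> a 1 * Cc T" using s Cc_nn by (intro mult_right_mono a_anti) auto
        finally have 1: "psi_inf c a s T \<le> a 1 * Cc T" .
        have "psi_inf c a s T * g s \<le> (a 1 * Cc T) * G"
          by (rule mult_mono[OF 1 G(2)]) (use s a_nn Cc_nn g_nn in auto)
        moreover have "0 \<le> psi_inf c a s T * g s" using s by (intro nn) auto
        ultimately show "norm (psi_inf c a s T * g s) \<le> norm ((a 1 * Cc T) * G)" unfolding real_norm_def by linarith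
      qed
    qed
    from set_integrable_Un[OF this i2] have "set_integrable lborel ({1<..t2} \<union> {t2<..}) (\<lambda>s. psi_inf c a s T * g s)" by simp
    moreover have "{1<..t2} \<union> {t2<..} = {1<..}" using t2(1) by auto
    ultimately show ?thesis by simp
  qed
  have mono: "F t2 \<le> F t" if t: "1 < t" "t \<le> t2" for t
  proof -
    have it: "set_integrable lborel {t<..} (\<lambda>s. psi_inf c a s T * g s)"
      by (rule set_integrable_subset[OF i1]) (use t in auto)
    show ?thesis unfolding F_def set_lebesgue_integral_def
    proof (rule integral_mono[OF i2[unfolded set_integrable_def] it[unfolded set_integrable_def]])
      fix s :: real
      show "indicator {t2<..} s *\<^sub>R (psi_inf c a s T * g s) \<le> indicator {t<..} s *\<^sub>R (psi_inf c a s T * g s)"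
        using nn[of s] t by (auto simp: indicator_def)
    qed
  qed
  have Eb: "E t \<le> G" if t: "1 < t" "t \<le> t2" for t
    unfolding E_def set_lebesgue_integral_def
  \<comment> \<open>Bounding the positive part suffices; as \<open>G \<ge> 0\<close>, this also
    covers a non-integrable integrand, whose integral is 0.\<close>
  proof (rule integral_real_bounded[OF G(1)])
    have [measurable]: "(\<lambda>s. psi_fin c a s T t) \<in> borel_measurable borel" unfolding psi_fin_def by measurable
    have "(\<integral>\<^sup>+s. ennreal (indicator {0<..<t} s *\<^sub>R ((psi_fin c a s T t - psi_inf c a s T) * g s)) \<partial>lborel)
      \<le> (\<integral>\<^sup>+s. ennreal G * (ennreal (psi_fin c a s T t) * indicator {0<..<t} s) \<partial>lborel)"
    proof (rule nn_integral_mono)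
      fix s :: real
      show "ennreal (indicator {0<..<t} s *\<^sub>R ((psi_fin c a s T t - psi_inf c a s T) * g s)) \<le> ennreal G * (ennreal (psi_fin c a s T t) * indicator {0<..<t} s)"
      proof (cases "s \<in> {0<..<t}")
        case True
        define q where "q = max 0 (psi_fin c a s T t)"
        have "psi_fin c a s T t - psi_inf c a s T \<le> q" unfolding psi_inf_def q_def using b_nn[of s T] by simp
        then have "(psi_fin c a s T t - psi_inf c a s T) * g s \<le> q * g s" using True by (intro mult_right_mono g_nn) auto
        also have "\<dots> \<le> q * G" using True t by (intro mult_left_mono G(2)) (auto simp: q_def)
        finally have "ennreal ((psi_fin c a s T t - psi_inf c a s T) * g s) \<le> ennreal (G * q)" by (intro ennreal_leI) (simp add: mult.commute)
        also have "\<dots> = ennreal G * ennreal q" using G(1) by (intro ennreal_mult) (auto simp: q_def)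
        also have "ennreal q = ennreal (psi_fin c a s T t)" by (auto simp: q_def max_def ennreal_neg)
        finally show ?thesis using True by simp
      qed simp
    qed
    also have "\<dots> = ennreal G * (\<integral>\<^sup>+s. ennreal (psi_fin c a s T t) * indicator {0<..<t} s \<partial>lborel)"
      by (rule nn_integral_cmult) measurable
    also have "\<dots> \<le> ennreal G * 1" using t by (intro mult_left_mono psi_fin_mass) auto
    finally show "(\<integral>\<^sup>+s. ennreal (indicator {0<..<t} s *\<^sub>R ((psi_fin c a s T t - psi_inf c a s T) * g s)) \<partial>lborel) \<le> ennreal G" by simp
  qed
  define M where "M = 2 * C + G / F t2"
  have F2: "F t2 > 0" using t2(2) by simp
  have M0: "M > 0" "2 * C \<le> M" "G / F t2 \<le> M" using C G(1) F2 by (auto simp: M_def add_pos_nonneg)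
  have "E t \<le> M * F t" if t: "t > 1" for t
  proof (cases "t \<ge> t2")
    case True
    have Ft: "F t > 0" using t2(2)[OF True] .
    have "E t \<le> 2 * (C * F t)" using t2(3)[OF True] Ft C by (simp add: divide_less_eq)
    also have "\<dots> = (2 * C) * F t" by simp
    also have "\<dots> \<le> M * F t" using M0 Ft by (intro mult_right_mono) auto
    finally show ?thesis .
  next
    case False
    have "E t \<le> (G / F t2) * F t2" using Eb[OF t] False F2 by simp
    also have "\<dots> \<le> M * F t" by (rule mult_mono[OF M0(3) mono[OF t]]) (use False M0 F2 in auto)
    finally show ?thesis .
  qed
  then show ?thesis using M0(1) unfolding E_def F_def by blast
qed

end

section \<open>Return to the original coefficients\<close>

context rv_coefficients
begin

lemma overshoot_horizon_a0:
  assumes T: "T > 0"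
  shows "overshoot_horizon \<gamma> c a0 A0 T"
proof unfold_locales
  show "c \<in> borel_measurable borel" "a0 \<in> borel_measurable borel" "A0 \<in> borel_measurable borel" by measurable
  show "set_integrable lborel {0<..<r} c" "set_integrable lborel {0<..<r} A0" for r by (rule c_int A0_int)+
  show "((\<lambda>t. t * c t * A0 t) \<longlongrightarrow> \<kappa>) at_top"
  proof (rule tendsto_cong[THEN iffD1, OF _ c_alpha_limit_1])
    show "eventually (\<lambda>t. t * c t * \<alpha> t = t * c t * A0 t) at_top"
      using eventually_gt_at_top[of 0] by eventually_elim (simp add: A0_def)
  qed
  show "A0 t > 0" if "t > 0" for t using alpha_pos[OF that] that by (simp add: A0_def)
qed (fact T c_nonpos c_pos c_antimono a0_nonneg a0_pos a0_antimono a0_tail convolution_A0 c_rv a0_rv A0_rv a0_limit)+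

text \<open>The autoregressive coefficient is evaluated at positive arguments only, where the
  extension by 0 is invisible; the same holds along the whole recursion.\<close>

lemma b_coeff_a0: "s > 0 \<Longrightarrow> b_coeff c (ar_coeff \<alpha>) s u = b_coeff c a0 s u"
  unfolding b_coeff_def by (intro set_lebesgue_integral_cong) (auto simp: a0_def)

lemma b_iter_a0: "s > 0 \<Longrightarrow> t \<ge> 0 \<Longrightarrow> b_iter c (ar_coeff \<alpha>) k s T t = b_iter c a0 k s T t"
proof (induction k arbitrary: s)
  case (Suc k)
  show ?case
  proof (cases k)
    case (Suc j)
    have "b_iter c (ar_coeff \<alpha>) (Suc j) s' T t = b_iter c a0 (Suc j) s' T t" if "s' > 0" for s'
      using Suc.IH[OF that] Suc.prems Suc by simp
    then show ?thesis unfolding Suc b_iter.simps(3)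
      using Suc.prems by (intro set_lebesgue_integral_cong) (auto simp: b_coeff_a0)
  qed (use Suc.prems in \<open>simp add: b_coeff_a0\<close>)
qed simp

lemma psi_inf_a0: "s > 0 \<Longrightarrow> psi_inf c (ar_coeff \<alpha>) s T = psi_inf c a0 s T"
  unfolding psi_inf_def by (rule b_coeff_a0)

lemma psi_fin_a0: "0 < s \<Longrightarrow> s < t \<Longrightarrow> psi_fin c (ar_coeff \<alpha>) s T t = psi_fin c a0 s T t"
  unfolding psi_fin_def by (intro suminf_cong arg_cong2[where f="(+)"] b_iter_a0) auto

end

text \<open>Regular variation fixes the sign of \<open>g\<close> only near infinity, whereas the
  second claim compares the integrals from \<open>t = 1\<close> on; this is the purpose of its sign
  condition. Asymptotic equivalence is expressed by the limit 1 of the quotient.\<close>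

theorem theorem4p2:
  fixes H \<rho> T :: real
    and \<nu> :: "real measure"
    and c a \<alpha> \<l> g :: "real \<Rightarrow> real"
  assumes H: "0 < H" "H < 1/2"
    and nu_borel: "sets \<nu> = sets (restrict_space borel {0<..})"
    and nu_int: "integrable \<nu> (\<lambda>s. 1 / (1 + s))"
    and c: "c = ma_coeff \<nu>"
    and c_zero: "filterlim c at_top (at_right 0)"
    and c_bigo: "\<exists>q>-1/2. c \<in> O[at_right 0](\<lambda>t. t powr q)"
    and l: "slowly_varying \<l>"
    and c_infinity:
      "((\<lambda>t. c t / (1 / Gamma (1/2 + H) * t powr (- (1/2 - H)) * \<l> t)) \<longlongrightarrow> 1) at_top"
    and alpha: "is_ar_alpha c \<alpha>"
    and a: "a = ar_coeff \<alpha>"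
    and g_meas: "g \<in> borel_measurable (restrict_space borel {0..})"
    and g_bounded: "\<forall>r. bounded (g ` {0..r})"
    and g_rv: "regularly_varying \<rho> g"
    and rho: "- (1/2) + H < \<rho>" "\<rho> < 1/2 + H"
    and T: "0 < T"
  shows
    "((\<lambda>t. (LINT s:{0<..<t}|lborel. (psi_fin c a s T t - psi_inf c a s T) * g s)
          / (C_const H \<rho> * (LINT s:{t<..}|lborel. psi_inf c a s T * g s))) \<longlongrightarrow> 1) at_top
     \<and> ((\<forall>s>0. 0 \<le> g s) \<longrightarrow>
        (\<exists>M>0. \<forall>t>1. (LINT s:{0<..<t}|lborel. (psi_fin c a s T t - psi_inf c a s T) * g s)
                  \<le> M * (LINT s:{t<..}|lborel. psi_inf c a s T * g s)))"
proof -
  interpret ma: ma_measure \<nu> c by unfold_locales (fact nu_borel nu_int c)+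
  define \<gamma> where "\<gamma> = 1/2 + H"
  have G: "Gamma \<gamma> > 0" using H by (intro Gamma_real_pos) (simp add: \<gamma>_def)
  have c_rv: "regularly_varying (\<gamma> - 1) c"
  proof (rule regularly_varying_asymp[OF _ ma.c_measurable])
    have e: "- (1/2 - H) + 0 = \<gamma> - 1" by (simp add: \<gamma>_def)
    show "regularly_varying (\<gamma> - 1) (\<lambda>t. t powr (- (1/2 - H)) * \<l> t)"
      using regularly_varying_mult[OF regularly_varying_powr[of "- (1/2 - H)"] l] unfolding e .
    have "((\<lambda>t. 1 / Gamma \<gamma> * (c t / (1 / Gamma \<gamma> * t powr (- (1/2 - H)) * \<l> t))) \<longlongrightarrow> 1 / Gamma \<gamma> * 1) at_top"
      using c_infinity unfolding \<gamma>_def by (intro tendsto_mult tendsto_const)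
    moreover have "1 / Gamma \<gamma> * (c t / (1 / Gamma \<gamma> * t powr (- (1/2 - H)) * \<l> t)) = c t / (t powr (- (1/2 - H)) * \<l> t)" for t
      using G by (simp add: field_simps)
    ultimately show "((\<lambda>t. c t / (t powr (- (1/2 - H)) * \<l> t)) \<longlongrightarrow> 1 / Gamma \<gamma>) at_top"
      by (simp only: mult_1_right)
    show "1 / Gamma \<gamma> > 0" using G by simp
  qed
  \<comment> \<open>Regular variation makes \<open>c\<close> positive far out, and monotonicity
    carries this back to all positive times.\<close>
  have c_pos: "c t > 0" if t: "t > 0" for t
  proof -
    obtain N where N: "\<And>t. t \<ge> N \<Longrightarrow> c t > 0"
      using regularly_varyingD(2)[OF c_rv] by (auto simp: eventually_at_top_linorder)
    have "0 < c (max t N)" by (rule N) simp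
    also have "\<dots> \<le> c t" using t by (intro ma.c_antimono) auto
    finally show ?thesis .
  qed
  have c_lim: "(c \<longlongrightarrow> 0) at_top"
    by (rule regularly_varying_tendsto_0[OF c_rv]) (use H in \<open>simp add: \<gamma>_def\<close>)
  interpret rv: rv_coefficients \<nu> c \<alpha> \<gamma>
    by unfold_locales (use alpha c_pos c_lim c_rv H in \<open>auto simp: \<gamma>_def\<close>)
  interpret oh: overshoot_horizon \<gamma> c rv.a0 rv.A0 T
    by (rule rv.overshoot_horizon_a0[OF T])
  \<comment> \<open>\<open>g\<close> is measurable on the closed half line; the extension by 0 is
    Borel on the whole line and leaves the integrals unchanged.\<close>
  define g0 where "g0 s = (if 0 \<le> s then g s else 0)" for s
  have "(\<lambda>x. indicator {0..} x *\<^sub>R g x) \<in> borel_measurable borel"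
    using g_meas by (subst (asm) borel_measurable_restrict_space_iff) auto
  moreover have "(\<lambda>x. indicator {0..} x *\<^sub>R g x) = g0" by (auto simp: g0_def indicator_def)
  ultimately have g0_m: "g0 \<in> borel_measurable borel" by simp
  have g0_rv: "regularly_varying \<rho> g0"
  proof (rule regularly_varying_asymp[OF g_rv g0_m])
    have "eventually (\<lambda>t. g0 t / g t = 1) at_top"
      using regularly_varyingD(2)[OF g_rv] eventually_ge_at_top[of 0] by eventually_elim (simp add: g0_def)
    then show "((\<lambda>t. g0 t / g t) \<longlongrightarrow> 1) at_top" by (rule tendsto_eventually)
  qed simp
  have g0_b: "\<exists>B. \<forall>x. 0 < x \<longrightarrow> x < r \<longrightarrow> \<bar>g0 x\<bar> \<le> B" for r
  proof -
    obtain B where "\<And>x. x \<in> g ` {0..r} \<Longrightarrow> norm x \<le> B" using g_bounded unfolding bounded_iff by blast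
    then show ?thesis by (intro exI[of _ B]) (auto simp: g0_def)
  qed
  have r: "\<gamma> - 1 < \<rho>" "\<rho> < \<gamma>" using rho by (auto simp: \<gamma>_def)
  have C: "C_const H \<rho> = 1 - \<rho> * Beta (1 - \<gamma> + \<rho>) (1 - \<gamma>) * ((1 - \<gamma>) / \<gamma>)"
  proof -
    have "1 - \<gamma> + \<rho> = 1/2 - H + \<rho>" "1 - \<gamma> = 1/2 - H" "(1 - \<gamma>) / \<gamma> = (1 - 2 * H) / (1 + 2 * H)"
      using H by (auto simp: \<gamma>_def field_simps)
    then show ?thesis unfolding C_const_def by simp
  qed
  have E: "(LINT s:{0<..<t}|lborel. (psi_fin c a s T t - psi_inf c a s T) * g s)
    = (LINT s:{0<..<t}|lborel. (psi_fin c rv.a0 s T t - psi_inf c rv.a0 s T) * g0 s)" for t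
    unfolding a by (intro set_lebesgue_integral_cong) (auto simp: rv.psi_fin_a0 rv.psi_inf_a0 g0_def)
  have F: "(LINT s:{t<..}|lborel. psi_inf c a s T * g s) = (LINT s:{t<..}|lborel. psi_inf c rv.a0 s T * g0 s)" if "t > 0" for t
    unfolding a using that by (intro set_lebesgue_integral_cong) (auto simp: rv.psi_inf_a0 g0_def)
  have ev: "eventually (\<lambda>t. (LINT s:{0<..<t}|lborel. (psi_fin c rv.a0 s T t - psi_inf c rv.a0 s T) * g0 s)
          / (C_const H \<rho> * (LINT s:{t<..}|lborel. psi_inf c rv.a0 s T * g0 s))
        = (LINT s:{0<..<t}|lborel. (psi_fin c a s T t - psi_inf c a s T) * g s)
          / (C_const H \<rho> * (LINT s:{t<..}|lborel. psi_inf c a s T * g s))) at_top"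
    using eventually_gt_at_top[of 0] by eventually_elim (simp only: E F)
  show ?thesis
  proof (intro conjI impI)
    show "((\<lambda>t. (LINT s:{0<..<t}|lborel. (psi_fin c a s T t - psi_inf c a s T) * g s)
          / (C_const H \<rho> * (LINT s:{t<..}|lborel. psi_inf c a s T * g s))) \<longlongrightarrow> 1) at_top"
      by (rule tendsto_cong[THEN iffD1, OF ev]) (rule oh.prediction_ratio_limit[OF g0_m g0_b g0_rv r C])
    assume nn: "\<forall>s>0. 0 \<le> g s"
    then have "0 \<le> g0 s" if "s > 0" for s using that by (simp add: g0_def)
    from oh.prediction_ratio_bound[OF g0_m g0_b g0_rv r this] obtain M where M: "M > 0"
      "\<And>t. t > 1 \<Longrightarrow> (LINT s:{0<..<t}|lborel. (psi_fin c rv.a0 s T t - psi_inf c rv.a0 s T) * g0 s)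
        \<le> M * (LINT s:{t<..}|lborel. psi_inf c rv.a0 s T * g0 s)" by blast
    show "\<exists>M>0. \<forall>t>1. (LINT s:{0<..<t}|lborel. (psi_fin c a s T t - psi_inf c a s T) * g s)
                  \<le> M * (LINT s:{t<..}|lborel. psi_inf c a s T * g s)"
    proof (intro exI[of _ M] conjI allI impI M(1))
      fix t :: real assume t: "t > 1"
      then have "t > 0" by simp
      from M(2)[OF t] show "(LINT s:{0<..<t}|lborel. (psi_fin c a s T t - psi_inf c a s T) * g s)
                  \<le> M * (LINT s:{t<..}|lborel. psi_inf c a s T * g s)"
        by (simp only: E F[OF \<open>t > 0\<close>])
    qed
  qed
qed

end
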